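(* Let $\mathscr{A},\mathscr{B},\mathscr{C}$ be $\mathcal{W}$-enriched categories, let $M\colon \mathscr{A}\to\mathscr{B}$ be a module and let $F\colon\mathscr{B}\to\mathscr{C}$ be a functor. Let $\eta_F\colon \mathscr{B}\Rightarrow \mathscr{C}(F,1)\circ F$ and $\varepsilon_F\colon F\circ\mathscr{C}(F,1)\Rightarrow\mathscr{C}$ be the unit and counit of the adjunction $F\dashv\mathscr{C}(F,1)$ in $\mathrm{Mod}$. For a functor $Z\colon\mathscr{A}\to\mathscr{C}$ and module morphisms $\alpha\colon M\Rightarrow\mathscr{C}(F,Z)=\mathscr{C}(F,1)\circ Z$ and $\beta\colon Z\Rightarrow F\circ M$, consider the two equations (associativity and unit constraints of $\mathrm{Mod}$ suppressed): (E1) the composite $M\xrightarrow{\ \alpha\ }\mathscr{C}(F,1)\circ Z\xrightarrow{\ \mathscr{C}(F,1)\circ\beta\ }\mathscr{C}(F,1)\circ F\circ M$ equals $\eta_F\circ M$; (E2) the composite $Z\xrightarrow{\ \beta\ }F\circ M\xrightarrow{\ F\circ\alpha\ }F\circ\mathscr{C}(F,1)\circ Z\xrightarrow{\ \varepsilon_F\circ Z\ }Z$ equals the identity $1_Z$. Then the following conditions are equivalent: (i) $F$ has an absolute $M$-weighted colimit; (ii) there exist a functor $Z\colon\mathscr{A}\to\mathscr{C}$ and module morphisms $\alpha\colon M\Rightarrow\mathscr{C}(F,Z)$ and $\beta\colon Z\Rightarrow F\circ M$ satisfying (E1) and (E2); (iii) the composite module $F\circ M\colon\mathscr{A}\to\mathscr{C}$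 is representable, that is, $F\circ M\cong Z$ for some functor $Z\colon\mathscr{A}\to\mathscr{C}$. Moreover, if idempotents split in $\mathscr{C}$, these conditions are also equivalent to: (iv) there exist a functor $Z\colon\mathscr{A}\to\mathscr{C}$ and module morphisms $\alpha\colon M\Rightarrow\mathscr{C}(F,Z)$ and $\beta\colon Z\Rightarrow F\circ M$ satisfying (E1).
   Context: Enrichment base. $\mathcal{W}$ is a bicategory, rich enough that $\mathcal{W}$-categories and modules form a bicategory $\mathrm{Mod}$ admitting all right liftings and right extensions: concretely, the hom-categories of $\mathcal{W}$ have small limits and colimits, and $\mathcal{W}$ has all right liftings and right extensions (so composition with a fixed 1-cell on either side preserves colimits). Categories are small relative to a chosen universe. (A monoidal category $\mathcal{V}$ is the one-object case.) $\mathcal{W}$-categories and functors. A $\mathcal{W}$-category $\mathscr{C}$ has a set of objects, each object $X$ having an extent $e(X)\in\mathcal{W}$; for objects $X,Y$ a 1-cell $\mathscr{C}(X,Y)\colon e(Y)\to e(X)$; and composition 2-cells $\mathscr{C}(X,Y)\circ\mathscr{C}(Y,Z)\Rightarrow\mathscr{C}(X,Z)$ and unit 2-cells $1_{e(X)}\Rightarrow\mathscr{C}(X,X)$ that are associative and unital. A functor $F\colon\mathscr{B}\to\mathscr{C}$ is an extent-preserving map on objects with 2-cells $\mathscr{B}(X,Y)\Rightarrow\mathscr{C}(FX,FY)$ compatible with composition and units. Idempotents split in $\mathscr{C}$ if, for each object $X$, each idempotent $1_{e(X)}\Rightarrow\mathscr{C}(X,X)$ splits through some object of the same extent as $X$.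 Modules. A module $M$ from $\mathscr{A}$ to $\mathscr{B}$ (also called a profunctor or distributor) consists of 1-cells $M(B,A)\colon e(A)\to e(B)$ with compatible associative and unital actions $\mathscr{B}(B',B)\circ M(B,A)\Rightarrow M(B',A)$ and $M(B,A)\circ\mathscr{A}(A,A')\Rightarrow M(B,A')$. Module morphisms are families of 2-cells compatible with the actions. Composition is $(N\circ M)(C,A)=\int^{B}N(C,B)\circ M(B,A)$; the identity module on $\mathscr{B}$ is given by the homs of $\mathscr{B}$ and is again denoted $\mathscr{B}$. $\mathrm{Mod}$ is the bicategory of $\mathcal{W}$-categories, modules and module morphisms. A functor $F\colon\mathscr{B}\to\mathscr{C}$ is identified with the module $F\colon\mathscr{B}\to\mathscr{C}$ given by $F(C,B)=\mathscr{C}(C,FB)$. It has in $\mathrm{Mod}$ the right adjoint $\mathscr{C}(F,1)\colon\mathscr{C}\to\mathscr{B}$ given by $\mathscr{C}(F,1)(B,C)=\mathscr{C}(FB,C)$. For functors $F\colon\mathscr{B}\to\mathscr{C}$ and $Z\colon\mathscr{A}\to\mathscr{C}$, $\mathscr{C}(F,Z)=\mathscr{C}(F,1)\circ Z\colon\mathscr{A}\to\mathscr{B}$ is the module with $\mathscr{C}(F,Z)(B,A)\cong\mathscr{C}(FB,ZA)$. For modules $M\colon\mathscr{A}\to\mathscr{B}$ and $K\colon\mathscr{C}\to\mathscr{B}$, $\mathscr{B}(M,K)\colon\mathscr{C}\to\mathscr{A}$ denotes the right lifting of $K$ through $M$: module morphisms $L\Rightarrow\mathscr{B}(M,K)$ correspond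 naturally to module morphisms $M\circ L\Rightarrow K$. Weighted colimits. Given a module $M\colon\mathscr{A}\to\mathscr{B}$ and a functor $F\colon\mathscr{B}\to\mathscr{C}$, a module morphism $\alpha\colon M\Rightarrow\mathscr{C}(F,Z)$, with $Z\colon\mathscr{A}\to\mathscr{C}$ a functor, exhibits $Z$ as an $M$-weighted colimit of $F$ if the module morphism $\mathscr{C}(Z,1)\Rightarrow\mathscr{B}(M,\mathscr{C}(F,1))$ corresponding to the composite $M\circ\mathscr{C}(Z,1)\xrightarrow{\alpha\circ 1}\mathscr{C}(F,1)\circ Z\circ\mathscr{C}(Z,1)\xrightarrow{1\circ\varepsilon_Z}\mathscr{C}(F,1)$ is invertible, where $\varepsilon_Z$ is the counit of $Z\dashv\mathscr{C}(Z,1)$. The colimit is preserved by a functor $H\colon\mathscr{C}\to\mathscr{X}$ if the composite $M\xrightarrow{\alpha}\mathscr{C}(F,Z)\xrightarrow{H}\mathscr{X}(HF,HZ)$ exhibits $HZ$ as an $M$-weighted colimit of $HF$. It is absolute if it is preserved by all functors out of $\mathscr{C}$. *)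

theory Defs
  imports Main
begin

unbundle cardinal_syntax

section \<open>Universes, categories and small (co)limits\<close>

text \<open>A universe is rendered by a type \<open>'u\<close>: the small sets are, up to bijection, the sets of
  elements of \<open>'u\<close> of cardinality strictly below that of \<open>'u\<close>. This cardinality is only required to be
  infinite and regular, so that Grothendieck universes (inaccessible cardinals) are a special case.\<close>

definition small :: "'u set \<Rightarrow> bool" where
  "small S \<longleftrightarrow> |S| <o |UNIV :: 'u set|"

definition universe :: "'u itself \<Rightarrow> bool" where
  "universe _ \<longleftrightarrow> infinite (UNIV :: 'u set) \<and> regularCard |UNIV :: 'u set|"

record ('a, 'b) cat =
  cobj :: "'a set"
  carr :: "'b set"
  cdom :: "'b \<Rightarrow> 'a"
  ccod :: "'b \<Rightarrow> 'a"
  cid :: "'a \<Rightarrow> 'b"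
  ccomp :: "'b \<Rightarrow> 'b \<Rightarrow> 'b"

definition chom :: "('a, 'b) cat \<Rightarrow> 'a \<Rightarrow> 'a \<Rightarrow> 'b set" where
  "chom K a b = {f \<in> carr K. cdom K f = a \<and> ccod K f = b}"

locale category =
  fixes K :: "('a, 'b) cat"
  assumes dom_cod: "f \<in> carr K \<Longrightarrow> cdom K f \<in> cobj K \<and> ccod K f \<in> cobj K"
    and id_in_hom: "a \<in> cobj K \<Longrightarrow> cid K a \<in> chom K a a"
    and comp_in_hom: "\<lbrakk>f \<in> chom K a b; g \<in> chom K b c\<rbrakk> \<Longrightarrow> ccomp K g f \<in> chom K a c"
    and id_left: "f \<in> chom K a b \<Longrightarrow> ccomp K (cid K b) f = f"
    and id_right: "f \<in> chom K a b \<Longrightarrow> ccomp K f (cid K a) = f"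
    and comp_assoc: "\<lbrakk>f \<in> chom K a b; g \<in> chom K b c; h \<in> chom K c d\<rbrakk>
      \<Longrightarrow> ccomp K (ccomp K h g) f = ccomp K h (ccomp K g f)"

definition diagram :: "('i, 'j) cat \<Rightarrow> ('a, 'b) cat \<Rightarrow> ('i \<Rightarrow> 'a) \<Rightarrow> ('j \<Rightarrow> 'b) \<Rightarrow> bool" where
  "diagram J K D0 D1 \<longleftrightarrow>
     (\<forall>i\<in>cobj J. D0 i \<in> cobj K \<and> D1 (cid J i) = cid K (D0 i)) \<and>
     (\<forall>u\<in>carr J. D1 u \<in> chom K (D0 (cdom J u)) (D0 (ccod J u))) \<and>
     (\<forall>u\<in>carr J. \<forall>v\<in>carr J. ccod J u = cdom J v \<longrightarrow> D1 (ccomp J v u) = ccomp K (D1 v) (D1 u))"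

definition cone ::
  "('i, 'j) cat \<Rightarrow> ('a, 'b) cat \<Rightarrow> ('i \<Rightarrow> 'a) \<Rightarrow> ('j \<Rightarrow> 'b) \<Rightarrow> 'a \<Rightarrow> ('i \<Rightarrow> 'b) \<Rightarrow> bool" where
  "cone J K D0 D1 p q \<longleftrightarrow> p \<in> cobj K \<and> (\<forall>i\<in>cobj J. q i \<in> chom K p (D0 i)) \<and>
     (\<forall>u\<in>carr J. ccomp K (D1 u) (q (cdom J u)) = q (ccod J u))"

definition cocone ::
  "('i, 'j) cat \<Rightarrow> ('a, 'b) cat \<Rightarrow> ('i \<Rightarrow> 'a) \<Rightarrow> ('j \<Rightarrow> 'b) \<Rightarrow> 'a \<Rightarrow> ('i \<Rightarrow> 'b) \<Rightarrow> bool" where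
  "cocone J K D0 D1 p q \<longleftrightarrow> p \<in> cobj K \<and> (\<forall>i\<in>cobj J. q i \<in> chom K (D0 i) p) \<and>
     (\<forall>u\<in>carr J. ccomp K (q (ccod J u)) (D1 u) = q (cdom J u))"

definition is_limit ::
  "('i, 'j) cat \<Rightarrow> ('a, 'b) cat \<Rightarrow> ('i \<Rightarrow> 'a) \<Rightarrow> ('j \<Rightarrow> 'b) \<Rightarrow> 'a \<Rightarrow> ('i \<Rightarrow> 'b) \<Rightarrow> bool" where
  "is_limit J K D0 D1 p q \<longleftrightarrow> cone J K D0 D1 p q \<and>
     (\<forall>p' q'. cone J K D0 D1 p' q' \<longrightarrow>
        (\<exists>!t. t \<in> chom K p' p \<and> (\<forall>i\<in>cobj J. ccomp K (q i) t = q' i)))"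

definition is_colimit ::
  "('i, 'j) cat \<Rightarrow> ('a, 'b) cat \<Rightarrow> ('i \<Rightarrow> 'a) \<Rightarrow> ('j \<Rightarrow> 'b) \<Rightarrow> 'a \<Rightarrow> ('i \<Rightarrow> 'b) \<Rightarrow> bool" where
  "is_colimit J K D0 D1 p q \<longleftrightarrow> cocone J K D0 D1 p q \<and>
     (\<forall>p' q'. cocone J K D0 D1 p' q' \<longrightarrow>
        (\<exists>!t. t \<in> chom K p p' \<and> (\<forall>i\<in>cobj J. ccomp K t (q i) = q' i)))"

text \<open>Every small category is isomorphic to one whose objects and arrows are elements of \<open>'u\<close>.\<close>

definition has_small_limits :: "'u itself \<Rightarrow> ('a, 'b) cat \<Rightarrow> bool" where
  "has_small_limits _ K \<longleftrightarrow>
     (\<forall>(J :: ('u, 'u) cat) D0 D1. category J \<and> small (carr J) \<and> diagram J K D0 D1 \<longrightarrow>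
        (\<exists>p q. is_limit J K D0 D1 p q))"

definition has_small_colimits :: "'u itself \<Rightarrow> ('a, 'b) cat \<Rightarrow> bool" where
  "has_small_colimits _ K \<longleftrightarrow>
     (\<forall>(J :: ('u, 'u) cat) D0 D1. category J \<and> small (carr J) \<and> diagram J K D0 D1 \<longrightarrow>
        (\<exists>p q. is_colimit J K D0 D1 p q))"


section \<open>Bicategories\<close>

text \<open>Composition is written in the classical order on both levels. The associator is directed
  \<open>(h \<star> g) \<star> f \<Rightarrow> h \<star> (g \<star> f)\<close>; the unitors are directed \<open>\<one> \<star> f \<Rightarrow> f\<close> and \<open>f \<star> \<one> \<Rightarrow> f\<close>.\<close>

record ('o, 'm, 'c) bicat =
  obj :: "'o set"
  cells1 :: "'m set"
  src :: "'m \<Rightarrow> 'o"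
  trg :: "'m \<Rightarrow> 'o"
  cells2 :: "'c set"
  dom2 :: "'c \<Rightarrow> 'm"
  cod2 :: "'c \<Rightarrow> 'm"
  unit1 :: "'o \<Rightarrow> 'm" (\<open>\<one>\<index>\<close>)
  comp1 :: "'m \<Rightarrow> 'm \<Rightarrow> 'm" (infixr \<open>\<star>\<index>\<close> 75)
  id2 :: "'m \<Rightarrow> 'c" (\<open>\<iota>\<index>\<close>)
  vcomp :: "'c \<Rightarrow> 'c \<Rightarrow> 'c" (infixr \<open>\<cdot>\<index>\<close> 65)
  hcomp :: "'c \<Rightarrow> 'c \<Rightarrow> 'c" (infixr \<open>\<ast>\<index>\<close> 75)
  assoc :: "'m \<Rightarrow> 'm \<Rightarrow> 'm \<Rightarrow> 'c" (\<open>\<a>\<index>\<close>)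
  lunit :: "'m \<Rightarrow> 'c" (\<open>\<l>\<index>\<close>)
  runit :: "'m \<Rightarrow> 'c" (\<open>\<r>\<index>\<close>)

definition hom1 :: "('o, 'm, 'c) bicat \<Rightarrow> 'o \<Rightarrow> 'o \<Rightarrow> 'm set" where
  "hom1 W a b = {f \<in> cells1 W. src W f = a \<and> trg W f = b}"

definition hom2 :: "('o, 'm, 'c) bicat \<Rightarrow> 'm \<Rightarrow> 'm \<Rightarrow> 'c set" where
  "hom2 W f g = {\<sigma> \<in> cells2 W. dom2 W \<sigma> = f \<and> cod2 W \<sigma> = g}"

definition inverse2 :: "('o, 'm, 'c) bicat \<Rightarrow> 'c \<Rightarrow> 'c \<Rightarrow> bool" where
  "inverse2 W \<sigma> \<tau> \<longleftrightarrow> \<sigma> \<in> cells2 W \<and> \<tau> \<in> hom2 W (cod2 W \<sigma>) (dom2 W \<sigma>) \<and>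
     \<tau> \<cdot>\<^bsub>W\<^esub> \<sigma> = \<iota>\<^bsub>W\<^esub> (dom2 W \<sigma>) \<and> \<sigma> \<cdot>\<^bsub>W\<^esub> \<tau> = \<iota>\<^bsub>W\<^esub> (cod2 W \<sigma>)"

definition iso2 :: "('o, 'm, 'c) bicat \<Rightarrow> 'c \<Rightarrow> bool" where
  "iso2 W \<sigma> \<longleftrightarrow> (\<exists>\<tau>. inverse2 W \<sigma> \<tau>)"

definition inv2 :: "('o, 'm, 'c) bicat \<Rightarrow> 'c \<Rightarrow> 'c" where
  "inv2 W \<sigma> = (THE \<tau>. inverse2 W \<sigma> \<tau>)"

definition isomorphic1 :: "('o, 'm, 'c) bicat \<Rightarrow> 'm \<Rightarrow> 'm \<Rightarrow> bool" where
  "isomorphic1 W f g \<longleftrightarrow> (\<exists>\<sigma>\<in>hom2 W f g. iso2 W \<sigma>)"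

definition homcat :: "('o, 'm, 'c) bicat \<Rightarrow> 'o \<Rightarrow> 'o \<Rightarrow> ('m, 'c) cat" where
  "homcat W a b = \<lparr>cobj = hom1 W a b,
     carr = {\<sigma> \<in> cells2 W. dom2 W \<sigma> \<in> hom1 W a b \<and> cod2 W \<sigma> \<in> hom1 W a b},
     cdom = dom2 W, ccod = cod2 W, cid = id2 W, ccomp = vcomp W\<rparr>"

locale bicategory =
  fixes W :: "('o, 'm, 'c) bicat" (structure)
  assumes src_trg: "f \<in> cells1 W \<Longrightarrow> src W f \<in> obj W \<and> trg W f \<in> obj W"
    and dom2_cod2: "\<sigma> \<in> cells2 W \<Longrightarrow> dom2 W \<sigma> \<in> cells1 W \<and> cod2 W \<sigma> \<in> cells1 W \<and>
      src W (dom2 W \<sigma>) = src W (cod2 W \<sigma>) \<and> trg W (dom2 W \<sigma>) = trg W (cod2 W \<sigma>)"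
    and hom_category: "\<lbrakk>a \<in> obj W; b \<in> obj W\<rbrakk> \<Longrightarrow> category (homcat W a b)"
    and unit1_in_hom: "a \<in> obj W \<Longrightarrow> \<one> a \<in> hom1 W a a"
    and comp1_in_hom: "\<lbrakk>f \<in> hom1 W a b; g \<in> hom1 W b c\<rbrakk> \<Longrightarrow> g \<star> f \<in> hom1 W a c"
    and hcomp_in_hom: "\<lbrakk>f \<in> hom1 W a b; g \<in> hom1 W b c; \<sigma> \<in> hom2 W f f'; \<tau> \<in> hom2 W g g'\<rbrakk>
      \<Longrightarrow> \<tau> \<ast> \<sigma> \<in> hom2 W (g \<star> f) (g' \<star> f')"
    and hcomp_id: "\<lbrakk>f \<in> hom1 W a b; g \<in> hom1 W b c\<rbrakk> \<Longrightarrow> \<iota> g \<ast> \<iota> f = \<iota> (g \<star> f)"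
    and interchange: "\<lbrakk>f \<in> hom1 W a b; g \<in> hom1 W b c; \<sigma> \<in> hom2 W f f'; \<sigma>' \<in> hom2 W f' f'';
        \<tau> \<in> hom2 W g g'; \<tau>' \<in> hom2 W g' g''\<rbrakk>
      \<Longrightarrow> (\<tau>' \<cdot> \<tau>) \<ast> (\<sigma>' \<cdot> \<sigma>) = (\<tau>' \<ast> \<sigma>') \<cdot> (\<tau> \<ast> \<sigma>)"
    and assoc_in_hom: "\<lbrakk>f \<in> hom1 W a b; g \<in> hom1 W b c; h \<in> hom1 W c d\<rbrakk>
      \<Longrightarrow> \<a> h g f \<in> hom2 W ((h \<star> g) \<star> f) (h \<star> g \<star> f)"
    and assoc_iso: "\<lbrakk>f \<in> hom1 W a b; g \<in> hom1 W b c; h \<in> hom1 W c d\<rbrakk> \<Longrightarrow> iso2 W (\<a> h g f)"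
    and assoc_natural: "\<lbrakk>f \<in> hom1 W a b; g \<in> hom1 W b c; h \<in> hom1 W c d;
        \<rho> \<in> hom2 W f f'; \<sigma> \<in> hom2 W g g'; \<tau> \<in> hom2 W h h'\<rbrakk>
      \<Longrightarrow> \<a> h' g' f' \<cdot> ((\<tau> \<ast> \<sigma>) \<ast> \<rho>) = (\<tau> \<ast> \<sigma> \<ast> \<rho>) \<cdot> \<a> h g f"
    and lunit_in_hom: "f \<in> hom1 W a b \<Longrightarrow> \<l> f \<in> hom2 W (\<one> b \<star> f) f"
    and lunit_iso: "f \<in> hom1 W a b \<Longrightarrow> iso2 W (\<l> f)"
    and lunit_natural: "\<lbrakk>f \<in> hom1 W a b; \<sigma> \<in> hom2 W f f'\<rbrakk> \<Longrightarrow> \<l> f' \<cdot> (\<iota> (\<one> b) \<ast> \<sigma>) = \<sigma> \<cdot> \<l> f"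
    and runit_in_hom: "f \<in> hom1 W a b \<Longrightarrow> \<r> f \<in> hom2 W (f \<star> \<one> a) f"
    and runit_iso: "f \<in> hom1 W a b \<Longrightarrow> iso2 W (\<r> f)"
    and runit_natural: "\<lbrakk>f \<in> hom1 W a b; \<sigma> \<in> hom2 W f f'\<rbrakk> \<Longrightarrow> \<r> f' \<cdot> (\<sigma> \<ast> \<iota> (\<one> a)) = \<sigma> \<cdot> \<r> f"
    and pentagon: "\<lbrakk>f \<in> hom1 W a b; g \<in> hom1 W b c; h \<in> hom1 W c d; k \<in> hom1 W d e\<rbrakk>
      \<Longrightarrow> (\<iota> k \<ast> \<a> h g f) \<cdot> \<a> k (h \<star> g) f \<cdot> (\<a> k h g \<ast> \<iota> f) = \<a> k h (g \<star> f) \<cdot> \<a> (k \<star> h) g f"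
    and triangle: "\<lbrakk>f \<in> hom1 W a b; g \<in> hom1 W b c\<rbrakk>
      \<Longrightarrow> (\<iota> g \<ast> \<l> f) \<cdot> \<a> g (\<one> b) f = \<r> g \<ast> \<iota> f"

definition is_right_lifting :: "('o, 'm, 'c) bicat \<Rightarrow> 'm \<Rightarrow> 'm \<Rightarrow> 'm \<Rightarrow> 'c \<Rightarrow> bool" where
  "is_right_lifting W f k r \<rho> \<longleftrightarrow>
     r \<in> hom1 W (src W k) (src W f) \<and> \<rho> \<in> hom2 W (f \<star>\<^bsub>W\<^esub> r) k \<and>
     (\<forall>l\<in>hom1 W (src W k) (src W f). \<forall>\<sigma>\<in>hom2 W (f \<star>\<^bsub>W\<^esub> l) k.
        \<exists>!\<tau>. \<tau> \<in> hom2 W l r \<and> \<rho> \<cdot>\<^bsub>W\<^esub> (\<iota>\<^bsub>W\<^esub> f \<ast>\<^bsub>W\<^esub> \<tau>) = \<sigma>)"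

definition is_right_extension :: "('o, 'm, 'c) bicat \<Rightarrow> 'm \<Rightarrow> 'm \<Rightarrow> 'm \<Rightarrow> 'c \<Rightarrow> bool" where
  "is_right_extension W f k r \<rho> \<longleftrightarrow>
     r \<in> hom1 W (trg W f) (trg W k) \<and> \<rho> \<in> hom2 W (r \<star>\<^bsub>W\<^esub> f) k \<and>
     (\<forall>l\<in>hom1 W (trg W f) (trg W k). \<forall>\<sigma>\<in>hom2 W (l \<star>\<^bsub>W\<^esub> f) k.
        \<exists>!\<tau>. \<tau> \<in> hom2 W l r \<and> \<rho> \<cdot>\<^bsub>W\<^esub> (\<tau> \<ast>\<^bsub>W\<^esub> \<iota>\<^bsub>W\<^esub> f) = \<sigma>)"

definition right_lifting :: "('o, 'm, 'c) bicat \<Rightarrow> 'm \<Rightarrow> 'm \<Rightarrow> 'm \<times> 'c" where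
  "right_lifting W f k = (SOME (r, \<rho>). is_right_lifting W f k r \<rho>)"

text \<open>The 2-cell \<open>l \<Rightarrow> r\<close> corresponding to \<open>\<sigma> : f \<star> l \<Rightarrow> k\<close>, with \<open>r\<close> the right lifting of \<open>k\<close>
  through \<open>f\<close>.\<close>

definition lifting_transpose :: "('o, 'm, 'c) bicat \<Rightarrow> 'm \<Rightarrow> 'm \<Rightarrow> 'm \<Rightarrow> 'c \<Rightarrow> 'c" where
  "lifting_transpose W f k l \<sigma> =
     (THE \<tau>. \<tau> \<in> hom2 W l (fst (right_lifting W f k)) \<and>
        snd (right_lifting W f k) \<cdot>\<^bsub>W\<^esub> (\<iota>\<^bsub>W\<^esub> f \<ast>\<^bsub>W\<^esub> \<tau>) = \<sigma>)"

definition enrichment_base :: "'u itself \<Rightarrow> ('o, 'm, 'c) bicat \<Rightarrow> bool" where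
  "enrichment_base U W \<longleftrightarrow> universe U \<and> bicategory W \<and>
     (\<forall>a\<in>obj W. \<forall>b\<in>obj W.
        has_small_limits U (homcat W a b) \<and> has_small_colimits U (homcat W a b)) \<and>
     (\<forall>f\<in>cells1 W. \<forall>k\<in>cells1 W. trg W f = trg W k \<longrightarrow> (\<exists>r \<rho>. is_right_lifting W f k r \<rho>)) \<and>
     (\<forall>f\<in>cells1 W. \<forall>k\<in>cells1 W. src W f = src W k \<longrightarrow> (\<exists>r \<rho>. is_right_extension W f k r \<rho>))"


section \<open>Enriched categories, functors and modules\<close>

record ('u, 'o, 'm, 'c) wcat =
  ob :: "'u set"
  ext :: "'u \<Rightarrow> 'o"
  hom :: "'u \<Rightarrow> 'u \<Rightarrow> 'm"
  cmp :: "'u \<Rightarrow> 'u \<Rightarrow> 'u \<Rightarrow> 'c"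
  unt :: "'u \<Rightarrow> 'c"

locale wcategory =
  fixes W :: "('o, 'm, 'c) bicat" (structure) and A :: "('u, 'o, 'm, 'c) wcat"
  assumes small_ob: "small (ob A)"
    and ext_in_obj: "x \<in> ob A \<Longrightarrow> ext A x \<in> obj W"
    and hom_in_hom: "\<lbrakk>x \<in> ob A; y \<in> ob A\<rbrakk> \<Longrightarrow> hom A x y \<in> hom1 W (ext A y) (ext A x)"
    and cmp_in_hom: "\<lbrakk>x \<in> ob A; y \<in> ob A; z \<in> ob A\<rbrakk>
      \<Longrightarrow> cmp A x y z \<in> hom2 W (hom A x y \<star> hom A y z) (hom A x z)"
    and unt_in_hom: "x \<in> ob A \<Longrightarrow> unt A x \<in> hom2 W (\<one> (ext A x)) (hom A x x)"
    and cmp_assoc: "\<lbrakk>x \<in> ob A; y \<in> ob A; z \<in> ob A; v \<in> ob A\<rbrakk>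
      \<Longrightarrow> cmp A x z v \<cdot> (cmp A x y z \<ast> \<iota> (hom A z v))
        = cmp A x y v \<cdot> (\<iota> (hom A x y) \<ast> cmp A y z v) \<cdot> \<a> (hom A x y) (hom A y z) (hom A z v)"
    and cmp_unt_left: "\<lbrakk>x \<in> ob A; y \<in> ob A\<rbrakk>
      \<Longrightarrow> cmp A x x y \<cdot> (unt A x \<ast> \<iota> (hom A x y)) = \<l> (hom A x y)"
    and cmp_unt_right: "\<lbrakk>x \<in> ob A; y \<in> ob A\<rbrakk>
      \<Longrightarrow> cmp A x y y \<cdot> (\<iota> (hom A x y) \<ast> unt A y) = \<r> (hom A x y)"

record ('u, 'o, 'm, 'c) wfun =
  fdom :: "('u, 'o, 'm, 'c) wcat"
  fcod :: "('u, 'o, 'm, 'c) wcat"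
  fob :: "'u \<Rightarrow> 'u"
  fmap :: "'u \<Rightarrow> 'u \<Rightarrow> 'c"

locale wfunctor =
  fixes W :: "('o, 'm, 'c) bicat" (structure) and F :: "('u, 'o, 'm, 'c) wfun"
    and B C :: "('u, 'o, 'm, 'c) wcat"
  assumes fdom: "fdom F = B" and fcod: "fcod F = C"
    and dom_wcategory: "wcategory W B" and cod_wcategory: "wcategory W C"
    and fob_in_ob: "x \<in> ob B \<Longrightarrow> fob F x \<in> ob C"
    and fob_ext: "x \<in> ob B \<Longrightarrow> ext C (fob F x) = ext B x"
    and fmap_in_hom: "\<lbrakk>x \<in> ob B; y \<in> ob B\<rbrakk>
      \<Longrightarrow> fmap F x y \<in> hom2 W (hom B x y) (hom C (fob F x) (fob F y))"
    and fmap_cmp: "\<lbrakk>x \<in> ob B; y \<in> ob B; z \<in> ob B\<rbrakk>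
      \<Longrightarrow> fmap F x z \<cdot> cmp B x y z
        = cmp C (fob F x) (fob F y) (fob F z) \<cdot> (fmap F x y \<ast> fmap F y z)"
    and fmap_unt: "x \<in> ob B \<Longrightarrow> fmap F x x \<cdot> unt B x = unt C (fob F x)"

definition wfun_comp :: "('o, 'm, 'c) bicat \<Rightarrow> ('u, 'o, 'm, 'c) wfun \<Rightarrow> ('u, 'o, 'm, 'c) wfun
    \<Rightarrow> ('u, 'o, 'm, 'c) wfun" where
  "wfun_comp W H F = \<lparr>fdom = fdom F, fcod = fcod H, fob = (\<lambda>x. fob H (fob F x)),
     fmap = (\<lambda>x y. fmap H (fob F x) (fob F y) \<cdot>\<^bsub>W\<^esub> fmap F x y)\<rparr>"

text \<open>The composite, in the ordinary category of objects of a fixed extent \<open>e\<close>, of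
  \<open>f : \<one> e \<Rightarrow> hom A x y\<close> and \<open>g : \<one> e \<Rightarrow> hom A y z\<close>.\<close>

definition point_comp :: "('o, 'm, 'c) bicat \<Rightarrow> ('u, 'o, 'm, 'c) wcat \<Rightarrow> 'u \<Rightarrow> 'u \<Rightarrow> 'u
    \<Rightarrow> 'c \<Rightarrow> 'c \<Rightarrow> 'c" where
  "point_comp W A x y z f g =
     cmp A x y z \<cdot>\<^bsub>W\<^esub> (f \<ast>\<^bsub>W\<^esub> g) \<cdot>\<^bsub>W\<^esub> inv2 W (\<l>\<^bsub>W\<^esub> (\<one>\<^bsub>W\<^esub> (ext A x)))"

definition idempotents_split :: "('o, 'm, 'c) bicat \<Rightarrow> ('u, 'o, 'm, 'c) wcat \<Rightarrow> bool" where
  "idempotents_split W A \<longleftrightarrow>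
     (\<forall>x\<in>ob A. \<forall>e\<in>hom2 W (\<one>\<^bsub>W\<^esub> (ext A x)) (hom A x x).
        point_comp W A x x x e e = e \<longrightarrow>
        (\<exists>y\<in>ob A. ext A y = ext A x \<and>
          (\<exists>s\<in>hom2 W (\<one>\<^bsub>W\<^esub> (ext A x)) (hom A x y). \<exists>r\<in>hom2 W (\<one>\<^bsub>W\<^esub> (ext A x)) (hom A y x).
             point_comp W A x y x s r = e \<and> point_comp W A y x y r s = unt A y)))"

text \<open>A module \<open>M\<close> from \<open>mdom M\<close> to \<open>mcod M\<close>: \<open>car M b a\<close> is \<open>M(b,a)\<close>, and the actions are
  \<open>lact M b' b a : hom (mcod M) b' b \<star> car M b a \<Rightarrow> car M b' a\<close> and
  \<open>ract M b a a' : car M b a \<star> hom (mdom M) a a' \<Rightarrow> car M b a'\<close>.\<close>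

record ('u, 'o, 'm, 'c) wmod =
  mdom :: "('u, 'o, 'm, 'c) wcat"
  mcod :: "('u, 'o, 'm, 'c) wcat"
  car :: "'u \<Rightarrow> 'u \<Rightarrow> 'm"
  lact :: "'u \<Rightarrow> 'u \<Rightarrow> 'u \<Rightarrow> 'c"
  ract :: "'u \<Rightarrow> 'u \<Rightarrow> 'u \<Rightarrow> 'c"

locale wmodule =
  fixes W :: "('o, 'm, 'c) bicat" (structure) and M :: "('u, 'o, 'm, 'c) wmod"
    and A B :: "('u, 'o, 'm, 'c) wcat"
  assumes mdom: "mdom M = A" and mcod: "mcod M = B"
    and dom_wcategory: "wcategory W A" and cod_wcategory: "wcategory W B"
    and car_in_hom: "\<lbrakk>b \<in> ob B; a \<in> ob A\<rbrakk> \<Longrightarrow> car M b a \<in> hom1 W (ext A a) (ext B b)"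
    and lact_in_hom: "\<lbrakk>b' \<in> ob B; b \<in> ob B; a \<in> ob A\<rbrakk>
      \<Longrightarrow> lact M b' b a \<in> hom2 W (hom B b' b \<star> car M b a) (car M b' a)"
    and ract_in_hom: "\<lbrakk>b \<in> ob B; a \<in> ob A; a' \<in> ob A\<rbrakk>
      \<Longrightarrow> ract M b a a' \<in> hom2 W (car M b a \<star> hom A a a') (car M b a')"
    and lact_assoc: "\<lbrakk>b'' \<in> ob B; b' \<in> ob B; b \<in> ob B; a \<in> ob A\<rbrakk>
      \<Longrightarrow> lact M b'' b a \<cdot> (cmp B b'' b' b \<ast> \<iota> (car M b a))
        = lact M b'' b' a \<cdot> (\<iota> (hom B b'' b') \<ast> lact M b' b a)
          \<cdot> \<a> (hom B b'' b') (hom B b' b) (car M b a)"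
    and lact_unt: "\<lbrakk>b \<in> ob B; a \<in> ob A\<rbrakk>
      \<Longrightarrow> lact M b b a \<cdot> (unt B b \<ast> \<iota> (car M b a)) = \<l> (car M b a)"
    and ract_assoc: "\<lbrakk>b \<in> ob B; a \<in> ob A; a' \<in> ob A; a'' \<in> ob A\<rbrakk>
      \<Longrightarrow> ract M b a' a'' \<cdot> (ract M b a a' \<ast> \<iota> (hom A a' a''))
        = ract M b a a'' \<cdot> (\<iota> (car M b a) \<ast> cmp A a a' a'')
          \<cdot> \<a> (car M b a) (hom A a a') (hom A a' a'')"
    and ract_unt: "\<lbrakk>b \<in> ob B; a \<in> ob A\<rbrakk>
      \<Longrightarrow> ract M b a a \<cdot> (\<iota> (car M b a) \<ast> unt A a) = \<r> (car M b a)"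
    and lact_ract: "\<lbrakk>b' \<in> ob B; b \<in> ob B; a \<in> ob A; a' \<in> ob A\<rbrakk>
      \<Longrightarrow> ract M b' a a' \<cdot> (lact M b' b a \<ast> \<iota> (hom A a a'))
        = lact M b' b a' \<cdot> (\<iota> (hom B b' b) \<ast> ract M b a a')
          \<cdot> \<a> (hom B b' b) (car M b a) (hom A a a')"

record ('u, 'o, 'm, 'c) wmor =
  msrc :: "('u, 'o, 'm, 'c) wmod"
  mtrg :: "('u, 'o, 'm, 'c) wmod"
  component :: "'u \<Rightarrow> 'u \<Rightarrow> 'c"

text \<open>Components at non-objects are \<open>undefined\<close>, so that equality of morphisms is equality of
  their components at objects.\<close>

definition mk_wmor :: "('u, 'o, 'm, 'c) wmod \<Rightarrow> ('u, 'o, 'm, 'c) wmod \<Rightarrow> ('u \<Rightarrow> 'u \<Rightarrow> 'c)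
    \<Rightarrow> ('u, 'o, 'm, 'c) wmor" where
  "mk_wmor M N t = \<lparr>msrc = M, mtrg = N,
     component = (\<lambda>b a. if b \<in> ob (mcod M) \<and> a \<in> ob (mdom M) then t b a else undefined)\<rparr>"

locale wmodule_morphism =
  fixes W :: "('o, 'm, 'c) bicat" (structure) and \<sigma> :: "('u, 'o, 'm, 'c) wmor"
    and M N :: "('u, 'o, 'm, 'c) wmod" and A B :: "('u, 'o, 'm, 'c) wcat"
  assumes msrc: "msrc \<sigma> = M" and mtrg: "mtrg \<sigma> = N"
    and src_wmodule: "wmodule W M A B" and trg_wmodule: "wmodule W N A B"
    and component_in_hom: "\<lbrakk>b \<in> ob B; a \<in> ob A\<rbrakk> \<Longrightarrow> component \<sigma> b a \<in> hom2 W (car M b a) (car N b a)"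
    and component_undefined: "\<not> (b \<in> ob B \<and> a \<in> ob A) \<Longrightarrow> component \<sigma> b a = undefined"
    and component_lact: "\<lbrakk>b' \<in> ob B; b \<in> ob B; a \<in> ob A\<rbrakk>
      \<Longrightarrow> component \<sigma> b' a \<cdot> lact M b' b a = lact N b' b a \<cdot> (\<iota> (hom B b' b) \<ast> component \<sigma> b a)"
    and component_ract: "\<lbrakk>b \<in> ob B; a \<in> ob A; a' \<in> ob A\<rbrakk>
      \<Longrightarrow> component \<sigma> b a' \<cdot> ract M b a a' = ract N b a a' \<cdot> (component \<sigma> b a \<ast> \<iota> (hom A a a'))"


section \<open>The bicategory of modules\<close>

text \<open>The coend of \<open>car N c b \<star> car M b a\<close> over the objects \<open>b\<close> of \<open>mcod M\<close>, for
  \<open>mdom N = mcod M\<close>.\<close>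

definition cowedge :: "('o, 'm, 'c) bicat \<Rightarrow> ('u, 'o, 'm, 'c) wmod \<Rightarrow> ('u, 'o, 'm, 'c) wmod
    \<Rightarrow> 'u \<Rightarrow> 'u \<Rightarrow> 'm \<Rightarrow> ('u \<Rightarrow> 'c) \<Rightarrow> bool" where
  "cowedge W N M c a p i \<longleftrightarrow>
     p \<in> hom1 W (ext (mdom M) a) (ext (mcod N) c) \<and>
     (\<forall>b\<in>ob (mcod M). i b \<in> hom2 W (car N c b \<star>\<^bsub>W\<^esub> car M b a) p) \<and>
     (\<forall>b\<in>ob (mcod M). \<forall>b'\<in>ob (mcod M).
        i b \<cdot>\<^bsub>W\<^esub> (\<iota>\<^bsub>W\<^esub> (car N c b) \<ast>\<^bsub>W\<^esub> lact M b b' a)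
            \<cdot>\<^bsub>W\<^esub> \<a>\<^bsub>W\<^esub> (car N c b) (hom (mcod M) b b') (car M b' a)
        = i b' \<cdot>\<^bsub>W\<^esub> (ract N c b b' \<ast>\<^bsub>W\<^esub> \<iota>\<^bsub>W\<^esub> (car M b' a)))"

definition is_coend :: "('o, 'm, 'c) bicat \<Rightarrow> ('u, 'o, 'm, 'c) wmod \<Rightarrow> ('u, 'o, 'm, 'c) wmod
    \<Rightarrow> 'u \<Rightarrow> 'u \<Rightarrow> 'm \<Rightarrow> ('u \<Rightarrow> 'c) \<Rightarrow> bool" where
  "is_coend W N M c a p i \<longleftrightarrow> cowedge W N M c a p i \<and>
     (\<forall>q j. cowedge W N M c a q j \<longrightarrow>
        (\<exists>!t. t \<in> hom2 W p q \<and> (\<forall>b\<in>ob (mcod M). t \<cdot>\<^bsub>W\<^esub> i b = j b)))"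

definition coend :: "('o, 'm, 'c) bicat \<Rightarrow> ('u, 'o, 'm, 'c) wmod \<Rightarrow> ('u, 'o, 'm, 'c) wmod
    \<Rightarrow> 'u \<Rightarrow> 'u \<Rightarrow> 'm \<times> ('u \<Rightarrow> 'c)" where
  "coend W N M c a = (SOME (p, i). is_coend W N M c a p i)"

context
  fixes W :: "('o, 'm, 'c) bicat" (structure)
begin

definition coend_ob ::
    "('u, 'o, 'm, 'c) wmod \<Rightarrow> ('u, 'o, 'm, 'c) wmod \<Rightarrow> 'u \<Rightarrow> 'u \<Rightarrow> 'm" where
  "coend_ob N M c a = fst (coend W N M c a)"

definition coend_in ::
    "('u, 'o, 'm, 'c) wmod \<Rightarrow> ('u, 'o, 'm, 'c) wmod \<Rightarrow> 'u \<Rightarrow> 'u \<Rightarrow> 'u \<Rightarrow> 'c" where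
  "coend_in N M c a = snd (coend W N M c a)"

text \<open>Composition with a 1-cell preserves coends in the presence of right liftings and right
  extensions, so the 2-cells below are determined by their restrictions along the coend
  inclusions.\<close>

definition mod_comp ::
    "('u, 'o, 'm, 'c) wmod \<Rightarrow> ('u, 'o, 'm, 'c) wmod \<Rightarrow> ('u, 'o, 'm, 'c) wmod" where
  "mod_comp N M = \<lparr>mdom = mdom M, mcod = mcod N, car = coend_ob N M,
     lact = (\<lambda>c' c a. THE t.
       t \<in> hom2 W (hom (mcod N) c' c \<star> coend_ob N M c a) (coend_ob N M c' a) \<and>
       (\<forall>b\<in>ob (mcod M). t \<cdot> (\<iota> (hom (mcod N) c' c) \<ast> coend_in N M c a b)
          = coend_in N M c' a b \<cdot> (lact N c' c b \<ast> \<iota> (car M b a))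
            \<cdot> inv2 W (\<a> (hom (mcod N) c' c) (car N c b) (car M b a)))),
     ract = (\<lambda>c a a'. THE t.
       t \<in> hom2 W (coend_ob N M c a \<star> hom (mdom M) a a') (coend_ob N M c a') \<and>
       (\<forall>b\<in>ob (mcod M). t \<cdot> (coend_in N M c a b \<ast> \<iota> (hom (mdom M) a a'))
          = coend_in N M c a' b \<cdot> (\<iota> (car N c b) \<ast> ract M b a a')
            \<cdot> \<a> (car N c b) (car M b a) (hom (mdom M) a a')))\<rparr>"

definition mod_id :: "('u, 'o, 'm, 'c) wcat \<Rightarrow> ('u, 'o, 'm, 'c) wmod" where
  "mod_id A = \<lparr>mdom = A, mcod = A, car = hom A, lact = cmp A, ract = cmp A\<rparr>"

definition mor_id :: "('u, 'o, 'm, 'c) wmod \<Rightarrow> ('u, 'o, 'm, 'c) wmor" where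
  "mor_id M = mk_wmor M M (\<lambda>b a. \<iota> (car M b a))"

definition mor_vcomp ::
    "('u, 'o, 'm, 'c) wmor \<Rightarrow> ('u, 'o, 'm, 'c) wmor \<Rightarrow> ('u, 'o, 'm, 'c) wmor" where
  "mor_vcomp \<tau> \<sigma> = mk_wmor (msrc \<sigma>) (mtrg \<tau>) (\<lambda>b a. component \<tau> b a \<cdot> component \<sigma> b a)"

definition mor_hcomp ::
    "('u, 'o, 'm, 'c) wmor \<Rightarrow> ('u, 'o, 'm, 'c) wmor \<Rightarrow> ('u, 'o, 'm, 'c) wmor" where
  "mor_hcomp \<tau> \<sigma> =
     (let N = msrc \<tau>; N' = mtrg \<tau>; M = msrc \<sigma>; M' = mtrg \<sigma> in
      mk_wmor (mod_comp N M) (mod_comp N' M') (\<lambda>c a. THE t.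
        t \<in> hom2 W (coend_ob N M c a) (coend_ob N' M' c a) \<and>
        (\<forall>b\<in>ob (mcod M). t \<cdot> coend_in N M c a b = coend_in N' M' c a b \<cdot> (component \<tau> c b \<ast> component \<sigma> b a))))"

definition mod_assoc :: "('u, 'o, 'm, 'c) wmod \<Rightarrow> ('u, 'o, 'm, 'c) wmod \<Rightarrow> ('u, 'o, 'm, 'c) wmod
    \<Rightarrow> ('u, 'o, 'm, 'c) wmor" where
  "mod_assoc P N M =
     mk_wmor (mod_comp (mod_comp P N) M) (mod_comp P (mod_comp N M)) (\<lambda>d a. THE t.
       t \<in> hom2 W (coend_ob (mod_comp P N) M d a) (coend_ob P (mod_comp N M) d a) \<and>
       (\<forall>c\<in>ob (mcod N). \<forall>b\<in>ob (mcod M).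
          t \<cdot> coend_in (mod_comp P N) M d a b \<cdot> (coend_in P N d b c \<ast> \<iota> (car M b a))
          = coend_in P (mod_comp N M) d a c \<cdot> (\<iota> (car P d c) \<ast> coend_in N M c a b)
            \<cdot> \<a> (car P d c) (car N c b) (car M b a)))"

definition mod_lunit :: "('u, 'o, 'm, 'c) wmod \<Rightarrow> ('u, 'o, 'm, 'c) wmor" where
  "mod_lunit M = mk_wmor (mod_comp (mod_id (mcod M)) M) M (\<lambda>c a. THE t.
     t \<in> hom2 W (coend_ob (mod_id (mcod M)) M c a) (car M c a) \<and>
     (\<forall>b\<in>ob (mcod M). t \<cdot> coend_in (mod_id (mcod M)) M c a b = lact M c b a))"

definition mod_runit :: "('u, 'o, 'm, 'c) wmod \<Rightarrow> ('u, 'o, 'm, 'c) wmor" where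
  "mod_runit M = mk_wmor (mod_comp M (mod_id (mdom M))) M (\<lambda>c a. THE t.
     t \<in> hom2 W (coend_ob M (mod_id (mdom M)) c a) (car M c a) \<and>
     (\<forall>b\<in>ob (mdom M). t \<cdot> coend_in M (mod_id (mdom M)) c a b = ract M c b a))"

definition Mod ::
    "(('u, 'o, 'm, 'c) wcat, ('u, 'o, 'm, 'c) wmod, ('u, 'o, 'm, 'c) wmor) bicat" where
  "Mod = \<lparr>obj = {A. wcategory W A},
     cells1 = {M. wmodule W M (mdom M) (mcod M)}, src = mdom, trg = mcod,
     cells2 = {\<sigma>. wmodule_morphism W \<sigma> (msrc \<sigma>) (mtrg \<sigma>) (mdom (msrc \<sigma>)) (mcod (msrc \<sigma>))},
     dom2 = msrc, cod2 = mtrg,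
     unit1 = mod_id, comp1 = mod_comp, id2 = mor_id, vcomp = mor_vcomp, hcomp = mor_hcomp,
     assoc = mod_assoc, lunit = mod_lunit, runit = mod_runit\<rparr>"


section \<open>Functors as modules\<close>

text \<open>The module \<open>C(1,F)\<close> with which a functor \<open>F : B \<rightarrow> C\<close> is identified, and its right adjoint
  \<open>C(F,1)\<close>.\<close>

definition rep :: "('u, 'o, 'm, 'c) wfun \<Rightarrow> ('u, 'o, 'm, 'c) wmod" where
  "rep F = (let C = fcod F in \<lparr>mdom = fdom F, mcod = C,
     car = (\<lambda>c b. hom C c (fob F b)),
     lact = (\<lambda>c' c b. cmp C c' c (fob F b)),
     ract = (\<lambda>c b b'. cmp C c (fob F b) (fob F b') \<cdot> (\<iota> (hom C c (fob F b)) \<ast> fmap F b b'))\<rparr>)"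

definition corep :: "('u, 'o, 'm, 'c) wfun \<Rightarrow> ('u, 'o, 'm, 'c) wmod" where
  "corep F = (let C = fcod F in \<lparr>mdom = C, mcod = fdom F,
     car = (\<lambda>b c. hom C (fob F b) c),
     lact = (\<lambda>b' b c. cmp C (fob F b') (fob F b) c \<cdot> (fmap F b' b \<ast> \<iota> (hom C (fob F b) c))),
     ract = (\<lambda>b c c'. cmp C (fob F b) c c')\<rparr>)"

definition hom_mod :: "('u, 'o, 'm, 'c) wfun \<Rightarrow> ('u, 'o, 'm, 'c) wfun \<Rightarrow> ('u, 'o, 'm, 'c) wmod" where
  "hom_mod F Z = mod_comp (corep F) (rep Z)"

text \<open>The component \<open>C(F,Z)(b,a) \<Rightarrow> C(F b, Z a)\<close> of the canonical isomorphism, induced by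
  composition in \<open>C\<close>.\<close>

definition hom_mod_iso ::
    "('u, 'o, 'm, 'c) wfun \<Rightarrow> ('u, 'o, 'm, 'c) wfun \<Rightarrow> 'u \<Rightarrow> 'u \<Rightarrow> 'c" where
  "hom_mod_iso F Z b a = (THE t.
     t \<in> hom2 W (car (hom_mod F Z) b a) (hom (fcod F) (fob F b) (fob Z a)) \<and>
     (\<forall>c\<in>ob (fcod F). t \<cdot> coend_in (corep F) (rep Z) b a c = cmp (fcod F) (fob F b) c (fob Z a)))"

definition rep_unit :: "('u, 'o, 'm, 'c) wfun \<Rightarrow> ('u, 'o, 'm, 'c) wmor" where
  "rep_unit F = mk_wmor (mod_id (fdom F)) (mod_comp (corep F) (rep F))
     (\<lambda>b b'. inv2 W (hom_mod_iso F F b b') \<cdot> fmap F b b')"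

definition rep_counit :: "('u, 'o, 'm, 'c) wfun \<Rightarrow> ('u, 'o, 'm, 'c) wmor" where
  "rep_counit F = mk_wmor (mod_comp (rep F) (corep F)) (mod_id (fcod F)) (\<lambda>c c'. THE t.
     t \<in> hom2 W (coend_ob (rep F) (corep F) c c') (hom (fcod F) c c') \<and>
     (\<forall>b\<in>ob (fdom F). t \<cdot> coend_in (rep F) (corep F) c c' b = cmp (fcod F) c (fob F b) c'))"

text \<open>The morphism \<open>C(F,Z) \<Rightarrow> X(HF,HZ)\<close> given by the effect \<open>C(F b, Z a) \<Rightarrow> X(H F b, H Z a)\<close>
  of \<open>H\<close> on homs.\<close>

definition hom_mod_map :: "('u, 'o, 'm, 'c) wfun \<Rightarrow> ('u, 'o, 'm, 'c) wfun \<Rightarrow> ('u, 'o, 'm, 'c) wfun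
    \<Rightarrow> ('u, 'o, 'm, 'c) wmor" where
  "hom_mod_map H F Z = mk_wmor (hom_mod F Z) (hom_mod (wfun_comp W H F) (wfun_comp W H Z))
     (\<lambda>b a. inv2 W (hom_mod_iso (wfun_comp W H F) (wfun_comp W H Z) b a)
        \<cdot> fmap H (fob F b) (fob Z a) \<cdot> hom_mod_iso F Z b a)"

end


section \<open>Weighted colimits\<close>

definition weighted_colimit :: "('o, 'm, 'c) bicat \<Rightarrow> ('u, 'o, 'm, 'c) wmod \<Rightarrow> ('u, 'o, 'm, 'c) wfun
    \<Rightarrow> ('u, 'o, 'm, 'c) wfun \<Rightarrow> ('u, 'o, 'm, 'c) wmor \<Rightarrow> bool" where
  "weighted_colimit W M F Z \<alpha> \<longleftrightarrow>
     wfunctor W Z (mdom M) (fcod F) \<and>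
     \<alpha> \<in> hom2 (Mod W) M (hom_mod W F Z) \<and>
     iso2 (Mod W) (lifting_transpose (Mod W) M (corep W F) (corep W Z)
       (\<r>\<^bsub>Mod W\<^esub> (corep W F)
        \<cdot>\<^bsub>Mod W\<^esub> (\<iota>\<^bsub>Mod W\<^esub> (corep W F) \<ast>\<^bsub>Mod W\<^esub> rep_counit W Z)
        \<cdot>\<^bsub>Mod W\<^esub> \<a>\<^bsub>Mod W\<^esub> (corep W F) (rep W Z) (corep W Z)
        \<cdot>\<^bsub>Mod W\<^esub> (\<alpha> \<ast>\<^bsub>Mod W\<^esub> \<iota>\<^bsub>Mod W\<^esub> (corep W Z))))"

definition preserves_weighted_colimit :: "('o, 'm, 'c) bicat \<Rightarrow> ('u, 'o, 'm, 'c) wmod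
    \<Rightarrow> ('u, 'o, 'm, 'c) wfun \<Rightarrow> ('u, 'o, 'm, 'c) wfun \<Rightarrow> ('u, 'o, 'm, 'c) wmor
    \<Rightarrow> ('u, 'o, 'm, 'c) wfun \<Rightarrow> bool" where
  "preserves_weighted_colimit W M F Z \<alpha> H \<longleftrightarrow>
     weighted_colimit W M (wfun_comp W H F) (wfun_comp W H Z) (hom_mod_map W H F Z \<cdot>\<^bsub>Mod W\<^esub> \<alpha>)"

definition absolute_weighted_colimit :: "('o, 'm, 'c) bicat \<Rightarrow> ('u, 'o, 'm, 'c) wmod
    \<Rightarrow> ('u, 'o, 'm, 'c) wfun \<Rightarrow> ('u, 'o, 'm, 'c) wfun \<Rightarrow> ('u, 'o, 'm, 'c) wmor \<Rightarrow> bool" where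
  "absolute_weighted_colimit W M F Z \<alpha> \<longleftrightarrow> weighted_colimit W M F Z \<alpha> \<and>
     (\<forall>(X :: ('u, 'o, 'm, 'c) wcat) H.
        wfunctor W H (fcod F) X \<longrightarrow> preserves_weighted_colimit W M F Z \<alpha> H)"

text \<open>The two equations on \<open>\<alpha> : M \<Rightarrow> C(F,Z)\<close> and \<open>\<beta> : Z \<Rightarrow> F \<circ> M\<close>, with the associativity and unit
  constraints of \<open>Mod W\<close> inserted.\<close>

definition equation_E1 :: "('o, 'm, 'c) bicat \<Rightarrow> ('u, 'o, 'm, 'c) wmod \<Rightarrow> ('u, 'o, 'm, 'c) wfun
    \<Rightarrow> ('u, 'o, 'm, 'c) wmor \<Rightarrow> ('u, 'o, 'm, 'c) wmor \<Rightarrow> bool" where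
  "equation_E1 W M F \<alpha> \<beta> \<longleftrightarrow>
     (\<iota>\<^bsub>Mod W\<^esub> (corep W F) \<ast>\<^bsub>Mod W\<^esub> \<beta>) \<cdot>\<^bsub>Mod W\<^esub> \<alpha>
     = \<a>\<^bsub>Mod W\<^esub> (corep W F) (rep W F) M
       \<cdot>\<^bsub>Mod W\<^esub> (rep_unit W F \<ast>\<^bsub>Mod W\<^esub> \<iota>\<^bsub>Mod W\<^esub> M)
       \<cdot>\<^bsub>Mod W\<^esub> inv2 (Mod W) (\<l>\<^bsub>Mod W\<^esub> M)"

definition equation_E2 :: "('o, 'm, 'c) bicat \<Rightarrow> ('u, 'o, 'm, 'c) wfun \<Rightarrow> ('u, 'o, 'm, 'c) wfun
    \<Rightarrow> ('u, 'o, 'm, 'c) wmor \<Rightarrow> ('u, 'o, 'm, 'c) wmor \<Rightarrow> bool" where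
  "equation_E2 W F Z \<alpha> \<beta> \<longleftrightarrow>
     \<l>\<^bsub>Mod W\<^esub> (rep W Z)
       \<cdot>\<^bsub>Mod W\<^esub> (rep_counit W F \<ast>\<^bsub>Mod W\<^esub> \<iota>\<^bsub>Mod W\<^esub> (rep W Z))
       \<cdot>\<^bsub>Mod W\<^esub> inv2 (Mod W) (\<a>\<^bsub>Mod W\<^esub> (rep W F) (corep W F) (rep W Z))
       \<cdot>\<^bsub>Mod W\<^esub> (\<iota>\<^bsub>Mod W\<^esub> (rep W F) \<ast>\<^bsub>Mod W\<^esub> \<alpha>)
       \<cdot>\<^bsub>Mod W\<^esub> \<beta>
     = \<iota>\<^bsub>Mod W\<^esub> (rep W Z)"

end

theory Submission
 imports Defs
begin

text \<open>
 Everything is reduced to calculations with elements. A generalized element of a 1-cell \<open>f\<close> of the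
 base is a 2-cell into \<open>f\<close> from a bracketed string of 1-cells. Elements can be juxtaposed, 2-cells act
 on them, and the coherence 2-cells act trivially; so a 2-cell is determined by its values and the
 axioms for enriched categories, functors and modules become the familiar equations. Since the base
 has right liftings and right extensions, composition preserves colimits, and 2-cells out of a
 coend \<open>\<integral> N(c,b) \<star> M(b,a)\<close>, even when it is whiskered, are determined by their values on the
 classes of \<open>n \<otimes> m\<close>.

 By the Yoneda isomorphism a morphism \<open>\<alpha> : M \<Rightarrow> C(F,Z)\<close> assigns to \<open>m\<close> in \<open>M(b,a)\<close> an element
 \<open>\<alpha>(m)\<close> of \<open>C(F b, Z a)\<close>; its mate \<open>F \<circ> M \<Rightarrow> Z\<close> sends the class of \<open>f \<otimes> m\<close> to \<open>f \<cdot> \<alpha>(m)\<close>, and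
 every morphism \<open>F \<circ> M \<Rightarrow> Z\<close> is such a mate. The first equation says \<open>\<beta>(\<alpha>(m)) = [1 \<otimes> m]\<close>, that is,
 \<open>\<beta>\<close> is a retraction of the mate; the second says that \<open>\<beta>\<close> is a section of it. Hence the two
 equations together say that the mate is invertible with inverse \<open>\<beta>\<close>, which is representability of
 \<open>F \<circ> M\<close>. If only the first holds, the composite of \<open>\<beta>\<close> with the mate is an idempotent on \<open>Z\<close>, and
 splitting it at each \<open>Z a\<close> yields a functor that represents \<open>F \<circ> M\<close> (\<open>E1_split\<close>).

 Given both equations, the points \<open>\<nu> = \<beta>(1)\<close> of \<open>(F \<circ> M)(Z a, a)\<close> satisfy \<open>\<alpha>(m) \<cdot> \<nu> = [1 \<otimes> m]\<close> and
 are sent by the mate to identities. Such points reconstruct a lift of any \<open>\<sigma> : M \<circ> L \<Rightarrow> C(F,1)\<close>,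
 so \<open>Z\<close> is a colimit (\<open>reconstructs_weighted_colimit\<close>); as the two properties of \<open>\<nu>\<close> are equations,
 every functor preserves them and the colimit is absolute (\<open>reconstructs_absolute\<close>).

 Conversely, an absolute colimit is preserved by the inclusion of \<open>C\<close> into the collage of the module
 \<open>F \<circ> M\<close>, in which \<open>(F \<circ> M)(c,a)\<close> is the hom from \<open>a\<close> to \<open>c\<close>. There the classes \<open>[1 \<otimes> m]\<close> form a
 cocone under \<open>F\<close> with vertex \<open>a\<close>, and the universal property provides \<open>\<nu>\<close> with
 \<open>\<alpha>(m) \<cdot> \<nu> = [1 \<otimes> m]\<close>, natural in \<open>a\<close> (\<open>absolute_collage\<close>). That the mate sends \<open>\<nu>\<close> to the identity
 is the uniqueness of lifts for the original colimit (\<open>absolute_E1_E2\<close>).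
\<close>



section \<open>Bicategories\<close>

lemma inverse2_unique:
 assumes "bicategory W" "inverse2 W s t" "inverse2 W s t'"
 shows "t = t'"
proof -
 interpret bicategory W by fact
 let ?a = "src W (dom2 W s)" and ?b = "trg W (dom2 W s)"
 have s: "s : cells2 W" using assms(2) by (simp add: inverse2_def)
 have par: "dom2 W s : hom1 W ?a ?b" "cod2 W s : hom1 W ?a ?b"
  using dom2_cod2[OF s] by (auto simp: hom1_def)
 have obj: "?a : obj W" "?b : obj W" using dom2_cod2[OF s] src_trg by auto
 interpret category "homcat W ?a ?b" using hom_category obj by blast
 let ?K = "homcat W ?a ?b"
 have tt: "t : chom ?K (cod2 W s) (dom2 W s)" "t' : chom ?K (cod2 W s) (dom2 W s)"
   "s : chom ?K (dom2 W s) (cod2 W s)"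
  using assms(2,3) par s by (auto simp: inverse2_def chom_def homcat_def hom2_def)
 have "t = ccomp ?K t (cid ?K (cod2 W s))" using id_right[OF tt(1)] by simp
 also have "\<dots> = ccomp ?K t (ccomp ?K s t')" using assms(3) by (simp add: inverse2_def homcat_def)
 also have "\<dots> = ccomp ?K (ccomp ?K t s) t'" using comp_assoc[OF tt(2,3,1)] by simp
 also have "\<dots> = t'" using assms(2) id_left[OF tt(2)] by (simp add: inverse2_def homcat_def)
 finally show ?thesis .
qed

context bicategory
begin

lemma hom2D: assumes "\<sigma> : hom2 W f g"
 shows "\<sigma> : cells2 W" "dom2 W \<sigma> = f" "cod2 W \<sigma> = g" "f : cells1 W" "g : cells1 W"
  "src W g = src W f" "trg W g = trg W f"
 using assms dom2_cod2[of \<sigma>] by (auto simp: hom2_def)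

lemma cod2_cells [simp]:
 assumes "\<sigma> : cells2 W"
 shows "dom2 W \<sigma> : cells1 W" "cod2 W \<sigma> : cells1 W" "src W (cod2 W \<sigma>) = src W (dom2 W \<sigma>)"
  "trg W (cod2 W \<sigma>) = trg W (dom2 W \<sigma>)"
 using dom2_cod2[OF assms] by auto

lemma src_in [simp]: "f : cells1 W ==> src W f : obj W"
 and trg_in [simp]: "f : cells1 W ==> trg W f : obj W"
 using src_trg by auto

lemma hom2_iff: "\<sigma> : hom2 W f g \<longleftrightarrow> \<sigma> : cells2 W & dom2 W \<sigma> = f & cod2 W \<sigma> = g"
 by (simp add: hom2_def)

lemma hom1_iff: "f : hom1 W a b \<longleftrightarrow> f : cells1 W & src W f = a & trg W f = b"
 by (simp add: hom1_def)

lemma parallel_comp: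
 assumes "\<sigma> : cells2 W" "\<tau> : cells2 W" "cod2 W \<sigma> = dom2 W \<tau>"
 shows "src W (dom2 W \<tau>) = src W (dom2 W \<sigma>)" "trg W (dom2 W \<tau>) = trg W (dom2 W \<sigma>)"
 using cod2_cells(3,4)[OF assms(1)] assms(3) by auto

lemma vcomp_cell [simp]:
 assumes "\<sigma> : cells2 W" "\<tau> : cells2 W" "cod2 W \<sigma> = dom2 W \<tau>"
 shows "\<tau> \<cdot> \<sigma> : cells2 W" "dom2 W (\<tau> \<cdot> \<sigma>) = dom2 W \<sigma>" "cod2 W (\<tau> \<cdot> \<sigma>) = cod2 W \<tau>"
proof -
 let ?a = "src W (dom2 W \<sigma>)" and ?b = "trg W (dom2 W \<sigma>)"
 interpret category "homcat W ?a ?b" using hom_category assms by simp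
 have "\<sigma> : chom (homcat W ?a ?b) (dom2 W \<sigma>) (cod2 W \<sigma>)" "\<tau> : chom (homcat W ?a ?b) (cod2 W \<sigma>) (cod2 W \<tau>)"
  using assms parallel_comp[OF assms] by (simp_all add: chom_def homcat_def hom1_def)
 then have "ccomp (homcat W ?a ?b) \<tau> \<sigma> : chom (homcat W ?a ?b) (dom2 W \<sigma>) (cod2 W \<tau>)" by (rule comp_in_hom)
 then show "\<tau> \<cdot> \<sigma> : cells2 W" "dom2 W (\<tau> \<cdot> \<sigma>) = dom2 W \<sigma>" "cod2 W (\<tau> \<cdot> \<sigma>) = cod2 W \<tau>"
  by (auto simp: chom_def homcat_def)
qed

lemma vcomp_in: "\<sigma> : hom2 W f g ==> \<tau> : hom2 W g h ==> \<tau> \<cdot> \<sigma> : hom2 W f h"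
 by (simp add: hom2_iff)

lemma vassoc:
 assumes "\<sigma> : cells2 W" "\<tau> : cells2 W" "\<rho> : cells2 W" "cod2 W \<sigma> = dom2 W \<tau>" "cod2 W \<tau> = dom2 W \<rho>"
 shows "(\<rho> \<cdot> \<tau>) \<cdot> \<sigma> = \<rho> \<cdot> \<tau> \<cdot> \<sigma>"
proof -
 let ?a = "src W (dom2 W \<sigma>)" and ?b = "trg W (dom2 W \<sigma>)"
 interpret category "homcat W ?a ?b" using hom_category assms by simp
 have "\<sigma> : chom (homcat W ?a ?b) (dom2 W \<sigma>) (cod2 W \<sigma>)" "\<tau> : chom (homcat W ?a ?b) (cod2 W \<sigma>) (cod2 W \<tau>)"
  "\<rho> : chom (homcat W ?a ?b) (cod2 W \<tau>) (cod2 W \<rho>)"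
  using assms parallel_comp[OF assms(1,2,4)] parallel_comp[OF assms(2,3,5)]
  by (simp_all add: chom_def homcat_def hom1_def)
 from comp_assoc[OF this] show ?thesis by (simp add: homcat_def)
qed

lemma id2_cell [simp]:
 assumes "f : cells1 W" shows "\<iota> f : cells2 W" "dom2 W (\<iota> f) = f" "cod2 W (\<iota> f) = f"
proof -
 interpret category "homcat W (src W f) (trg W f)" using hom_category assms by simp
 have "f : cobj (homcat W (src W f) (trg W f))" using assms by (simp add: homcat_def hom1_def)
 from id_in_hom[OF this] show "\<iota> f : cells2 W" "dom2 W (\<iota> f) = f" "cod2 W (\<iota> f) = f"
  by (auto simp: homcat_def chom_def)
qed

lemma vid [simp]:
 assumes "\<sigma> : cells2 W"
 shows "g = cod2 W \<sigma> ==> \<iota> g \<cdot> \<sigma> = \<sigma>" "f = dom2 W \<sigma> ==> \<sigma> \<cdot> \<iota> f = \<sigma>"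
proof -
 let ?a = "src W (dom2 W \<sigma>)" and ?b = "trg W (dom2 W \<sigma>)"
 interpret category "homcat W ?a ?b" using hom_category assms by simp
 have "\<sigma> : chom (homcat W ?a ?b) (dom2 W \<sigma>) (cod2 W \<sigma>)"
  using assms by (simp add: chom_def homcat_def hom1_def)
 from id_left[OF this] id_right[OF this]
 show "g = cod2 W \<sigma> ==> \<iota> g \<cdot> \<sigma> = \<sigma>" "f = dom2 W \<sigma> ==> \<sigma> \<cdot> \<iota> f = \<sigma>" by (simp_all add: homcat_def)
qed

lemma comp1_cell [simp]:
 assumes "f : cells1 W" "g : cells1 W" "src W g = trg W f"
 shows "g \<star> f : cells1 W" "src W (g \<star> f) = src W f" "trg W (g \<star> f) = trg W g"
 using comp1_in_hom[of f "src W f" "trg W f" g "trg W g"] assms by (auto simp: hom1_def)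

lemma unit1_cell [simp]:
 assumes "a : obj W"
 shows "\<one> a : cells1 W" "src W (\<one> a) = a" "trg W (\<one> a) = a"
 using unit1_in_hom[OF assms] by (auto simp: hom1_def)

lemma hcomp_cell [simp]:
 assumes "\<sigma> : cells2 W" "\<tau> : cells2 W" "src W (dom2 W \<tau>) = trg W (dom2 W \<sigma>)"
 shows "\<tau> \<ast> \<sigma> : cells2 W" "dom2 W (\<tau> \<ast> \<sigma>) = dom2 W \<tau> \<star> dom2 W \<sigma>" "cod2 W (\<tau> \<ast> \<sigma>) = cod2 W \<tau> \<star> cod2 W \<sigma>"
 using hcomp_in_hom[of "dom2 W \<sigma>" "src W (dom2 W \<sigma>)" "trg W (dom2 W \<sigma>)" "dom2 W \<tau>" "trg W (dom2 W \<tau>)"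
   \<sigma> "cod2 W \<sigma>" \<tau> "cod2 W \<tau>"] assms
 by (auto simp: hom2_iff hom1_iff)

lemma hid [simp]: "[|f : cells1 W; g : cells1 W; src W g = trg W f|] ==> \<iota> g \<ast> \<iota> f = \<iota> (g \<star> f)"
 using hcomp_id[of f "src W f" "trg W f" g "trg W g"] by (simp add: hom1_iff)

lemma inter:
 assumes "\<sigma> : cells2 W" "\<tau> : cells2 W" "\<sigma>' : cells2 W" "\<tau>' : cells2 W"
  "cod2 W \<sigma> = dom2 W \<sigma>'" "cod2 W \<tau> = dom2 W \<tau>'" "src W (dom2 W \<tau>) = trg W (dom2 W \<sigma>)"
 shows "(\<tau>' \<ast> \<sigma>') \<cdot> (\<tau> \<ast> \<sigma>) = (\<tau>' \<cdot> \<tau>) \<ast> (\<sigma>' \<cdot> \<sigma>)"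
 using interchange[of "dom2 W \<sigma>" "src W (dom2 W \<sigma>)" "trg W (dom2 W \<sigma>)" "dom2 W \<tau>" "trg W (dom2 W \<tau>)"
  \<sigma> "cod2 W \<sigma>" \<sigma>' "cod2 W \<sigma>'" \<tau> "cod2 W \<tau>" \<tau>' "cod2 W \<tau>'"] assms
 by (simp add: hom2_iff hom1_iff)

lemma assoc_cell [simp]:
 assumes "f : cells1 W" "g : cells1 W" "h : cells1 W" "src W g = trg W f" "src W h = trg W g"
 shows "\<a> h g f : cells2 W" "dom2 W (\<a> h g f) = (h \<star> g) \<star> f" "cod2 W (\<a> h g f) = h \<star> g \<star> f"
  "iso2 W (\<a> h g f)"
 using assoc_in_hom[of f "src W f" "trg W f" g "trg W g" h "trg W h"]
  assoc_iso[of f "src W f" "trg W f" g "trg W g" h "trg W h"] assms by (auto simp: hom1_iff hom2_iff)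

lemma lunit_cell [simp]:
 assumes "f : cells1 W"
 shows "\<l> f : cells2 W" "dom2 W (\<l> f) = \<one> (trg W f) \<star> f" "cod2 W (\<l> f) = f" "iso2 W (\<l> f)"
 using lunit_in_hom[of f "src W f" "trg W f"] lunit_iso[of f "src W f" "trg W f"] assms
 by (auto simp: hom1_iff hom2_iff)

lemma runit_cell [simp]:
 assumes "f : cells1 W"
 shows "\<r> f : cells2 W" "dom2 W (\<r> f) = f \<star> \<one> (src W f)" "cod2 W (\<r> f) = f" "iso2 W (\<r> f)"
 using runit_in_hom[of f "src W f" "trg W f"] runit_iso[of f "src W f" "trg W f"] assms
 by (auto simp: hom1_iff hom2_iff)

lemma assoc_nat:
 assumes "\<rho> : cells2 W" "\<sigma> : cells2 W" "\<tau> : cells2 W" 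
  "src W (dom2 W \<sigma>) = trg W (dom2 W \<rho>)" "src W (dom2 W \<tau>) = trg W (dom2 W \<sigma>)"
 shows "\<a> (cod2 W \<tau>) (cod2 W \<sigma>) (cod2 W \<rho>) \<cdot> ((\<tau> \<ast> \<sigma>) \<ast> \<rho>)
  = (\<tau> \<ast> \<sigma> \<ast> \<rho>) \<cdot> \<a> (dom2 W \<tau>) (dom2 W \<sigma>) (dom2 W \<rho>)"
 using assms by (intro assoc_natural) (auto simp: hom1_iff hom2_iff)

lemma lunit_nat: "\<sigma> : cells2 W ==> e = trg W (dom2 W \<sigma>) ==>
  \<l> (cod2 W \<sigma>) \<cdot> (\<iota> (\<one> e) \<ast> \<sigma>) = \<sigma> \<cdot> \<l> (dom2 W \<sigma>)"
 by (rule lunit_natural[of _ "src W (dom2 W \<sigma>)"]) (auto simp: hom1_iff hom2_iff)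

lemma runit_nat: "\<sigma> : cells2 W ==> e = src W (dom2 W \<sigma>) ==>
  \<r> (cod2 W \<sigma>) \<cdot> (\<sigma> \<ast> \<iota> (\<one> e)) = \<sigma> \<cdot> \<r> (dom2 W \<sigma>)"
 by (rule runit_natural[of _ _ "trg W (dom2 W \<sigma>)"]) (auto simp: hom1_iff hom2_iff)

lemma penta:
 assumes "f : cells1 W" "g : cells1 W" "h : cells1 W" "k : cells1 W"
  "src W g = trg W f" "src W h = trg W g" "src W k = trg W h"
 shows "(\<iota> k \<ast> \<a> h g f) \<cdot> \<a> k (h \<star> g) f \<cdot> (\<a> k h g \<ast> \<iota> f) = \<a> k h (g \<star> f) \<cdot> \<a> (k \<star> h) g f"
 using assms by (intro pentagon) (auto simp: hom1_iff)

lemma trian: "[|f : cells1 W; g : cells1 W; src W g = trg W f; b = trg W f|]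
  ==> (\<iota> g \<ast> \<l> f) \<cdot> \<a> g (\<one> b) f = \<r> g \<ast> \<iota> f"
 by (rule triangle) (auto simp: hom1_iff)

lemma inv2_inverse2: "iso2 W \<sigma> ==> inverse2 W \<sigma> (inv2 W \<sigma>)"
 unfolding iso2_def inv2_def
 by (rule theI') (metis inverse2_unique bicategory_axioms)

lemma iso2_cells: "iso2 W \<sigma> ==> \<sigma> : cells2 W"
 by (auto simp: iso2_def inverse2_def)

lemma inv2_eqI: "inverse2 W \<sigma> \<tau> ==> inv2 W \<sigma> = \<tau>"
 by (metis inverse2_unique bicategory_axioms inv2_inverse2 iso2_def)

lemma inv2_cell [simp]:
 assumes "iso2 W \<sigma>"
 shows "inv2 W \<sigma> : cells2 W" "dom2 W (inv2 W \<sigma>) = cod2 W \<sigma>" "cod2 W (inv2 W \<sigma>) = dom2 W \<sigma>"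
  "inv2 W \<sigma> \<cdot> \<sigma> = \<iota> (dom2 W \<sigma>)" "\<sigma> \<cdot> inv2 W \<sigma> = \<iota> (cod2 W \<sigma>)"
 using inv2_inverse2[OF assms] by (auto simp: inverse2_def hom2_iff)

lemma iso2_inv2 [simp]: "iso2 W \<sigma> ==> iso2 W (inv2 W \<sigma>)"
 unfolding iso2_def[of W "inv2 W \<sigma>"]
 by (rule exI[of _ \<sigma>]) (auto simp: inverse2_def hom2_iff dest: iso2_cells)

lemma iso2_id [simp]: "f : cells1 W ==> iso2 W (\<iota> f)"
 unfolding iso2_def by (rule exI[of _ "\<iota> f"]) (simp add: inverse2_def hom2_iff)

lemma iso2_vcomp [simp]:
 assumes "iso2 W \<sigma>" "iso2 W \<tau>" "cod2 W \<sigma> = dom2 W \<tau>"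
 shows "iso2 W (\<tau> \<cdot> \<sigma>)"
proof -
 note c = iso2_cells[OF assms(1)] iso2_cells[OF assms(2)]
 have 1: "(inv2 W \<sigma> \<cdot> inv2 W \<tau>) \<cdot> \<tau> \<cdot> \<sigma> = \<iota> (dom2 W \<sigma>)"
 proof -
  have "(inv2 W \<sigma> \<cdot> inv2 W \<tau>) \<cdot> \<tau> \<cdot> \<sigma> = inv2 W \<sigma> \<cdot> (inv2 W \<tau> \<cdot> \<tau>) \<cdot> \<sigma>"
   using assms c by (simp add: vassoc del: inv2_cell(4,5))
  then show ?thesis using assms c by simp
 qed
 have 2: "(\<tau> \<cdot> \<sigma>) \<cdot> inv2 W \<sigma> \<cdot> inv2 W \<tau> = \<iota> (cod2 W \<tau>)"
 proof -
  have "(\<tau> \<cdot> \<sigma>) \<cdot> inv2 W \<sigma> \<cdot> inv2 W \<tau> = \<tau> \<cdot> (\<sigma> \<cdot> inv2 W \<sigma>) \<cdot> inv2 W \<tau>"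
   using assms c by (simp add: vassoc del: inv2_cell(4,5))
  then show ?thesis using assms c by simp
 qed
 show ?thesis unfolding iso2_def
  by (rule exI[of _ "inv2 W \<sigma> \<cdot> inv2 W \<tau>"]) (use assms c 1 2 in "simp add: inverse2_def hom2_iff")
qed

lemma iso2_hcomp [simp]:
 assumes "iso2 W \<sigma>" "iso2 W \<tau>" "src W (dom2 W \<tau>) = trg W (dom2 W \<sigma>)"
 shows "iso2 W (\<tau> \<ast> \<sigma>)"
 unfolding iso2_def
 by (rule exI[of _ "inv2 W \<tau> \<ast> inv2 W \<sigma>"])
  (use assms iso2_cells[OF assms(1)] iso2_cells[OF assms(2)] in "simp add: inverse2_def hom2_iff inter")

lemma iso2_cancel_right:
 assumes "iso2 W \<rho>" "\<sigma> \<cdot> \<rho> = \<tau> \<cdot> \<rho>" "\<sigma> : cells2 W" "\<tau> : cells2 W" "dom2 W \<sigma> = cod2 W \<rho>" "dom2 W \<tau> = cod2 W \<rho>"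
 shows "\<sigma> = \<tau>"
proof -
 have "\<sigma> = \<sigma> \<cdot> \<rho> \<cdot> inv2 W \<rho>" using assms by simp
 also have "\<dots> = (\<sigma> \<cdot> \<rho>) \<cdot> inv2 W \<rho>"
  using assms(1,3-6) iso2_cells[OF assms(1)] by (simp add: vassoc del: inv2_cell(4,5))
 also have "\<dots> = (\<tau> \<cdot> \<rho>) \<cdot> inv2 W \<rho>" by (simp only: assms(2))
 also have "\<dots> = \<tau> \<cdot> \<rho> \<cdot> inv2 W \<rho>"
  using assms(1,3-6) iso2_cells[OF assms(1)] by (simp add: vassoc del: inv2_cell(4,5))
 also have "\<dots> = \<tau>" using assms by simp
 finally show ?thesis .
qed

lemma iso2_cancel_left:
 assumes "iso2 W \<rho>" "\<rho> \<cdot> \<sigma> = \<rho> \<cdot> \<tau>" "\<sigma> : cells2 W" "\<tau> : cells2 W" "cod2 W \<sigma> = dom2 W \<rho>" "cod2 W \<tau> = dom2 W \<rho>"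
 shows "\<sigma> = \<tau>"
proof -
 have "\<sigma> = (inv2 W \<rho> \<cdot> \<rho>) \<cdot> \<sigma>" using assms by simp
 also have "\<dots> = inv2 W \<rho> \<cdot> \<rho> \<cdot> \<sigma>"
  using assms(1,3-6) iso2_cells[OF assms(1)] by (simp add: vassoc del: inv2_cell(4,5))
 also have "\<dots> = inv2 W \<rho> \<cdot> \<rho> \<cdot> \<tau>" by (simp only: assms(2))
 also have "\<dots> = (inv2 W \<rho> \<cdot> \<rho>) \<cdot> \<tau>"
  using assms(1,3-6) iso2_cells[OF assms(1)] by (simp add: vassoc del: inv2_cell(4,5))
 also have "\<dots> = \<tau>" using assms by simp
 finally show ?thesis .
qed

text \<open>Whiskering with a unit 1-cell is faithful, by naturality of the unitors.\<close>

lemma unit_whisker_left: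
 assumes "\<sigma> : hom2 W f g" "\<tau> : hom2 W f g" "e = trg W f" "\<iota> (\<one> e) \<ast> \<sigma> = \<iota> (\<one> e) \<ast> \<tau>"
 shows "\<sigma> = \<tau>"
proof (rule iso2_cancel_right[of "\<l> f"])
 show "\<sigma> \<cdot> \<l> f = \<tau> \<cdot> \<l> f"
  using lunit_nat[of \<sigma> e] lunit_nat[of \<tau> e] assms hom2D[OF assms(1)] hom2D[OF assms(2)] by auto
qed (use assms hom2D[OF assms(1)] hom2D[OF assms(2)] in auto)

lemma unit_whisker_right:
 assumes "\<sigma> : hom2 W f g" "\<tau> : hom2 W f g" "e = src W f" "\<sigma> \<ast> \<iota> (\<one> e) = \<tau> \<ast> \<iota> (\<one> e)"
 shows "\<sigma> = \<tau>"
proof (rule iso2_cancel_right[of "\<r> f"])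
 show "\<sigma> \<cdot> \<r> f = \<tau> \<cdot> \<r> f"
  using runit_nat[of \<sigma> e] runit_nat[of \<tau> e] assms hom2D[OF assms(1)] hom2D[OF assms(2)] by auto
qed (use assms hom2D[OF assms(1)] hom2D[OF assms(2)] in auto)

text \<open>Kelly's theorem: the triangle and the pentagon imply the compatibility of the unitors
 with composite 1-cells. Both sides agree after whiskering with a unit 1-cell, which is
 faithful.\<close>

lemma lunit_comp:
 assumes f: "f : cells1 W" and g: "g : cells1 W" and fg: "src W f = trg W g" and e: "e = trg W f"
 shows "\<l> (f \<star> g) \<cdot> \<a> (\<one> e) f g = \<l> f \<ast> \<iota> g"
proof (rule unit_whisker_left[where e = e and f = "(\<one> e \<star> f) \<star> g" and g = "f \<star> g"])
 let ?I = "\<one> e"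
 have I: "?I : cells1 W" "src W ?I = e" "trg W ?I = e" "e : obj W" using f e by auto
 note t = f g fg e I
 let ?p = "\<a> ?I (?I \<star> f) g \<cdot> (\<a> ?I ?I f \<ast> \<iota> g)"
 show "\<iota> ?I \<ast> (\<l> (f \<star> g) \<cdot> \<a> ?I f g) = \<iota> ?I \<ast> (\<l> f \<ast> \<iota> g)"
 proof (rule iso2_cancel_right[of ?p])
  have "(\<iota> ?I \<ast> (\<l> (f \<star> g) \<cdot> \<a> ?I f g)) \<cdot> ?p = (\<iota> ?I \<ast> \<l> (f \<star> g)) \<cdot> (\<iota> ?I \<ast> \<a> ?I f g) \<cdot> ?p"
   using t inter[of "\<a> ?I f g" "\<iota> ?I" "\<l> (f \<star> g)" "\<iota> ?I"] by (subst vassoc[symmetric]) auto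
  also have "\<dots> = (\<iota> ?I \<ast> \<l> (f \<star> g)) \<cdot> \<a> ?I ?I (f \<star> g) \<cdot> \<a> (?I \<star> ?I) f g"
   using penta[of g f ?I ?I] t by simp
  also have "\<dots> = (\<r> ?I \<ast> \<iota> (f \<star> g)) \<cdot> \<a> (?I \<star> ?I) f g"
   using t trian[of "f \<star> g" ?I e] by (subst vassoc[symmetric]) auto
  also have "\<dots> = \<a> ?I f g \<cdot> ((\<r> ?I \<ast> \<iota> f) \<ast> \<iota> g)"
   using assoc_nat[of "\<iota> g" "\<iota> f" "\<r> ?I"] t by simp
  also have "\<dots> = \<a> ?I f g \<cdot> (((\<iota> ?I \<ast> \<l> f) \<cdot> \<a> ?I ?I f) \<ast> \<iota> g)"
   using t trian[of f ?I e] by simp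
  also have "\<dots> = \<a> ?I f g \<cdot> ((\<iota> ?I \<ast> \<l> f) \<ast> \<iota> g) \<cdot> (\<a> ?I ?I f \<ast> \<iota> g)"
   using t inter[of "\<iota> g" "\<a> ?I ?I f" "\<iota> g" "\<iota> ?I \<ast> \<l> f"] by simp
  also have "\<dots> = (\<a> ?I f g \<cdot> ((\<iota> ?I \<ast> \<l> f) \<ast> \<iota> g)) \<cdot> (\<a> ?I ?I f \<ast> \<iota> g)"
   using t by (simp add: vassoc)
  also have "\<dots> = ((\<iota> ?I \<ast> (\<l> f \<ast> \<iota> g)) \<cdot> \<a> ?I (?I \<star> f) g) \<cdot> (\<a> ?I ?I f \<ast> \<iota> g)"
   using t assoc_nat[of "\<iota> g" "\<l> f" "\<iota> ?I"] by simp
  also have "\<dots> = (\<iota> ?I \<ast> (\<l> f \<ast> \<iota> g)) \<cdot> ?p" using t by (simp add: vassoc)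
  finally show "(\<iota> ?I \<ast> (\<l> (f \<star> g) \<cdot> \<a> ?I f g)) \<cdot> ?p = (\<iota> ?I \<ast> (\<l> f \<ast> \<iota> g)) \<cdot> ?p" .
 qed (use t in auto)
qed (use assms in "auto simp: hom2_iff")

lemma runit_comp:
 assumes f: "f : cells1 W" and g: "g : cells1 W" and fg: "src W f = trg W g" and e: "e = src W g"
 shows "(\<iota> f \<ast> \<r> g) \<cdot> \<a> f g (\<one> e) = \<r> (f \<star> g)"
proof (rule unit_whisker_right[where e = e and f = "(f \<star> g) \<star> \<one> e" and g = "f \<star> g"])
 let ?I = "\<one> e"
 have I: "?I : cells1 W" "src W ?I = e" "trg W ?I = e" "e : obj W" using g e by auto
 note t = f g fg e[symmetric] I
 show "((\<iota> f \<ast> \<r> g) \<cdot> \<a> f g ?I) \<ast> \<iota> ?I = \<r> (f \<star> g) \<ast> \<iota> ?I"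
 proof (rule iso2_cancel_left[of "\<a> f g ?I"])
  have "\<a> f g ?I \<cdot> (((\<iota> f \<ast> \<r> g) \<cdot> \<a> f g ?I) \<ast> \<iota> ?I)
    = \<a> f g ?I \<cdot> ((\<iota> f \<ast> \<r> g) \<ast> \<iota> ?I) \<cdot> (\<a> f g ?I \<ast> \<iota> ?I)"
   using t inter[of "\<iota> ?I" "\<a> f g ?I" "\<iota> ?I" "\<iota> f \<ast> \<r> g"] by simp
  also have "\<dots> = (\<a> f g ?I \<cdot> ((\<iota> f \<ast> \<r> g) \<ast> \<iota> ?I)) \<cdot> (\<a> f g ?I \<ast> \<iota> ?I)"
   using t by (simp add: vassoc)
  also have "\<dots> = ((\<iota> f \<ast> (\<r> g \<ast> \<iota> ?I)) \<cdot> \<a> f (g \<star> ?I) ?I) \<cdot> (\<a> f g ?I \<ast> \<iota> ?I)"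
   using t assoc_nat[of "\<iota> ?I" "\<r> g" "\<iota> f"] by simp
  also have "\<dots> = ((\<iota> f \<ast> ((\<iota> g \<ast> \<l> ?I) \<cdot> \<a> g ?I ?I)) \<cdot> \<a> f (g \<star> ?I) ?I) \<cdot> (\<a> f g ?I \<ast> \<iota> ?I)"
   using t trian[of ?I g e] by simp
  also have "\<dots> = (\<iota> f \<ast> (\<iota> g \<ast> \<l> ?I)) \<cdot> (\<iota> f \<ast> \<a> g ?I ?I) \<cdot> \<a> f (g \<star> ?I) ?I \<cdot> (\<a> f g ?I \<ast> \<iota> ?I)"
   using t inter[of "\<a> g ?I ?I" "\<iota> f" "\<iota> g \<ast> \<l> ?I" "\<iota> f", symmetric] by (simp add: vassoc)
  also have "\<dots> = (\<iota> f \<ast> (\<iota> g \<ast> \<l> ?I)) \<cdot> \<a> f g (?I \<star> ?I) \<cdot> \<a> (f \<star> g) ?I ?I"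
   using penta[of ?I ?I g f] t by simp
  also have "\<dots> = (\<a> f g ?I \<cdot> (\<iota> (f \<star> g) \<ast> \<l> ?I)) \<cdot> \<a> (f \<star> g) ?I ?I"
   using assoc_nat[of "\<l> ?I" "\<iota> g" "\<iota> f"] t by (simp add: vassoc)
  also have "\<dots> = \<a> f g ?I \<cdot> (\<r> (f \<star> g) \<ast> \<iota> ?I)"
   using trian[of ?I "f \<star> g" e] t by (simp add: vassoc)
  finally show "\<a> f g ?I \<cdot> (((\<iota> f \<ast> \<r> g) \<cdot> \<a> f g ?I) \<ast> \<iota> ?I) = \<a> f g ?I \<cdot> (\<r> (f \<star> g) \<ast> \<iota> ?I)" .
 qed (use t in auto)
qed (use assms in "auto simp: hom2_iff")

text \<open>The last of Kelly's consequences of the axioms: both unitors of a unit 1-cell agree.\<close>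

lemma lunit_runit_unit:
 assumes "e : obj W" shows "\<l> (\<one> e) = \<r> (\<one> e)"
proof (rule unit_whisker_right[where e = e and f = "\<one> e \<star> \<one> e" and g = "\<one> e"])
 let ?I = "\<one> e"
 have "\<l> (?I \<star> ?I) = \<iota> ?I \<ast> \<l> ?I"
  by (rule iso2_cancel_left[of "\<l> ?I"]) (use assms lunit_nat[of "\<l> ?I" e] in auto)
 then show "\<l> ?I \<ast> \<iota> ?I = \<r> ?I \<ast> \<iota> ?I"
  using lunit_comp[of ?I ?I e] trian[of ?I ?I e] assms by simp
qed (use assms in "auto simp: hom2_iff")

end


section \<open>Generalized elements\<close>

text \<open>The stage is a list of 1-cells, so that concatenation of stages is strictly associative;
 this is what makes the coherence 2-cells disappear from equations between elements.\<close>

datatype ('m, 'c) element = Element (stage: "'m list") (cell: 'c)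

context bicategory
begin

primrec path_comp :: "'o => 'm list => 'm" where
 "path_comp e [] = \<one> e"
| "path_comp e (f # fs) = f \<star> path_comp e fs"

primrec path :: "'o => 'm list => bool" where
 "path e [] \<longleftrightarrow> e : obj W"
| "path e (f # fs) \<longleftrightarrow> f : cells1 W & src W f = trg W (path_comp e fs) & path e fs"

text \<open>The coherence 2-cell from the composite of a concatenated string to the composite of the
 two parts.\<close>

primrec unappend :: "'o => 'm list => 'm list => 'c" where
 "unappend e [] qs = inv2 W (\<l> (path_comp e qs))"
| "unappend e (f # fs) qs =
   inv2 W (\<a> f (path_comp (trg W (path_comp e qs)) fs) (path_comp e qs)) \<cdot> (\<iota> f \<ast> unappend e fs qs)"

lemma path_comp_cell [simp]: "path e ps ==> path_comp e ps : cells1 W"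
 "path e ps ==> src W (path_comp e ps) = e" "path e ps ==> e : obj W"
 by (induction ps) auto

lemma path_append:
 assumes "path e qs" "path (trg W (path_comp e qs)) ps"
 shows "path e (ps @ qs)" "trg W (path_comp e (ps @ qs)) = trg W (path_comp (trg W (path_comp e qs)) ps)"
 using assms(2) by (induction ps) (use assms(1) in auto)

lemma unappend_cell [simp]:
 assumes "path e qs" "path (trg W (path_comp e qs)) ps"
 shows "iso2 W (unappend e ps qs)" "unappend e ps qs : cells2 W"
  "dom2 W (unappend e ps qs) = path_comp e (ps @ qs)"
  "cod2 W (unappend e ps qs) = path_comp (trg W (path_comp e qs)) ps \<star> path_comp e qs"
proof -
 let ?s = "unappend e ps qs"
 have "iso2 W ?s & ?s : cells2 W & dom2 W ?s = path_comp e (ps @ qs) &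
  cod2 W ?s = path_comp (trg W (path_comp e qs)) ps \<star> path_comp e qs"
  using assms(2) by (induction ps) (use assms(1) path_append[OF assms(1)] in auto)
 then show "iso2 W ?s" "?s : cells2 W" "dom2 W ?s = path_comp e (ps @ qs)"
  "cod2 W ?s = path_comp (trg W (path_comp e qs)) ps \<star> path_comp e qs" by auto
qed

text \<open>The only instance of coherence for strings that the calculus of elements needs: splitting
 a threefold concatenation in the two possible orders differs by the associator.\<close>

lemma unappend_assoc:
 assumes r: "path e rs" and q: "path (trg W (path_comp e rs)) qs"
  and p: "path (trg W (path_comp (trg W (path_comp e rs)) qs)) ps"
 defines "R \<equiv> path_comp e rs" defines "Q \<equiv> path_comp (trg W R) qs"
 shows "\<a> (path_comp (trg W Q) ps) Q R \<cdot> (unappend (trg W R) ps qs \<ast> \<iota> R) \<cdot> unappend e (ps @ qs) rs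
  = (\<iota> (path_comp (trg W Q) ps) \<ast> unappend e qs rs) \<cdot> unappend e ps (qs @ rs)"
 using p
proof (induction ps)
 case Nil
 have R: "R : cells1 W" "src W R = e" and Q: "Q : cells1 W" "src W Q = trg W R"
  using r q by (simp_all add: R_def Q_def)
 let ?u = "unappend e qs rs" and ?b = "trg W Q"
 have u: "?u : cells2 W" "dom2 W ?u = path_comp e (qs @ rs)" "cod2 W ?u = Q \<star> R"
  using r q by (simp_all add: R_def Q_def)
 have qr: "path_comp e (qs @ rs) : cells1 W" "trg W (path_comp e (qs @ rs)) = ?b"
  using path_append[OF r q] by (simp_all add: R_def Q_def)
 let ?I = "\<one> ?b"
 have "\<a> ?I Q R \<cdot> (inv2 W (\<l> Q) \<ast> \<iota> R) \<cdot> ?u = (\<iota> ?I \<ast> ?u) \<cdot> inv2 W (\<l> (path_comp e (qs @ rs)))"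
 proof (rule iso2_cancel_left[of "\<l> (Q \<star> R)"])
  have "\<l> (Q \<star> R) \<cdot> \<a> ?I Q R \<cdot> (inv2 W (\<l> Q) \<ast> \<iota> R) \<cdot> ?u
    = ((\<l> (Q \<star> R) \<cdot> \<a> ?I Q R) \<cdot> (inv2 W (\<l> Q) \<ast> \<iota> R)) \<cdot> ?u"
   using R Q u by (simp add: vassoc)
  also have "\<dots> = ?u" using R Q u lunit_comp[of Q R ?b] by (simp add: inter)
  also have "\<dots> = (\<l> (Q \<star> R) \<cdot> (\<iota> ?I \<ast> ?u)) \<cdot> inv2 W (\<l> (path_comp e (qs @ rs)))"
   using R Q u qr lunit_nat[of ?u ?b] by (simp add: vassoc)
  also have "\<dots> = \<l> (Q \<star> R) \<cdot> (\<iota> ?I \<ast> ?u) \<cdot> inv2 W (\<l> (path_comp e (qs @ rs)))"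
   using R Q u qr by (subst vassoc) auto
  finally show "\<l> (Q \<star> R) \<cdot> \<a> ?I Q R \<cdot> (inv2 W (\<l> Q) \<ast> \<iota> R) \<cdot> ?u
   = \<l> (Q \<star> R) \<cdot> (\<iota> ?I \<ast> ?u) \<cdot> inv2 W (\<l> (path_comp e (qs @ rs)))" .
 qed (use R Q u qr in auto)
 then show ?case by (simp add: R_def Q_def)
next
 case (Cons f ps)
 have R: "R : cells1 W" "src W R = e" and Q: "Q : cells1 W" "src W Q = trg W R"
  using r q by (simp_all add: R_def Q_def)
 define P where "P = path_comp (trg W Q) ps"
 have pp: "path (trg W Q) ps" using Cons.prems by (simp add: R_def Q_def)
 have P: "P : cells1 W" "src W P = trg W Q" using pp by (simp_all add: P_def)
 have f: "f : cells1 W" "src W f = trg W P" using Cons.prems by (simp_all add: P_def R_def Q_def)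
 let ?v = "unappend e qs rs" and ?w = "unappend e ps (qs @ rs)"
 let ?u = "unappend (trg W R) ps qs" and ?x = "unappend e (ps @ qs) rs"
 have pq: "path (trg W R) (ps @ qs)" "trg W (path_comp (trg W R) (ps @ qs)) = trg W P"
  using path_append[of "trg W R" qs ps] q pp by (simp_all add: R_def Q_def P_def)
 have qr: "path e (qs @ rs)" "trg W (path_comp e (qs @ rs)) = trg W Q"
  using path_append[OF r q] by (simp_all add: R_def Q_def)
 let ?PQ = "path_comp (trg W R) (ps @ qs)" and ?QR = "path_comp e (qs @ rs)"
 let ?PQR = "path_comp e (ps @ qs @ rs)"
 have PQ: "?PQ : cells1 W" "src W ?PQ = trg W R" using pq by simp_all
 have QR: "?QR : cells1 W" "src W ?QR = e" using qr by simp_all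
 have PQR: "?PQR : cells1 W" "src W ?PQR = e" "trg W ?PQR = trg W P"
  using path_append[of e "qs @ rs" ps] qr pp by (simp_all add: P_def)
 have v: "?v : cells2 W" "dom2 W ?v = ?QR" "cod2 W ?v = Q \<star> R"
  using r q by (simp_all add: R_def Q_def)
 have w: "?w : cells2 W" "dom2 W ?w = ?PQR" "cod2 W ?w = P \<star> ?QR"
  using qr pp by (simp_all add: P_def)
 have u: "?u : cells2 W" "dom2 W ?u = ?PQ" "cod2 W ?u = P \<star> Q"
  using q pp by (simp_all add: P_def R_def Q_def)
 have x: "?x : cells2 W" "dom2 W ?x = ?PQR" "cod2 W ?x = ?PQ \<star> R"
  using r pq by (simp_all add: R_def)
 have IH: "\<a> P Q R \<cdot> (?u \<ast> \<iota> R) \<cdot> ?x = (\<iota> P \<ast> ?v) \<cdot> ?w"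
  using Cons.IH pp by (simp add: P_def R_def Q_def)
 note t = R Q P f pq(2) qr(2) PQ QR PQR v w u x
 have "\<a> (f \<star> P) Q R \<cdot> ((inv2 W (\<a> f P Q) \<cdot> (\<iota> f \<ast> ?u)) \<ast> \<iota> R) \<cdot> inv2 W (\<a> f ?PQ R) \<cdot> (\<iota> f \<ast> ?x)
  = (\<iota> (f \<star> P) \<ast> ?v) \<cdot> inv2 W (\<a> f P ?QR) \<cdot> (\<iota> f \<ast> ?w)" (is "?L = ?Rt")
 proof (rule iso2_cancel_left[of "\<a> f P (Q \<star> R)"])
  have "\<a> f P (Q \<star> R) \<cdot> ?L
   = (\<a> f P (Q \<star> R) \<cdot> \<a> (f \<star> P) Q R) \<cdot> ((inv2 W (\<a> f P Q) \<cdot> (\<iota> f \<ast> ?u)) \<ast> \<iota> R) \<cdot> inv2 W (\<a> f ?PQ R) \<cdot> (\<iota> f \<ast> ?x)"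
   using t by (simp add: vassoc)
  also have "\<dots> = (\<iota> f \<ast> \<a> P Q R) \<cdot> \<a> f (P \<star> Q) R \<cdot> ((\<a> f P Q \<ast> \<iota> R) \<cdot>
    ((inv2 W (\<a> f P Q) \<cdot> (\<iota> f \<ast> ?u)) \<ast> \<iota> R)) \<cdot> inv2 W (\<a> f ?PQ R) \<cdot> (\<iota> f \<ast> ?x)"
   unfolding penta[OF R(1) Q(1) P(1) f(1) Q(2) P(2) f(2), symmetric] using t by (simp add: vassoc)
  also have "(\<a> f P Q \<ast> \<iota> R) \<cdot> ((inv2 W (\<a> f P Q) \<cdot> (\<iota> f \<ast> ?u)) \<ast> \<iota> R) = (\<iota> f \<ast> ?u) \<ast> \<iota> R"
  proof -
   have "\<a> f P Q \<cdot> (inv2 W (\<a> f P Q) \<cdot> (\<iota> f \<ast> ?u)) = \<iota> f \<ast> ?u"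
    using t by (subst vassoc[symmetric]) auto
   then show ?thesis using t by (simp add: inter)
  qed
  also have "\<a> f (P \<star> Q) R \<cdot> ((\<iota> f \<ast> ?u) \<ast> \<iota> R) \<cdot> inv2 W (\<a> f ?PQ R) \<cdot> (\<iota> f \<ast> ?x)
    = (\<a> f (P \<star> Q) R \<cdot> ((\<iota> f \<ast> ?u) \<ast> \<iota> R)) \<cdot> inv2 W (\<a> f ?PQ R) \<cdot> (\<iota> f \<ast> ?x)"
   using t by (simp add: vassoc)
  also have "\<a> f (P \<star> Q) R \<cdot> ((\<iota> f \<ast> ?u) \<ast> \<iota> R) = (\<iota> f \<ast> ?u \<ast> \<iota> R) \<cdot> \<a> f ?PQ R"
   using assoc_nat[of "\<iota> R" ?u "\<iota> f"] t by simp
  also have "((\<iota> f \<ast> ?u \<ast> \<iota> R) \<cdot> \<a> f ?PQ R) \<cdot> inv2 W (\<a> f ?PQ R) \<cdot> (\<iota> f \<ast> ?x)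
   = (\<iota> f \<ast> ?u \<ast> \<iota> R) \<cdot> (\<a> f ?PQ R \<cdot> inv2 W (\<a> f ?PQ R)) \<cdot> (\<iota> f \<ast> ?x)"
   using t by (simp add: vassoc del: inv2_cell(4,5))
  also have "\<dots> = \<iota> f \<ast> ((?u \<ast> \<iota> R) \<cdot> ?x)" using t by (simp add: inter)
  also have "(\<iota> f \<ast> \<a> P Q R) \<cdot> (\<iota> f \<ast> ((?u \<ast> \<iota> R) \<cdot> ?x)) = \<iota> f \<ast> ((\<iota> P \<ast> ?v) \<cdot> ?w)"
   using t by (simp add: inter IH)
  also have "\<dots> = (\<iota> f \<ast> \<iota> P \<ast> ?v) \<cdot> (\<a> f P ?QR \<cdot> inv2 W (\<a> f P ?QR)) \<cdot> (\<iota> f \<ast> ?w)"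
   using t by (simp add: inter)
  also have "\<dots> = ((\<iota> f \<ast> \<iota> P \<ast> ?v) \<cdot> \<a> f P ?QR) \<cdot> inv2 W (\<a> f P ?QR) \<cdot> (\<iota> f \<ast> ?w)"
   using t by (simp add: vassoc del: inv2_cell(4,5))
  also have "(\<iota> f \<ast> \<iota> P \<ast> ?v) \<cdot> \<a> f P ?QR = \<a> f P (Q \<star> R) \<cdot> (\<iota> (f \<star> P) \<ast> ?v)"
   using assoc_nat[of ?v "\<iota> P" "\<iota> f"] t by simp
  also have "(\<a> f P (Q \<star> R) \<cdot> (\<iota> (f \<star> P) \<ast> ?v)) \<cdot> inv2 W (\<a> f P ?QR) \<cdot> (\<iota> f \<ast> ?w)
    = \<a> f P (Q \<star> R) \<cdot> ?Rt" using t by (simp add: vassoc)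
  finally show "\<a> f P (Q \<star> R) \<cdot> ?L = \<a> f P (Q \<star> R) \<cdot> ?Rt" .
 qed (use t in auto)
 then show ?case by (simp add: P_def R_def Q_def qr(2)[unfolded R_def Q_def])
qed

lemma unappend_Nil:
 assumes "path e ps" shows "\<r> (path_comp e ps) \<cdot> unappend e ps [] = \<iota> (path_comp e ps)"
 using assms
proof (induction ps)
 case Nil then show ?case using lunit_runit_unit[of e] by simp
next
 case (Cons f ps)
 let ?P = "path_comp e ps" let ?I = "\<one> e" let ?u = "unappend e ps []"
 have t: "f : cells1 W" "?P : cells1 W" "src W ?P = e" "e : obj W" "src W f = trg W ?P" 
  using Cons.prems by auto
 have u: "?u : cells2 W" "dom2 W ?u = ?P" "cod2 W ?u = ?P \<star> ?I"
  using Cons.prems unappend_cell[of e "[]" ps] by auto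
 have "\<r> (f \<star> ?P) \<cdot> inv2 W (\<a> f ?P ?I) \<cdot> (\<iota> f \<ast> ?u)
  = (\<iota> f \<ast> \<r> ?P) \<cdot> (\<a> f ?P ?I \<cdot> inv2 W (\<a> f ?P ?I)) \<cdot> (\<iota> f \<ast> ?u)"
  using runit_comp[of f ?P e, symmetric] t u by (simp add: vassoc del: inv2_cell(4,5))
 also have "\<dots> = \<iota> (f \<star> ?P)" using t u Cons by (simp add: inter)
 finally show ?case using t by simp
qed

definition El :: "'m => (('m, 'c) element) set" where
 "El f = {x. path (src W f) (stage x) & cell x : hom2 W (path_comp (src W f) (stage x)) f}"

definition ap :: "'c => ('m, 'c) element => ('m, 'c) element" where
 "ap \<sigma> x = Element (stage x) (\<sigma> \<cdot> cell x)"

definition ten :: "('m, 'c) element => ('m, 'c) element => ('m, 'c) element" where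
 "ten x y = Element (stage x @ stage y)
   ((cell x \<ast> cell y) \<cdot> unappend (src W (cod2 W (cell y))) (stage x) (stage y))"

definition pt :: "'c => ('m, 'c) element" where
 "pt \<sigma> = Element [] \<sigma>"

lemma ElD:
 assumes "x : El f"
 shows "f : cells1 W" "path (src W f) (stage x)" "cell x : cells2 W"
  "dom2 W (cell x) = path_comp (src W f) (stage x)" "cod2 W (cell x) = f"
  "trg W (path_comp (src W f) (stage x)) = trg W f"
 using assms by (auto simp: El_def dest: hom2D)

lemma ElI: "path (src W f) ps ==> \<sigma> : hom2 W (path_comp (src W f) ps) f ==> Element ps \<sigma> : El f"
 by (simp add: El_def)

lemma ap_El [simp]:
 assumes "\<sigma> : cells2 W" "x : El (dom2 W \<sigma>)" "f = cod2 W \<sigma>"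
 shows "ap \<sigma> x : El f"
 unfolding ap_def by (rule ElI) (use assms ElD[OF assms(2)] in "auto simp: hom2_iff")

lemma ten_El [simp]:
 assumes x: "x : El f" and y: "y : El g" and "src W f = trg W g"
 shows "ten x y : El (f \<star> g)"
 unfolding ten_def
 by (rule ElI) (use assms ElD[OF x] ElD[OF y] path_append[of "src W g" "stage y" "stage x"] in "auto simp: hom2_iff")

lemma pt_El [simp]: "\<sigma> : cells2 W ==> dom2 W \<sigma> = \<one> e ==> e : obj W ==> f = cod2 W \<sigma> ==> pt \<sigma> : El f"
 unfolding pt_def by (rule ElI) (auto simp: hom2_iff)

lemma ap_vcomp [simp]:
 "[|\<sigma> : cells2 W; \<tau> : cells2 W; cod2 W \<sigma> = dom2 W \<tau>; x : El (dom2 W \<sigma>)|] ==> ap (\<tau> \<cdot> \<sigma>) x = ap \<tau> (ap \<sigma> x)"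
 by (simp add: ap_def vassoc ElD)

lemma ap_id [simp]: "x : El f ==> ap (\<iota> f) x = x"
 by (simp add: ap_def ElD element.expand)

lemma ap_pt [simp]: "ap \<sigma> (pt \<tau>) = pt (\<sigma> \<cdot> \<tau>)"
 by (simp add: ap_def pt_def)

lemma cell_pt [simp]: "cell (pt \<sigma>) = \<sigma>" and pt_eq_iff [simp]: "pt \<sigma> = pt \<tau> \<longleftrightarrow> \<sigma> = \<tau>"
 by (simp_all add: pt_def)

lemma ap_inv2 [simp]:
 assumes "iso2 W \<sigma>"
 shows "x : El (dom2 W \<sigma>) ==> ap (inv2 W \<sigma>) (ap \<sigma> x) = x"
  "y : El (cod2 W \<sigma>) ==> ap \<sigma> (ap (inv2 W \<sigma>) y) = y"
 using assms iso2_cells[OF assms] by (simp_all add: ap_vcomp[symmetric] del: ap_vcomp)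

lemma ap_hcomp [simp]:
 assumes "\<tau> : cells2 W" "\<sigma> : cells2 W" "src W (dom2 W \<tau>) = trg W (dom2 W \<sigma>)"
  and x: "x : El (dom2 W \<tau>)" and y: "y : El (dom2 W \<sigma>)"
 shows "ap (\<tau> \<ast> \<sigma>) (ten x y) = ten (ap \<tau> x) (ap \<sigma> y)"
 using assms ElD[OF x] ElD[OF y] by (simp add: ap_def ten_def inter[symmetric] vassoc)

text \<open>Both bracketings of a triple have the same stage, a concatenation of lists, and on it the
 associator is absorbed by the coherence of the splittings.\<close>

lemma ap_assoc [simp]:
 assumes x: "x : El h" and y: "y : El g" and z: "z : El f" and "src W h = trg W g" "src W g = trg W f"
 shows "ap (\<a> h g f) (ten (ten x y) z) = ten x (ten y z)"
proof -
 note X = ElD[OF x] and Y = ElD[OF y] and Z = ElD[OF z]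
 define e where "e = src W f"
 define R where "R = path_comp e (stage z)"
 define Q where "Q = path_comp (trg W f) (stage y)"
 define P where "P = path_comp (trg W g) (stage x)"
 have fg: "trg W R = trg W f" "trg W Q = trg W g"
  using X Y Z assms(4,5) by (simp_all add: R_def Q_def e_def)
 have pz: "path e (stage z)" and py: "path (trg W R) (stage y)" and px: "path (trg W Q) (stage x)"
  using X Y Z assms(4,5) unfolding fg by (simp_all add: e_def)
 let ?pq = "path_comp (trg W R) (stage x @ stage y)" and ?qr = "path_comp e (stage y @ stage z)"
 let ?u = "unappend (trg W R) (stage x) (stage y)" and ?w = "unappend e (stage x @ stage y) (stage z)"
 let ?v = "unappend e (stage y) (stage z)" and ?s = "unappend e (stage x) (stage y @ stage z)"
 have PQ: "P = path_comp (trg W Q) (stage x)" "Q = path_comp (trg W R) (stage y)"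
  by (simp only: P_def fg, simp only: Q_def fg)
 have pq: "path (trg W R) (stage x @ stage y)" "trg W ?pq = trg W P"
  using path_append[of "trg W R" "stage y" "stage x"] px py PQ by simp_all
 have qr: "path e (stage y @ stage z)" "trg W ?qr = trg W Q"
  using path_append[of e "stage z" "stage y"] py pz PQ by (simp_all add: R_def)
 have P: "P : cells1 W" "src W P = trg W Q" and Q: "Q : cells1 W" "src W Q = trg W R" and R: "R : cells1 W"
  and pqc: "?pq : cells1 W" "src W ?pq = trg W R" and qrc: "?qr : cells1 W"
  using px py pz pq qr PQ by (simp_all add: R_def)
 have u: "?u : cells2 W" "dom2 W ?u = ?pq" "cod2 W ?u = P \<star> Q"
  and v: "?v : cells2 W" "dom2 W ?v = ?qr" "cod2 W ?v = Q \<star> R"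
  using px py pz PQ by (simp_all add: R_def)
 have w: "?w : cells2 W" "cod2 W ?w = ?pq \<star> R"
  using pz pq by (simp_all add: R_def)
 have s: "?s : cells2 W" "cod2 W ?s = P \<star> ?qr"
  using unappend_cell[of e "stage y @ stage z" "stage x"] qr px PQ(1) by simp_all
 define a b c where "a = cell x" and "b = cell y" and "c = cell z"
 have a: "a : cells2 W" "dom2 W a = P" "cod2 W a = h" and b: "b : cells2 W" "dom2 W b = Q" "cod2 W b = g"
  and c: "c : cells2 W" "dom2 W c = R" "cod2 W c = f"
  using X Y Z assms(4,5) by (simp_all add: a_def b_def c_def P_def Q_def R_def e_def)
 note t = P Q R a b c pqc qrc pq(2) qr(2) u v w s
 have "\<a> h g f \<cdot> (((a \<ast> b) \<cdot> ?u) \<ast> c) \<cdot> ?w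
   = \<a> h g f \<cdot> (((a \<ast> b) \<ast> c) \<cdot> (?u \<ast> \<iota> R)) \<cdot> ?w"
  using t inter[of "\<iota> R" ?u c "a \<ast> b"] by simp
 also have "\<dots> = (\<a> h g f \<cdot> ((a \<ast> b) \<ast> c)) \<cdot> (?u \<ast> \<iota> R) \<cdot> ?w"
  using t X(1) Y(1) Z(1) assms(4,5) fg by (simp add: vassoc)
 also have "\<dots> = ((a \<ast> b \<ast> c) \<cdot> \<a> P Q R) \<cdot> (?u \<ast> \<iota> R) \<cdot> ?w"
  using assoc_nat[of c b a] t by simp
 also have "\<dots> = (a \<ast> b \<ast> c) \<cdot> \<a> P Q R \<cdot> (?u \<ast> \<iota> R) \<cdot> ?w"
  using t by (simp add: vassoc)
 also have "\<a> P Q R \<cdot> (?u \<ast> \<iota> R) \<cdot> ?w = (\<iota> P \<ast> ?v) \<cdot> ?s"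
  using unappend_assoc[OF pz py[unfolded R_def] px[unfolded PQ(2) R_def]]
  by (simp only: R_def[symmetric] PQ[symmetric])
 also have "(a \<ast> b \<ast> c) \<cdot> (\<iota> P \<ast> ?v) \<cdot> ?s = ((a \<ast> b \<ast> c) \<cdot> (\<iota> P \<ast> ?v)) \<cdot> ?s"
  using t by (simp add: vassoc)
 also have "(a \<ast> b \<ast> c) \<cdot> (\<iota> P \<ast> ?v) = a \<ast> ((b \<ast> c) \<cdot> ?v)"
  using t inter[of ?v "\<iota> P" "b \<ast> c" a] by simp
 finally show ?thesis
  using t fg assms(4,5) X(1) Y(1) Z(1) path_comp_cell(2)[OF pz, folded R_def] by (simp add: ap_def ten_def a_def[symmetric] b_def[symmetric] c_def[symmetric] e_def[symmetric])
qed

lemma ap_inv_assoc [simp]: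
 assumes x: "x : El h" and y: "y : El g" and z: "z : El f" and "src W h = trg W g" "src W g = trg W f"
 shows "ap (inv2 W (\<a> h g f)) (ten x (ten y z)) = ten (ten x y) z"
proof -
 have "ten (ten x y) z : El ((h \<star> g) \<star> f)" using assms ElD(1)[OF x] ElD(1)[OF y] ElD(1)[OF z] by simp
 then have "ap (inv2 W (\<a> h g f)) (ap (\<a> h g f) (ten (ten x y) z)) = ten (ten x y) z"
  using assms ElD(1)[OF x] ElD(1)[OF y] ElD(1)[OF z] by (subst ap_inv2(1)) auto
 then show ?thesis using assms by simp
qed

lemma ap_lunit [simp]:
 assumes x: "x : El f" and e: "e = trg W f"
 shows "ap (\<l> f) (ten (pt (\<iota> (\<one> e))) x) = x"
proof -
 note X = ElD[OF x]
 let ?P = "path_comp (src W f) (stage x)"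
 have "\<l> f \<cdot> (\<iota> (\<one> e) \<ast> cell x) \<cdot> inv2 W (\<l> ?P) = (\<l> f \<cdot> (\<iota> (\<one> e) \<ast> cell x)) \<cdot> inv2 W (\<l> ?P)"
  using X e by (simp add: vassoc)
 also have "\<dots> = cell x \<cdot> \<l> ?P \<cdot> inv2 W (\<l> ?P)"
  using X e lunit_nat[of "cell x" e] by (simp add: vassoc del: inv2_cell(4,5))
 also have "\<dots> = cell x" using X by simp
 finally show ?thesis using X by (simp add: ap_def ten_def pt_def element.expand)
qed

lemma ap_runit [simp]:
 assumes x: "x : El f" and e: "e = src W f"
 shows "ap (\<r> f) (ten x (pt (\<iota> (\<one> e)))) = x"
proof -
 note X = ElD[OF x]
 let ?P = "path_comp e (stage x)"
 have u: "unappend e (stage x) [] : cells2 W" "dom2 W (unappend e (stage x) []) = ?P"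
  "cod2 W (unappend e (stage x) []) = ?P \<star> \<one> e"
  using X e unappend_cell[of e "[]" "stage x"] by auto
 have "\<r> f \<cdot> (cell x \<ast> \<iota> (\<one> e)) \<cdot> unappend e (stage x) [] = (\<r> f \<cdot> (cell x \<ast> \<iota> (\<one> e))) \<cdot> unappend e (stage x) []"
  using X e u by (simp add: vassoc)
 also have "\<dots> = cell x \<cdot> \<r> ?P \<cdot> unappend e (stage x) []"
  using X e u runit_nat[of "cell x" e] by (simp add: vassoc)
 also have "\<dots> = cell x" using X e by (simp add: unappend_Nil)
 finally show ?thesis using X e by (simp add: ap_def ten_def pt_def element.expand)
qed

lemma ap_inv_lunit [simp]:
 assumes x: "x : El f"
 shows "ap (inv2 W (\<l> f)) x = ten (pt (\<iota> (\<one> (trg W f)))) x"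
proof -
 have "ten (pt (\<iota> (\<one> (trg W f)))) x : El (\<one> (trg W f) \<star> f)" using x ElD(1)[OF x] by (intro ten_El) auto
 then have "ap (inv2 W (\<l> f)) (ap (\<l> f) (ten (pt (\<iota> (\<one> (trg W f)))) x)) = ten (pt (\<iota> (\<one> (trg W f)))) x"
  using ElD(1)[OF x] by (subst ap_inv2(1)) auto
 then show ?thesis using x by simp
qed

text \<open>The generic element, the identity up to a unitor. Its cell is invertible, so values at it
 determine a 2-cell.\<close>

definition generic :: "'m => ('m, 'c) element" where
 "generic f = Element [f] (\<r> f)"

lemma generic_El [simp]: "f : cells1 W ==> generic f : El f"
 unfolding generic_def by (rule ElI) (auto simp: hom2_iff)

lemma iso2_generic [simp]: "f : cells1 W ==> iso2 W (cell (generic f))"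
 by (simp add: generic_def)

lemma iso2_ten:
 assumes x: "x : El f" and y: "y : El g" and "src W f = trg W g" "iso2 W (cell x)" "iso2 W (cell y)"
 shows "iso2 W (cell (ten x y))"
 unfolding ten_def
 using assms ElD[OF x] ElD[OF y] by simp

lemma iso2_ten_generic [simp]:
 assumes "f : cells1 W" "g : cells1 W" "src W f = trg W g"
 shows "iso2 W (cell (ten (generic f) (generic g)))"
  "h : cells1 W ==> src W g = trg W h ==> iso2 W (cell (ten (ten (generic f) (generic g)) (generic h)))"
  "h : cells1 W ==> src W h = trg W f ==> iso2 W (cell (ten (generic h) (ten (generic f) (generic g))))"
proof -
 show 1: "iso2 W (cell (ten (generic f) (generic g)))"
  by (rule iso2_ten[of _ f _ g]) (use assms in simp_all)
 show "h : cells1 W ==> src W g = trg W h ==> iso2 W (cell (ten (ten (generic f) (generic g)) (generic h)))"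
  by (rule iso2_ten[of _ "f \<star> g" _ h]) (use assms 1 in simp_all)
 show "h : cells1 W ==> src W h = trg W f ==> iso2 W (cell (ten (generic h) (ten (generic f) (generic g))))"
  by (rule iso2_ten[of _ h _ "f \<star> g"]) (use assms 1 in simp_all)
qed

lemma el_cancel:
 assumes "\<sigma> : hom2 W f g" "\<tau> : hom2 W f g" "x : El f" "iso2 W (cell x)" "ap \<sigma> x = ap \<tau> x"
 shows "\<sigma> = \<tau>"
 by (rule iso2_cancel_right[of "cell x"]) (use assms ElD[OF assms(3)] in "auto simp: ap_def hom2_iff")

lemma el_ext:
 assumes "\<sigma> : hom2 W f g" "\<tau> : hom2 W f g" "!!x. x : El f ==> ap \<sigma> x = ap \<tau> x"
 shows "\<sigma> = \<tau>"
 by (rule el_cancel[OF assms(1,2), of "generic f"]) (use assms(3) hom2D[OF assms(1)] in auto)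

lemma el_ext2:
 assumes "\<sigma> : hom2 W (f \<star> g) h" "\<tau> : hom2 W (f \<star> g) h" "f : cells1 W" "g : cells1 W" "src W f = trg W g"
  "!!x y. x : El f ==> y : El g ==> ap \<sigma> (ten x y) = ap \<tau> (ten x y)"
 shows "\<sigma> = \<tau>"
 by (rule el_cancel[OF assms(1,2), of "ten (generic f) (generic g)"]) (use assms in simp_all)

lemma el_ext3:
 assumes "\<sigma> : hom2 W ((f \<star> g) \<star> h) k" "\<tau> : hom2 W ((f \<star> g) \<star> h) k" "f : cells1 W" "g : cells1 W" "h : cells1 W"
  "src W f = trg W g" "src W g = trg W h"
  "!!x y z. x : El f ==> y : El g ==> z : El h ==> ap \<sigma> (ten (ten x y) z) = ap \<tau> (ten (ten x y) z)"
 shows "\<sigma> = \<tau>"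
 by (rule el_cancel[OF assms(1,2), of "ten (ten (generic f) (generic g)) (generic h)"]) (use assms in simp_all)

end


section \<open>Gluing diagrams\<close>

text \<open>The shape of the diagram whose colimit is a coend: a vertex for each \<open>b\<close>, an edge for
 each pair, and two legs from the edge to its ends. The same shape with the legs reversed
 serves for ends.\<close>

datatype 'u shape = Vertex 'u | Edge 'u 'u | Fst_Leg 'u 'u | Snd_Leg 'u 'u

primrec shape_src :: "'u shape => 'u shape" where
 "shape_src (Vertex b) = Vertex b" | "shape_src (Edge b b') = Edge b b'"
| "shape_src (Fst_Leg b b') = Edge b b'" | "shape_src (Snd_Leg b b') = Edge b b'"

primrec shape_trg :: "'u shape => 'u shape" where
 "shape_trg (Vertex b) = Vertex b" | "shape_trg (Edge b b') = Edge b b'"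
| "shape_trg (Fst_Leg b b') = Vertex b" | "shape_trg (Snd_Leg b b') = Vertex b'"

definition shape_obs :: "'u set => 'u shape set" where
 "shape_obs S = Vertex ` S \<union> (\<Union>b\<in>S. Edge b ` S)"

definition shape_arrs :: "'u set => 'u shape set" where
 "shape_arrs S = shape_obs S \<union> (\<Union>b\<in>S. Fst_Leg b ` S) \<union> (\<Union>b\<in>S. Snd_Leg b ` S)"

lemma shape_obs_iff: "x : shape_obs S \<longleftrightarrow> (case x of Vertex b => b : S | Edge b b' => b : S & b' : S | _ => False)"
 and shape_arrs_iff: "x : shape_arrs S \<longleftrightarrow> (case x of Vertex b => b : S | Edge b b' => b : S & b' : S
   | Fst_Leg b b' => b : S & b' : S | Snd_Leg b b' => b : S & b' : S)"
 by (auto simp: shape_arrs_def shape_obs_def split: shape.splits)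

definition shape_comp :: "'u shape => 'u shape => 'u shape" where
 "shape_comp y x = (if x : range Vertex \<union> range (case_prod Edge) then y else x)"

text \<open>Diagrams are indexed by categories whose objects and arrows are elements of the universe
 type, so the shape is transported along an injection \<open>e\<close>.\<close>

definition coded_shape :: "('u shape => 'u) => ('u shape => 'u shape) => ('u shape => 'u shape) => 'u set
  => ('u, 'u) cat" where
 "coded_shape e d c S = \<lparr>cobj = e ` shape_obs S, carr = e ` shape_arrs S,
   cdom = (%x. e (d (inv e x))), ccod = (%x. e (c (inv e x))), cid = (%x. x),
   ccomp = (%y x. e (shape_comp (inv e y) (inv e x)))\<rparr>"

lemma shape_comp_simps [simp]:
 "shape_comp y (Vertex b) = y" "shape_comp y (Edge b b') = y"
 "shape_comp y (Fst_Leg b b') = Fst_Leg b b'" "shape_comp y (Snd_Leg b b') = Snd_Leg b b'"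
 by (auto simp: shape_comp_def)

lemma chom_coded:
 assumes "inj e"
 shows "chom (coded_shape e d c S) a b = e ` {x : shape_arrs S. e (d x) = a & e (c x) = b}"
 using assms by (auto simp: chom_def coded_shape_def inj_image_mem_iff)

lemma coded_shape_category:
 assumes "inj e" and dc: "d = shape_src & c = shape_trg \<or> d = shape_trg & c = shape_src"
 shows "category (coded_shape e d c S)"
proof
 let ?J = "coded_shape e d c S"
 have e: "!!x y. e x = e y \<longleftrightarrow> x = y" "!!x. inv e (e x) = x" using assms(1) by (auto simp: inj_eq)
 have ob: "!!x. x : shape_arrs S ==> d x : shape_obs S & c x : shape_obs S"
  using dc by (auto simp: shape_arrs_iff shape_obs_iff split: shape.splits)
 have id: "!!x. x : shape_obs S ==> x : shape_arrs S & d x = x & c x = x & (ALL y. shape_comp y x = y)"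
  using dc by (auto simp: shape_arrs_iff shape_obs_iff split: shape.splits)
 have leg: "!!x. x : shape_arrs S ==> x \<notin> shape_obs S ==> (ALL y. shape_comp y x = x)"
  by (auto simp: shape_arrs_iff shape_obs_iff split: shape.splits)
 have legs: "x : shape_arrs S ==> y : shape_arrs S ==> c x = d y ==> x : shape_obs S & c x = x \<or> y : shape_obs S & d y = y" for x y
  using dc by (auto simp: shape_arrs_iff shape_obs_iff split: shape.splits)
 have comp: "shape_comp y x : shape_arrs S & d (shape_comp y x) = d x & c (shape_comp y x) = c y"
  if "x : shape_arrs S" "y : shape_arrs S" "c x = d y" for x y
  using legs[OF that] id leg that by (metis (no_types))
 note defs = chom_coded[OF assms(1)] 
 show "cdom ?J f : cobj ?J & ccod ?J f : cobj ?J" if "f : carr ?J" for f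
  using that ob by (auto simp: coded_shape_def e)
 show "cid ?J a : chom ?J a a" if "a : cobj ?J" for a
  using that id by (auto simp: coded_shape_def e chom_def)
 show "ccomp ?J g f : chom ?J a b'" if "f : chom ?J a b" "g : chom ?J b b'" for a b f g b'
  using that comp by (auto simp: defs e) (auto simp: coded_shape_def e)
 show "ccomp ?J (cid ?J b) f = f" if "f : chom ?J a b" for a b f
  using that id leg ob unfolding defs by (auto simp: coded_shape_def e) (metis)
 show "ccomp ?J f (cid ?J a) = f" if "f : chom ?J a b" for a b f
  using that id ob unfolding defs by (auto simp: coded_shape_def e)
 show "ccomp ?J (ccomp ?J h g) f = ccomp ?J h (ccomp ?J g f)"
  if "f : chom ?J a b" "g : chom ?J b b'" "h : chom ?J b' b''" for a b b' b'' f g h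
  using that unfolding defs by (auto simp: coded_shape_def e shape_comp_def)
qed

lemma small_image: "|A| <o |UNIV :: 'u set| ==> small (f ` A :: 'u set)"
 unfolding small_def using card_of_image ordLeq_ordLess_trans by blast

lemma shape_arrs_small:
 assumes "universe TYPE('u)" "small (S :: 'u set)"
 shows "|shape_arrs S| <o |UNIV :: 'u set|"
proof -
 have inf: "infinite (UNIV :: 'u set)" and reg: "regularCard |UNIV :: 'u set|"
  using assms(1) by (auto simp: universe_def)
 have st: "stable |UNIV :: 'u set|"
  using regularCard_stable[OF card_of_Card_order _ reg] inf by (simp add: Field_card_of)
 have im: "|f ` S| <o |UNIV :: 'u set|" for f :: "'u => 'u shape"
  using assms(2) card_of_image ordLeq_ordLess_trans unfolding small_def by blast
 have un: "|\<Union>b\<in>S. f b ` S| <o |UNIV :: 'u set|" for f :: "'u => 'u => 'u shape"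
  by (rule card_of_UNION_ordLess_infinite[OF st]) (use assms(2) im in "auto simp: small_def")
 show ?thesis unfolding shape_arrs_def shape_obs_def
  by (intro card_of_Un_ordLess_infinite[OF inf] im un)
qed

text \<open>An infinite set contains the natural numbers and is equinumerous with its square, which
 gives room to encode a tag and two arguments.\<close>

lemma ex_shape_code:
 assumes "universe TYPE('u)" shows "EX e :: 'u shape => 'u. inj e"
proof -
 have inf: "infinite (UNIV :: 'u set)" using assms by (auto simp: universe_def)
 then obtain n :: "nat => 'u" where n: "inj n" using infinite_countable_subset by blast
 have "|UNIV \<times> UNIV :: ('u \<times> 'u) set| =o |UNIV :: 'u set|" using card_of_Times_same_infinite[OF inf] .
 then have "|UNIV :: ('u \<times> 'u) set| \<le>o |UNIV :: 'u set|" by (simp add: ordIso_imp_ordLeq)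
 then have "EX p :: 'u \<times> 'u => 'u. inj_on p UNIV & p ` UNIV \<subseteq> UNIV" by (simp only: card_of_ordLeq)
 then obtain p :: "'u \<times> 'u => 'u" where p: "inj p" by auto
 let ?e = "%x. case x of Vertex b => p (n 0, p (b, b)) | Edge b b' => p (n 1, p (b, b'))
   | Fst_Leg b b' => p (n 2, p (b, b')) | Snd_Leg b b' => p (n 3, p (b, b'))"
 have "inj ?e"
 proof (rule injI)
  fix x y assume "?e x = ?e y"
  then show "x = y" by (cases x; cases y) (simp_all add: inj_eq[OF n] inj_eq[OF p])
 qed
 then show ?thesis by blast
qed

definition amalgamates :: "('a, 'b) cat => 'u set => ('u => 'a) => ('u => 'u => 'b) => ('u => 'u => 'b) => 'a => ('u => 'b) => bool" where
 "amalgamates K S f u v q j \<longleftrightarrow> q : cobj K & (ALL b:S. j b : chom K (f b) q) &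
   (ALL b:S. ALL b':S. ccomp K (j b) (u b b') = ccomp K (j b') (v b b'))"

definition amalgam :: "('a, 'b) cat => 'u set => ('u => 'a) => ('u => 'u => 'b) => ('u => 'u => 'b) => 'a => ('u => 'b) => bool" where
 "amalgam K S f u v p i \<longleftrightarrow> amalgamates K S f u v p i &
   (ALL q j. amalgamates K S f u v q j --> (\<exists>!t. t : chom K p q & (ALL b:S. ccomp K t (i b) = j b)))"

text \<open>A cocone on the shape is determined by its components at the vertices.\<close>

lemma ex_amalgam:
 fixes S :: "'u set" and K :: "('a, 'b) cat"
 assumes K: "category K" and U: "universe TYPE('u)" and S: "small S" and co: "has_small_colimits TYPE('u) K"
  and f: "!!x. x : S ==> f x : cobj K"
  and ty: "!!x y. x : S ==> y : S ==> k x y : cobj K & u x y : chom K (k x y) (f x) & v x y : chom K (k x y) (f y)"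
 shows "EX p i. amalgam K S f u v p i"
proof -
 obtain e :: "'u shape => 'u" where e: "inj e" using ex_shape_code U by blast
 let ?J = "coded_shape e shape_src shape_trg S"
 define D0 where "D0 x = (case inv e x of Vertex x => f x | Edge x y => k x y)" for x
 define D1 where "D1 x = (case inv e x of Vertex x => cid K (f x) | Edge x y => cid K (k x y)
   | Fst_Leg x y => u x y | Snd_Leg x y => v x y)" for x
 have ie: "inv e (e x) = x" and ee: "e x = e y \<longleftrightarrow> x = y" for x y using e by (simp_all add: inj_eq)
 note c = category.id_in_hom[OF K] category.id_left[OF K] category.id_right[OF K]
 have idl: "ccomp K (cid K (ccod K g)) g = g" "ccomp K g (cid K (cdom K g)) = g" if "g : carr K" for g
  using c that category.dom_cod[OF K that] by (auto simp: chom_def)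
 have D0: "D0 (e (Vertex x)) = f x" "D0 (e (Edge x y)) = k x y" for x y by (simp_all add: D0_def ie)
 have D1: "D1 (e (Vertex x)) = cid K (f x)" "D1 (e (Edge x y)) = cid K (k x y)" "D1 (e (Fst_Leg x y)) = u x y" "D1 (e (Snd_Leg x y)) = v x y" for x y
  by (simp_all add: D1_def ie)
 have sm: "small (carr ?J)"
  using small_image[OF shape_arrs_small[OF U S]] by (simp add: coded_shape_def)
 have Jo: "cobj ?J = e ` shape_obs S" "carr ?J = e ` shape_arrs S" "cdom ?J (e x) = e (shape_src x)" "ccod ?J (e x) = e (shape_trg x)"
  "cid ?J z = z" "ccomp ?J (e y) (e x) = e (shape_comp y x)" for x y z
  by (simp_all add: coded_shape_def ie)
 have ob: "D0 (e x) : cobj K & D1 (e x) = cid K (D0 (e x))" if "x : shape_obs S" for x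
  using that f ty by (auto simp: shape_obs_def D0 D1)
 have arr: "D1 (e x) : chom K (D0 (e (shape_src x))) (D0 (e (shape_trg x)))" if "x : shape_arrs S" for x
  using that f ty c(1) by (auto simp: shape_arrs_def shape_obs_def D0 D1)
 have dg: "diagram ?J K D0 D1"
  unfolding diagram_def
 proof (intro conjI ballI impI)
  fix i j assume "i : carr ?J" "j : carr ?J" "ccod ?J i = cdom ?J j"
  then obtain x y where x: "i = e x" "j = e y" "x : shape_arrs S" "y : shape_arrs S" "shape_trg x = shape_src y"
   by (auto simp: Jo ee)
  note ax = arr[OF x(3)] and ay = arr[OF x(4)]
  show "D1 (ccomp ?J j i) = ccomp K (D1 j) (D1 i)"
   using x ax ay c(2)[OF ax] c(3)[OF ay] by (cases x; cases y) (auto simp: Jo D0 D1)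
 qed (use ob arr in "auto simp: Jo")
 have cc: "cocone ?J K D0 D1 p i \<longleftrightarrow> amalgamates K S f u v p (%x. i (e (Vertex x))) &
   (ALL x:S. ALL y:S. i (e (Edge x y)) = ccomp K (i (e (Vertex x))) (u x y))" for p i
 proof
  assume "cocone ?J K D0 D1 p i"
  then have p: "p : cobj K" and i: "!!x. x : shape_obs S ==> i (e x) : chom K (D0 (e x)) p"
   and ar: "!!x. x : shape_arrs S ==> ccomp K (i (e (shape_trg x))) (D1 (e x)) = i (e (shape_src x))"
   by (auto simp: cocone_def Jo)
  show "amalgamates K S f u v p (%x. i (e (Vertex x))) & (ALL x:S. ALL y:S. i (e (Edge x y)) = ccomp K (i (e (Vertex x))) (u x y))"
   using p i[of "Vertex _"] ar[of "Fst_Leg _ _"] ar[of "Snd_Leg _ _"] by (simp add: amalgamates_def shape_arrs_iff shape_obs_iff D0 D1)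
 next
  assume "amalgamates K S f u v p (%x. i (e (Vertex x))) & (ALL x:S. ALL y:S. i (e (Edge x y)) = ccomp K (i (e (Vertex x))) (u x y))"
  then have p: "p : cobj K" and i: "!!x. x : S ==> i (e (Vertex x)) : chom K (f x) p"
   and iE: "!!x y. x : S ==> y : S ==> i (e (Edge x y)) = ccomp K (i (e (Vertex x))) (u x y)"
   and ii: "!!x y. x : S ==> y : S ==> ccomp K (i (e (Vertex x))) (u x y) = ccomp K (i (e (Vertex y))) (v x y)"
   by (auto simp: amalgamates_def)
  have i': "i (e (Edge x y)) : chom K (k x y) p" if "x : S" "y : S" for x y
   unfolding iE[OF that] using category.comp_in_hom[OF K] ty[OF that] i[OF that(1)] by blast
  have "ccomp K (i (e (shape_trg x))) (D1 (e x)) = i (e (shape_src x))" if "x : shape_arrs S" for x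
   using that c(3)[OF i] c(3)[OF i'] by (auto simp: shape_arrs_def shape_obs_def D1 iE ii)
  moreover have "i (e x) : chom K (D0 (e x)) p" if "x : shape_obs S" for x
   using that i i' by (auto simp: shape_obs_def D0)
  ultimately show "cocone ?J K D0 D1 p i" using p by (auto simp: cocone_def Jo)
 qed
 obtain p i where "is_colimit ?J K D0 D1 p i"
  using co coded_shape_category[OF e] sm dg unfolding has_small_colimits_def by blast
 then have pp: "cocone ?J K D0 D1 p i" and
  un: "!!q j. cocone ?J K D0 D1 q j ==> \<exists>!t. t : chom K p q & (ALL i':cobj ?J. ccomp K t (i i') = j i')"
  by (auto simp: is_colimit_def)
 note pp = pp[unfolded cc]
 have "amalgam K S f u v p (%x. i (e (Vertex x)))"
  unfolding amalgam_def
 proof (intro conjI allI impI)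
  show "amalgamates K S f u v p (%x. i (e (Vertex x)))" using pp by blast
  fix q j assume g: "amalgamates K S f u v q j"
  define j' where "j' x = (case inv e x of Vertex x => j x | Edge x y => ccomp K (j x) (u x y))" for x
  have "cocone ?J K D0 D1 q j'" unfolding cc using g by (simp add: j'_def ie)
  note un' = un[OF this]
  have "(ALL i':cobj ?J. ccomp K t (i i') = j' i') \<longleftrightarrow> (ALL x:S. ccomp K t (i (e (Vertex x))) = j x)"
   if t: "t : chom K p q" for t
  proof -
   have "ccomp K t (i (e (Edge x y))) = ccomp K (j x) (u x y)" if xy: "x : S" "y : S" "ccomp K t (i (e (Vertex x))) = j x" for x y
    using category.comp_assoc[OF K, of "u x y" "k x y" "f x" "i (e (Vertex x))" p t q] pp ty[OF xy(1,2)] t xy by (auto simp: amalgamates_def)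
   then show ?thesis by (auto simp: Jo shape_obs_def j'_def ie)
  qed
  then show "\<exists>!t. t : chom K p q & (ALL b:S. ccomp K t (i (e (Vertex b))) = j b)"
   using un' by (metis (no_types, lifting))
 qed
 then show ?thesis by blast
qed

definition op_cat :: "('a, 'b) cat => ('a, 'b) cat" where
 "op_cat K = \<lparr>cobj = cobj K, carr = carr K, cdom = ccod K, ccod = cdom K, cid = cid K, ccomp = (%g f. ccomp K f g)\<rparr>"

lemma op_cat_sel [simp]: "cobj (op_cat K) = cobj K" "carr (op_cat K) = carr K" "cdom (op_cat K) = ccod K"
 "ccod (op_cat K) = cdom K" "cid (op_cat K) = cid K" "ccomp (op_cat K) g f = ccomp K f g"
 by (simp_all add: op_cat_def)

lemma chom_op_cat: "chom (op_cat K) a b = chom K b a"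
 by (auto simp: chom_def)

lemma category_op_cat: "category K ==> category (op_cat K)"
 by (rule category.intro) (auto simp: chom_op_cat category.dom_cod category.id_in_hom category.comp_in_hom
  category.id_left category.id_right category.comp_assoc)

text \<open>Limits are colimits in the opposite category; this gives co-gluings from gluings.\<close>

lemma colimits_op_cat: "has_small_limits TYPE('u) K ==> has_small_colimits TYPE('u) (op_cat K)"
 unfolding has_small_colimits_def
proof (intro allI impI, elim conjE)
 fix J :: "('u, 'u) cat" and D0 D1
 assume lim: "has_small_limits TYPE('u) K" and J: "category J" "small (carr J)" "diagram J (op_cat K) D0 D1"
 have "diagram (op_cat J) K D0 D1" using J(3) by (simp add: diagram_def chom_op_cat)
 then obtain p q where "is_limit (op_cat J) K D0 D1 p q"
  using lim category_op_cat[OF J(1)] J(2) unfolding has_small_limits_def op_cat_sel by (metis op_cat_sel(2))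
 then have "is_colimit J (op_cat K) D0 D1 p q"
  by (simp add: is_limit_def is_colimit_def cone_def cocone_def chom_op_cat)
 then show "EX p q. is_colimit J (op_cat K) D0 D1 p q" by blast
qed

context bicategory
begin

definition glues :: "'m set => 'u set => ('u => 'm) => ('u => 'u => 'c) => ('u => 'u => 'c) => 'm => ('u => 'c) => bool" where
 "glues H S f u v q j \<longleftrightarrow> q : H & (ALL b:S. j b : hom2 W (f b) q) & (ALL b:S. ALL b':S. j b \<cdot> u b b' = j b' \<cdot> v b b')"

definition glued :: "'m set => 'u set => ('u => 'm) => ('u => 'u => 'c) => ('u => 'u => 'c) => 'm => ('u => 'c) => bool" where
 "glued H S f u v p i \<longleftrightarrow> glues H S f u v p i &
   (ALL q j. glues H S f u v q j --> (\<exists>!t. t : hom2 W p q & (ALL b:S. t \<cdot> i b = j b)))"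

definition coglues :: "'m set => 'u set => ('u => 'm) => ('u => 'u => 'c) => ('u => 'u => 'c) => 'm => ('u => 'c) => bool" where
 "coglues H S f u v q j \<longleftrightarrow> q : H & (ALL b:S. j b : hom2 W q (f b)) & (ALL b:S. ALL b':S. u b b' \<cdot> j b = v b b' \<cdot> j b')"

definition coglued :: "'m set => 'u set => ('u => 'm) => ('u => 'u => 'c) => ('u => 'u => 'c) => 'm => ('u => 'c) => bool" where
 "coglued H S f u v p i \<longleftrightarrow> coglues H S f u v p i &
   (ALL q j. coglues H S f u v q j --> (\<exists>!t. t : hom2 W q p & (ALL b:S. i b \<cdot> t = j b)))"

text \<open>An operation \<open>T\<close> on 2-cells for which maps out of \<open>T0 l\<close> correspond to maps out of
 \<open>l\<close> has a right adjoint as far as \<open>q\<close> is concerned, and therefore preserves the gluing.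
 Whiskering on either side is of this kind.\<close>

lemma glued_transport:
 assumes gl: "glued (hom1 W a b) S f u v p i"
  and ty: "!!x y. x : S ==> y : S ==> k x y : hom1 W a b & u x y : hom2 W (k x y) (f x) & v x y : hom2 W (k x y) (f y)"
  and T: "!!l l' \<sigma>. l : hom1 W a b ==> \<sigma> : hom2 W l l' ==> T \<sigma> : hom2 W (T0 l) (T0 l')"
  and Tc: "!!l l' l'' \<sigma> \<tau>. l : hom1 W a b ==> \<sigma> : hom2 W l l' ==> \<tau> : hom2 W l' l'' ==> T (\<tau> \<cdot> \<sigma>) = T \<tau> \<cdot> T \<sigma>"
  and r: "r : hom1 W a b" and \<rho>: "\<rho> : hom2 W (T0 r) q"
  and univ: "!!l \<sigma>. l : hom1 W a b ==> \<sigma> : hom2 W (T0 l) q ==> \<exists>!\<tau>. \<tau> : hom2 W l r & \<rho> \<cdot> T \<tau> = \<sigma>"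
  and q: "glues H S (%x. T0 (f x)) (%x y. T (u x y)) (%x y. T (v x y)) q j"
 shows "\<exists>!t. t : hom2 W (T0 p) q & (ALL x:S. t \<cdot> T (i x) = j x)"
proof -
 have j: "!!x. x : S ==> j x : hom2 W (T0 (f x)) q"
  and jj: "!!x y. x : S ==> y : S ==> j x \<cdot> T (u x y) = j y \<cdot> T (v x y)"
  using q by (auto simp: glues_def)
 have p: "p : hom1 W a b" and i: "!!x. x : S ==> i x : hom2 W (f x) p"
  using gl by (auto simp: glued_def glues_def)
 have f: "f x : hom1 W a b" if "x : S" for x
  using hom2D[OF i[OF that]] p by (auto simp: hom1_iff)
 have wh: "\<rho> \<cdot> T (\<tau> \<cdot> \<sigma>) = (\<rho> \<cdot> T \<tau>) \<cdot> T \<sigma>"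
  if "l : hom1 W a b" "\<sigma> : hom2 W l l'" "\<tau> : hom2 W l' r" for l l' \<sigma> \<tau>
 proof -
  have "l' : hom1 W a b" using hom2D[OF that(2)] that(1) by (auto simp: hom1_iff)
  then show ?thesis using Tc[OF that] T[OF that(1,2)] T[OF _ that(3)] \<rho> by (simp add: hom2_iff vassoc)
 qed
 have uniq: "\<tau> = \<tau>'" if "l : hom1 W a b" "\<tau> : hom2 W l r" "\<tau>' : hom2 W l r" "\<rho> \<cdot> T \<tau> = \<rho> \<cdot> T \<tau>'" for l \<tau> \<tau>'
  using univ[OF that(1) vcomp_in[OF T[OF that(1,2)] \<rho>]] that(2-4) by (metis (no_types))
 have "ALL x:S. EX t. t : hom2 W (f x) r & \<rho> \<cdot> T t = j x" using univ f j by blast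
 then obtain j' where j': "!!x. x : S ==> j' x : hom2 W (f x) r" "!!x. x : S ==> \<rho> \<cdot> T (j' x) = j x" by metis
 have "glues (hom1 W a b) S f u v r j'"
  unfolding glues_def
 proof (intro conjI ballI)
  fix x y assume xy: "x : S" "y : S"
  note t = ty[OF xy]
  have "\<rho> \<cdot> T (j' x \<cdot> u x y) = \<rho> \<cdot> T (j' y \<cdot> v x y)"
   using wh[of _ "u x y" _ "j' x"] wh[of _ "v x y" _ "j' y"] t j' xy jj by auto
  moreover have "j' x \<cdot> u x y : hom2 W (k x y) r" "j' y \<cdot> v x y : hom2 W (k x y) r"
   using vcomp_in t j' xy by auto
  ultimately show "j' x \<cdot> u x y = j' y \<cdot> v x y" using uniq[of "k x y"] t by simp
 qed (use r j' in auto)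
 then obtain t' where t': "t' : hom2 W p r" "!!x. x : S ==> t' \<cdot> i x = j' x"
  and t'u: "!!s. s : hom2 W p r ==> (ALL x:S. s \<cdot> i x = j' x) ==> s = t'"
  using gl unfolding glued_def by metis
 show ?thesis
 proof (rule ex1I[of _ "\<rho> \<cdot> T t'"])
  show "\<rho> \<cdot> T t' : hom2 W (T0 p) q & (ALL x:S. (\<rho> \<cdot> T t') \<cdot> T (i x) = j x)"
   using wh[OF f i t'(1)] t' j' vcomp_in[OF T[OF p t'(1)] \<rho>] by auto
  fix s assume s: "s : hom2 W (T0 p) q & (ALL x:S. s \<cdot> T (i x) = j x)"
  then obtain s' where s': "s' : hom2 W p r" "\<rho> \<cdot> T s' = s" using univ[OF p] by blast
  have "s' \<cdot> i x = j' x" if x: "x : S" for x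
  proof -
   have "\<rho> \<cdot> T (s' \<cdot> i x) = j x" using wh[OF f[OF x] i[OF x] s'(1)] s s' x by simp
   moreover have "s' \<cdot> i x : hom2 W (f x) r" using vcomp_in[OF i[OF x] s'(1)] .
   ultimately show ?thesis using uniq[OF f[OF x]] j'[OF x] by simp
  qed
  then show "s = \<rho> \<cdot> T t'" using t'u[OF s'(1)] s' by simp
 qed
qed

lemma glued_whisker_left:
 assumes gl: "glued (hom1 W a b) S f u v p i"
  and g: "g : hom1 W b c"
  and lift: "!!k. k : cells1 W ==> trg W k = c ==> EX r \<rho>. is_right_lifting W g k r \<rho>"
  and ty: "!!x y. x : S ==> y : S ==> k x y : hom1 W a b & u x y : hom2 W (k x y) (f x) & v x y : hom2 W (k x y) (f y)"
  and q: "glues (hom1 W a c) S (%x. g \<star> f x) (%x y. \<iota> g \<ast> u x y) (%x y. \<iota> g \<ast> v x y) q j"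
 shows "\<exists>!t. t : hom2 W (g \<star> p) q & (ALL x:S. t \<cdot> (\<iota> g \<ast> i x) = j x)"
proof -
 have q': "q : cells1 W" "src W q = a" "trg W q = c" using q by (auto simp: glues_def hom1_iff)
 have gc: "g : cells1 W" "src W g = b" using g by (auto simp: hom1_iff)
 obtain r \<rho> where "is_right_lifting W g q r \<rho>" using lift q' by blast
 then have r: "r : hom1 W a b" "\<rho> : hom2 W (g \<star> r) q"
  "!!l \<sigma>. l : hom1 W a b ==> \<sigma> : hom2 W (g \<star> l) q ==> \<exists>!\<tau>. \<tau> : hom2 W l r & \<rho> \<cdot> (\<iota> g \<ast> \<tau>) = \<sigma>"
  using q' gc by (auto simp: is_right_lifting_def)
 show ?thesis
  by (rule glued_transport[OF gl ty _ _ r q]) (use gc in "auto simp: hom1_iff hom2_iff inter")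
qed

lemma glued_whisker_right:
 assumes gl: "glued (hom1 W b c) S f u v p i"
  and h: "h : hom1 W a b"
  and lift: "!!k. k : cells1 W ==> src W k = a ==> EX r \<rho>. is_right_extension W h k r \<rho>"
  and ty: "!!x y. x : S ==> y : S ==> k x y : hom1 W b c & u x y : hom2 W (k x y) (f x) & v x y : hom2 W (k x y) (f y)"
  and q: "glues (hom1 W a c) S (%x. f x \<star> h) (%x y. u x y \<ast> \<iota> h) (%x y. v x y \<ast> \<iota> h) q j"
 shows "\<exists>!t. t : hom2 W (p \<star> h) q & (ALL x:S. t \<cdot> (i x \<ast> \<iota> h) = j x)"
proof -
 have q': "q : cells1 W" "src W q = a" "trg W q = c" using q by (auto simp: glues_def hom1_iff)
 have hc: "h : cells1 W" "trg W h = b" using h by (auto simp: hom1_iff)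
 obtain r \<rho> where "is_right_extension W h q r \<rho>" using lift q' by blast
 then have r: "r : hom1 W b c" "\<rho> : hom2 W (r \<star> h) q"
  "!!l \<sigma>. l : hom1 W b c ==> \<sigma> : hom2 W (l \<star> h) q ==> \<exists>!\<tau>. \<tau> : hom2 W l r & \<rho> \<cdot> (\<tau> \<ast> \<iota> h) = \<sigma>"
  using q' hc by (auto simp: is_right_extension_def)
 show ?thesis
  by (rule glued_transport[OF gl ty _ _ r q]) (use hc in "auto simp: hom1_iff hom2_iff inter")
qed

end

locale enriched_base = bicategory W for W :: "('o, 'm, 'c) bicat" (structure) +
 fixes U :: "'u itself"
 assumes enrichment_base: "enrichment_base U W"
begin

lemma univ: "universe U" using enrichment_base by (simp add: enrichment_base_def)

lemma ex_right_lifting: "[|f : cells1 W; k : cells1 W; trg W f = trg W k|] ==> EX r \<rho>. is_right_lifting W f k r \<rho>"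
 and ex_right_extension: "[|f : cells1 W; k : cells1 W; src W f = src W k|] ==> EX r \<rho>. is_right_extension W f k r \<rho>"
 using enrichment_base by (simp_all add: enrichment_base_def)

lemma chom_homcat: "x : hom1 W a b ==> chom (homcat W a b) x y = hom2 W x y"
 using dom2_cod2 by (auto simp: chom_def homcat_def hom1_iff hom2_iff)

lemma ex_glued:
 fixes S :: "'u set"
 assumes S: "small S" and ab: "a : obj W" "b : obj W"
  and f: "!!x. x : S ==> f x : hom1 W a b"
  and ty: "!!x y. x : S ==> y : S ==> k x y : hom1 W a b & u x y : hom2 W (k x y) (f x) & v x y : hom2 W (k x y) (f y)"
 shows "EX p i. glued (hom1 W a b) S f u v p i"
proof -
 have K: "cobj (homcat W a b) = hom1 W a b" "ccomp (homcat W a b) = vcomp W" by (simp_all add: homcat_def)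
 have co: "has_small_colimits TYPE('u) (homcat W a b)"
  using enrichment_base ab unfolding enrichment_base_def has_small_colimits_def by blast
 have "EX p i. amalgam (homcat W a b) S f u v p i"
  by (rule ex_amalgam[OF hom_category[OF ab] _ S co, where k = k]) (use univ f ty in "simp_all add: K chom_homcat universe_def")
 moreover have "amalgam (homcat W a b) S f u v p i \<longleftrightarrow> glued (hom1 W a b) S f u v p i" for p i
 proof -
  have "amalgamates (homcat W a b) S f u v q j \<longleftrightarrow> glues (hom1 W a b) S f u v q j" for q j
   using f by (simp add: amalgamates_def glues_def K chom_homcat)
  note eq = this
  show ?thesis
  proof (cases "p : hom1 W a b")
   case True
   then show ?thesis unfolding amalgam_def glued_def by (simp add: eq chom_homcat K cong: conj_cong) (auto simp: glues_def chom_homcat)?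
  next
   case False
   then show ?thesis by (simp add: amalgam_def amalgamates_def glued_def glues_def K)
  qed
 qed
 ultimately show ?thesis by simp
qed

lemma ex_coglued:
 fixes S :: "'u set"
 assumes S: "small S" and ab: "a : obj W" "b : obj W"
  and f: "!!x. x : S ==> f x : hom1 W a b"
  and ty: "!!x y. x : S ==> y : S ==> k x y : hom1 W a b & u x y : hom2 W (f x) (k x y) & v x y : hom2 W (f y) (k x y)"
 shows "EX p i. coglued (hom1 W a b) S f u v p i"
proof -
 let ?K = "op_cat (homcat W a b)"
 have K: "cobj (homcat W a b) = hom1 W a b" "ccomp (homcat W a b) = vcomp W" by (simp_all add: homcat_def)
 have co: "has_small_colimits TYPE('u) ?K"
  by (rule colimits_op_cat) (use enrichment_base ab in "unfold enrichment_base_def has_small_limits_def, blast")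
 have "EX p i. amalgam ?K S f u v p i"
  by (rule ex_amalgam[OF category_op_cat[OF hom_category[OF ab]] _ S co, where k = k])
   (use univ f ty in "simp_all add: K chom_op_cat chom_homcat universe_def")
 moreover have "amalgam ?K S f u v p i \<longleftrightarrow> coglued (hom1 W a b) S f u v p i" for p i
 proof -
  have "amalgamates ?K S f u v q j \<longleftrightarrow> coglues (hom1 W a b) S f u v q j" for q j
   using f by (auto simp: amalgamates_def coglues_def K chom_op_cat chom_homcat)
  note eq = this
  show ?thesis
  proof (cases "p : hom1 W a b")
   case True
   then show ?thesis unfolding amalgam_def coglued_def by (simp add: eq chom_op_cat chom_homcat K cong: conj_cong) (auto simp: coglues_def chom_op_cat chom_homcat)?
  next
   case False
   then show ?thesis by (simp add: amalgam_def amalgamates_def coglued_def coglues_def K)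
  qed
 qed
 ultimately show ?thesis by simp
qed

end


section \<open>Enriched categories, functors and modules on elements\<close>

text \<open>On elements, \<open>cm\<close> is composition in a category, \<open>la\<close> and \<open>ra\<close> are the two actions on a
module, \<open>cl\<close> is the class of \<open>n \<otimes> m\<close> in a coend and \<open>app\<close> is the value of a morphism.\<close>

context bicategory
begin

abbreviation isfun :: "('u, 'o, 'm, 'c) wfun => bool" where "isfun F \<equiv> wfunctor W F (fdom F) (fcod F)"
abbreviation ismod :: "('u, 'o, 'm, 'c) wmod => bool" where "ismod M \<equiv> wmodule W M (mdom M) (mcod M)"
abbreviation cor :: "('u, 'o, 'm, 'c) wfun => ('u, 'o, 'm, 'c) wmod" where "cor \<equiv> corep W"
abbreviation rp :: "('u, 'o, 'm, 'c) wfun => ('u, 'o, 'm, 'c) wmod" where "rp \<equiv> rep W"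
abbreviation mors :: "('u, 'o, 'm, 'c) wmod => ('u, 'o, 'm, 'c) wmod => ('u, 'o, 'm, 'c) wmor set" where "mors \<equiv> hom2 (Mod W)"
abbreviation idm :: "('u, 'o, 'm, 'c) wmod => ('u, 'o, 'm, 'c) wmor" where "idm \<equiv> mor_id W"
abbreviation vc :: "('u, 'o, 'm, 'c) wmor => ('u, 'o, 'm, 'c) wmor => ('u, 'o, 'm, 'c) wmor" where "vc \<equiv> mor_vcomp W"
abbreviation hc :: "('u, 'o, 'm, 'c) wmor => ('u, 'o, 'm, 'c) wmor => ('u, 'o, 'm, 'c) wmor" where "hc \<equiv> mor_hcomp W"
abbreviation cmod :: "('u, 'o, 'm, 'c) wmod => ('u, 'o, 'm, 'c) wmod => ('u, 'o, 'm, 'c) wmod" where "cmod \<equiv> mod_comp W"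
abbreviation cob :: "('u, 'o, 'm, 'c) wmod => ('u, 'o, 'm, 'c) wmod => 'u => 'u => 'm" where "cob \<equiv> coend_ob W"
abbreviation cin :: "('u, 'o, 'm, 'c) wmod => ('u, 'o, 'm, 'c) wmod => 'u => 'u => 'u => 'c" where "cin \<equiv> coend_in W"
abbreviation cm where "cm A x y z f g \<equiv> ap (cmp A x y z) (ten f g)"
abbreviation la where "la M b' b a x m \<equiv> ap (lact M b' b a) (ten x m)"
abbreviation ra where "ra M b a a' m x \<equiv> ap (ract M b a a') (ten m x)"
abbreviation cl where "cl N M c a b n m \<equiv> ap (coend_in W N M c a b) (ten n m)"
abbreviation app where "app \<sigma> b a x \<equiv> ap (component \<sigma> b a) x"

end

context bicategory
begin

subsection \<open>Categories\<close>

context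
 fixes A :: "('u, 'o, 'm, 'c) wcat"
 assumes A: "wcategory W A"
begin

lemma ext_obj [simp]: "x : ob A ==> ext A x : obj W"
 using wcategory.ext_in_obj[OF A] .

lemma hom_cell [simp]:
 assumes "x : ob A" "y : ob A"
 shows "hom A x y : cells1 W" "src W (hom A x y) = ext A y" "trg W (hom A x y) = ext A x"
 using wcategory.hom_in_hom[OF A assms] by (auto simp: hom1_iff)

lemma cmp_cell [simp]:
 assumes "x : ob A" "y : ob A" "z : ob A"
 shows "cmp A x y z : cells2 W" "dom2 W (cmp A x y z) = hom A x y \<star> hom A y z" "cod2 W (cmp A x y z) = hom A x z"
 using wcategory.cmp_in_hom[OF A assms] by (auto simp: hom2_iff)

lemma unt_cell [simp]:
 assumes "x : ob A"
 shows "unt A x : cells2 W" "dom2 W (unt A x) = \<one> (ext A x)" "cod2 W (unt A x) = hom A x x"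
 using wcategory.unt_in_hom[OF A assms] by (auto simp: hom2_iff)

lemma cmp_assoc_el [simp]:
 assumes o: "x : ob A" "y : ob A" "z : ob A" "v : ob A"
  and e: "f : El (hom A x y)" "g : El (hom A y z)" "h : El (hom A z v)"
 shows "cm A x z v (cm A x y z f g) h = cm A x y v f (cm A y z v g h)"
proof -
 have "ap (cmp A x z v \<cdot> (cmp A x y z \<ast> \<iota> (hom A z v))) (ten (ten f g) h)
  = ap (cmp A x y v \<cdot> (\<iota> (hom A x y) \<ast> cmp A y z v) \<cdot> \<a> (hom A x y) (hom A y z) (hom A z v)) (ten (ten f g) h)"
  by (simp add: wcategory.cmp_assoc[OF A o])
 then show ?thesis using o e by simp
qed

lemma cmp_unt_el [simp]:
 assumes o: "x : ob A" "y : ob A" and e: "f : El (hom A x y)"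
 shows "cm A x x y (pt (unt A x)) f = f" "cm A x y y f (pt (unt A y)) = f"
proof -
 have "ap (cmp A x x y \<cdot> (unt A x \<ast> \<iota> (hom A x y))) (ten (pt (\<iota> (\<one> (ext A x)))) f) = f"
  unfolding wcategory.cmp_unt_left[OF A o] using o e by simp
 then show "cm A x x y (pt (unt A x)) f = f" using o e by simp
 have "ap (cmp A x y y \<cdot> (\<iota> (hom A x y) \<ast> unt A y)) (ten f (pt (\<iota> (\<one> (ext A y))))) = f"
  unfolding wcategory.cmp_unt_right[OF A o] using o e by simp
 then show "cm A x y y f (pt (unt A y)) = f" using o e by simp
qed

end

text \<open>The axioms are equations between 2-cells; they hold as soon as they hold on elements.\<close>

lemma wcategoryI:
 fixes A :: "('u, 'o, 'm, 'c) wcat"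
 assumes "small (ob A)"
  and "!!x. x : ob A ==> ext A x : obj W"
  and hom: "!!x y. x : ob A ==> y : ob A ==> hom A x y : hom1 W (ext A y) (ext A x)"
  and cmp: "!!x y z. [|x : ob A; y : ob A; z : ob A|] ==> cmp A x y z : hom2 W (hom A x y \<star> hom A y z) (hom A x z)"
  and unt: "!!x. x : ob A ==> unt A x : hom2 W (\<one> (ext A x)) (hom A x x)"
  and assoc: "!!x y z v f g h. [|x : ob A; y : ob A; z : ob A; v : ob A;
    f : El (hom A x y); g : El (hom A y z); h : El (hom A z v)|]
   ==> cm A x z v (cm A x y z f g) h = cm A x y v f (cm A y z v g h)"
  and unt_l: "!!x y f. [|x : ob A; y : ob A; f : El (hom A x y)|] ==> cm A x x y (pt (unt A x)) f = f"
  and unt_r: "!!x y f. [|x : ob A; y : ob A; f : El (hom A x y)|] ==> cm A x y y f (pt (unt A y)) = f"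
 shows "wcategory W A"
proof (rule wcategory.intro)
 note h = hom[unfolded hom1_iff, THEN conjunct1] hom[unfolded hom1_iff, THEN conjunct2, THEN conjunct1]
  hom[unfolded hom1_iff, THEN conjunct2, THEN conjunct2]
 note c = cmp[THEN hom2D(1)] cmp[THEN hom2D(2)] cmp[THEN hom2D(3)]
 note u = unt[THEN hom2D(1)] unt[THEN hom2D(2)] unt[THEN hom2D(3)]
 show "cmp A x z v \<cdot> (cmp A x y z \<ast> \<iota> (hom A z v))
  = cmp A x y v \<cdot> (\<iota> (hom A x y) \<ast> cmp A y z v) \<cdot> \<a> (hom A x y) (hom A y z) (hom A z v)"
  if o: "x : ob A" "y : ob A" "z : ob A" "v : ob A" for x y z v
  by (rule el_ext3[of _ "hom A x y" "hom A y z" "hom A z v" "hom A x v"])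
   (use o assoc[OF o] in "simp_all add: h c hom2_iff")
 show "cmp A x x y \<cdot> (unt A x \<ast> \<iota> (hom A x y)) = \<l> (hom A x y)" if o: "x : ob A" "y : ob A" for x y
 proof (rule iso2_cancel_right[of "inv2 W (\<l> (hom A x y))"])
  show "(cmp A x x y \<cdot> (unt A x \<ast> \<iota> (hom A x y))) \<cdot> inv2 W (\<l> (hom A x y)) = \<l> (hom A x y) \<cdot> inv2 W (\<l> (hom A x y))"
   by (rule el_ext[of _ "hom A x y" "hom A x y"])
    (use o unt_l[OF o] assms(2) in "simp_all add: h c u hom2_iff")
 qed (use o assms(2) in "simp_all add: h c u")
 show "cmp A x y y \<cdot> (\<iota> (hom A x y) \<ast> unt A y) = \<r> (hom A x y)" if o: "x : ob A" "y : ob A" for x y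
 proof (rule el_cancel[of _ "hom A x y \<star> \<one> (ext A y)" "hom A x y" _ "ten (generic (hom A x y)) (pt (\<iota> (\<one> (ext A y))))"])
  show "iso2 W (cell (ten (generic (hom A x y)) (pt (\<iota> (\<one> (ext A y))))))"
   by (rule iso2_ten[of _ "hom A x y" _ "\<one> (ext A y)"]) (use o assms(2) in "simp_all add: h")
 qed (use o unt_r[OF o] assms(2) in "simp_all add: h c u hom2_iff")
qed (fact assms)+

subsection \<open>Functors\<close>

context
 fixes F :: "('u, 'o, 'm, 'c) wfun"
 assumes F: "isfun F"
begin

lemma fdom_wcat [simp]: "wcategory W (fdom F)" and fcod_wcat [simp]: "wcategory W (fcod F)"
 using wfunctor.dom_wcategory[OF F] wfunctor.cod_wcategory[OF F] by auto

lemma fob_ob [simp]: "x : ob (fdom F) ==> C = fcod F ==> fob F x : ob C"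
 and ext_fob [simp]: "x : ob (fdom F) ==> C = fcod F ==> ext C (fob F x) = ext (fdom F) x"
 using wfunctor.fob_in_ob[OF F] wfunctor.fob_ext[OF F] by auto

lemma fmap_cell [simp]:
 assumes "x : ob (fdom F)" "y : ob (fdom F)"
 shows "fmap F x y : cells2 W" "dom2 W (fmap F x y) = hom (fdom F) x y" "cod2 W (fmap F x y) = hom (fcod F) (fob F x) (fob F y)"
 using wfunctor.fmap_in_hom[OF F assms] by (auto simp: hom2_iff)

lemma fmap_cmp_el [simp]:
 assumes o: "x : ob (fdom F)" "y : ob (fdom F)" "z : ob (fdom F)" and B: "B = fdom F"
  and e: "f : El (hom (fdom F) x y)" "g : El (hom (fdom F) y z)"
 shows "ap (fmap F x z) (cm B x y z f g)
  = cm (fcod F) (fob F x) (fob F y) (fob F z) (ap (fmap F x y) f) (ap (fmap F y z) g)"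
proof -
 have "ap (fmap F x z \<cdot> cmp (fdom F) x y z) (ten f g)
  = ap (cmp (fcod F) (fob F x) (fob F y) (fob F z) \<cdot> (fmap F x y \<ast> fmap F y z)) (ten f g)"
  by (simp add: wfunctor.fmap_cmp[OF F o])
 then show ?thesis using o e B by simp
qed

lemma fmap_unt_el [simp]: "x : ob (fdom F) ==> B = fdom F ==> fmap F x x \<cdot> unt B x = unt (fcod F) (fob F x)"
 using wfunctor.fmap_unt[OF F] by simp

end

lemma wfunctorI:
 fixes F :: "('u, 'o, 'm, 'c) wfun"
 assumes "fdom F = B" "fcod F = C" and B: "wcategory W B" and C: "wcategory W C"
  and fob: "!!x. x : ob B ==> fob F x : ob C" "!!x. x : ob B ==> ext C (fob F x) = ext B x"
  and fm: "!!x y. [|x : ob B; y : ob B|] ==> fmap F x y : hom2 W (hom B x y) (hom C (fob F x) (fob F y))"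
  and cmp: "!!x y z f g. [|x : ob B; y : ob B; z : ob B; f : El (hom B x y); g : El (hom B y z)|]
   ==> ap (fmap F x z) (cm B x y z f g)
    = cm C (fob F x) (fob F y) (fob F z) (ap (fmap F x y) f) (ap (fmap F y z) g)"
  and "!!x. x : ob B ==> ap (fmap F x x) (pt (unt B x)) = pt (unt C (fob F x))"
 shows "wfunctor W F B C"
proof (rule wfunctor.intro)
 note m = fm[THEN hom2D(1)] fm[THEN hom2D(2)] fm[THEN hom2D(3)]
 show "fmap F x z \<cdot> cmp B x y z = cmp C (fob F x) (fob F y) (fob F z) \<cdot> (fmap F x y \<ast> fmap F y z)"
  if o: "x : ob B" "y : ob B" "z : ob B" for x y z
  by (rule el_ext2[of _ "hom B x y" "hom B y z" "hom C (fob F x) (fob F z)"])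
   (use o cmp[OF o] B C fob in "simp_all add: m hom2_iff")
 show "fmap F x x \<cdot> unt B x = unt C (fob F x)" if "x : ob B" for x
  using assms(9)[OF that] by simp
qed (fact assms)+

subsection \<open>Modules\<close>

context
 fixes M :: "('u, 'o, 'm, 'c) wmod"
 assumes M: "ismod M"
begin

lemma mdom_wcat [simp]: "wcategory W (mdom M)" and mcod_wcat [simp]: "wcategory W (mcod M)"
 using wmodule.dom_wcategory[OF M] wmodule.cod_wcategory[OF M] by auto

lemma car_cell [simp]:
 assumes "b : ob (mcod M)" "a : ob (mdom M)"
 shows "car M b a : cells1 W" "src W (car M b a) = ext (mdom M) a" "trg W (car M b a) = ext (mcod M) b"
 using wmodule.car_in_hom[OF M assms] by (auto simp: hom1_iff)

lemma lact_cell [simp]: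
 assumes "b' : ob (mcod M)" "b : ob (mcod M)" "a : ob (mdom M)"
 shows "lact M b' b a : cells2 W" "dom2 W (lact M b' b a) = hom (mcod M) b' b \<star> car M b a" "cod2 W (lact M b' b a) = car M b' a"
 using wmodule.lact_in_hom[OF M assms] by (auto simp: hom2_iff)

lemma ract_cell [simp]:
 assumes "b : ob (mcod M)" "a : ob (mdom M)" "a' : ob (mdom M)"
 shows "ract M b a a' : cells2 W" "dom2 W (ract M b a a') = car M b a \<star> hom (mdom M) a a'" "cod2 W (ract M b a a') = car M b a'"
 using wmodule.ract_in_hom[OF M assms] by (auto simp: hom2_iff)

lemma lact_assoc_el [simp]:
 assumes o: "b'' : ob (mcod M)" "b' : ob (mcod M)" "b : ob (mcod M)" "a : ob (mdom M)" and B: "B = mcod M"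
  and e: "x : El (hom (mcod M) b'' b')" "y : El (hom (mcod M) b' b)" "m : El (car M b a)"
 shows "la M b'' b a (cm B b'' b' b x y) m
  = la M b'' b' a x (la M b' b a y m)"
proof -
 have "ap (lact M b'' b a \<cdot> (cmp (mcod M) b'' b' b \<ast> \<iota> (car M b a))) (ten (ten x y) m)
  = ap (lact M b'' b' a \<cdot> (\<iota> (hom (mcod M) b'' b') \<ast> lact M b' b a)
     \<cdot> \<a> (hom (mcod M) b'' b') (hom (mcod M) b' b) (car M b a)) (ten (ten x y) m)"
  by (simp add: wmodule.lact_assoc[OF M o])
 then show ?thesis using o e B by simp
qed

lemma ract_assoc_el [simp]:
 assumes o: "b : ob (mcod M)" "a : ob (mdom M)" "a' : ob (mdom M)" "a'' : ob (mdom M)"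
  and e: "m : El (car M b a)" "x : El (hom (mdom M) a a')" "y : El (hom (mdom M) a' a'')"
 shows "ra M b a' a'' (ra M b a a' m x) y
  = ra M b a a'' m (cm (mdom M) a a' a'' x y)"
proof -
 have "ap (ract M b a' a'' \<cdot> (ract M b a a' \<ast> \<iota> (hom (mdom M) a' a''))) (ten (ten m x) y)
  = ap (ract M b a a'' \<cdot> (\<iota> (car M b a) \<ast> cmp (mdom M) a a' a'')
     \<cdot> \<a> (car M b a) (hom (mdom M) a a') (hom (mdom M) a' a'')) (ten (ten m x) y)"
  by (simp add: wmodule.ract_assoc[OF M o])
 then show ?thesis using o e by simp
qed

lemma lact_ract_el [simp]:
 assumes o: "b' : ob (mcod M)" "b : ob (mcod M)" "a : ob (mdom M)" "a' : ob (mdom M)"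
  and e: "x : El (hom (mcod M) b' b)" "m : El (car M b a)" "y : El (hom (mdom M) a a')"
 shows "ra M b' a a' (la M b' b a x m) y
  = la M b' b a' x (ra M b a a' m y)"
proof -
 have "ap (ract M b' a a' \<cdot> (lact M b' b a \<ast> \<iota> (hom (mdom M) a a'))) (ten (ten x m) y)
  = ap (lact M b' b a' \<cdot> (\<iota> (hom (mcod M) b' b) \<ast> ract M b a a')
     \<cdot> \<a> (hom (mcod M) b' b) (car M b a) (hom (mdom M) a a')) (ten (ten x m) y)"
  by (simp add: wmodule.lact_ract[OF M o])
 then show ?thesis using o e by simp
qed

lemma act_unt_el [simp]:
 assumes o: "b : ob (mcod M)" "a : ob (mdom M)" and m: "m : El (car M b a)"
 shows "B = mcod M ==> la M b b a (pt (unt B b)) m = m"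
  "A = mdom M ==> ra M b a a m (pt (unt A a)) = m"
proof -
 have "ap (lact M b b a \<cdot> (unt (mcod M) b \<ast> \<iota> (car M b a))) (ten (pt (\<iota> (\<one> (ext (mcod M) b)))) m) = m"
  unfolding wmodule.lact_unt[OF M o] using o m by simp
 then show "B = mcod M ==> la M b b a (pt (unt B b)) m = m" using o m by simp
 have "ap (ract M b a a \<cdot> (\<iota> (car M b a) \<ast> unt (mdom M) a)) (ten m (pt (\<iota> (\<one> (ext (mdom M) a))))) = m"
  unfolding wmodule.ract_unt[OF M o] using o m by simp
 then show "A = mdom M ==> ra M b a a m (pt (unt A a)) = m" using o m by simp
qed

end

lemma wmoduleI:
 fixes M :: "('u, 'o, 'm, 'c) wmod"
 assumes "mdom M = A" "mcod M = B" and A: "wcategory W A" and B: "wcategory W B"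
  and car: "!!b a. [|b : ob B; a : ob A|] ==> car M b a : hom1 W (ext A a) (ext B b)"
  and lact: "!!b' b a. [|b' : ob B; b : ob B; a : ob A|] ==> lact M b' b a : hom2 W (hom B b' b \<star> car M b a) (car M b' a)"
  and ract: "!!b a a'. [|b : ob B; a : ob A; a' : ob A|] ==> ract M b a a' : hom2 W (car M b a \<star> hom A a a') (car M b a')"
  and ll: "!!b'' b' b a x y m. [|b'' : ob B; b' : ob B; b : ob B; a : ob A;
    x : El (hom B b'' b'); y : El (hom B b' b); m : El (car M b a)|]
   ==> la M b'' b a (cm B b'' b' b x y) m
     = la M b'' b' a x (la M b' b a y m)"
  and lu: "!!b a m. [|b : ob B; a : ob A; m : El (car M b a)|] ==> la M b b a (pt (unt B b)) m = m"
  and rr: "!!b a a' a'' x y m. [|b : ob B; a : ob A; a' : ob A; a'' : ob A;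
    m : El (car M b a); x : El (hom A a a'); y : El (hom A a' a'')|]
   ==> ra M b a' a'' (ra M b a a' m x) y
     = ra M b a a'' m (cm A a a' a'' x y)"
  and ru: "!!b a m. [|b : ob B; a : ob A; m : El (car M b a)|] ==> ra M b a a m (pt (unt A a)) = m"
  and lr: "!!b' b a a' x m y. [|b' : ob B; b : ob B; a : ob A; a' : ob A;
    x : El (hom B b' b); m : El (car M b a); y : El (hom A a a')|]
   ==> ra M b' a a' (la M b' b a x m) y
     = la M b' b a' x (ra M b a a' m y)"
 shows "wmodule W M A B"
proof (rule wmodule.intro)
 note h = car[unfolded hom1_iff, THEN conjunct1] car[unfolded hom1_iff, THEN conjunct2, THEN conjunct1]
  car[unfolded hom1_iff, THEN conjunct2, THEN conjunct2]
 note l = lact[THEN hom2D(1)] lact[THEN hom2D(2)] lact[THEN hom2D(3)]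
 note r = ract[THEN hom2D(1)] ract[THEN hom2D(2)] ract[THEN hom2D(3)]
 note s = h l r hom2_iff A B
 show "lact M b'' b a \<cdot> (cmp B b'' b' b \<ast> \<iota> (car M b a))
    = lact M b'' b' a \<cdot> (\<iota> (hom B b'' b') \<ast> lact M b' b a)
     \<cdot> \<a> (hom B b'' b') (hom B b' b) (car M b a)"
  if o: "b'' : ob B" "b' : ob B" "b : ob B" "a : ob A" for b'' b' b a
  by (rule el_ext3[of _ "hom B b'' b'" "hom B b' b" "car M b a" "car M b'' a"])
   (use o ll[OF o] in "simp_all add: s")
 show "ract M b a' a'' \<cdot> (ract M b a a' \<ast> \<iota> (hom A a' a''))
    = ract M b a a'' \<cdot> (\<iota> (car M b a) \<ast> cmp A a a' a'')
     \<cdot> \<a> (car M b a) (hom A a a') (hom A a' a'')"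
  if o: "b : ob B" "a : ob A" "a' : ob A" "a'' : ob A" for b a a' a''
  by (rule el_ext3[of _ "car M b a" "hom A a a'" "hom A a' a''" "car M b a''"])
   (use o rr[OF o] in "simp_all add: s")
 show "ract M b' a a' \<cdot> (lact M b' b a \<ast> \<iota> (hom A a a'))
    = lact M b' b a' \<cdot> (\<iota> (hom B b' b) \<ast> ract M b a a')
     \<cdot> \<a> (hom B b' b) (car M b a) (hom A a a')"
  if o: "b' : ob B" "b : ob B" "a : ob A" "a' : ob A" for b' b a a'
  by (rule el_ext3[of _ "hom B b' b" "car M b a" "hom A a a'" "car M b' a'"])
   (use o lr[OF o] in "simp_all add: s")
 show "lact M b b a \<cdot> (unt B b \<ast> \<iota> (car M b a)) = \<l> (car M b a)" if o: "b : ob B" "a : ob A" for b a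
 proof (rule iso2_cancel_right[of "inv2 W (\<l> (car M b a))"])
  show "(lact M b b a \<cdot> (unt B b \<ast> \<iota> (car M b a))) \<cdot> inv2 W (\<l> (car M b a)) = \<l> (car M b a) \<cdot> inv2 W (\<l> (car M b a))"
   by (rule el_ext[of _ "car M b a" "car M b a"])
    (use o lu[OF o] in "simp_all add: s")
 qed (use o in "simp_all add: s")
 show "ract M b a a \<cdot> (\<iota> (car M b a) \<ast> unt A a) = \<r> (car M b a)" if o: "b : ob B" "a : ob A" for b a
 proof (rule el_cancel[of _ "car M b a \<star> \<one> (ext A a)" "car M b a" _ "ten (generic (car M b a)) (pt (\<iota> (\<one> (ext A a))))"])
  show "iso2 W (cell (ten (generic (car M b a)) (pt (\<iota> (\<one> (ext A a))))))"
   by (rule iso2_ten[of _ "car M b a" _ "\<one> (ext A a)"]) (use o in "simp_all add: s")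
 qed (use o ru[OF o] in "simp_all add: s")
qed (fact assms)+

subsection \<open>Module morphisms\<close>

lemma Mod_sel [simp]:
 "dom2 (Mod W) = msrc" "cod2 (Mod W) = mtrg" "comp1 (Mod W) = cmod" "vcomp (Mod W) = vc"
 "hcomp (Mod W) = hc" "id2 (Mod W) = idm" "assoc (Mod W) = mod_assoc W"
 "lunit (Mod W) = mod_lunit W" "runit (Mod W) = mod_runit W" "src (Mod W) = mdom" "trg (Mod W) = mcod"
 "unit1 (Mod W) = mod_id"
 by (simp_all add: Mod_def fun_eq_iff)

lemma Mod_cells1 [simp]: "M : cells1 (Mod W) \<longleftrightarrow> ismod M"
 by (simp add: Mod_def)

lemma Mod_cells2: "\<sigma> : cells2 (Mod W) \<longleftrightarrow> wmodule_morphism W \<sigma> (msrc \<sigma>) (mtrg \<sigma>) (mdom (msrc \<sigma>)) (mcod (msrc \<sigma>))"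
 by (simp add: Mod_def)

lemma mk_wmor_sel [simp]: "msrc (mk_wmor M N t) = M" "mtrg (mk_wmor M N t) = N"
 "b : ob (mcod M) ==> a : ob (mdom M) ==> component (mk_wmor M N t) b a = t b a"
 by (simp_all add: mk_wmor_def)

context
 fixes \<sigma> :: "('u, 'o, 'm, 'c) wmor"
 assumes s: "\<sigma> : cells2 (Mod W)"
begin

lemma mor_mods [simp]: "ismod (msrc \<sigma>)"
  "wmodule W (mtrg \<sigma>) (mdom (msrc \<sigma>)) (mcod (msrc \<sigma>))"
 and mor_parallel [simp]: "mdom (mtrg \<sigma>) = mdom (msrc \<sigma>)" "mcod (mtrg \<sigma>) = mcod (msrc \<sigma>)"
proof -
 have "wmodule W (mtrg \<sigma>) (mdom (msrc \<sigma>)) (mcod (msrc \<sigma>))"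
  and "ismod (msrc \<sigma>)"
  using s by (auto simp: Mod_cells2 wmodule_morphism_def)
 moreover from this(1) show "mdom (mtrg \<sigma>) = mdom (msrc \<sigma>)" "mcod (mtrg \<sigma>) = mcod (msrc \<sigma>)"
  by (auto dest: wmodule.mdom wmodule.mcod)
 ultimately show "ismod (msrc \<sigma>)"
  "wmodule W (mtrg \<sigma>) (mdom (msrc \<sigma>)) (mcod (msrc \<sigma>))" by auto
qed

lemma component_cell [simp]:
 assumes "b : ob (mcod (msrc \<sigma>))" "a : ob (mdom (msrc \<sigma>))"
 shows "component \<sigma> b a : cells2 W" "dom2 W (component \<sigma> b a) = car (msrc \<sigma>) b a"
  "cod2 W (component \<sigma> b a) = car (mtrg \<sigma>) b a"
 using wmodule_morphism.component_in_hom[OF s[unfolded Mod_cells2] assms] by (auto simp: hom2_iff)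

lemma component_lact_el [simp]:
 assumes o: "b' : ob (mcod (msrc \<sigma>))" "b : ob (mcod (msrc \<sigma>))" "a : ob (mdom (msrc \<sigma>))" and M: "M = msrc \<sigma>"
  and e: "x : El (hom (mcod (msrc \<sigma>)) b' b)" "m : El (car (msrc \<sigma>) b a)"
 shows "app \<sigma> b' a (la M b' b a x m) = la (mtrg \<sigma>) b' b a x (app \<sigma> b a m)"
proof -
 have "ap (component \<sigma> b' a \<cdot> lact (msrc \<sigma>) b' b a) (ten x m)
  = ap (lact (mtrg \<sigma>) b' b a \<cdot> (\<iota> (hom (mcod (msrc \<sigma>)) b' b) \<ast> component \<sigma> b a)) (ten x m)"
  by (simp add: wmodule_morphism.component_lact[OF s[unfolded Mod_cells2] o])
 then show ?thesis using o e M by simp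
qed

lemma component_ract_el [simp]:
 assumes o: "b : ob (mcod (msrc \<sigma>))" "a : ob (mdom (msrc \<sigma>))" "a' : ob (mdom (msrc \<sigma>))" and M: "M = msrc \<sigma>"
  and e: "m : El (car (msrc \<sigma>) b a)" "x : El (hom (mdom (msrc \<sigma>)) a a')"
 shows "app \<sigma> b a' (ra M b a a' m x) = ra (mtrg \<sigma>) b a a' (app \<sigma> b a m) x"
proof -
 have "ap (component \<sigma> b a' \<cdot> ract (msrc \<sigma>) b a a') (ten m x)
  = ap (ract (mtrg \<sigma>) b a a' \<cdot> (component \<sigma> b a \<ast> \<iota> (hom (mdom (msrc \<sigma>)) a a'))) (ten m x)"
  by (simp add: wmodule_morphism.component_ract[OF s[unfolded Mod_cells2] o])
 then show ?thesis using o e M by simp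
qed

end

lemma Mod_hom2_iff: "\<sigma> : mors M N \<longleftrightarrow> \<sigma> : cells2 (Mod W) & msrc \<sigma> = M & mtrg \<sigma> = N"
 by (simp add: hom2_def)

lemma Mod_hom1_iff: "M : hom1 (Mod W) A B \<longleftrightarrow> ismod M & mdom M = A & mcod M = B"
 by (simp add: hom1_def)

lemma mor_eqI:
 assumes "\<sigma> : mors M N" "\<tau> : mors M N"
  "!!b a x. [|b : ob (mcod M); a : ob (mdom M); x : El (car M b a)|] ==> app \<sigma> b a x = app \<tau> b a x"
 shows "\<sigma> = \<tau>"
proof -
 have s: "\<sigma> : cells2 (Mod W)" "msrc \<sigma> = M" "mtrg \<sigma> = N" and t: "\<tau> : cells2 (Mod W)" "msrc \<tau> = M" "mtrg \<tau> = N"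
  using assms(1,2) by (auto simp: Mod_hom2_iff)
 have "component \<sigma> b a = component \<tau> b a" for b a
 proof (cases "b : ob (mcod M) & a : ob (mdom M)")
  case True
  then show ?thesis by (intro el_ext[of _ "car M b a" "car N b a"]) (use s t assms(3) in "auto simp: hom2_iff")
 next
  case False
  then show ?thesis
   using wmodule_morphism.component_undefined[OF s(1)[unfolded Mod_cells2], of b a]
    wmodule_morphism.component_undefined[OF t(1)[unfolded Mod_cells2], of b a] s t by auto
 qed
 then show ?thesis using s t by (cases \<sigma>; cases \<tau>) (auto simp: fun_eq_iff)
qed

lemma mk_wmor_in:
 assumes M: "ismod M" and N: "ismod N" and MN: "mdom N = mdom M" "mcod N = mcod M"
  and t: "!!b a. [|b : ob (mcod M); a : ob (mdom M)|] ==> t b a : hom2 W (car M b a) (car N b a)"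
  and l: "!!b' b a x m. [|b' : ob (mcod M); b : ob (mcod M); a : ob (mdom M); x : El (hom (mcod M) b' b); m : El (car M b a)|]
   ==> ap (t b' a) (la M b' b a x m) = la N b' b a x (ap (t b a) m)"
  and r: "!!b a a' m x. [|b : ob (mcod M); a : ob (mdom M); a' : ob (mdom M); m : El (car M b a); x : El (hom (mdom M) a a')|]
   ==> ap (t b a') (ra M b a a' m x) = ra N b a a' (ap (t b a) m) x"
 shows "mk_wmor M N t : mors M N"
proof -
 note T = t[THEN hom2D(1)] t[THEN hom2D(2)] t[THEN hom2D(3)]
 have "wmodule_morphism W (mk_wmor M N t) M N (mdom M) (mcod M)"
 proof (rule wmodule_morphism.intro)
  show "wmodule W N (mdom M) (mcod M)" using N MN by simp
  show "component (mk_wmor M N t) b' a \<cdot> lact M b' b a = lact N b' b a \<cdot> (\<iota> (hom (mcod M) b' b) \<ast> component (mk_wmor M N t) b a)"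
   if o: "b' : ob (mcod M)" "b : ob (mcod M)" "a : ob (mdom M)" for b' b a
   by (rule el_ext2[of _ "hom (mcod M) b' b" "car M b a" "car N b' a"])
    (use o M N MN l[OF o] in "simp_all add: T hom2_iff")
  show "component (mk_wmor M N t) b a' \<cdot> ract M b a a' = ract N b a a' \<cdot> (component (mk_wmor M N t) b a \<ast> \<iota> (hom (mdom M) a a'))"
   if o: "b : ob (mcod M)" "a : ob (mdom M)" "a' : ob (mdom M)" for b a a'
   by (rule el_ext2[of _ "car M b a" "hom (mdom M) a a'" "car N b a'"])
    (use o M N MN r[OF o] in "simp_all add: T hom2_iff")
 qed (use M t in "auto simp: mk_wmor_def")
 then show ?thesis by (simp add: Mod_hom2_iff Mod_cells2)
qed

end


section \<open>Generating sets of elements\<close>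

context bicategory
begin

definition generates :: "('m, 'c) element set => 'm => bool" where
 "generates X f \<longleftrightarrow> f : cells1 W & X \<subseteq> El f &
   (ALL g. \<forall>\<sigma>\<in>hom2 W f g. \<forall>\<tau>\<in>hom2 W f g. (ALL x:X. ap \<sigma> x = ap \<tau> x) --> \<sigma> = \<tau>)"

definition Ten :: "('m, 'c) element set => ('m, 'c) element set => ('m, 'c) element set" where
 "Ten X Y = {ten x y | x y. x : X & y : Y}"

lemma ball_Ten [simp]: "(ALL z:Ten X Y. P z) \<longleftrightarrow> (ALL x:X. ALL y:Y. P (ten x y))"
 by (auto simp: Ten_def)

lemma generates_El [simp]: "f : cells1 W ==> generates (El f) f"
 unfolding generates_def using el_ext by blast

lemma gen_ext:
 assumes "generates X f" "\<sigma> : hom2 W f g" "\<tau> : hom2 W f g" "ALL x:X. ap \<sigma> x = ap \<tau> x"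
 shows "\<sigma> = \<tau>"
 using assms unfolding generates_def by blast

lemma generates_unit [simp]: "e : obj W ==> generates {pt (\<iota> (\<one> e))} (\<one> e)"
 unfolding generates_def by (auto intro: el_cancel[of _ "\<one> e" _ _ "pt (\<iota> (\<one> e))"])

end

context enriched_base
begin

text \<open>Transposing first along a right extension and then along a right lifting reduces the
 equality of two 2-cells on a composite to their equality on each factor. This is the step at
 which the closed structure of the base is used.\<close>

lemma generates_Ten:
 assumes X: "generates X f" and Y: "generates Y g" and fg: "src W f = trg W g"
 shows "generates (Ten X Y) (f \<star> g)"
 unfolding generates_def
proof (intro conjI allI ballI impI)
 have f: "f : cells1 W" and XE: "X \<subseteq> El f" and g: "g : cells1 W" and YE: "Y \<subseteq> El g"
  using X Y by (auto simp: generates_def)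
 show "f \<star> g : cells1 W" using f g fg by simp
 show "Ten X Y \<subseteq> El (f \<star> g)" using XE YE fg by (auto simp: Ten_def intro!: ten_El)
 fix k \<sigma> \<tau> assume s: "\<sigma> : hom2 W (f \<star> g) k" and t: "\<tau> : hom2 W (f \<star> g) k"
  and eq: "ALL z:Ten X Y. ap \<sigma> z = ap \<tau> z"
 have k: "k : cells1 W" "src W k = src W g" "trg W k = trg W f" using hom2D[OF s] f g fg by auto
 have sc: "\<sigma> : cells2 W" "dom2 W \<sigma> = f \<star> g" "cod2 W \<sigma> = k" and tc: "\<tau> : cells2 W" "dom2 W \<tau> = f \<star> g" "cod2 W \<tau> = k"
  using s t by (auto simp: hom2_iff)
 have step: "\<sigma> \<cdot> (\<iota> f \<ast> cell y) = \<tau> \<cdot> (\<iota> f \<ast> cell y)" if y: "y : Y" for y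
 proof -
  note yE = ElD[OF subsetD[OF YE y]]
  define Q where "Q = path_comp (src W g) (stage y)"
  have Q: "Q : cells1 W" "src W Q = src W g" "trg W Q = trg W g" and cy: "cell y : cells2 W" "dom2 W (cell y) = Q" "cod2 W (cell y) = g"
   using yE by (simp_all add: Q_def)
  obtain r \<rho> where "is_right_extension W Q k r \<rho>" using ex_right_extension[of Q k] Q k by auto
  then have r: "r : hom1 W (trg W g) (trg W f)" and \<rho>: "\<rho> : hom2 W (r \<star> Q) k"
   and univ: "!!l \<upsilon>. l : hom1 W (trg W g) (trg W f) ==> \<upsilon> : hom2 W (l \<star> Q) k ==> \<exists>!\<theta>. \<theta> : hom2 W l r & \<rho> \<cdot> (\<theta> \<ast> \<iota> Q) = \<upsilon>"
   using Q k by (auto simp: is_right_extension_def)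
  have rr: "r : cells1 W" "src W r = trg W g" and \<rho>c: "\<rho> : cells2 W" "dom2 W \<rho> = r \<star> Q" "cod2 W \<rho> = k"
   using r \<rho> by (auto simp: hom1_iff hom2_iff)
  have fh: "f : hom1 W (trg W g) (trg W f)" using f fg by (simp add: hom1_iff)
  have "\<sigma> \<cdot> (\<iota> f \<ast> cell y) : hom2 W (f \<star> Q) k" "\<tau> \<cdot> (\<iota> f \<ast> cell y) : hom2 W (f \<star> Q) k"
   using f g fg sc tc cy Q by (simp_all add: hom2_iff)
  then obtain a b where a: "a : hom2 W f r" "\<rho> \<cdot> (a \<ast> \<iota> Q) = \<sigma> \<cdot> (\<iota> f \<ast> cell y)"
   and b: "b : hom2 W f r" "\<rho> \<cdot> (b \<ast> \<iota> Q) = \<tau> \<cdot> (\<iota> f \<ast> cell y)"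
   using univ[OF fh] by metis
  have "ap a x = ap b x" if x: "x : X" for x
  proof -
   note xE = ElD[OF subsetD[OF XE x]]
   define P where "P = path_comp (src W f) (stage x)"
   have P: "P : cells1 W" "src W P = trg W g" "trg W P = trg W f" and cx: "cell x : cells2 W" "dom2 W (cell x) = P" "cod2 W (cell x) = f"
    using xE fg by (simp_all add: P_def)
   have exp: "\<rho> \<cdot> ((c \<cdot> cell x) \<ast> \<iota> Q) = \<upsilon> \<cdot> (cell x \<ast> cell y)"
    if c: "c : hom2 W f r" "\<rho> \<cdot> (c \<ast> \<iota> Q) = \<upsilon> \<cdot> (\<iota> f \<ast> cell y)" and u: "\<upsilon> : hom2 W (f \<star> g) k" for c \<upsilon>
   proof -
    have "\<rho> \<cdot> ((c \<cdot> cell x) \<ast> \<iota> Q) = (\<rho> \<cdot> (c \<ast> \<iota> Q)) \<cdot> (cell x \<ast> \<iota> Q)"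
     using c(1) cx Q P \<rho>c rr f fg by (simp add: hom2_iff vassoc inter)
    also have "\<dots> = \<upsilon> \<cdot> ((\<iota> f \<ast> cell y) \<cdot> (cell x \<ast> \<iota> Q))"
     unfolding c(2) using u cx cy Q P f g fg by (simp add: hom2_iff vassoc)
    also have "(\<iota> f \<ast> cell y) \<cdot> (cell x \<ast> \<iota> Q) = cell x \<ast> cell y"
     using cx cy Q P f g fg by (simp add: inter)
    finally show ?thesis .
   qed
   have e: "\<sigma> \<cdot> (cell x \<ast> cell y) = \<tau> \<cdot> (cell x \<ast> cell y)"
   proof (rule iso2_cancel_right[of "unappend (src W g) (stage x) (stage y)"])
    have u: "iso2 W (unappend (src W g) (stage x) (stage y))" "unappend (src W g) (stage x) (stage y) : cells2 W"
     "cod2 W (unappend (src W g) (stage x) (stage y)) = P \<star> Q"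
     using xE yE fg by (simp_all add: P_def Q_def)
    have "ap \<sigma> (ten x y) = ap \<tau> (ten x y)" using eq x y by simp
    then have *: "\<sigma> \<cdot> (cell x \<ast> cell y) \<cdot> unappend (src W g) (stage x) (stage y)
      = \<tau> \<cdot> (cell x \<ast> cell y) \<cdot> unappend (src W g) (stage x) (stage y)"
     using yE(5) by (simp only: ap_def ten_def element.sel element.inject)
    show "(\<sigma> \<cdot> (cell x \<ast> cell y)) \<cdot> unappend (src W g) (stage x) (stage y)
      = (\<tau> \<cdot> (cell x \<ast> cell y)) \<cdot> unappend (src W g) (stage x) (stage y)"
     using * sc tc u cx cy P Q by (simp add: vassoc)
    show "iso2 W (unappend (src W g) (stage x) (stage y))" by fact
   qed (use sc tc cx cy P Q xE yE fg in "simp_all add: P_def Q_def")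
   have ph: "P : hom1 W (trg W g) (trg W f)" using P by (simp add: hom1_iff)
   have "a \<cdot> cell x : hom2 W P r" "b \<cdot> cell x : hom2 W P r" using a(1) b(1) cx by (auto simp: hom2_iff)
   moreover have "\<rho> \<cdot> ((a \<cdot> cell x) \<ast> \<iota> Q) = \<rho> \<cdot> ((b \<cdot> cell x) \<ast> \<iota> Q)"
    using exp[OF a s] exp[OF b t] e by simp
   moreover have "\<rho> \<cdot> ((a \<cdot> cell x) \<ast> \<iota> Q) : hom2 W (P \<star> Q) k"
    using exp[OF a s] sc cx cy P Q by (simp add: hom2_iff)
   ultimately have "a \<cdot> cell x = b \<cdot> cell x" using univ[OF ph] by metis
   then show ?thesis by (simp add: ap_def)
  qed
  then have "a = b" using gen_ext[OF X a(1) b(1)] by blast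
  then show ?thesis using a b by simp
 qed
 obtain r \<rho> where "is_right_lifting W f k r \<rho>" using ex_right_lifting[of f k] f k by auto
 then have r: "r : hom1 W (src W g) (src W f)" and \<rho>: "\<rho> : hom2 W (f \<star> r) k"
  and univ: "!!l \<upsilon>. l : hom1 W (src W g) (src W f) ==> \<upsilon> : hom2 W (f \<star> l) k ==> \<exists>!\<theta>. \<theta> : hom2 W l r & \<rho> \<cdot> (\<iota> f \<ast> \<theta>) = \<upsilon>"
  using k by (auto simp: is_right_lifting_def)
 have rr: "r : cells1 W" "trg W r = src W f" and \<rho>c: "\<rho> : cells2 W" "dom2 W \<rho> = f \<star> r" "cod2 W \<rho> = k"
  using r \<rho> by (auto simp: hom1_iff hom2_iff)
 have gh: "g : hom1 W (src W g) (src W f)" using g fg by (simp add: hom1_iff)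
 obtain a b where a: "a : hom2 W g r" "\<rho> \<cdot> (\<iota> f \<ast> a) = \<sigma>" and b: "b : hom2 W g r" "\<rho> \<cdot> (\<iota> f \<ast> b) = \<tau>"
  using univ[OF gh] s t by metis
 have "ap a y = ap b y" if y: "y : Y" for y
 proof -
  note yE = ElD[OF subsetD[OF YE y]]
  define Q where "Q = path_comp (src W g) (stage y)"
  have Q: "Q : cells1 W" "src W Q = src W g" "trg W Q = trg W g" and cy: "cell y : cells2 W" "dom2 W (cell y) = Q" "cod2 W (cell y) = g"
   using yE by (simp_all add: Q_def)
  have Qh: "Q : hom1 W (src W g) (src W f)" using Q fg by (simp add: hom1_iff)
  have exp: "\<rho> \<cdot> (\<iota> f \<ast> (c \<cdot> cell y)) = (\<rho> \<cdot> (\<iota> f \<ast> c)) \<cdot> (\<iota> f \<ast> cell y)" if c: "c : hom2 W g r" for c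
   using c cy Q \<rho>c rr f fg by (simp add: hom2_iff vassoc inter)
  have "a \<cdot> cell y : hom2 W Q r" "b \<cdot> cell y : hom2 W Q r" using a(1) b(1) cy by (auto simp: hom2_iff)
  moreover have "\<rho> \<cdot> (\<iota> f \<ast> (a \<cdot> cell y)) = \<rho> \<cdot> (\<iota> f \<ast> (b \<cdot> cell y))"
   using exp[OF a(1)] exp[OF b(1)] a b step[OF y] by simp
  moreover have "\<rho> \<cdot> (\<iota> f \<ast> (a \<cdot> cell y)) : hom2 W (f \<star> Q) k"
   using exp[OF a(1)] a sc cy Q f fg by (simp add: hom2_iff)
  ultimately have "a \<cdot> cell y = b \<cdot> cell y" using univ[OF Qh] by metis
  then show ?thesis by (simp add: ap_def)
 qed
 then have "a = b" using gen_ext[OF Y a(1) b(1)] by blast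
 then show "\<sigma> = \<tau>" using a b by simp
qed

lemma gen_ext2:
 assumes "generates X f" "generates Y g" "src W f = trg W g" "\<sigma> : hom2 W (f \<star> g) h" "\<tau> : hom2 W (f \<star> g) h"
  "!!x y. x : X ==> y : Y ==> ap \<sigma> (ten x y) = ap \<tau> (ten x y)"
 shows "\<sigma> = \<tau>"
 using gen_ext[OF generates_Ten[OF assms(1-3)] assms(4,5)] assms(6) by auto

lemma gen_ext3:
 assumes "generates X f" "generates Y g" "generates Z h" "src W f = trg W g" "src W g = trg W h"
  "\<sigma> : hom2 W ((f \<star> g) \<star> h) k" "\<tau> : hom2 W ((f \<star> g) \<star> h) k"
  "!!x y z. x : X ==> y : Y ==> z : Z ==> ap \<sigma> (ten (ten x y) z) = ap \<tau> (ten (ten x y) z)"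
 shows "\<sigma> = \<tau>"
proof -
 have "src W (f \<star> g) = trg W h" using assms(1-5) by (simp add: generates_def)
 from gen_ext[OF generates_Ten[OF generates_Ten[OF assms(1,2,4)] assms(3) this] assms(6,7)] assms(8)
 show ?thesis by auto
qed

subsection \<open>Coends\<close>

definition coend_gens :: "('u, 'o, 'm, 'c) wmod => ('u, 'o, 'm, 'c) wmod => 'u => 'u
  => ('u => ('m, 'c) element set) => ('u => ('m, 'c) element set) => ('m, 'c) element set" where
 "coend_gens N M c a X Y = {cl N M c a b n m | b n m. b : ob (mcod M) & n : X b & m : Y b}"

lemma ball_coend_gens [simp]: "(ALL z:coend_gens N M c a X Y. P z) \<longleftrightarrow>
  (ALL b:ob (mcod M). ALL n:X b. ALL m:Y b. P (cl N M c a b n m))"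
 by (auto simp: coend_gens_def)

lemma coend_gensE:
 assumes "x : coend_gens N M c a X Y"
 obtains b n m where "b : ob (mcod M)" "n : X b" "m : Y b" "x = cl N M c a b n m"
 using assms unfolding coend_gens_def by blast

lemma mod_comp_sel [simp]:
 "mdom (cmod N M) = mdom M" "mcod (cmod N M) = mcod N" "car (cmod N M) = cob N M"
 by (simp_all add: mod_comp_def)


context
 fixes N M :: "('u, 'o, 'm, 'c) wmod"
 assumes N: "ismod N" and M: "ismod M" and NM: "mdom N = mcod M"
begin

definition coend_left where
 "coend_left c a b b' = (\<iota> (car N c b) \<ast> lact M b b' a) \<cdot> \<a> (car N c b) (hom (mcod M) b b') (car M b' a)"

definition coend_right where
 "coend_right c a b b' = ract N c b b' \<ast> \<iota> (car M b' a)"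

abbreviation coend_glued where
 "coend_glued c a p i \<equiv> glued (hom1 W (ext (mdom M) a) (ext (mcod N) c)) (ob (mcod M)) (%b. car N c b \<star> car M b a)
   (coend_left c a) (coend_right c a) p i"

lemma is_coend_iff: "is_coend W N M c a p i \<longleftrightarrow> coend_glued c a p i"
 by (simp add: is_coend_def cowedge_def glued_def glues_def coend_left_def coend_right_def)

lemma small_ob_mcod: "small (ob (mcod M))"
 using wcategory.small_ob[OF wmodule.cod_wcategory[OF M]] .

context
 fixes c a
 assumes c: "c : ob (mcod N)" and a: "a : ob (mdom M)"
begin

lemma coend_typing:
 assumes "b : ob (mcod M)" "b' : ob (mcod M)"
 shows "(car N c b \<star> hom (mcod M) b b') \<star> car M b' a : hom1 W (ext (mdom M) a) (ext (mcod N) c)"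
  "coend_left c a b b' : hom2 W ((car N c b \<star> hom (mcod M) b b') \<star> car M b' a) (car N c b \<star> car M b a)"
  "coend_right c a b b' : hom2 W ((car N c b \<star> hom (mcod M) b b') \<star> car M b' a) (car N c b' \<star> car M b' a)"
  "car N c b \<star> car M b a : hom1 W (ext (mdom M) a) (ext (mcod N) c)"
 using assms N M NM c a by (simp_all add: coend_left_def coend_right_def hom1_iff hom2_iff)

lemma coend_spec: "coend_glued c a (cob N M c a) (cin N M c a)"
proof -
 have "EX p i. coend_glued c a p i"
  by (rule ex_glued[where k = "%b b'. (car N c b \<star> hom (mcod M) b b') \<star> car M b' a"])
   (use coend_typing small_ob_mcod c a N M in auto)
 then have "EX pi. (case pi of (p, i) => is_coend W N M c a p i)" by (auto simp: is_coend_iff)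
 from someI_ex[OF this] show ?thesis
  by (simp add: coend_ob_def coend_in_def coend_def is_coend_iff split: prod.splits)
qed

lemma coend_ob_cell [simp]: "cob N M c a : cells1 W" "src W (cob N M c a) = ext (mdom M) a"
 "trg W (cob N M c a) = ext (mcod N) c"
 using coend_spec by (auto simp: glued_def glues_def hom1_iff)

lemma coend_in_cell [simp]:
 assumes "b : ob (mcod M)"
 shows "cin N M c a b : cells2 W" "dom2 W (cin N M c a b) = car N c b \<star> car M b a"
  "cod2 W (cin N M c a b) = cob N M c a"
 using coend_spec assms by (auto simp: glued_def glues_def hom2_iff)

lemma coend_bal:
 assumes b: "b : ob (mcod M)" "b' : ob (mcod M)" and "n : El (car N c b)" "f : El (hom (mcod M) b b')" "m : El (car M b' a)"
 shows "cl N M c a b' (ra N c b b' n f) m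
  = cl N M c a b n (la M b b' a f m)"
proof -
 have "ap (cin N M c a b \<cdot> coend_left c a b b') (ten (ten n f) m) = ap (cin N M c a b' \<cdot> coend_right c a b b') (ten (ten n f) m)"
  using coend_spec b by (simp add: glued_def glues_def)
 then show ?thesis using assms N M NM c a by (simp add: coend_left_def coend_right_def)
qed

lemma coend_factor:
 assumes q: "q : cells1 W" "src W q = ext (mdom M) a" "trg W q = ext (mcod N) c"
  and j: "!!b. b : ob (mcod M) ==> j b : hom2 W (car N c b \<star> car M b a) q"
  and bal: "!!b b' n f m. [|b : ob (mcod M); b' : ob (mcod M); n : El (car N c b); f : El (hom (mcod M) b b'); m : El (car M b' a)|]
   ==> ap (j b) (ten n (la M b b' a f m)) = ap (j b') (ten (ra N c b b' n f) m)"
 shows "\<exists>!t. t : hom2 W (cob N M c a) q & (ALL b:ob (mcod M). t \<cdot> cin N M c a b = j b)"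
proof -
 note J = j[THEN hom2D(1)] j[THEN hom2D(2)] j[THEN hom2D(3)]
 have "glues (hom1 W (ext (mdom M) a) (ext (mcod N) c)) (ob (mcod M)) (%b. car N c b \<star> car M b a) (coend_left c a) (coend_right c a) q j"
  unfolding glues_def
 proof (intro conjI ballI)
  fix b b' assume b: "b : ob (mcod M)" "b' : ob (mcod M)"
  show "j b \<cdot> coend_left c a b b' = j b' \<cdot> coend_right c a b b'"
   by (rule el_ext3[of _ "car N c b" "hom (mcod M) b b'" "car M b' a" q])
    (use N M NM c a q b bal[OF b] in "simp_all add: coend_left_def coend_right_def hom2_iff J")
 qed (use q j in "auto simp: hom1_iff")
 then show ?thesis using coend_spec unfolding glued_def by blast
qed

lemma coend_factor_left:
 assumes g: "g : cells1 W" "src W g = ext (mcod N) c"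
  and q: "q : cells1 W" "src W q = ext (mdom M) a" "trg W q = trg W g"
  and j: "!!b. b : ob (mcod M) ==> j b : hom2 W (g \<star> car N c b \<star> car M b a) q"
  and bal: "!!b b' x n f m. [|b : ob (mcod M); b' : ob (mcod M); x : El g; n : El (car N c b); f : El (hom (mcod M) b b'); m : El (car M b' a)|]
   ==> ap (j b) (ten x (ten n (la M b b' a f m))) = ap (j b') (ten x (ten (ra N c b b' n f) m))"
 shows "\<exists>!t. t : hom2 W (g \<star> cob N M c a) q & (ALL b:ob (mcod M). t \<cdot> (\<iota> g \<ast> cin N M c a b) = j b)"
proof (rule glued_whisker_left[OF coend_spec, where c = "trg W g" and k = "%b b'. (car N c b \<star> hom (mcod M) b b') \<star> car M b' a"])
 note J = j[THEN hom2D(1)] j[THEN hom2D(2)] j[THEN hom2D(3)]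
 show "glues (hom1 W (ext (mdom M) a) (trg W g)) (ob (mcod M)) (%b. g \<star> car N c b \<star> car M b a)
   (%b b'. \<iota> g \<ast> coend_left c a b b') (%b b'. \<iota> g \<ast> coend_right c a b b') q j"
  unfolding glues_def
 proof (intro conjI ballI)
  fix b b' assume b: "b : ob (mcod M)" "b' : ob (mcod M)"
  show "j b \<cdot> (\<iota> g \<ast> coend_left c a b b') = j b' \<cdot> (\<iota> g \<ast> coend_right c a b b')"
   by (rule gen_ext2[OF generates_El generates_Ten[OF generates_Ten[OF generates_El generates_El] generates_El],
      of g "car N c b" "hom (mcod M) b b'" "car M b' a" _ q])
    (use N M NM c a g q b bal[OF b] in "auto simp add: coend_left_def coend_right_def hom2_iff J Ten_def")
 qed (use q j in "auto simp: hom1_iff")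
qed (use coend_typing g ex_right_lifting[of g] in "auto simp: hom1_iff")

lemma coend_factor_right:
 assumes h: "h : cells1 W" "trg W h = ext (mdom M) a"
  and q: "q : cells1 W" "src W q = src W h" "trg W q = ext (mcod N) c"
  and j: "!!b. b : ob (mcod M) ==> j b : hom2 W ((car N c b \<star> car M b a) \<star> h) q"
  and bal: "!!b b' x n f m. [|b : ob (mcod M); b' : ob (mcod M); x : El h; n : El (car N c b); f : El (hom (mcod M) b b'); m : El (car M b' a)|]
   ==> ap (j b) (ten (ten n (la M b b' a f m)) x) = ap (j b') (ten (ten (ra N c b b' n f) m) x)"
 shows "\<exists>!t. t : hom2 W (cob N M c a \<star> h) q & (ALL b:ob (mcod M). t \<cdot> (cin N M c a b \<ast> \<iota> h) = j b)"
proof (rule glued_whisker_right[OF coend_spec, where a = "src W h" and k = "%b b'. (car N c b \<star> hom (mcod M) b b') \<star> car M b' a"])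
 note J = j[THEN hom2D(1)] j[THEN hom2D(2)] j[THEN hom2D(3)]
 show "glues (hom1 W (src W h) (ext (mcod N) c)) (ob (mcod M)) (%b. (car N c b \<star> car M b a) \<star> h)
   (%b b'. coend_left c a b b' \<ast> \<iota> h) (%b b'. coend_right c a b b' \<ast> \<iota> h) q j"
  unfolding glues_def
 proof (intro conjI ballI)
  fix b b' assume b: "b : ob (mcod M)" "b' : ob (mcod M)"
  show "j b \<cdot> (coend_left c a b b' \<ast> \<iota> h) = j b' \<cdot> (coend_right c a b b' \<ast> \<iota> h)"
   by (rule gen_ext2[OF generates_Ten[OF generates_Ten[OF generates_El generates_El] generates_El] generates_El,
      of "car N c b" "hom (mcod M) b b'" "car M b' a" h _ q])
    (use N M NM c a h q b bal[OF b] in "auto simp add: coend_left_def coend_right_def hom2_iff J Ten_def")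
 qed (use q j in "auto simp: hom1_iff")
qed (use coend_typing h ex_right_extension[of h] in "auto simp: hom1_iff")

lemma coend_El [simp]: "[|b : ob (mcod M); n : El (car N c b); m : El (car M b a)|]
  ==> cl N M c a b n m : El (cob N M c a)"
 using N M NM c a by (intro ap_El) auto

text \<open>Two 2-cells out of a coend that agree on classes agree after composition with each
 inclusion, and the coend is a colimit.\<close>

lemma generates_coend:
 assumes X: "!!b. b : ob (mcod M) ==> generates (X b) (car N c b)"
  and Y: "!!b. b : ob (mcod M) ==> generates (Y b) (car M b a)"
 shows "generates (coend_gens N M c a X Y) (cob N M c a)"
 unfolding generates_def
proof (intro conjI allI ballI impI)
 have XE: "X b \<subseteq> El (car N c b)" "Y b \<subseteq> El (car M b a)" if "b : ob (mcod M)" for b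
  using X Y that by (auto simp: generates_def)
 show "coend_gens N M c a X Y \<subseteq> El (cob N M c a)" unfolding coend_gens_def using XE by (auto intro!: coend_El)
 fix q \<sigma> \<tau> assume s: "\<sigma> : hom2 W (cob N M c a) q" and t: "\<tau> : hom2 W (cob N M c a) q"
  and eq: "ALL z:coend_gens N M c a X Y. ap \<sigma> z = ap \<tau> z"
 note S = hom2D[OF s] and T = hom2D[OF t]
 have j: "\<sigma> \<cdot> cin N M c a b = \<tau> \<cdot> cin N M c a b" if b: "b : ob (mcod M)" for b
  by (rule gen_ext2[OF X Y, of b b _ q]) (use b S T XE N M NM c a eq in "auto simp: hom2_iff subset_iff")
 have "\<exists>!t. t : hom2 W (cob N M c a) q & (ALL b:ob (mcod M). t \<cdot> cin N M c a b = \<sigma> \<cdot> cin N M c a b)"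
  by (rule coend_factor) (use S coend_bal N M NM c a in "auto simp: hom2_iff")
 then show "\<sigma> = \<tau>" using s t j by metis
qed simp

end

subsection \<open>Composite modules\<close>

lemma lact_mod_comp:
 assumes o: "c' : ob (mcod N)" "c : ob (mcod N)" "a : ob (mdom M)"
 shows "lact (cmod N M) c' c a : hom2 W (hom (mcod N) c' c \<star> cob N M c a) (cob N M c' a)"
  and "!!b x n m. [|b : ob (mcod M); x : El (hom (mcod N) c' c); n : El (car N c b); m : El (car M b a)|] ==>
   la (cmod N M) c' c a x (cl N M c a b n m)
    = cl N M c' a b (la N c' c b x n) m"
proof -
 let ?j = "%b. cin N M c' a b \<cdot> (lact N c' c b \<ast> \<iota> (car M b a)) \<cdot> inv2 W (\<a> (hom (mcod N) c' c) (car N c b) (car M b a))"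
 let ?t = "lact (cmod N M) c' c a"
 have "\<exists>!t. t : hom2 W (hom (mcod N) c' c \<star> cob N M c a) (cob N M c' a) &
   (ALL b:ob (mcod M). t \<cdot> (\<iota> (hom (mcod N) c' c) \<ast> cin N M c a b) = ?j b)"
 proof (rule coend_factor_left)
  fix b b' x n f m assume *: "b : ob (mcod M)" "b' : ob (mcod M)" "x : El (hom (mcod N) c' c)" "n : El (car N c b)"
   "f : El (hom (mcod M) b b')" "m : El (car M b' a)"
  show "ap (?j b) (ten x (ten n (la M b b' a f m))) = ap (?j b') (ten x (ten (ra N c b b' n f) m))"
   using * o N M NM coend_bal[OF o(1,3) *(1,2), of "la N c' c b x n" f m]
   by (simp add: lact_ract_el[symmetric] del: lact_ract_el)
 qed (use o N M NM in "auto simp: hom2_iff")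
 from theI'[OF this] have t: "?t : hom2 W (hom (mcod N) c' c \<star> cob N M c a) (cob N M c' a)"
  "!!b. b : ob (mcod M) ==> ?t \<cdot> (\<iota> (hom (mcod N) c' c) \<ast> cin N M c a b) = ?j b"
  by (simp_all add: mod_comp_def)
 show "?t : hom2 W (hom (mcod N) c' c \<star> cob N M c a) (cob N M c' a)" by fact
 fix b x n m assume *: "b : ob (mcod M)" "x : El (hom (mcod N) c' c)" "n : El (car N c b)" "m : El (car M b a)"
 have "ap (?t \<cdot> (\<iota> (hom (mcod N) c' c) \<ast> cin N M c a b)) (ten x (ten n m)) = ap (?j b) (ten x (ten n m))"
  using t(2) * by simp
 then show "ap ?t (ten x (cl N M c a b n m)) = cl N M c' a b (la N c' c b x n) m"
  using * o N M NM hom2D[OF t(1)] by simp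
qed

lemma ract_mod_comp:
 assumes o: "c : ob (mcod N)" "a : ob (mdom M)" "a' : ob (mdom M)"
 shows "ract (cmod N M) c a a' : hom2 W (cob N M c a \<star> hom (mdom M) a a') (cob N M c a')"
  and "!!b x n m. [|b : ob (mcod M); x : El (hom (mdom M) a a'); n : El (car N c b); m : El (car M b a)|] ==>
   ra (cmod N M) c a a' (cl N M c a b n m) x
    = cl N M c a' b n (ra M b a a' m x)"
proof -
 let ?j = "%b. cin N M c a' b \<cdot> (\<iota> (car N c b) \<ast> ract M b a a') \<cdot> \<a> (car N c b) (car M b a) (hom (mdom M) a a')"
 let ?t = "ract (cmod N M) c a a'"
 have "\<exists>!t. t : hom2 W (cob N M c a \<star> hom (mdom M) a a') (cob N M c a') &
   (ALL b:ob (mcod M). t \<cdot> (cin N M c a b \<ast> \<iota> (hom (mdom M) a a')) = ?j b)"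
 proof (rule coend_factor_right)
  fix b b' x n f m assume *: "b : ob (mcod M)" "b' : ob (mcod M)" "x : El (hom (mdom M) a a')" "n : El (car N c b)"
   "f : El (hom (mcod M) b b')" "m : El (car M b' a)"
  show "ap (?j b) (ten (ten n (la M b b' a f m)) x) = ap (?j b') (ten (ten (ra N c b b' n f) m) x)"
   using * o N M NM coend_bal[OF o(1,3) *(1,2), of n f "ra M b' a a' m x"] by simp
 qed (use o N M NM in "auto simp: hom2_iff")
 from theI'[OF this] have t: "?t : hom2 W (cob N M c a \<star> hom (mdom M) a a') (cob N M c a')"
  "!!b. b : ob (mcod M) ==> ?t \<cdot> (cin N M c a b \<ast> \<iota> (hom (mdom M) a a')) = ?j b"
  by (simp_all add: mod_comp_def)
 show "?t : hom2 W (cob N M c a \<star> hom (mdom M) a a') (cob N M c a')" by fact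
 fix b x n m assume *: "b : ob (mcod M)" "x : El (hom (mdom M) a a')" "n : El (car N c b)" "m : El (car M b a)"
 have "ap (?t \<cdot> (cin N M c a b \<ast> \<iota> (hom (mdom M) a a'))) (ten (ten n m) x) = ap (?j b) (ten (ten n m) x)"
  using t(2) * by simp
 then show "ap ?t (ten (cl N M c a b n m) x) = cl N M c a' b n (ra M b a a' m x)"
  using * o N M NM hom2D[OF t(1)] by simp
qed

lemma lact_mod_comp_el [simp]:
 assumes "c' : ob (mcod N)" "c : ob (mcod N)" "a : ob (mdom M)" "b : ob (mcod M)"
  "x : El (hom (mcod N) c' c)" "n : El (car N c b)" "m : El (car M b a)"
 shows "la (cmod N M) c' c a x (cl N M c a b n m)
    = cl N M c' a b (la N c' c b x n) m"
 using assms lact_mod_comp(2) by blast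

lemma ract_mod_comp_el [simp]:
 assumes "c : ob (mcod N)" "a : ob (mdom M)" "a' : ob (mdom M)" "b : ob (mcod M)"
  "x : El (hom (mdom M) a a')" "n : El (car N c b)" "m : El (car M b a)"
 shows "ra (cmod N M) c a a' (cl N M c a b n m) x
    = cl N M c a' b n (ra M b a a' m x)"
 using assms ract_mod_comp(2) by blast

lemma wmodule_mod_comp: "wmodule W (cmod N M) (mdom M) (mcod N)"
proof (rule wmodule.intro)
 let ?P = "cmod N M"
 have gen: "generates (coend_gens N M c a (%b. El (car N c b)) (%b. El (car M b a))) (cob N M c a)"
  if "c : ob (mcod N)" "a : ob (mdom M)" for c a
  using that N M NM by (intro generates_coend) auto
 have l: "lact ?P c' c a : cells2 W" "dom2 W (lact ?P c' c a) = hom (mcod N) c' c \<star> cob N M c a"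
   "cod2 W (lact ?P c' c a) = cob N M c' a" if "c' : ob (mcod N)" "c : ob (mcod N)" "a : ob (mdom M)" for c' c a
  using lact_mod_comp(1)[OF that] by (auto simp: hom2_iff)
 have r: "ract ?P c a a' : cells2 W" "dom2 W (ract ?P c a a') = cob N M c a \<star> hom (mdom M) a a'"
   "cod2 W (ract ?P c a a') = cob N M c a'" if "c : ob (mcod N)" "a : ob (mdom M)" "a' : ob (mdom M)" for c a a'
  using ract_mod_comp(1)[OF that] by (auto simp: hom2_iff)
 note [simp] = l r N[unfolded NM] M NM
 show "car ?P c a : hom1 W (ext (mdom M) a) (ext (mcod N) c)" if "c : ob (mcod N)" "a : ob (mdom M)" for c a
  using that by (simp add: hom1_iff)
 show "lact ?P c'' c a \<cdot> (cmp (mcod N) c'' c' c \<ast> \<iota> (car ?P c a))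
    = lact ?P c'' c' a \<cdot> (\<iota> (hom (mcod N) c'' c') \<ast> lact ?P c' c a) \<cdot> \<a> (hom (mcod N) c'' c') (hom (mcod N) c' c) (car ?P c a)"
  if o: "c'' : ob (mcod N)" "c' : ob (mcod N)" "c : ob (mcod N)" "a : ob (mdom M)" for c'' c' c a
  by (rule gen_ext3[OF generates_El generates_El gen, of "hom (mcod N) c'' c'" "hom (mcod N) c' c" c a])
   (use o in "auto simp: hom2_iff coend_gens_def")
 show "lact ?P c c a \<cdot> (unt (mcod N) c \<ast> \<iota> (car ?P c a)) = \<l> (car ?P c a)"
  if o: "c : ob (mcod N)" "a : ob (mdom M)" for c a
 proof (rule iso2_cancel_right[of "inv2 W (\<l> (car ?P c a))"])
  show "(lact ?P c c a \<cdot> (unt (mcod N) c \<ast> \<iota> (car ?P c a))) \<cdot> inv2 W (\<l> (car ?P c a)) = \<l> (car ?P c a) \<cdot> inv2 W (\<l> (car ?P c a))"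
   by (rule gen_ext[OF gen, of c a]) (use o in "auto simp: hom2_iff")
 qed (use o in auto)
 show "ract ?P c a' a'' \<cdot> (ract ?P c a a' \<ast> \<iota> (hom (mdom M) a' a''))
    = ract ?P c a a'' \<cdot> (\<iota> (car ?P c a) \<ast> cmp (mdom M) a a' a'') \<cdot> \<a> (car ?P c a) (hom (mdom M) a a') (hom (mdom M) a' a'')"
  if o: "c : ob (mcod N)" "a : ob (mdom M)" "a' : ob (mdom M)" "a'' : ob (mdom M)" for c a a' a''
  by (rule gen_ext3[OF gen generates_El generates_El, of c a "hom (mdom M) a a'" "hom (mdom M) a' a''"])
   (use o in "auto simp: hom2_iff coend_gens_def")
 show "ract ?P c a a \<cdot> (\<iota> (car ?P c a) \<ast> unt (mdom M) a) = \<r> (car ?P c a)"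
  if o: "c : ob (mcod N)" "a : ob (mdom M)" for c a
  by (rule gen_ext2[OF gen generates_unit, of c a "ext (mdom M) a"]) (use o in "auto simp: hom2_iff coend_gens_def")
 show "ract ?P c' a a' \<cdot> (lact ?P c' c a \<ast> \<iota> (hom (mdom M) a a'))
    = lact ?P c' c a' \<cdot> (\<iota> (hom (mcod N) c' c) \<ast> ract ?P c a a') \<cdot> \<a> (hom (mcod N) c' c) (car ?P c a) (hom (mdom M) a a')"
  if o: "c' : ob (mcod N)" "c : ob (mcod N)" "a : ob (mdom M)" "a' : ob (mdom M)" for c' c a a'
  by (rule gen_ext3[OF generates_El gen generates_El, of "hom (mcod N) c' c" c a "hom (mdom M) a a'"])
   (use o in "auto simp: hom2_iff coend_gens_def")
qed (use N M NM lact_mod_comp(1) ract_mod_comp(1) in auto)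

end

end


section \<open>The structure of the bicategory of modules\<close>

lemma the_spec:
 assumes "x = (THE t. P t)" "\<exists>!t. P t" shows "P x"
 using theI'[OF assms(2)] assms(1) by simp

context bicategory
begin

lemma wmodule_mod_id [simp]:
 fixes A :: "('u, 'o, 'm, 'c) wcat"
 assumes "wcategory W A" "B = A" "C = A" shows "wmodule W (mod_id A) B C"
 unfolding assms(2,3) by (rule wmoduleI) (use assms(1) in "auto simp: mod_id_def hom1_iff hom2_iff")

lemma mod_id_sel [simp]: "mdom (mod_id A) = A" "mcod (mod_id A) = A" "car (mod_id A) = hom A"
 "lact (mod_id A) = cmp A" "ract (mod_id A) = cmp A"
 by (simp_all add: mod_id_def)

lemma rep_sel [simp]:
 "mdom (rp F) = fdom F" "mcod (rp F) = fcod F" "car (rp F) c b = hom (fcod F) c (fob F b)"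
 "lact (rp F) c' c b = cmp (fcod F) c' c (fob F b)"
 "ract (rp F) c b b' = cmp (fcod F) c (fob F b) (fob F b') \<cdot> (\<iota> (hom (fcod F) c (fob F b)) \<ast> fmap F b b')"
 by (simp_all add: rep_def Let_def)

lemma corep_sel [simp]:
 "mdom (cor F) = fcod F" "mcod (cor F) = fdom F" "car (cor F) b c = hom (fcod F) (fob F b) c"
 "lact (cor F) b' b c = cmp (fcod F) (fob F b') (fob F b) c \<cdot> (fmap F b' b \<ast> \<iota> (hom (fcod F) (fob F b) c))"
 "ract (cor F) b c c' = cmp (fcod F) (fob F b) c c'"
 by (simp_all add: corep_def Let_def)

lemma wmodule_rep [simp]: 
 fixes F :: "('u, 'o, 'm, 'c) wfun"
 assumes "isfun F" "B = fdom F" "C = fcod F" shows "wmodule W (rp F) B C"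
 unfolding assms(2,3) by (rule wmoduleI) (use assms(1) in "auto simp: hom1_iff hom2_iff")

lemma wmodule_corep [simp]:
 fixes F :: "('u, 'o, 'm, 'c) wfun"
 assumes "isfun F" "B = fdom F" "C = fcod F" shows "wmodule W (cor F) C B"
 unfolding assms(2,3) by (rule wmoduleI) (use assms(1) in "auto simp: hom1_iff hom2_iff")

lemma wfun_comp_sel [simp]: "fdom (wfun_comp W H F) = fdom F" "fcod (wfun_comp W H F) = fcod H"
 "fob (wfun_comp W H F) x = fob H (fob F x)"
 "fmap (wfun_comp W H F) x y = fmap H (fob F x) (fob F y) \<cdot> fmap F x y"
 by (simp_all add: wfun_comp_def)

lemma wfunctor_comp [simp]:
 fixes F H :: "('u, 'o, 'm, 'c) wfun"
 assumes "isfun F" "isfun H" "fdom H = fcod F"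
  and "B = fdom F" "X = fcod H"
 shows "wfunctor W (wfun_comp W H F) B X"
 unfolding assms(4,5) by (rule wfunctorI) (use assms(1) assms(2)[unfolded assms(3)] assms(3) in "auto simp: hom2_iff vassoc")

subsection \<open>Vertical composition\<close>

lemma mor_id_sel [simp]: "msrc (idm M) = M" "mtrg (idm M) = M"
 "b : ob (mcod M) ==> a : ob (mdom M) ==> component (idm M) b a = \<iota> (car M b a)"
 by (simp_all add: mor_id_def)

lemma mor_id_cell [simp]:
 fixes M :: "('u, 'o, 'm, 'c) wmod"
 assumes "ismod M" shows "idm M : cells2 (Mod W)"
proof -
 have "idm M : mors M M"
  unfolding mor_id_def by (rule mk_wmor_in) (use assms in "auto simp: hom2_iff")
 then show ?thesis by (simp add: Mod_hom2_iff)
qed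

lemma mor_vcomp_sel [simp]: "msrc (vc \<tau> \<sigma>) = msrc \<sigma>" "mtrg (vc \<tau> \<sigma>) = mtrg \<tau>"
 "b : ob (mcod (msrc \<sigma>)) ==> a : ob (mdom (msrc \<sigma>)) ==>
   component (vc \<tau> \<sigma>) b a = component \<tau> b a \<cdot> component \<sigma> b a"
 by (simp_all add: mor_vcomp_def)

lemma mor_vcomp_cell [simp]:
 fixes \<sigma> \<tau> :: "('u, 'o, 'm, 'c) wmor"
 assumes s: "\<sigma> : cells2 (Mod W)" and t: "\<tau> : cells2 (Mod W)" and st: "mtrg \<sigma> = msrc \<tau>"
 shows "vc \<tau> \<sigma> : cells2 (Mod W)"
proof -
 have p: "mdom (msrc \<tau>) = mdom (msrc \<sigma>)" "mcod (msrc \<tau>) = mcod (msrc \<sigma>)"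
  using mor_parallel[OF s] st by simp_all
 have "vc \<tau> \<sigma> : mors (msrc \<sigma>) (mtrg \<tau>)"
  unfolding mor_vcomp_def
  by (rule mk_wmor_in) (use mor_mods[OF s] mor_mods[OF t] mor_parallel[OF s] mor_parallel[OF t] s t st p in "simp_all add: hom2_iff")
 then show ?thesis by (simp add: Mod_hom2_iff)
qed

lemma mor_vcomp_in: "\<sigma> : mors M N ==> \<tau> : mors N P ==> vc \<tau> \<sigma> : mors M P"
 by (simp add: Mod_hom2_iff)

lemma mor_vcomp_el:
 assumes "\<sigma> : mors M N" "\<tau> : mors N P" "b : ob (mcod M)" "a : ob (mdom M)" "x : El (car M b a)"
 shows "app (vc \<tau> \<sigma>) b a x = app \<tau> b a (app \<sigma> b a x)"
 using assms mor_parallel[of \<sigma>] by (simp add: Mod_hom2_iff)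

lemma component_El:
 assumes "\<sigma> : mors M N" "b : ob (mcod M)" "a : ob (mdom M)" "x : El (car M b a)"
 shows "app \<sigma> b a x : El (car N b a)"
 using assms by (auto simp: Mod_hom2_iff intro!: ap_El)

lemma Mod_hom2D:
 assumes "\<sigma> : mors M N"
 shows "\<sigma> : cells2 (Mod W)" "msrc \<sigma> = M" "mtrg \<sigma> = N" "ismod M" "ismod N"
  "mdom N = mdom M" "mcod N = mcod M"
 using assms mor_mods[of \<sigma>] mor_parallel[of \<sigma>] by (auto simp: Mod_hom2_iff)

lemma mor_vcomp_assoc:
 assumes "\<sigma> : mors M N" "\<tau> : mors N P" "\<rho> : mors P Q"
 shows "vc (vc \<rho> \<tau>) \<sigma> = vc \<rho> (vc \<tau> \<sigma>)"
proof (rule mor_eqI)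
 show 1: "vc (vc \<rho> \<tau>) \<sigma> : mors M Q" "vc \<rho> (vc \<tau> \<sigma>) : mors M Q"
  using assms mor_vcomp_in by blast+
 show "app (vc (vc \<rho> \<tau>) \<sigma>) b a x = app (vc \<rho> (vc \<tau> \<sigma>)) b a x"
  if o: "b : ob (mcod M)" "a : ob (mdom M)" "x : El (car M b a)" for b a x
  using o Mod_hom2D[OF assms(1)] component_El[OF assms(1) o] mor_vcomp_in[OF assms(1,2)] mor_vcomp_in[OF assms(2,3)]
   mor_vcomp_el[OF assms(1) mor_vcomp_in[OF assms(2,3)]] mor_vcomp_el[OF assms(2,3)] mor_vcomp_el[OF assms(1,2)]
   mor_vcomp_el[OF mor_vcomp_in[OF assms(1,2)] assms(3)] by simp
qed

lemma mor_vcomp_id: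
 assumes "\<sigma> : mors M N"
 shows "vc (idm N) \<sigma> = \<sigma>" "vc \<sigma> (idm M) = \<sigma>"
proof -
 note s = Mod_hom2D[OF assms]
 have i: "idm M : mors M M" "idm N : mors N N" using s by (simp_all add: Mod_hom2_iff)
 show "vc (idm N) \<sigma> = \<sigma>"
  by (rule mor_eqI[OF mor_vcomp_in[OF assms i(2)] assms])
   (use mor_vcomp_el[OF assms i(2)] component_El[OF assms] s in simp)
 show "vc \<sigma> (idm M) = \<sigma>"
  by (rule mor_eqI[OF mor_vcomp_in[OF i(1) assms] assms])
   (use mor_vcomp_el[OF i(1) assms] s in simp)
qed

lemma Mod_inverse2_iff:
 "inverse2 (Mod W) \<sigma> \<tau> \<longleftrightarrow> \<sigma> : cells2 (Mod W) & \<tau> : mors (mtrg \<sigma>) (msrc \<sigma>) &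
   vc \<tau> \<sigma> = idm (msrc \<sigma>) & vc \<sigma> \<tau> = idm (mtrg \<sigma>)"
 by (simp add: inverse2_def)

lemma Mod_inv2:
 assumes "iso2 (Mod W) \<sigma>" "\<sigma> : mors M N"
 shows "inv2 (Mod W) \<sigma> : mors N M"
  "vc (inv2 (Mod W) \<sigma>) \<sigma> = idm M" "vc \<sigma> (inv2 (Mod W) \<sigma>) = idm N"
proof -
 note s = Mod_hom2D[OF assms(2)]
 have "\<exists>!\<tau>. inverse2 (Mod W) \<sigma> \<tau>"
 proof (rule ex_ex1I)
  show "\<exists>\<tau>. inverse2 (Mod W) \<sigma> \<tau>" using assms by (simp add: iso2_def)
  fix \<tau> \<tau>' assume "inverse2 (Mod W) \<sigma> \<tau>" "inverse2 (Mod W) \<sigma> \<tau>'"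
  then have t: "\<tau> : mors N M" "vc \<tau> \<sigma> = idm M"
   and t': "\<tau>' : mors N M" "vc \<sigma> \<tau>' = idm N" by (auto simp: Mod_inverse2_iff s)
  have "\<tau> = vc \<tau> (vc \<sigma> \<tau>')" using mor_vcomp_id[OF t(1)] t' by simp
  also have "\<dots> = vc (vc \<tau> \<sigma>) \<tau>'" using mor_vcomp_assoc[OF t'(1) assms(2) t(1)] by simp
  also have "\<dots> = \<tau>'" using mor_vcomp_id[OF t'(1)] t by simp
  finally show "\<tau> = \<tau>'" .
 qed
 then have "inverse2 (Mod W) \<sigma> (inv2 (Mod W) \<sigma>)" unfolding inv2_def by (rule theI')
 then show "inv2 (Mod W) \<sigma> : mors N M"
  "vc (inv2 (Mod W) \<sigma>) \<sigma> = idm M" "vc \<sigma> (inv2 (Mod W) \<sigma>) = idm N"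
  using s by (simp_all add: Mod_inverse2_iff)
qed

lemma Mod_inv2_el:
 assumes "iso2 (Mod W) \<sigma>" "\<sigma> : mors M N" "b : ob (mcod M)" "a : ob (mdom M)"
 shows "x : El (car M b a) ==> app (inv2 (Mod W) \<sigma>) b a (app \<sigma> b a x) = x"
  "y : El (car N b a) ==> app \<sigma> b a (app (inv2 (Mod W) \<sigma>) b a y) = y"
proof -
 note i = Mod_inv2[OF assms(1,2)] and s = Mod_hom2D[OF assms(2)]
 show "x : El (car M b a) ==> app (inv2 (Mod W) \<sigma>) b a (app \<sigma> b a x) = x"
  using mor_vcomp_el[OF assms(2) i(1) assms(3,4), of x] i(2) assms(3,4) by simp
 show "y : El (car N b a) ==> app \<sigma> b a (app (inv2 (Mod W) \<sigma>) b a y) = y"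
  using mor_vcomp_el[OF i(1) assms(2), of b a y] i(3) assms(3,4) s by simp
qed

text \<open>The family of inverses is again compatible with the actions, so a morphism of modules is
 invertible when its components are.\<close>

lemma Mod_isoI:
 assumes \<sigma>: "\<sigma> : mors M N"
  and t: "!!b a. [|b : ob (mcod M); a : ob (mdom M)|] ==> t b a : hom2 W (car N b a) (car M b a)"
  and ts: "!!b a x. [|b : ob (mcod M); a : ob (mdom M); x : El (car M b a)|] ==> ap (t b a) (app \<sigma> b a x) = x"
  and st: "!!b a y. [|b : ob (mcod M); a : ob (mdom M); y : El (car N b a)|] ==> app \<sigma> b a (ap (t b a) y) = y"
 shows "iso2 (Mod W) \<sigma>"
proof -
 note s = Mod_hom2D[OF \<sigma>]
 have tE: "ap (t b a) y : El (car M b a)" if "b : ob (mcod M)" "a : ob (mdom M)" "y : El (car N b a)" for b a y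
  using hom2D[OF t[OF that(1,2)]] that by simp
 have \<tau>: "mk_wmor N M t : mors N M"
 proof (rule mk_wmor_in)
  fix b' b a x m assume *: "b' : ob (mcod N)" "b : ob (mcod N)" "a : ob (mdom N)" "x : El (hom (mcod N) b' b)" "m : El (car N b a)"
  have "ap (t b' a) (la N b' b a x (app \<sigma> b a (ap (t b a) m))) = la M b' b a x (ap (t b a) m)"
   using * s tE[of b a m] ts[of b' a "la M b' b a x (ap (t b a) m)"] by simp
  then show "ap (t b' a) (la N b' b a x m) = la M b' b a x (ap (t b a) m)"
   using * st[of b a m] s by simp
 next
  fix b a a' m x assume *: "b : ob (mcod N)" "a : ob (mdom N)" "a' : ob (mdom N)" "m : El (car N b a)" "x : El (hom (mdom N) a a')"
  have "ap (t b a') (ra N b a a' (app \<sigma> b a (ap (t b a) m)) x) = ra M b a a' (ap (t b a) m) x"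
   using * s tE[of b a m] ts[of b a' "ra M b a a' (ap (t b a) m) x"] by simp
  then show "ap (t b a') (ra N b a a' m x) = ra M b a a' (ap (t b a) m) x"
   using * st[of b a m] s by simp
 qed (use s t in auto)
 have i: "idm M : mors M M" "idm N : mors N N" using s by (simp_all add: Mod_hom2_iff)
 have "vc (mk_wmor N M t) \<sigma> = idm M"
  by (rule mor_eqI[OF mor_vcomp_in[OF \<sigma> \<tau>] i(1)]) (use mor_vcomp_el[OF \<sigma> \<tau>] ts s in simp)
 moreover have "vc \<sigma> (mk_wmor N M t) = idm N"
  by (rule mor_eqI[OF mor_vcomp_in[OF \<tau> \<sigma>] i(2)]) (use mor_vcomp_el[OF \<tau> \<sigma>] st s in simp)
 ultimately show ?thesis unfolding iso2_def
  by (intro exI[of _ "mk_wmor N M t"]) (use s \<tau> in "simp add: Mod_inverse2_iff")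
qed

end

context enriched_base
begin

lemma mor_eqI_gen:
 fixes M N :: "('u, 'o, 'm, 'c) wmod"
 assumes "\<sigma> : mors M N" "\<tau> : mors M N"
  and G: "!!b a. [|b : ob (mcod M); a : ob (mdom M)|] ==> generates (G b a) (car M b a)"
  and "!!b a x. [|b : ob (mcod M); a : ob (mdom M); x : G b a|] ==> app \<sigma> b a x = app \<tau> b a x"
 shows "\<sigma> = \<tau>"
proof (rule mor_eqI[OF assms(1,2)])
 fix b a x assume o: "b : ob (mcod M)" "a : ob (mdom M)" "x : El (car M b a)"
 have "component \<sigma> b a = component \<tau> b a"
  by (rule gen_ext[OF G[OF o(1,2)], of _ "car N b a"])
   (use Mod_hom2D[OF assms(1)] Mod_hom2D[OF assms(2)] o assms(4) in "auto simp: hom2_iff")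
 then show "app \<sigma> b a x = app \<tau> b a x" by simp
qed

lemma mk_wmor_gen:
 fixes M N :: "('u, 'o, 'm, 'c) wmod"
 assumes M: "ismod M" and N: "ismod N" and MN: "mdom N = mdom M" "mcod N = mcod M"
  and t: "!!b a. [|b : ob (mcod M); a : ob (mdom M)|] ==> t b a : hom2 W (car M b a) (car N b a)"
  and G: "!!b a. [|b : ob (mcod M); a : ob (mdom M)|] ==> generates (G b a) (car M b a)"
  and l: "!!b' b a x m. [|b' : ob (mcod M); b : ob (mcod M); a : ob (mdom M); x : El (hom (mcod M) b' b); m : G b a|]
   ==> ap (t b' a) (la M b' b a x m) = la N b' b a x (ap (t b a) m)"
  and r: "!!b a a' m x. [|b : ob (mcod M); a : ob (mdom M); a' : ob (mdom M); m : G b a; x : El (hom (mdom M) a a')|]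
   ==> ap (t b a') (ra M b a a' m x) = ra N b a a' (ap (t b a) m) x"
 shows "mk_wmor M N t : mors M N"
proof (rule mk_wmor_in[OF M N MN t])
 note T = t[THEN hom2D(1)] t[THEN hom2D(2)] t[THEN hom2D(3)]
 have GE: "m : El (car M b a)" if "b : ob (mcod M)" "a : ob (mdom M)" "m : G b a" for b a m
  using G[OF that(1,2)] that(3) by (auto simp: generates_def)
 fix b' b a x m assume *: "b' : ob (mcod M)" "b : ob (mcod M)" "a : ob (mdom M)" "x : El (hom (mcod M) b' b)" "m : El (car M b a)"
 have "t b' a \<cdot> lact M b' b a = lact N b' b a \<cdot> (\<iota> (hom (mcod M) b' b) \<ast> t b a)"
  by (rule gen_ext2[OF generates_El G, of "hom (mcod M) b' b" b a _ "car N b' a"])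
   (use * M N MN l[of b' b a] GE[of b a] in "simp_all add: T hom2_iff")
 then have "ap (t b' a \<cdot> lact M b' b a) (ten x m) = ap (lact N b' b a \<cdot> (\<iota> (hom (mcod M) b' b) \<ast> t b a)) (ten x m)" by simp
 then show "ap (t b' a) (la M b' b a x m) = la N b' b a x (ap (t b a) m)"
  using * M N MN by (simp add: T)
next
 note T = t[THEN hom2D(1)] t[THEN hom2D(2)] t[THEN hom2D(3)]
 have GE: "m : El (car M b a)" if "b : ob (mcod M)" "a : ob (mdom M)" "m : G b a" for b a m
  using G[OF that(1,2)] that(3) by (auto simp: generates_def)
 fix b a a' m x assume *: "b : ob (mcod M)" "a : ob (mdom M)" "a' : ob (mdom M)" "m : El (car M b a)" "x : El (hom (mdom M) a a')"
 have "t b a' \<cdot> ract M b a a' = ract N b a a' \<cdot> (t b a \<ast> \<iota> (hom (mdom M) a a'))"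
  by (rule gen_ext2[OF G generates_El, of b a "hom (mdom M) a a'" _ "car N b a'"])
   (use * M N MN r[of b a a'] GE[of b a] in "simp_all add: T hom2_iff")
 then have "ap (t b a' \<cdot> ract M b a a') (ten m x) = ap (ract N b a a' \<cdot> (t b a \<ast> \<iota> (hom (mdom M) a a'))) (ten m x)" by simp
 then show "ap (t b a') (ra M b a a' m x) = ra N b a a' (ap (t b a) m) x"
  using * M N MN by (simp add: T)
qed

definition coend_El_gens :: "('u, 'o, 'm, 'c) wmod => ('u, 'o, 'm, 'c) wmod => 'u => 'u => ('m, 'c) element set" where
 "coend_El_gens N M c a = coend_gens N M c a (%b. El (car N c b)) (%b. El (car M b a))"

lemma ball_coend_El_gens [simp]: "(ALL z:coend_El_gens N M c a. P z) \<longleftrightarrow>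
  (ALL b:ob (mcod M). ALL n:El (car N c b). ALL m:El (car M b a). P (cl N M c a b n m))"
 by (simp add: coend_El_gens_def)

lemma coend_El_gensE:
 assumes "x : coend_El_gens N M c a"
 obtains b n m where "b : ob (mcod M)" "n : El (car N c b)" "m : El (car M b a)" "x = cl N M c a b n m"
 using assms unfolding coend_El_gens_def by (rule coend_gensE)

lemma generates_coend_El [simp]:
 assumes "ismod N" "ismod M" "mdom N = mcod M" "c : ob (mcod N)" "a : ob (mdom M)"
 shows "generates (coend_El_gens N M c a) (cob N M c a)"
 unfolding coend_El_gens_def by (rule generates_coend) (use assms in auto)

subsection \<open>Horizontal composition\<close>

context
 fixes \<sigma> \<tau> :: "('u, 'o, 'm, 'c) wmor"
 assumes s: "\<sigma> : cells2 (Mod W)" and t: "\<tau> : cells2 (Mod W)" and st: "mdom (msrc \<tau>) = mcod (msrc \<sigma>)"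
begin

lemma hcomp_sel [simp]: "msrc (hc \<tau> \<sigma>) = cmod (msrc \<tau>) (msrc \<sigma>)"
  "mtrg (hc \<tau> \<sigma>) = cmod (mtrg \<tau>) (mtrg \<sigma>)"
 by (simp_all add: mor_hcomp_def Let_def)

lemma hcomp_component:
 assumes o: "c : ob (mcod (msrc \<tau>))" "a : ob (mdom (msrc \<sigma>))"
 shows "component (hc \<tau> \<sigma>) c a : hom2 W (cob (msrc \<tau>) (msrc \<sigma>) c a) (cob (mtrg \<tau>) (mtrg \<sigma>) c a)"
  "!!b n m. [|b : ob (mcod (msrc \<sigma>)); n : El (car (msrc \<tau>) c b); m : El (car (msrc \<sigma>) b a)|] ==>
   app (hc \<tau> \<sigma>) c a (cl (msrc \<tau>) (msrc \<sigma>) c a b n m)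
    = cl (mtrg \<tau>) (mtrg \<sigma>) c a b (app \<tau> c b n) (app \<sigma> b a m)"
proof -
 define N M N' M' where "N = msrc \<tau>" and "M = msrc \<sigma>" and "N' = mtrg \<tau>" and "M' = mtrg \<sigma>"
 note d = N_def[symmetric] M_def[symmetric] N'_def[symmetric] M'_def[symmetric]
 have w: "ismod N" "ismod M" "ismod N'" "ismod M'"
  and p: "mdom N' = mdom N" "mcod N' = mcod N" "mdom M' = mdom M" "mcod M' = mcod M" "mdom N = mcod M"
  using mor_mods[OF s] mor_mods[OF t] mor_parallel[OF s] mor_parallel[OF t] st by (simp_all add: d)
 let ?t = "component (hc \<tau> \<sigma>) c a"
 let ?j = "%b. cin N' M' c a b \<cdot> (component \<tau> c b \<ast> component \<sigma> b a)"
 have o': "c : ob (mcod N)" "a : ob (mdom M)" using o by (simp_all add: d)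
 note u = o' s t w p d
 have ex: "\<exists>!t. t : hom2 W (cob N M c a) (cob N' M' c a) & (ALL b:ob (mcod M). t \<cdot> cin N M c a b = ?j b)"
 proof (rule coend_factor)
  fix b b' n f m assume *: "b : ob (mcod M)" "b' : ob (mcod M)" "n : El (car N c b)" "f : El (hom (mcod M) b b')" "m : El (car M b' a)"
  show "ap (?j b) (ten n (la M b b' a f m)) = ap (?j b') (ten (ra N c b b' n f) m)"
   using * u coend_bal[of N' M' c a b b' "app \<tau> c b n" f "app \<sigma> b' a m"] by simp
 qed (use u in "auto simp: hom2_iff")
 have "?t = (THE t. t : hom2 W (cob N M c a) (cob N' M' c a) & (ALL b:ob (mcod M). t \<cdot> cin N M c a b = ?j b))"
  using o' by (simp add: mor_hcomp_def Let_def d)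
 from the_spec[OF this ex] have t: "?t : hom2 W (cob N M c a) (cob N' M' c a)"
  "!!b. b : ob (mcod M) ==> ?t \<cdot> cin N M c a b = ?j b" by auto
 show "?t : hom2 W (cob (msrc \<tau>) (msrc \<sigma>) c a) (cob (mtrg \<tau>) (mtrg \<sigma>) c a)" using t(1) by (simp add: d)
 fix b n m assume *: "b : ob (mcod (msrc \<sigma>))" "n : El (car (msrc \<tau>) c b)" "m : El (car (msrc \<sigma>) b a)"
 have "ap (?t \<cdot> cin N M c a b) (ten n m) = ap (?j b) (ten n m)"
  using t(2) * by (simp add: d)
 then show "ap ?t (cl (msrc \<tau>) (msrc \<sigma>) c a b n m)
    = cl (mtrg \<tau>) (mtrg \<sigma>) c a b (app \<tau> c b n) (app \<sigma> b a m)"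
  using * u hom2D[OF t(1)] by simp
qed

lemma hcomp_el [simp]:
 assumes "N = msrc \<tau>" "M = msrc \<sigma>" "c : ob (mcod (msrc \<tau>))" "a : ob (mdom (msrc \<sigma>))"
  "b : ob (mcod (msrc \<sigma>))" "n : El (car (msrc \<tau>) c b)" "m : El (car (msrc \<sigma>) b a)"
 shows "app (hc \<tau> \<sigma>) c a (cl N M c a b n m)
    = cl (mtrg \<tau>) (mtrg \<sigma>) c a b (app \<tau> c b n) (app \<sigma> b a m)"
 using assms hcomp_component(2) by simp

lemma hcomp_cell2 [simp]: "hc \<tau> \<sigma> : cells2 (Mod W)"
proof -
 define N M N' M' where "N = msrc \<tau>" and "M = msrc \<sigma>" and "N' = mtrg \<tau>" and "M' = mtrg \<sigma>"
 note d = N_def[symmetric] M_def[symmetric] N'_def[symmetric] M'_def[symmetric]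
 have w: "ismod N" "ismod M" "ismod N'" "ismod M'"
  and p: "mdom N' = mdom N" "mcod N' = mcod N" "mdom M' = mdom M" "mcod M' = mcod M" "mdom N = mcod M"
  using mor_mods[OF s] mor_mods[OF t] mor_parallel[OF s] mor_parallel[OF t] st by (simp_all add: d)
 note u = s t w p d
 let ?h = "component (hc \<tau> \<sigma>)"
 note hc = hcomp_component(1)[unfolded d] and he = hcomp_component(2)[unfolded d]
 have eq: "hc \<tau> \<sigma> = mk_wmor (cmod N M) (cmod N' M') ?h"
  by (simp add: mor_hcomp_def Let_def d mk_wmor_def cong: if_cong)
 have "mk_wmor (cmod N M) (cmod N' M') ?h : mors (cmod N M) (cmod N' M')"
  by (rule mk_wmor_gen[where G = "coend_El_gens N M"])
   (use u hc wmodule_mod_comp[of N M] wmodule_mod_comp[of N' M'] in "auto elim!: coend_El_gensE simp: he")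
 then show ?thesis unfolding eq[symmetric] by (simp add: Mod_hom2_iff)
qed

end

lemma mor_hcomp_in:
 fixes \<sigma> \<tau> :: "('u, 'o, 'm, 'c) wmor"
 assumes "\<tau> : mors N N'" "\<sigma> : mors M M'" "mdom N = mcod M"
 shows "hc \<tau> \<sigma> : mors (cmod N M) (cmod N' M')"
 using assms by (auto simp: Mod_hom2_iff)

lemma whisker_vcomp:
 fixes P M N L :: "('u, 'o, 'm, 'c) wmod"
 assumes P: "ismod P" and s: "\<sigma> : mors M N" and t: "\<tau> : mors N L" and "mdom P = mcod M"
 shows "hc (idm P) (vc \<tau> \<sigma>) = vc (hc (idm P) \<tau>) (hc (idm P) \<sigma>)"
proof -
 note S = Mod_hom2D[OF s] and T = Mod_hom2D[OF t]
 have iP: "idm P : mors P P" using P by (simp add: Mod_hom2_iff)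
 note h1 = mor_hcomp_in[OF iP s] and h2 = mor_hcomp_in[OF iP t]
 note ts = mor_vcomp_in[OF s t]
 show ?thesis
  by (rule mor_eqI_gen[OF mor_hcomp_in[OF iP ts] mor_vcomp_in[OF h1 h2], where G = "coend_El_gens P M"])
   (use assms S T in "auto elim!: coend_El_gensE simp: mor_vcomp_el[OF h1 h2] mor_vcomp_el[OF s t] mor_vcomp_in")
qed

lemma whisker_id:
 fixes P M :: "('u, 'o, 'm, 'c) wmod"
 assumes P: "ismod P" and M: "ismod M" and "mdom P = mcod M"
 shows "hc (idm P) (idm M) = idm (cmod P M)"
proof -
 have i: "idm P : mors P P" "idm M : mors M M" "idm (cmod P M) : mors (cmod P M) (cmod P M)"
  using assms wmodule_mod_comp[of P M] by (simp_all add: Mod_hom2_iff)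
 show ?thesis
  by (rule mor_eqI_gen[OF mor_hcomp_in[OF i(1,2)] i(3), where G = "coend_El_gens P M"])
   (use assms in "auto elim!: coend_El_gensE")
qed

end


context bicategory
begin

lemma gen_el:
 assumes "generates X f" "\<sigma> : hom2 W f g" "\<tau> : hom2 W f g" "ALL x:X. ap \<sigma> x = ap \<tau> x"
 shows "ap \<sigma> y = ap \<tau> y"
 using gen_ext[OF assms] by simp

text \<open>An equation \<open>\<tau> \<circ> \<sigma> = 1\<close> needs to be checked on generating elements only.\<close>

lemma gen_id:
 assumes "generates X f" "\<sigma> : hom2 W f g" "\<tau> : hom2 W g f" "ALL x:X. ap \<tau> (ap \<sigma> x) = x" and y: "y : El f"
 shows "ap \<tau> (ap \<sigma> y) = y"
proof -
 note s = hom2D[OF assms(2)] and t = hom2D[OF assms(3)]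
 have XE: "X \<subseteq> El f" using assms(1) by (simp add: generates_def)
 have "ap (\<tau> \<cdot> \<sigma>) y = ap (\<iota> f) y"
  by (rule gen_el[OF assms(1), of _ f]) (use s t assms(4) XE in "auto simp: hom2_iff subset_iff")
 then show ?thesis using s t y by simp
qed

lemma iso2I:
 assumes s: "\<sigma> : hom2 W f g" and t: "\<tau> : hom2 W g f"
  and "!!x. x : El f ==> ap \<tau> (ap \<sigma> x) = x" "!!x. x : El g ==> ap \<sigma> (ap \<tau> x) = x"
 shows "iso2 W \<sigma>" "inv2 W \<sigma> = \<tau>"
proof -
 note S = hom2D[OF s] and T = hom2D[OF t]
 have "\<tau> \<cdot> \<sigma> = \<iota> f" by (rule el_ext[of _ f f]) (use S T assms in "simp_all add: hom2_iff")
 moreover have "\<sigma> \<cdot> \<tau> = \<iota> g" by (rule el_ext[of _ g g]) (use S T assms in "simp_all add: hom2_iff")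
 ultimately have "inverse2 W \<sigma> \<tau>" using S T by (simp add: inverse2_def hom2_iff)
 then show "iso2 W \<sigma>" "inv2 W \<sigma> = \<tau>" using inv2_eqI by (auto simp: iso2_def)
qed

end

context enriched_base
begin

subsection \<open>Associativity\<close>

context
 fixes P N M :: "('u, 'o, 'm, 'c) wmod"
 assumes P: "ismod P" and N: "ismod N" and M: "ismod M"
  and PN: "mdom P = mcod N" and NM: "mdom N = mcod M"
begin

lemma comp_mods: "wmodule W (cmod P N) (mcod M) (mcod P)" "wmodule W (cmod N M) (mdom M) (mcod N)"
 "wmodule W P (mcod N) (mcod P)" "wmodule W N (mcod M) (mcod N)"
 "wmodule W (cmod (cmod P N) M) (mdom M) (mcod P)" "wmodule W (cmod P (cmod N M)) (mdom M) (mcod P)"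
 using wmodule_mod_comp[OF P N PN] wmodule_mod_comp[OF N M NM] P N PN NM M
  wmodule_mod_comp[of "cmod P N" M] wmodule_mod_comp[of P "cmod N M"] by simp_all

text \<open>The associator is defined by a condition on the classes of a double coend, so a coend is
 factored through twice.\<close>

lemma assoc_factor_left:
 assumes o: "d : ob (mcod P)" "a : ob (mdom M)"
  and q: "q : cells1 W" "src W q = ext (mdom M) a" "trg W q = ext (mcod P) d"
  and J: "!!c b. [|c : ob (mcod N); b : ob (mcod M)|] ==> J c b : hom2 W ((car P d c \<star> car N c b) \<star> car M b a) q"
  and bal1: "!!c c' b p f n m. [|c : ob (mcod N); c' : ob (mcod N); b : ob (mcod M); p : El (car P d c); f : El (hom (mcod N) c c');
     n : El (car N c' b); m : El (car M b a)|]
    ==> ap (J c b) (ten (ten p (la N c c' b f n)) m) = ap (J c' b) (ten (ten (ra P d c c' p f) n) m)"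
  and bal2: "!!c b b' p f n m. [|c : ob (mcod N); b : ob (mcod M); b' : ob (mcod M); p : El (car P d c); f : El (hom (mcod M) b b');
     n : El (car N c b); m : El (car M b' a)|]
    ==> ap (J c b) (ten (ten p n) (la M b b' a f m)) = ap (J c b') (ten (ten p (ra N c b b' n f)) m)"
 shows "EX t:hom2 W (cob (cmod P N) M d a) q. ALL c:ob (mcod N). ALL b:ob (mcod M).
   t \<cdot> cin (cmod P N) M d a b \<cdot> (cin P N d b c \<ast> \<iota> (car M b a)) = J c b"
proof -
 note u = o q P M PN NM comp_mods
 note Jc = J[THEN hom2D(1)] J[THEN hom2D(2)] J[THEN hom2D(3)]
 have "EX t. t : hom2 W (cob P N d b \<star> car M b a) q & (ALL c:ob (mcod N). t \<cdot> (cin P N d b c \<ast> \<iota> (car M b a)) = J c b)"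
  if b: "b : ob (mcod M)" for b
  by (rule ex1_implies_ex, rule coend_factor_right) (use u b bal1 J in auto)
 then obtain T where T: "!!b. b : ob (mcod M) ==> T b : hom2 W (cob P N d b \<star> car M b a) q"
  and TJ: "!!b c. b : ob (mcod M) ==> c : ob (mcod N) ==> T b \<cdot> (cin P N d b c \<ast> \<iota> (car M b a)) = J c b"
  by metis
 note Tc = T[THEN hom2D(1)] T[THEN hom2D(2)] T[THEN hom2D(3)]
 have Tel: "ap (T b) (ten (cl P N d b c p n) m) = ap (J c b) (ten (ten p n) m)"
  if "b : ob (mcod M)" "c : ob (mcod N)" "p : El (car P d c)" "n : El (car N c b)" "m : El (car M b a)" for b c p n m
 proof -
  have "ap (T b \<cdot> (cin P N d b c \<ast> \<iota> (car M b a))) (ten (ten p n) m) = ap (J c b) (ten (ten p n) m)"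
   using TJ that by simp
  then show ?thesis using u that by (simp add: Tc)
 qed
 have "\<exists>!t. t : hom2 W (cob (cmod P N) M d a) q & (ALL b:ob (mcod M). t \<cdot> cin (cmod P N) M d a b = T b)"
 proof (rule coend_factor)
  fix b b' w f m
  assume *: "b : ob (mcod M)" "b' : ob (mcod M)" "w : El (car (cmod P N) d b)" "f : El (hom (mcod M) b b')" "m : El (car M b' a)"
  have "T b \<cdot> (\<iota> (cob P N d b) \<ast> lact M b b' a) \<cdot> \<a> (cob P N d b) (hom (mcod M) b b') (car M b' a)
   = T b' \<cdot> (ract (cmod P N) d b b' \<ast> \<iota> (car M b' a))"
   by (rule gen_ext3[OF generates_coend_El generates_El generates_El, of P N d b "hom (mcod M) b b'" "car M b' a" _ q])
    (use u *(1,2) ract_cell[of "cmod P N" d b b'] in "auto elim!: coend_gensE coend_El_gensE simp: Tc hom2_iff Tel bal2")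
  then have "ap (T b \<cdot> (\<iota> (cob P N d b) \<ast> lact M b b' a) \<cdot> \<a> (cob P N d b) (hom (mcod M) b b') (car M b' a)) (ten (ten w f) m)
   = ap (T b' \<cdot> (ract (cmod P N) d b b' \<ast> \<iota> (car M b' a))) (ten (ten w f) m)" by simp
  then show "ap (T b) (ten w (la M b b' a f m)) = ap (T b') (ten (ra (cmod P N) d b b' w f) m)"
   using u * ract_cell[of "cmod P N" d b b'] by (simp add: Tc)
 qed (use u T in auto)
 then obtain t where t: "t : hom2 W (cob (cmod P N) M d a) q"
  "!!b. b : ob (mcod M) ==> t \<cdot> cin (cmod P N) M d a b = T b" by blast
 have "t \<cdot> cin (cmod P N) M d a b \<cdot> (cin P N d b c \<ast> \<iota> (car M b a)) = J c b"
  if "c : ob (mcod N)" "b : ob (mcod M)" for c b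
 proof -
  have "t \<cdot> cin (cmod P N) M d a b \<cdot> (cin P N d b c \<ast> \<iota> (car M b a))
   = (t \<cdot> cin (cmod P N) M d a b) \<cdot> (cin P N d b c \<ast> \<iota> (car M b a))"
   using that u hom2D[OF t(1)] by (simp add: vassoc)
  then show ?thesis using that t TJ by simp
 qed
 then show ?thesis using t(1) by blast
qed

lemma assoc_factor_right:
 assumes o: "d : ob (mcod P)" "a : ob (mdom M)"
  and q: "q : cells1 W" "src W q = ext (mdom M) a" "trg W q = ext (mcod P) d"
  and J: "!!c b. [|c : ob (mcod N); b : ob (mcod M)|] ==> J c b : hom2 W (car P d c \<star> (car N c b \<star> car M b a)) q"
  and bal1: "!!c c' b p f n m. [|c : ob (mcod N); c' : ob (mcod N); b : ob (mcod M); p : El (car P d c); f : El (hom (mcod N) c c');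
     n : El (car N c' b); m : El (car M b a)|]
    ==> ap (J c b) (ten p (ten (la N c c' b f n) m)) = ap (J c' b) (ten (ra P d c c' p f) (ten n m))"
  and bal2: "!!c b b' p f n m. [|c : ob (mcod N); b : ob (mcod M); b' : ob (mcod M); p : El (car P d c); f : El (hom (mcod M) b b');
     n : El (car N c b); m : El (car M b' a)|]
    ==> ap (J c b) (ten p (ten n (la M b b' a f m))) = ap (J c b') (ten p (ten (ra N c b b' n f) m))"
 shows "EX t:hom2 W (cob P (cmod N M) d a) q. ALL c:ob (mcod N). ALL b:ob (mcod M). 
   ALL p:El (car P d c). ALL n:El (car N c b). ALL m:El (car M b a).
   ap t (cl P (cmod N M) d a c p (cl N M c a b n m)) = ap (J c b) (ten p (ten n m))"
proof -
 note u = o q P M PN NM comp_mods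
 note Jc = J[THEN hom2D(1)] J[THEN hom2D(2)] J[THEN hom2D(3)]
 have "EX t. t : hom2 W (car P d c \<star> cob N M c a) q & (ALL b:ob (mcod M). t \<cdot> (\<iota> (car P d c) \<ast> cin N M c a b) = J c b)"
  if c: "c : ob (mcod N)" for c
  by (rule ex1_implies_ex, rule coend_factor_left) (use u c bal2 J in auto)
 then obtain T where T: "!!c. c : ob (mcod N) ==> T c : hom2 W (car P d c \<star> cob N M c a) q"
  and TJ: "!!b c. b : ob (mcod M) ==> c : ob (mcod N) ==> T c \<cdot> (\<iota> (car P d c) \<ast> cin N M c a b) = J c b"
  by metis
 note Tc = T[THEN hom2D(1)] T[THEN hom2D(2)] T[THEN hom2D(3)]
 have Tel: "ap (T c) (ten p (cl N M c a b n m)) = ap (J c b) (ten p (ten n m))"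
  if "b : ob (mcod M)" "c : ob (mcod N)" "p : El (car P d c)" "n : El (car N c b)" "m : El (car M b a)" for b c p n m
 proof -
  have "ap (T c \<cdot> (\<iota> (car P d c) \<ast> cin N M c a b)) (ten p (ten n m)) = ap (J c b) (ten p (ten n m))"
   using TJ that by simp
  then show ?thesis using u that by (simp add: Tc)
 qed
 have "\<exists>!t. t : hom2 W (cob P (cmod N M) d a) q & (ALL c:ob (mcod (cmod N M)). t \<cdot> cin P (cmod N M) d a c = T c)"
 proof (rule coend_factor)
  fix c c' p f w
  assume "c : ob (mcod (cmod N M))" "c' : ob (mcod (cmod N M))" "p : El (car P d c)"
   "f : El (hom (mcod (cmod N M)) c c')" "w : El (car (cmod N M) c' a)"
  then have *: "c : ob (mcod N)" "c' : ob (mcod N)" "p : El (car P d c)" "f : El (hom (mcod N) c c')" "w : El (cob N M c' a)" by simp_all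
  have "T c \<cdot> (\<iota> (car P d c) \<ast> lact (cmod N M) c c' a) \<cdot> \<a> (car P d c) (hom (mcod N) c c') (cob N M c' a)
   = T c' \<cdot> (ract P d c c' \<ast> \<iota> (cob N M c' a))"
   by (rule gen_ext3[OF generates_El generates_El generates_coend_El, of "car P d c" "hom (mcod N) c c'" N M c' a _ q])
    (use u *(1,2) lact_cell[of "cmod N M" c c' a] in "auto elim!: coend_gensE coend_El_gensE simp: Tc hom2_iff Tel bal1")
  then have "ap (T c \<cdot> (\<iota> (car P d c) \<ast> lact (cmod N M) c c' a) \<cdot> \<a> (car P d c) (hom (mcod N) c c') (cob N M c' a)) (ten (ten p f) w)
   = ap (T c' \<cdot> (ract P d c c' \<ast> \<iota> (cob N M c' a))) (ten (ten p f) w)" by simp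
  then show "ap (T c) (ten p (la (cmod N M) c c' a f w)) = ap (T c') (ten (ra P d c c' p f) w)"
   using u * lact_cell[of "cmod N M" c c' a] by (simp add: Tc)
 qed (use u T in auto)
 then obtain t where t: "t : hom2 W (cob P (cmod N M) d a) q"
  "!!c. c : ob (mcod N) ==> t \<cdot> cin P (cmod N M) d a c = T c" by auto
 have "ap t (cl P (cmod N M) d a c p (cl N M c a b n m)) = ap (J c b) (ten p (ten n m))"
  if *: "c : ob (mcod N)" "b : ob (mcod M)" "p : El (car P d c)" "n : El (car N c b)" "m : El (car M b a)" for c b p n m
 proof -
  have "ap (t \<cdot> cin P (cmod N M) d a c) (ten p (cl N M c a b n m)) = ap (J c b) (ten p (ten n m))"
   using t(2) Tel * by simp
  then show ?thesis using * u hom2D[OF t(1)] by simp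
 qed
 then show ?thesis using t(1) by blast
qed

lemma assoc_sel [simp]: "msrc (mod_assoc W P N M) = cmod (cmod P N) M"
 "mtrg (mod_assoc W P N M) = cmod P (cmod N M)"
 by (simp_all add: mod_assoc_def)

lemma assoc_gens [simp]:
 assumes o: "d : ob (mcod P)" "a : ob (mdom M)"
 shows "generates (coend_gens (cmod P N) M d a (%b. coend_El_gens P N d b) (%b. El (car M b a))) (cob (cmod P N) M d a)"
  "generates (coend_gens P (cmod N M) d a (%c. El (car P d c)) (%c. coend_El_gens N M c a)) (cob P (cmod N M) d a)"
 by (rule generates_coend; use o P M PN NM comp_mods in auto)+

lemma assoc_component:
 assumes o: "d : ob (mcod P)" "a : ob (mdom M)"
 shows "component (mod_assoc W P N M) d a : hom2 W (cob (cmod P N) M d a) (cob P (cmod N M) d a)"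
  and "!!c b p n m. [|c : ob (mcod N); b : ob (mcod M); p : El (car P d c); n : El (car N c b); m : El (car M b a)|] ==>
   app (mod_assoc W P N M) d a (cl (cmod P N) M d a b (cl P N d b c p n) m)
    = cl P (cmod N M) d a c p (cl N M c a b n m)"
proof -
 note u = o P M PN NM comp_mods
 let ?t = "component (mod_assoc W P N M) d a"
 let ?J = "%c b. cin P (cmod N M) d a c \<cdot> (\<iota> (car P d c) \<ast> cin N M c a b) \<cdot> \<a> (car P d c) (car N c b) (car M b a)"
 let ?p = "%t. t : hom2 W (cob (cmod P N) M d a) (cob P (cmod N M) d a) &
    (ALL c:ob (mcod N). ALL b:ob (mcod M).
     t \<cdot> cin (cmod P N) M d a b \<cdot> (cin P N d b c \<ast> \<iota> (car M b a)) = ?J c b)"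
 have el: "ap t (cl (cmod P N) M d a b (cl P N d b c p n) m)
    = cl P (cmod N M) d a c p (cl N M c a b n m)"
  if t: "?p t" and *: "c : ob (mcod N)" "b : ob (mcod M)" "p : El (car P d c)" "n : El (car N c b)" "m : El (car M b a)" for t c b p n m
 proof -
  have "ap (t \<cdot> cin (cmod P N) M d a b \<cdot> (cin P N d b c \<ast> \<iota> (car M b a))) (ten (ten p n) m) = ap (?J c b) (ten (ten p n) m)"
   using t * by simp
  then show ?thesis using u * t[THEN conjunct1, THEN hom2D(1)] t[THEN conjunct1, THEN hom2D(2)] by simp
 qed
 have ex: "\<exists>!t. ?p t"
 proof (rule ex_ex1I)
  have "EX t:hom2 W (cob (cmod P N) M d a) (cob P (cmod N M) d a). ALL c:ob (mcod N). ALL b:ob (mcod M).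
   t \<cdot> cin (cmod P N) M d a b \<cdot> (cin P N d b c \<ast> \<iota> (car M b a)) = ?J c b"
  proof (rule assoc_factor_left)
   fix c c' b p f n m
   assume *: "c : ob (mcod N)" "c' : ob (mcod N)" "b : ob (mcod M)" "p : El (car P d c)" "f : El (hom (mcod N) c c')" "n : El (car N c' b)" "m : El (car M b a)"
   show "ap (?J c b) (ten (ten p (la N c c' b f n)) m) = ap (?J c' b) (ten (ten (ra P d c c' p f) n) m)"
    using * u coend_bal[of P "cmod N M" d a c c' p f "cl N M c' a b n m"] by simp
  next
   fix c b b' p f n m
   assume *: "c : ob (mcod N)" "b : ob (mcod M)" "b' : ob (mcod M)" "p : El (car P d c)" "f : El (hom (mcod M) b b')" "n : El (car N c b)" "m : El (car M b' a)"
   show "ap (?J c b) (ten (ten p n) (la M b b' a f m)) = ap (?J c b') (ten (ten p (ra N c b b' n f)) m)"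
    using * u coend_bal[of N M c a b b' n f m] by simp
  qed (use u in "auto simp: hom2_iff")
  then show "EX t. ?p t" by blast
  fix t t' assume t: "?p t" "?p t'"
  show "t = t'"
   by (rule gen_ext[OF assoc_gens(1)[OF o], of _ "cob P (cmod N M) d a"])
    (use t el[OF t(1)] el[OF t(2)] in auto)
 qed
 have "?t = (THE t. ?p t)" using o by (simp add: mod_assoc_def)
 from the_spec[OF this ex] have t: "?p ?t" .
 then show "?t : hom2 W (cob (cmod P N) M d a) (cob P (cmod N M) d a)" by blast
 show "!!c b p n m. [|c : ob (mcod N); b : ob (mcod M); p : El (car P d c); n : El (car N c b); m : El (car M b a)|] ==>
   ap ?t (cl (cmod P N) M d a b (cl P N d b c p n) m)
    = cl P (cmod N M) d a c p (cl N M c a b n m)"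
  by (rule el[OF t])
qed

lemma assoc_in_hom: "mod_assoc W P N M : mors (cmod (cmod P N) M) (cmod P (cmod N M))"
proof -
 note u = P M PN NM comp_mods
 let ?h = "component (mod_assoc W P N M)"
 have eq: "mod_assoc W P N M = mk_wmor (cmod (cmod P N) M) (cmod P (cmod N M)) ?h"
  by (simp add: mod_assoc_def mk_wmor_def cong: if_cong)
 have "mk_wmor (cmod (cmod P N) M) (cmod P (cmod N M)) ?h
   : mors (cmod (cmod P N) M) (cmod P (cmod N M))"
  by (rule mk_wmor_gen[where G = "%d a. coend_gens (cmod P N) M d a (%b. coend_El_gens P N d b) (%b. El (car M b a))"])
   (use u assoc_component in "auto elim!: coend_gensE coend_El_gensE")
 then show ?thesis unfolding eq[symmetric] .
qed

lemma assoc_iso2: "iso2 (Mod W) (mod_assoc W P N M)"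
proof -
 note u = P M PN NM comp_mods
 let ?s = "component (mod_assoc W P N M)"
 let ?J = "%d a c b. cin (cmod P N) M d a b \<cdot> (cin P N d b c \<ast> \<iota> (car M b a)) \<cdot> inv2 W (\<a> (car P d c) (car N c b) (car M b a))"
 have "EX t:hom2 W (cob P (cmod N M) d a) (cob (cmod P N) M d a). ALL c:ob (mcod N). ALL b:ob (mcod M). 
   ALL p:El (car P d c). ALL n:El (car N c b). ALL m:El (car M b a).
   ap t (cl P (cmod N M) d a c p (cl N M c a b n m)) = ap (?J d a c b) (ten p (ten n m))"
  if o: "d : ob (mcod P)" "a : ob (mdom M)" for d a
 proof (rule assoc_factor_right)
  fix c c' b p f n m
  assume *: "c : ob (mcod N)" "c' : ob (mcod N)" "b : ob (mcod M)" "p : El (car P d c)" "f : El (hom (mcod N) c c')" "n : El (car N c' b)" "m : El (car M b a)"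
  show "ap (?J d a c b) (ten p (ten (la N c c' b f n) m)) = ap (?J d a c' b) (ten (ra P d c c' p f) (ten n m))"
   using * u o coend_bal[of P N d b c c' p f n] by simp
 next
  fix c b b' p f n m
  assume *: "c : ob (mcod N)" "b : ob (mcod M)" "b' : ob (mcod M)" "p : El (car P d c)" "f : El (hom (mcod M) b b')" "n : El (car N c b)" "m : El (car M b' a)"
  show "ap (?J d a c b) (ten p (ten n (la M b b' a f m))) = ap (?J d a c b') (ten p (ten (ra N c b b' n f) m))"
   using * u o coend_bal[of "cmod P N" M d a b b' "cl P N d b c p n" f m] by simp
 qed (use u o in "auto simp: hom2_iff")
 then obtain t where t: "!!d a. [|d : ob (mcod P); a : ob (mdom M)|] ==> t d a : hom2 W (cob P (cmod N M) d a) (cob (cmod P N) M d a)"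
  and te: "!!d a c b p n m. [|d : ob (mcod P); a : ob (mdom M); c : ob (mcod N); b : ob (mcod M); p : El (car P d c); n : El (car N c b); m : El (car M b a)|]
   ==> ap (t d a) (cl P (cmod N M) d a c p (cl N M c a b n m)) = ap (?J d a c b) (ten p (ten n m))"
  by metis
 have te': "ap (t d a) (cl P (cmod N M) d a c p (cl N M c a b n m))
   = cl (cmod P N) M d a b (cl P N d b c p n) m"
  if "d : ob (mcod P)" "a : ob (mdom M)" "c : ob (mcod N)" "b : ob (mcod M)" "p : El (car P d c)" "n : El (car N c b)" "m : El (car M b a)" for d a c b p n m
  using te[OF that] that u by simp
 show ?thesis
 proof (rule Mod_isoI[OF assoc_in_hom, of t])
  fix d a assume "d : ob (mcod (cmod (cmod P N) M))" "a : ob (mdom (cmod (cmod P N) M))"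
  then have o: "d : ob (mcod P)" "a : ob (mdom M)" by simp_all
  show "t d a : hom2 W (car (cmod P (cmod N M)) d a) (car (cmod (cmod P N) M) d a)"
   using t[OF o] by simp
  show "ap (t d a) (ap (?s d a) x) = x" if "x : El (car (cmod (cmod P N) M) d a)" for x
   by (rule gen_id[OF assoc_gens(1)[OF o] assoc_component(1)[OF o] t[OF o]])
    (use that o te' assoc_component(2)[OF o] in auto)
  show "ap (?s d a) (ap (t d a) x) = x" if "x : El (car (cmod P (cmod N M)) d a)" for x
   by (rule gen_id[OF assoc_gens(2)[OF o] t[OF o] assoc_component(1)[OF o]])
    (use that o te' assoc_component(2)[OF o] in auto)
 qed
qed

lemma assoc_inv_el:
 assumes o: "d : ob (mcod P)" "a : ob (mdom M)" and 
  *: "c : ob (mcod N)" "b : ob (mcod M)" "p : El (car P d c)" "n : El (car N c b)" "m : El (car M b a)"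
 shows "app (inv2 (Mod W) (mod_assoc W P N M)) d a (cl P (cmod N M) d a c p (cl N M c a b n m))
   = cl (cmod P N) M d a b (cl P N d b c p n) m"
proof -
 let ?x = "cl (cmod P N) M d a b (cl P N d b c p n) m"
 have "?x : El (cob (cmod P N) M d a)"
  using o * P M PN NM comp_mods by simp
 then have "app (inv2 (Mod W) (mod_assoc W P N M)) d a (app (mod_assoc W P N M) d a ?x) = ?x"
  using Mod_inv2_el(1)[OF assoc_iso2 assoc_in_hom, of d a ?x] o by simp
 then show ?thesis using assoc_component(2)[OF o *] by simp
qed

end

subsection \<open>Units\<close>

context
 fixes M :: "('u, 'o, 'm, 'c) wmod"
 assumes M: "ismod M"
begin

lemma mod_id_mods: "wmodule W (cmod (mod_id (mcod M)) M) (mdom M) (mcod M)"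
 "wmodule W (cmod M (mod_id (mdom M))) (mdom M) (mcod M)"
 using wmodule_mod_comp[of "mod_id (mcod M)" M] wmodule_mod_comp[of M "mod_id (mdom M)"] M by simp_all

lemma lunit_sel [simp]: "msrc (mod_lunit W M) = cmod (mod_id (mcod M)) M" "mtrg (mod_lunit W M) = M"
 and runit_sel [simp]: "msrc (mod_runit W M) = cmod M (mod_id (mdom M))" "mtrg (mod_runit W M) = M"
 by (simp_all add: mod_lunit_def mod_runit_def)

lemma lunit_component:
 assumes o: "c : ob (mcod M)" "a : ob (mdom M)"
 shows "component (mod_lunit W M) c a : hom2 W (cob (mod_id (mcod M)) M c a) (car M c a)"
  and "!!b f m. [|b : ob (mcod M); f : El (hom (mcod M) c b); m : El (car M b a)|] ==>
   app (mod_lunit W M) c a (cl (mod_id (mcod M)) M c a b f m) = la M c b a f m"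
proof -
 let ?t = "component (mod_lunit W M) c a"
 let ?p = "%t. t : hom2 W (cob (mod_id (mcod M)) M c a) (car M c a) &
   (ALL b:ob (mcod M). t \<cdot> cin (mod_id (mcod M)) M c a b = lact M c b a)"
 have ex: "\<exists>!t. ?p t"
  by (rule coend_factor) (use o M in "auto simp: hom2_iff")
 have "?t = (THE t. ?p t)" using o by (simp add: mod_lunit_def)
 from the_spec[OF this ex] have t: "?t : hom2 W (cob (mod_id (mcod M)) M c a) (car M c a)"
   "!!b. b : ob (mcod M) ==> ?t \<cdot> cin (mod_id (mcod M)) M c a b = lact M c b a" by auto
 show "?t : hom2 W (cob (mod_id (mcod M)) M c a) (car M c a)" by fact
 fix b f m assume *: "b : ob (mcod M)" "f : El (hom (mcod M) c b)" "m : El (car M b a)"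
 have "ap (?t \<cdot> cin (mod_id (mcod M)) M c a b) (ten f m) = la M c b a f m" using t(2) * by simp
 then show "ap ?t (cl (mod_id (mcod M)) M c a b f m) = la M c b a f m"
  using * o M hom2D[OF t(1)] by simp
qed

lemma runit_component:
 assumes o: "c : ob (mcod M)" "a : ob (mdom M)"
 shows "component (mod_runit W M) c a : hom2 W (cob M (mod_id (mdom M)) c a) (car M c a)"
  and "!!b f m. [|b : ob (mdom M); m : El (car M c b); f : El (hom (mdom M) b a)|] ==>
   app (mod_runit W M) c a (cl M (mod_id (mdom M)) c a b m f) = ra M c b a m f"
proof -
 let ?t = "component (mod_runit W M) c a"
 let ?p = "%t. t : hom2 W (cob M (mod_id (mdom M)) c a) (car M c a) &
   (ALL b:ob (mdom M). t \<cdot> cin M (mod_id (mdom M)) c a b = ract M c b a)"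
 have "\<exists>!t. t : hom2 W (cob M (mod_id (mdom M)) c a) (car M c a) &
   (ALL b:ob (mcod (mod_id (mdom M))). t \<cdot> cin M (mod_id (mdom M)) c a b = ract M c b a)"
  by (rule coend_factor) (use o M in "auto simp: hom2_iff")
 then have ex: "\<exists>!t. ?p t" by simp
 have "?t = (THE t. ?p t)" using o by (simp add: mod_runit_def)
 from the_spec[OF this ex] have t: "?t : hom2 W (cob M (mod_id (mdom M)) c a) (car M c a)"
   "!!b. b : ob (mdom M) ==> ?t \<cdot> cin M (mod_id (mdom M)) c a b = ract M c b a" by auto
 show "?t : hom2 W (cob M (mod_id (mdom M)) c a) (car M c a)" by fact
 fix b f m assume *: "b : ob (mdom M)" "m : El (car M c b)" "f : El (hom (mdom M) b a)"
 have "ap (?t \<cdot> cin M (mod_id (mdom M)) c a b) (ten m f) = ra M c b a m f" using t(2) * by simp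
 then show "ap ?t (cl M (mod_id (mdom M)) c a b m f) = ra M c b a m f"
  using * o M hom2D[OF t(1)] by simp
qed

lemma lunit_in_hom: "mod_lunit W M : mors (cmod (mod_id (mcod M)) M) M"
proof -
 let ?h = "component (mod_lunit W M)"
 have eq: "mod_lunit W M = mk_wmor (cmod (mod_id (mcod M)) M) M ?h"
  by (simp add: mod_lunit_def mk_wmor_def cong: if_cong)
 have "mk_wmor (cmod (mod_id (mcod M)) M) M ?h : mors (cmod (mod_id (mcod M)) M) M"
  by (rule mk_wmor_gen[where G = "coend_El_gens (mod_id (mcod M)) M"])
   (use M mod_id_mods lunit_component in "auto elim!: coend_gensE coend_El_gensE")
 then show ?thesis unfolding eq[symmetric] .
qed

lemma runit_in_hom: "mod_runit W M : mors (cmod M (mod_id (mdom M))) M"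
proof -
 let ?h = "component (mod_runit W M)"
 have eq: "mod_runit W M = mk_wmor (cmod M (mod_id (mdom M))) M ?h"
  by (simp add: mod_runit_def mk_wmor_def cong: if_cong)
 have "mk_wmor (cmod M (mod_id (mdom M))) M ?h : mors (cmod M (mod_id (mdom M))) M"
  by (rule mk_wmor_gen[where G = "coend_El_gens M (mod_id (mdom M))"])
   (use M mod_id_mods runit_component in "auto elim!: coend_gensE coend_El_gensE")
 then show ?thesis unfolding eq[symmetric] .
qed

lemma lunit_inverse:
 "iso2 (Mod W) (mod_lunit W M)"
 "!!c a m. [|c : ob (mcod M); a : ob (mdom M); m : El (car M c a)|] ==>
  app (inv2 (Mod W) (mod_lunit W M)) c a m = cl (mod_id (mcod M)) M c a c (pt (unt (mcod M) c)) m"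
proof -
 let ?I = "mod_id (mcod M)"
 let ?t = "%c a. cin ?I M c a c \<cdot> (unt (mcod M) c \<ast> \<iota> (car M c a)) \<cdot> inv2 W (\<l> (car M c a))"
 have tin: "?t c a : hom2 W (car M c a) (cob ?I M c a)" if "c : ob (mcod M)" "a : ob (mdom M)" for c a
  using that M by (simp add: hom2_iff)
 show i: "iso2 (Mod W) (mod_lunit W M)"
 proof (rule Mod_isoI[OF lunit_in_hom, of ?t])
  fix c a assume "c : ob (mcod (cmod ?I M))" "a : ob (mdom (cmod ?I M))"
  then have o: "c : ob (mcod M)" "a : ob (mdom M)" by simp_all
  show "?t c a : hom2 W (car M c a) (car (cmod ?I M) c a)" using tin[OF o] by simp
  show "ap (?t c a) (app (mod_lunit W M) c a x) = x" if x: "x : El (car (cmod ?I M) c a)" for x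
  proof (rule gen_id[OF generates_coend_El[of ?I M c a] lunit_component(1)[OF o] tin[OF o]])
   show "ALL x:coend_El_gens ?I M c a. ap (?t c a) (app (mod_lunit W M) c a x) = x"
   proof
    fix x assume "x : coend_El_gens ?I M c a"
    then obtain b f m where x: "b : ob (mcod M)" "f : El (hom (mcod M) c b)" "m : El (car M b a)" "x = cl ?I M c a b f m"
     by (auto elim!: coend_gensE coend_El_gensE)
    show "ap (?t c a) (app (mod_lunit W M) c a x) = x"
     using x o M lunit_component(2)[OF o] coend_bal[of ?I M c a c b "pt (unt (mcod M) c)" f m] by simp
   qed
  qed (use M o x in auto)
  show "app (mod_lunit W M) c a (ap (?t c a) y) = y" if "y : El (car M c a)" for y
   using that o M lunit_component(2)[OF o] by simp
 qed
 fix c a m assume *: "c : ob (mcod M)" "a : ob (mdom M)" "m : El (car M c a)"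
 let ?x = "cl ?I M c a c (pt (unt (mcod M) c)) m"
 have "?x : El (cob ?I M c a)" using * M by simp
 then have "app (inv2 (Mod W) (mod_lunit W M)) c a (app (mod_lunit W M) c a ?x) = ?x"
  using Mod_inv2_el(1)[OF i lunit_in_hom, of c a ?x] * by simp
 then show "app (inv2 (Mod W) (mod_lunit W M)) c a m = ?x"
  using * M lunit_component(2)[OF *(1,2), of c "pt (unt (mcod M) c)" m] by simp
qed

end
end


section \<open>Functors as modules\<close>

context enriched_base
begin

subsection \<open>The Yoneda isomorphism\<close>

text \<open>The action \<open>C(F b, c) \<star> P(c,a) \<Rightarrow> P(F b, a)\<close> exhibits the composite of \<open>C(F,1)\<close> with
 \<open>P\<close> as \<open>P(F b, a)\<close>.\<close>

definition yoneda :: "('u, 'o, 'm, 'c) wfun => ('u, 'o, 'm, 'c) wmod => 'u => 'u => 'c" where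
 "yoneda F P b a = (THE t. t : hom2 W (cob (cor F) P b a) (car P (fob F b) a) &
   (ALL c:ob (mcod P). t \<cdot> cin (cor F) P b a c = lact P (fob F b) c a))"

abbreviation idpt :: "('u, 'o, 'm, 'c) wfun => 'u => ('m, 'c) element" where
 "idpt F b \<equiv> pt (unt (fcod F) (fob F b))"

context
 fixes F :: "('u, 'o, 'm, 'c) wfun" and P :: "('u, 'o, 'm, 'c) wmod"
 assumes F: "isfun F" and P: "ismod P" and FP: "fcod F = mcod P"
begin

lemma corep_comp: "wmodule W (cmod (cor F) P) (mdom P) (fdom F)"
 using wmodule_mod_comp[of "cor F" P] F P FP by simp

lemma F': "wfunctor W F (fdom F) (mcod P)" using F FP by simp

context
 fixes b a assumes b: "b : ob (fdom F)" and a: "a : ob (mdom P)"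
begin

lemma corep_coend_cell [simp]:
 "cob (cor F) P b a : cells1 W" "src W (cob (cor F) P b a) = ext (mdom P) a"
 "trg W (cob (cor F) P b a) = ext (fdom F) b"
 "c : ob (mcod P) ==> cin (cor F) P b a c : cells2 W"
 "c : ob (mcod P) ==> dom2 W (cin (cor F) P b a c) = hom (mcod P) (fob F b) c \<star> car P c a"
 "c : ob (mcod P) ==> cod2 W (cin (cor F) P b a c) = cob (cor F) P b a"
 using F P FP a b coend_ob_cell[of "cor F" P b a] coend_in_cell[of "cor F" P b a c] by simp_all

lemma fob_mcod: "fob F b : ob (mcod P)" "ext (mcod P) (fob F b) = ext (fdom F) b"
 using F P FP b by simp_all

lemma yoneda_spec:
 "yoneda F P b a : hom2 W (cob (cor F) P b a) (car P (fob F b) a)"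
 "c : ob (mcod P) ==> yoneda F P b a \<cdot> cin (cor F) P b a c = lact P (fob F b) c a"
proof -
 have ex: "\<exists>!t. t : hom2 W (cob (cor F) P b a) (car P (fob F b) a) &
   (ALL c:ob (mcod P). t \<cdot> cin (cor F) P b a c = lact P (fob F b) c a)"
  by (rule coend_factor) (use F P FP F' a b fob_mcod in "auto simp: hom2_iff")
 show "yoneda F P b a : hom2 W (cob (cor F) P b a) (car P (fob F b) a)"
  "c : ob (mcod P) ==> yoneda F P b a \<cdot> cin (cor F) P b a c = lact P (fob F b) c a"
  using the_spec[OF yoneda_def ex] by auto
qed

lemma yoneda_cell [simp]: "yoneda F P b a : cells2 W" "dom2 W (yoneda F P b a) = cob (cor F) P b a"
 "cod2 W (yoneda F P b a) = car P (fob F b) a"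
 using yoneda_spec(1) by (auto simp: hom2_iff)

lemma yoneda_el [simp]:
 assumes "c : ob (mcod P)" "f : El (hom (mcod P) (fob F b) c)" "p : El (car P c a)"
 shows "ap (yoneda F P b a) (cl (cor F) P b a c f p) = la P (fob F b) c a f p"
proof -
 have "ap (yoneda F P b a \<cdot> cin (cor F) P b a c) (ten f p) = la P (fob F b) c a f p"
  using yoneda_spec(2) assms by simp
 then show ?thesis using assms F P FP a b fob_mcod by simp
qed

lemma yoneda_one [simp]:
 assumes "p : El (car P (fob F b) a)" "C = mcod P"
 shows "ap (yoneda F P b a) (cl (cor F) P b a (fob F b) (pt (unt C (fob F b))) p) = p"
 using assms fob_mcod F P FP a b by simp

text \<open>Every class in \<open>C(F,1) \<circ> P\<close> is represented by an element of the form \<open>1 \<otimes> p\<close>.\<close>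

lemma yoneda_norm:
 assumes "c : ob (mcod P)" "f : El (hom (mcod P) (fob F b) c)" "p : El (car P c a)"
 shows "cl (cor F) P b a c f p
  = cl (cor F) P b a (fob F b) (idpt F b) (la P (fob F b) c a f p)"
 using coend_bal[of "cor F" P b a "fob F b" c "idpt F b" f p] assms F P FP a b fob_mcod by simp

lemma yoneda_inv: 
 assumes "e : El (cob (cor F) P b a)"
 shows "cl (cor F) P b a (fob F b) (idpt F b) (ap (yoneda F P b a) e) = e"
proof -
 let ?t = "cin (cor F) P b a (fob F b) \<cdot> (unt (mcod P) (fob F b) \<ast> \<iota> (car P (fob F b) a)) \<cdot> inv2 W (\<l> (car P (fob F b) a))"
 have t: "?t : hom2 W (car P (fob F b) a) (cob (cor F) P b a)"
  using F P FP a b fob_mcod by (simp add: hom2_iff)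
 have te: "ap ?t x = cl (cor F) P b a (fob F b) (idpt F b) x" if "x : El (car P (fob F b) a)" for x
  using that F P FP a b fob_mcod by simp
 have "ap ?t (ap (yoneda F P b a) e) = e"
 proof (rule gen_id[OF generates_coend_El[of "cor F" P b a] yoneda_spec(1) t])
  show "ALL x:coend_El_gens (cor F) P b a. ap ?t (ap (yoneda F P b a) x) = x"
  proof
   fix x assume "x : coend_El_gens (cor F) P b a"
   then obtain c f p where x: "c : ob (mcod P)" "f : El (hom (mcod P) (fob F b) c)" "p : El (car P c a)"
    "x = cl (cor F) P b a c f p" by (auto elim!: coend_El_gensE simp: FP)
   have "la P (fob F b) c a f p : El (car P (fob F b) a)" using x P a b fob_mcod by simp
   then show "ap ?t (ap (yoneda F P b a) x) = x"
    unfolding x(4) yoneda_norm[OF x(1-3)] yoneda_el[OF x(1-3)] using te fob_mcod x P a b FP yoneda_one by simp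
  qed
 qed (use F P FP a b assms in auto)
 moreover have "ap (yoneda F P b a) e : El (car P (fob F b) a)" using assms by simp
 ultimately show ?thesis using te by simp
qed

lemma yoneda_inv2:
 shows "x : El (car P (fob F b) a) ==>
   ap (inv2 W (yoneda F P b a)) x = cl (cor F) P b a (fob F b) (idpt F b) x"
  and yoneda_iso2 [simp]: "iso2 W (yoneda F P b a)"
proof -
 let ?t = "cin (cor F) P b a (fob F b) \<cdot> (unt (mcod P) (fob F b) \<ast> \<iota> (car P (fob F b) a)) \<cdot> inv2 W (\<l> (car P (fob F b) a))"
 have t: "?t : hom2 W (car P (fob F b) a) (cob (cor F) P b a)"
  using F P FP a b fob_mcod by (simp add: hom2_iff)
 have te: "ap ?t x = cl (cor F) P b a (fob F b) (idpt F b) x" if "x : El (car P (fob F b) a)" for x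
  using that F P FP a b fob_mcod by simp
 have 1: "ap ?t (ap (yoneda F P b a) e) = e" if "e : El (cob (cor F) P b a)" for e
  using te[of "ap (yoneda F P b a) e"] that yoneda_inv by simp
 have 2: "ap (yoneda F P b a) (ap ?t x) = x" if "x : El (car P (fob F b) a)" for x
  unfolding te[OF that] using that FP by simp
 note i = iso2I[OF yoneda_spec(1) t 1 2]
 show "iso2 W (yoneda F P b a)" by (rule i)
 show "x : El (car P (fob F b) a) ==>
   ap (inv2 W (yoneda F P b a)) x = cl (cor F) P b a (fob F b) (idpt F b) x"
  using te i(2) by simp
qed

end

text \<open>Morphisms into \<open>C(F,1) \<circ> P\<close> amount to families into \<open>P(F b, a)\<close>, by the Yoneda
 isomorphism.\<close>

lemma into_corep_comp:
 assumes M: "ismod M" and "mcod M = fdom F" "mdom M = mdom P"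
  and g: "!!b a. [|b : ob (fdom F); a : ob (mdom P)|] ==> g b a : hom2 W (car M b a) (car P (fob F b) a)"
  and l: "!!b' b a x m. [|b' : ob (fdom F); b : ob (fdom F); a : ob (mdom P); x : El (hom (fdom F) b' b); m : El (car M b a)|]
   ==> ap (g b' a) (la M b' b a x m) = la P (fob F b') (fob F b) a (ap (fmap F b' b) x) (ap (g b a) m)"
  and r: "!!b a a' m x. [|b : ob (fdom F); a : ob (mdom P); a' : ob (mdom P); m : El (car M b a); x : El (hom (mdom P) a a')|]
   ==> ap (g b a') (ra M b a a' m x) = ra P (fob F b) a a' (ap (g b a) m) x"
 shows "mk_wmor M (cmod (cor F) P) (%b a. inv2 W (yoneda F P b a) \<cdot> g b a) : mors M (cmod (cor F) P)"
proof (rule mk_wmor_in)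
 note G = g[THEN hom2D(1)] g[THEN hom2D(2)] g[THEN hom2D(3)]
 note u = F F' P FP fob_mcod corep_comp assms(1-3) G
 have gE: "ap (g b a) m : El (car P (fob F b) a)" if "b : ob (fdom F)" "a : ob (mdom P)" "m : El (car M b a)" for b a m
  using that u by simp
 fix b' b a x m assume "b' : ob (mcod M)" "b : ob (mcod M)" "a : ob (mdom M)" "x : El (hom (mcod M) b' b)" "m : El (car M b a)"
 then have *: "b' : ob (fdom F)" "b : ob (fdom F)" "a : ob (mdom P)" "x : El (hom (fdom F) b' b)" "m : El (car M b a)" 
  using assms(2,3) by simp_all
 have fx: "ap (fmap F b' b) x : El (hom (mcod P) (fob F b') (fob F b))" using * u by simp
 have "la P (fob F b') (fob F b) a (ap (fmap F b' b) x) (ap (g b a) m) : El (car P (fob F b') a)"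
  using * u fx gE by simp
 then show "ap (inv2 W (yoneda F P b' a) \<cdot> g b' a) (la M b' b a x m)
   = la (cmod (cor F) P) b' b a x (ap (inv2 W (yoneda F P b a) \<cdot> g b a) m)"
  using * u l[OF *] gE[of b a m] fx yoneda_norm[of b' a "fob F b" "ap (fmap F b' b) x" "ap (g b a) m"]
  by (simp add: yoneda_inv2)
next
 note G = g[THEN hom2D(1)] g[THEN hom2D(2)] g[THEN hom2D(3)]
 note u = F F' P FP fob_mcod corep_comp assms(1-3) G
 have gE: "ap (g b a) m : El (car P (fob F b) a)" if "b : ob (fdom F)" "a : ob (mdom P)" "m : El (car M b a)" for b a m
  using that u by simp
 fix b a a' m x assume "b : ob (mcod M)" "a : ob (mdom M)" "a' : ob (mdom M)" "m : El (car M b a)" "x : El (hom (mdom M) a a')"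
 then have *: "b : ob (fdom F)" "a : ob (mdom P)" "a' : ob (mdom P)" "m : El (car M b a)" "x : El (hom (mdom P) a a')"
  using assms(2,3) by simp_all
 show "ap (inv2 W (yoneda F P b a') \<cdot> g b a') (ra M b a a' m x)
   = ra (cmod (cor F) P) b a a' (ap (inv2 W (yoneda F P b a) \<cdot> g b a) m) x"
  using * u r[OF *] gE[of b a m] by (simp add: yoneda_inv2)
qed (use F P FP corep_comp assms(1-3) g[THEN hom2D(1)] g[THEN hom2D(2)] g[THEN hom2D(3)] in "auto simp: hom2_iff")

end

lemma hom_mod_iso_eq:
 assumes "fcod Z = fcod F" shows "hom_mod_iso W F Z b a = yoneda F (rp Z) b a"
 unfolding hom_mod_iso_def yoneda_def hom_mod_def by (simp add: assms)

subsection \<open>Unit and counit\<close>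

lemma rep_unit_in_hom:
 fixes F :: "('u, 'o, 'm, 'c) wfun"
 assumes F: "isfun F"
 shows "rep_unit W F : mors (mod_id (fdom F)) (cmod (cor F) (rp F))"
 unfolding rep_unit_def hom_mod_iso_eq[OF refl]
 by (rule into_corep_comp) (use F in "auto simp: hom2_iff")

lemma rep_unit_el:
 fixes F :: "('u, 'o, 'm, 'c) wfun"
 assumes F: "isfun F" and o: "b : ob (fdom F)" "b' : ob (fdom F)" "x : El (hom (fdom F) b b')"
 shows "app (rep_unit W F) b b' x = cl (cor F) (rp F) b b' (fob F b) (idpt F b) (ap (fmap F b b') x)"
 using o F by (simp add: rep_unit_def hom_mod_iso_eq yoneda_inv2)

lemma rep_counit_el:
 fixes F :: "('u, 'o, 'm, 'c) wfun"
 assumes F: "isfun F" and o: "c : ob (fcod F)" "c' : ob (fcod F)"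
 shows "component (rep_counit W F) c c' : hom2 W (cob (rp F) (cor F) c c') (hom (fcod F) c c')"
 "!!b f g. [|b : ob (fdom F); f : El (hom (fcod F) c (fob F b)); g : El (hom (fcod F) (fob F b) c')|] ==>
   app (rep_counit W F) c c' (cl (rp F) (cor F) c c' b f g) = cm (fcod F) c (fob F b) c' f g"
proof -
 let ?t = "component (rep_counit W F) c c'"
 let ?p = "%t. t : hom2 W (cob (rp F) (cor F) c c') (hom (fcod F) c c') &
   (ALL b:ob (fdom F). t \<cdot> cin (rp F) (cor F) c c' b = cmp (fcod F) c (fob F b) c')"
 have "\<exists>!t. t : hom2 W (cob (rp F) (cor F) c c') (hom (fcod F) c c') &
   (ALL b:ob (mcod (cor F)). t \<cdot> cin (rp F) (cor F) c c' b = cmp (fcod F) c (fob F b) c')"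
  by (rule coend_factor) (use F o in "auto simp: hom2_iff")
 then have ex: "\<exists>!t. ?p t" by simp
 have "?t = (THE t. ?p t)" using o by (simp add: rep_counit_def)
 from the_spec[OF this ex] have t: "?p ?t" .
 then show "?t : hom2 W (cob (rp F) (cor F) c c') (hom (fcod F) c c')" by blast
 note tc = hom2D[OF this]
 fix b f g assume *: "b : ob (fdom F)" "f : El (hom (fcod F) c (fob F b))" "g : El (hom (fcod F) (fob F b) c')"
 have "ap (?t \<cdot> cin (rp F) (cor F) c c' b) (ten f g) = cm (fcod F) c (fob F b) c' f g"
  using t * by simp
 then show "ap ?t (cl (rp F) (cor F) c c' b f g) = cm (fcod F) c (fob F b) c' f g"
  using * tc o F coend_in_cell[of "rp F" "cor F" c c' b] by simp
qed

lemma rep_counit_in_hom: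
 fixes F :: "('u, 'o, 'm, 'c) wfun"
 assumes F: "isfun F"
 shows "rep_counit W F : mors (cmod (rp F) (cor F)) (mod_id (fcod F))"
proof -
 let ?h = "component (rep_counit W F)"
 have w: "wmodule W (cmod (rp F) (cor F)) (fcod F) (fcod F)"
  using wmodule_mod_comp[of "rp F" "cor F"] F by simp
 have eq: "rep_counit W F = mk_wmor (cmod (rp F) (cor F)) (mod_id (fcod F)) ?h"
  by (simp add: rep_counit_def mk_wmor_def cong: if_cong)
 have "mk_wmor (cmod (rp F) (cor F)) (mod_id (fcod F)) ?h : mors (cmod (rp F) (cor F)) (mod_id (fcod F))"
  by (rule mk_wmor_gen[where G = "coend_El_gens (rp F) (cor F)"])
   (use F w rep_counit_el[OF F] in "auto elim!: coend_El_gensE")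
 then show ?thesis unfolding eq[symmetric] .
qed

subsection \<open>Morphisms into a composite with \<open>C(F,1)\<close>\<close>

text \<open>The family \<open>M(b,a) \<Rightarrow> P(F b, a)\<close> corresponding to a morphism \<open>\<alpha> : M \<Rightarrow> C(F,1) \<circ> P\<close>.\<close>

definition bar :: "('u, 'o, 'm, 'c) wfun => ('u, 'o, 'm, 'c) wmod => ('u, 'o, 'm, 'c) wmor => 'u => 'u => 'c" where
 "bar F P \<alpha> b a = yoneda F P b a \<cdot> component \<alpha> b a"

context
 fixes F :: "('u, 'o, 'm, 'c) wfun" and P M :: "('u, 'o, 'm, 'c) wmod" and \<alpha> :: "('u, 'o, 'm, 'c) wmor"
 assumes F: "isfun F" and P: "ismod P" and FP: "fcod F = mcod P"
  and \<alpha>: "\<alpha> : mors M (cmod (cor F) P)"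
begin

lemma bar_mods: "wmodule W M (mdom P) (fdom F)" "mdom M = mdom P" "mcod M = fdom F"
 using Mod_hom2D[OF \<alpha>] by simp_all

lemma bar_cell [simp]:
 assumes "b : ob (fdom F)" "a : ob (mdom P)"
 shows "bar F P \<alpha> b a : cells2 W" "dom2 W (bar F P \<alpha> b a) = car M b a" "cod2 W (bar F P \<alpha> b a) = car P (fob F b) a"
 using assms F P FP Mod_hom2D[OF \<alpha>] by (simp_all add: bar_def)

lemma component_bar:
 assumes "b : ob (fdom F)" "a : ob (mdom P)" "m : El (car M b a)"
 shows "app \<alpha> b a m = cl (cor F) P b a (fob F b) (idpt F b) (ap (bar F P \<alpha> b a) m)"
 using assms F P FP Mod_hom2D[OF \<alpha>] yoneda_inv[of F P b a "app \<alpha> b a m"] by (simp add: bar_def)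

lemma bar_lact:
 assumes "b' : ob (fdom F)" "b : ob (fdom F)" "a : ob (mdom P)" "x : El (hom (fdom F) b' b)" "m : El (car M b a)"
 shows "ap (bar F P \<alpha> b' a) (la M b' b a x m)
  = la P (fob F b') (fob F b) a (ap (fmap F b' b) x) (ap (bar F P \<alpha> b a) m)"
proof -
 let ?y = "ap (bar F P \<alpha> b a) m"
 note d = Mod_hom2D[OF \<alpha>]
 note u = assms F F'[OF F P FP] P FP bar_mods d fob_mcod[OF F P FP]
 have y: "?y : El (car P (fob F b) a)" using u by simp
 have fx: "ap (fmap F b' b) x : El (hom (mcod P) (fob F b') (fob F b))" using u by simp
 have "app \<alpha> b' a (la M b' b a x m) = la (cmod (cor F) P) b' b a x (app \<alpha> b a m)"
  using u by simp
 also have "\<dots> = cl (cor F) P b' a (fob F b) (ap (fmap F b' b) x) ?y"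
  unfolding component_bar[OF assms(2,3,5)] using u y by simp
 finally have *: "app \<alpha> b' a (la M b' b a x m)
   = cl (cor F) P b' a (fob F b) (ap (fmap F b' b) x) ?y" .
 have "ap (bar F P \<alpha> b' a) (la M b' b a x m) = ap (yoneda F P b' a) (app \<alpha> b' a (la M b' b a x m))"
  unfolding bar_def by (rule ap_vcomp) (use u in simp_all)
 then show ?thesis unfolding * using u y fx by simp
qed

lemma bar_ract:
 assumes "b : ob (fdom F)" "a : ob (mdom P)" "a' : ob (mdom P)" "x : El (hom (mdom P) a a')" "m : El (car M b a)"
 shows "ap (bar F P \<alpha> b a') (ra M b a a' m x)
  = ra P (fob F b) a a' (ap (bar F P \<alpha> b a) m) x"
proof -
 let ?y = "ap (bar F P \<alpha> b a) m"
 note d = Mod_hom2D[OF \<alpha>]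
 note u = assms F F'[OF F P FP] P FP bar_mods d fob_mcod[OF F P FP]
 have y: "?y : El (car P (fob F b) a)" using u by simp
 have yx: "ra P (fob F b) a a' ?y x : El (car P (fob F b) a')" using u y by simp
 have "app \<alpha> b a' (ra M b a a' m x) = ra (cmod (cor F) P) b a a' (app \<alpha> b a m) x"
  using u by simp
 also have "\<dots> = cl (cor F) P b a' (fob F b) (idpt F b) (ra P (fob F b) a a' ?y x)"
  unfolding component_bar[OF assms(1,2,5)] using u y by simp
 finally have *: "app \<alpha> b a' (ra M b a a' m x)
   = cl (cor F) P b a' (fob F b) (idpt F b) (ra P (fob F b) a a' ?y x)" .
 have "ap (bar F P \<alpha> b a') (ra M b a a' m x) = ap (yoneda F P b a') (app \<alpha> b a' (ra M b a a' m x))"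
  unfolding bar_def by (rule ap_vcomp) (use u in simp_all)
 then show ?thesis unfolding * using u yx by simp
qed

end

lemma hom_mod_map_in_hom:
 fixes F H Z :: "('u, 'o, 'm, 'c) wfun"
 assumes F: "isfun F" and Z: "isfun Z" and H: "isfun H"
  and FZ: "fcod Z = fcod F" and FH: "fdom H = fcod F"
 shows "hom_mod_map W H F Z : mors (hom_mod W F Z) (hom_mod W (wfun_comp W H F) (wfun_comp W H Z))"
proof -
 let ?HF = "wfun_comp W H F" and ?HZ = "wfun_comp W H Z"
 note u = F Z H FZ FH
 have "mk_wmor (cmod (cor F) (rp Z)) (cmod (cor ?HF) (rp ?HZ))
   (%b a. inv2 W (yoneda ?HF (rp ?HZ) b a) \<cdot> (fmap H (fob F b) (fob Z a) \<cdot> yoneda F (rp Z) b a))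
   : mors (cmod (cor F) (rp Z)) (cmod (cor ?HF) (rp ?HZ))"
 proof (rule into_corep_comp)
  show "isfun ?HF" using u by simp
  show "ismod (rp ?HZ)" using u wfunctor_comp[of Z H] by simp
  show "ismod (cmod (cor F) (rp Z))"
   using u wmodule_mod_comp[of "cor F" "rp Z"] by simp
  have Z': "wfunctor W Z (fdom Z) (fcod F)" and H': "wfunctor W H (fcod F) (fcod H)" using u by simp_all
  note v = F Z H FZ FH Z' H'
  have i: "\<alpha> : mors (cmod (cor F) (rp Z)) (cmod (cor F) (rp Z))"
   if "\<alpha> = idm (cmod (cor F) (rp Z))" for \<alpha>
   using that u wmodule_mod_comp[of "cor F" "rp Z"] by (simp add: Mod_hom2_iff)
  let ?i = "idm (cmod (cor F) (rp Z))"
  have bar: "bar F (rp Z) ?i b a = yoneda F (rp Z) b a" if "b : ob (fdom F)" "a : ob (fdom Z)" for b a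
   using that v by (simp add: bar_def)
  have RZ: "ismod (rp Z)" "fcod F = mcod (rp Z)" using v by simp_all
  note bl = bar_lact[OF F RZ i[OF refl]] and br = bar_ract[OF F RZ i[OF refl]]
  show "fmap H (fob F b) (fob Z a) \<cdot> yoneda F (rp Z) b a : hom2 W (car (cmod (cor F) (rp Z)) b a) (car (rp ?HZ) (fob ?HF b) a)"
   if "b : ob (fdom ?HF)" "a : ob (mdom (rp ?HZ))" for b a
   using that v by (simp add: hom2_iff)
  show "ap (fmap H (fob F b') (fob Z a) \<cdot> yoneda F (rp Z) b' a) (la (cmod (cor F) (rp Z)) b' b a x m)
   = la (rp ?HZ) (fob ?HF b') (fob ?HF b) a (ap (fmap ?HF b' b) x) (ap (fmap H (fob F b) (fob Z a) \<cdot> yoneda F (rp Z) b a) m)"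
   if "b' : ob (fdom ?HF)" "b : ob (fdom ?HF)" "a : ob (mdom (rp ?HZ))" "x : El (hom (fdom ?HF) b' b)" "m : El (car (cmod (cor F) (rp Z)) b a)"
   for b' b a x m
  proof -
   have o: "b' : ob (fdom F)" "b : ob (fdom F)" "a : ob (fdom Z)" "x : El (hom (fdom F) b' b)" "m : El (cob (cor F) (rp Z) b a)"
    using that by simp_all
   have lm: "la (cmod (cor F) (rp Z)) b' b a x m : El (cob (cor F) (rp Z) b' a)"
    using o v corep_comp[OF F RZ] lact_cell[of "cmod (cor F) (rp Z)" b' b a] by simp
   show ?thesis using o v lm bl[of b' b a x m] by (simp add: bar)
  qed
  show "ap (fmap H (fob F b) (fob Z a') \<cdot> yoneda F (rp Z) b a') (ra (cmod (cor F) (rp Z)) b a a' m x)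
   = ra (rp ?HZ) (fob ?HF b) a a' (ap (fmap H (fob F b) (fob Z a) \<cdot> yoneda F (rp Z) b a) m) x"
   if "b : ob (fdom ?HF)" "a : ob (mdom (rp ?HZ))" "a' : ob (mdom (rp ?HZ))" "m : El (car (cmod (cor F) (rp Z)) b a)" "x : El (hom (mdom (rp ?HZ)) a a')"
   for b a a' m x
  proof -
   have o: "b : ob (fdom F)" "a : ob (fdom Z)" "a' : ob (fdom Z)" "x : El (hom (fdom Z) a a')" "m : El (cob (cor F) (rp Z) b a)"
    using that by simp_all
   have lm: "ra (cmod (cor F) (rp Z)) b a a' m x : El (cob (cor F) (rp Z) b a')"
    using o v corep_comp[OF F RZ] ract_cell[of "cmod (cor F) (rp Z)" b a a'] by simp
   show ?thesis using o v lm br[of b a a' x m] by (simp add: bar)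
  qed
 qed (use u in simp_all)
 then show ?thesis using FZ FH by (simp add: hom_mod_map_def hom_mod_def hom_mod_iso_eq)
qed

text \<open>In terms of Yoneda families, composing with \<open>C(F,Z) \<Rightarrow> X(HF,HZ)\<close> is applying \<open>H\<close>.\<close>

lemma hom_mod_map_bar:
 fixes F H Z :: "('u, 'o, 'm, 'c) wfun"
 assumes F: "isfun F" and Z: "isfun Z" and H: "isfun H"
  and FZ: "fcod Z = fcod F" and FH: "fdom H = fcod F"
  and \<alpha>: "\<alpha> : mors M (hom_mod W F Z)"
  and o: "b : ob (fdom F)" "a : ob (fdom Z)" "m : El (car M b a)"
 shows "ap (bar (wfun_comp W H F) (rp (wfun_comp W H Z)) (vc (hom_mod_map W H F Z) \<alpha>) b a) m
  = ap (fmap H (fob F b) (fob Z a)) (ap (bar F (rp Z) \<alpha> b a) m)"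
proof -
 let ?HF = "wfun_comp W H F" and ?HZ = "wfun_comp W H Z"
 have Z': "wfunctor W Z (fdom Z) (fcod F)" and H': "wfunctor W H (fcod F) (fcod H)" using Z H FZ FH by simp_all
 have HF: "isfun ?HF" "isfun ?HZ" "fcod ?HF = mcod (rp ?HZ)"
  using F Z H FZ FH by simp_all
 have \<alpha>': "\<alpha> : mors M (cmod (cor F) (rp Z))" using \<alpha> by (simp add: hom_mod_def)
 note d = Mod_hom2D[OF \<alpha>']
 have RZ: "ismod (rp Z)" "fcod F = mcod (rp Z)" using Z FZ by simp_all
 note h = hom_mod_map_in_hom[OF F Z H FZ FH]
 have o': "b : ob (mcod M)" "a : ob (mdom M)" using o d by simp_all
 let ?e = "app \<alpha> b a m"
 have e: "?e : El (cob (cor F) (rp Z) b a)" using component_El[OF \<alpha>' o' o(3)] by simp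
 have be: "ap (bar F (rp Z) \<alpha> b a) m = ap (yoneda F (rp Z) b a) ?e"
  unfolding bar_def by (rule ap_vcomp) (use d o o' F Z' FZ in simp_all)
 have yE: "ap (yoneda F (rp Z) b a) ?e : El (hom (fcod F) (fob F b) (fob Z a))"
  using e F RZ(1) o FZ Z' by simp
 let ?y = "ap (fmap H (fob F b) (fob Z a)) (ap (yoneda F (rp Z) b a) ?e)"
 have y: "?y : El (hom (fcod H) (fob H (fob F b)) (fob H (fob Z a)))"
  using yE H' F Z' o FZ FH by simp
 have 1: "app (hom_mod_map W H F Z) b a ?e = ap (inv2 W (yoneda ?HF (rp ?HZ) b a)) ?y"
  using o e yE y HF F Z' H' FZ FH
  by (simp add: hom_mod_map_def hom_mod_iso_eq hom_mod_def)
 have 2: "ap (bar ?HF (rp ?HZ) (vc (hom_mod_map W H F Z) \<alpha>) b a) m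
  = ap (yoneda ?HF (rp ?HZ) b a) (app (vc (hom_mod_map W H F Z) \<alpha>) b a m)"
  unfolding bar_def by (rule ap_vcomp)
   (use o o' o(3) d Mod_hom2D[OF h] HF in "simp_all add: hom_mod_def")
 show ?thesis
  unfolding 2 mor_vcomp_el[OF \<alpha> h o' o(3)] 1 be
  using y o HF F Z H FZ FH by simp
qed

end


section \<open>The two equations and weighted colimits on elements\<close>

context enriched_base
begin

declare bar_cell [simp del]

lemma hcomp_hom_el:
 fixes N M :: "('u, 'o, 'm, 'c) wmod"
 assumes "\<tau> : mors N N'" "\<sigma> : mors M M'" "mdom N = mcod M"
  and "c : ob (mcod N)" "a : ob (mdom M)" "b : ob (mcod M)" "n : El (car N c b)" "m : El (car M b a)"
 shows "app (hc \<tau> \<sigma>) c a (cl N M c a b n m)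
  = cl N' M' c a b (app \<tau> c b n) (app \<sigma> b a m)"
proof -
 have s: "msrc \<tau> = N" "mtrg \<tau> = N'" "msrc \<sigma> = M" "mtrg \<sigma> = M'" "\<tau> : cells2 (Mod W)" "\<sigma> : cells2 (Mod W)"
  using assms(1,2) by (simp_all add: Mod_hom2_iff)
 show ?thesis
  by (rule hcomp_el[OF s(6,5) _ s(1)[symmetric] s(3)[symmetric], unfolded s(1-4), OF assms(3-8)])
qed

lemma component_lact_hom:
 assumes \<sigma>: "\<sigma> : mors M N"
  and "b' : ob (mcod M)" "b : ob (mcod M)" "a : ob (mdom M)" "x : El (hom (mcod M) b' b)" "m : El (car M b a)"
 shows "app \<sigma> b' a (la M b' b a x m) = la N b' b a x (app \<sigma> b a m)"
proof -
 note s = Mod_hom2D(1-3)[OF \<sigma>]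
 show ?thesis by (rule component_lact_el[OF s(1) _ _ _ s(2)[symmetric], unfolded s(2,3), OF assms(2-6)])
qed

lemma component_ract_hom:
 assumes \<sigma>: "\<sigma> : mors M N"
  and "b : ob (mcod M)" "a : ob (mdom M)" "a' : ob (mdom M)" "m : El (car M b a)" "x : El (hom (mdom M) a a')"
 shows "app \<sigma> b a' (ra M b a a' m x) = ra N b a a' (app \<sigma> b a m) x"
proof -
 note s = Mod_hom2D(1-3)[OF \<sigma>]
 show ?thesis by (rule component_ract_el[OF s(1) _ _ _ s(2)[symmetric], unfolded s(2,3), OF assms(2-6)])
qed

lemma equation_E2_Mod: "equation_E2 W F Z \<alpha> \<beta> \<longleftrightarrow>
  vc (mod_lunit W (rp Z)) (vc (hc (rep_counit W F) (idm (rp Z)))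
  (vc (inv2 (Mod W) (mod_assoc W (rp F) (cor F) (rp Z)))
   (vc (hc (idm (rp F)) \<alpha>) \<beta>))) = idm (rp Z)"
 unfolding equation_E2_def Mod_sel ..

lemma equation_E1_Mod: "equation_E1 W M F \<alpha> \<beta> \<longleftrightarrow>
  vc (hc (idm (cor F)) \<beta>) \<alpha>
  = vc (mod_assoc W (cor F) (rp F) M)
   (vc (hc (rep_unit W F) (idm M)) (inv2 (Mod W) (mod_lunit W M)))"
 unfolding equation_E1_def Mod_sel ..

lemma id_hom2: "ismod M ==> idm M : mors M M"
 for M :: "('u, 'o, 'm, 'c) wmod"
 by (simp add: Mod_hom2_iff)

context
 fixes F Z :: "('u, 'o, 'm, 'c) wfun" and M :: "('u, 'o, 'm, 'c) wmod"
 assumes F: "isfun F" and Z: "wfunctor W Z (fdom Z) (fcod F)" and ZF: "fcod Z = fcod F"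
  and M: "wmodule W M (fdom Z) (fdom F)" and MA: "mdom M = fdom Z" and MB: "mcod M = fdom F"
begin

lemma Zc: "isfun Z" using Z ZF by simp

lemma Mc: "ismod M" using M MA MB by simp

lemma RF: "ismod (rp F)"
 and CF: "ismod (cor F)"
 and RZ: "ismod (rp Z)"
 and CZ: "ismod (cor Z)"
 using F Zc by simp_all

lemma FZ': "fcod F = mcod (rp Z)" using ZF by simp

lemma FM: "wmodule W (cmod (rp F) M) (fdom Z) (fcod F)"
 using wmodule_mod_comp[OF RF Mc] MA MB by simp

lemma FMc: "ismod (cmod (rp F) M)"
 using FM MA by simp

lemma FM_El:
 assumes "c : ob (fcod F)" "a : ob (fdom Z)" "b : ob (fdom F)" "f : El (hom (fcod F) c (fob F b))" "m : El (car M b a)"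
 shows "cl (rp F) M c a b f m : El (cob (rp F) M c a)"
 using assms coend_El[OF RF Mc, of c a b f m] MA MB by simp

lemma FM_act:
 assumes "c : ob (fcod F)" "a : ob (fdom Z)" "b : ob (fdom F)" "f : El (hom (fcod F) c (fob F b))" "m : El (car M b a)"
 shows "c' : ob (fcod F) ==> x : El (hom (fcod F) c' c) ==>
   la (cmod (rp F) M) c' c a x (cl (rp F) M c a b f m)
   = cl (rp F) M c' a b (cm (fcod F) c' c (fob F b) x f) m"
  "a' : ob (fdom Z) ==> y : El (hom (fdom Z) a a') ==>
   ra (cmod (rp F) M) c a a' (cl (rp F) M c a b f m) y
   = cl (rp F) M c a' b f (ra M b a a' m y)"
 using assms lact_mod_comp_el[OF RF Mc, of c' c a b x f m] ract_mod_comp_el[OF RF Mc, of c a a' b y f m] MA MB by simp_all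

lemma FM_bal:
 assumes "c : ob (fcod F)" "a : ob (fdom Z)" "b : ob (fdom F)" "b' : ob (fdom F)" "f : El (hom (fcod F) c (fob F b))"
  "x : El (hom (fdom F) b b')" "m : El (car M b' a)"
 shows "cl (rp F) M c a b' (cm (fcod F) c (fob F b) (fob F b') f (ap (fmap F b b') x)) m
  = cl (rp F) M c a b f (la M b b' a x m)"
 using assms coend_bal[OF RF Mc, of c a b b' f x m] MA MB F by simp

lemma FM_gens:
 assumes "c : ob (fcod F)" "a : ob (fdom Z)"
 shows "generates (coend_El_gens (rp F) M c a) (cob (rp F) M c a)"
 using generates_coend_El[OF RF Mc, of c a] assms MA MB by simp

lemma FM_gensE:
 assumes "x : coend_El_gens (rp F) M c a"
 obtains b f m where "b : ob (fdom F)" "f : El (hom (fcod F) c (fob F b))" "m : El (car M b a)"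
  "x = cl (rp F) M c a b f m"
 using assms by (auto elim!: coend_El_gensE simp: MB)

subsection \<open>The mate of a morphism into \<open>C(F,1) \<circ> Z\<close>\<close>

text \<open>The composite \<open>F \<circ> M \<Rightarrow> F \<circ> C(F,1) \<circ> Z \<Rightarrow> Z\<close>.\<close>

definition mate where
 "mate \<alpha> = vc (mod_lunit W (rp Z)) (vc (hc (rep_counit W F) (idm (rp Z)))
   (vc (inv2 (Mod W) (mod_assoc W (rp F) (cor F) (rp Z))) (hc (idm (rp F)) \<alpha>)))"

context
 fixes \<alpha> :: "('u, 'o, 'm, 'c) wmor"
 assumes \<alpha>: "\<alpha> : mors M (cmod (cor F) (rp Z))"
begin

lemma bar_El:
 assumes "b : ob (fdom F)" "a : ob (fdom Z)" "m : El (car M b a)"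
 shows "ap (bar F (rp Z) \<alpha> b a) m : El (hom (fcod F) (fob F b) (fob Z a))"
proof -
 note c = bar_cell[OF F RZ FZ' \<alpha> assms(1), unfolded rep_sel, OF assms(2)]
 show ?thesis unfolding ZF[symmetric]
  by (rule ap_El[OF c(1) _ c(3)[symmetric]]) (simp only: c(2) assms(3))
qed

lemma mate_steps:
 "hc (idm (rp F)) \<alpha> : mors (cmod (rp F) M) (cmod (rp F) (cmod (cor F) (rp Z)))"
 "inv2 (Mod W) (mod_assoc W (rp F) (cor F) (rp Z))
  : mors (cmod (rp F) (cmod (cor F) (rp Z))) (cmod (cmod (rp F) (cor F)) (rp Z))"
 "hc (rep_counit W F) (idm (rp Z)) : mors (cmod (cmod (rp F) (cor F)) (rp Z))
   (cmod (mod_id (mcod (rp Z))) (rp Z))"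
 "mod_lunit W (rp Z) : mors (cmod (mod_id (mcod (rp Z))) (rp Z)) (rp Z)"
proof -
 have p: "mdom (rp F) = mcod (cor F)" "mdom (cor F) = mcod (rp Z)" using ZF by simp_all
 show "hc (idm (rp F)) \<alpha> : mors (cmod (rp F) M) (cmod (rp F) (cmod (cor F) (rp Z)))"
  by (rule mor_hcomp_in[OF _ \<alpha>]) (use RF MB in "simp_all add: Mod_hom2_iff")
 show "inv2 (Mod W) (mod_assoc W (rp F) (cor F) (rp Z))
  : mors (cmod (rp F) (cmod (cor F) (rp Z))) (cmod (cmod (rp F) (cor F)) (rp Z))"
  by (rule Mod_inv2(1)[OF assoc_iso2[OF RF CF RZ p] assoc_in_hom[OF RF CF RZ p]])
 show "hc (rep_counit W F) (idm (rp Z)) : mors (cmod (cmod (rp F) (cor F)) (rp Z))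
   (cmod (mod_id (mcod (rp Z))) (rp Z))"
  by (rule mor_hcomp_in) (use rep_counit_in_hom[OF F] RZ ZF in "simp_all add: Mod_hom2_iff")
 show "mod_lunit W (rp Z) : mors (cmod (mod_id (mcod (rp Z))) (rp Z)) (rp Z)"
  by (rule lunit_in_hom[OF RZ])
qed

lemma mate_in_hom: "mate \<alpha> : mors (cmod (rp F) M) (rp Z)"
 unfolding mate_def using mate_steps mor_vcomp_in by blast

lemma mate_el:
 assumes o: "c : ob (fcod F)" "a : ob (fdom Z)" "b : ob (fdom F)" and f: "f : El (hom (fcod F) c (fob F b))" and m: "m : El (car M b a)"
 shows "app (mate \<alpha>) c a (cl (rp F) M c a b f m)
  = cm (fcod F) c (fob F b) (fob Z a) f (ap (bar F (rp Z) \<alpha> b a) m)"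
proof -
 note u = o F Z ZF MA MB Mod_hom2D(1-5)[OF \<alpha>] M
 have p: "mdom (rp F) = mcod (cor F)" "mdom (cor F) = mcod (rp Z)" using ZF by simp_all
 let ?x0 = "cl (rp F) M c a b f m"
 let ?y = "ap (bar F (rp Z) \<alpha> b a) m"
 let ?x1 = "cl (rp F) (cmod (cor F) (rp Z)) c a b f (cl (cor F) (rp Z) b a (fob F b) (idpt F b) ?y)"
 let ?x2 = "cl (cmod (rp F) (cor F)) (rp Z) c a (fob F b) (cl (rp F) (cor F) c (fob F b) b f (idpt F b)) ?y"
 let ?x3 = "cl (mod_id (mcod (rp Z))) (rp Z) c a (fob F b) f ?y"
 note s1 = mate_steps(1) and s2 = mate_steps(2) and s3 = mate_steps(3) and s4 = mate_steps(4)
 have y: "?y : El (hom (fcod F) (fob F b) (fob Z a))" using bar_El o m by simp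
 have i: "idpt F b : El (hom (fcod F) (fob F b) (fob F b))" using u by simp
 have x0: "?x0 : El (cob (rp F) M c a)" using FM_El o f m by simp
 have cm: "component \<alpha> b a : cells2 W" using u by simp
 have 1: "app (hc (idm (rp F)) \<alpha>) c a ?x0 = ?x1"
  using u f m component_bar[OF F RZ FZ' \<alpha>, of b a m] by simp
 have 2: "app (inv2 (Mod W) (mod_assoc W (rp F) (cor F) (rp Z))) c a ?x1 = ?x2"
  using assoc_inv_el[OF RF CF RZ p, of c a b "fob F b" f "idpt F b" ?y] u f y i by simp
 note cr = rep_counit_in_hom[OF F]
 have fi: "app (rep_counit W F) c (fob F b) (cl (rp F) (cor F) c (fob F b) b f (idpt F b)) = f"
  using rep_counit_el(2)[OF F, of c "fob F b" b f "idpt F b"] u f i by simp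
 have e2: "cl (rp F) (cor F) c (fob F b) b f (idpt F b) : El (cob (rp F) (cor F) c (fob F b))"
  using coend_El[OF RF CF, of c "fob F b" b f "idpt F b"] u f i by simp
 have 3: "app (hc (rep_counit W F) (idm (rp Z))) c a ?x2 = ?x3"
 proof -
  have "app (idm (rp Z)) (fob F b) a ?y = ?y" using o F y Z ZF by simp
  then show ?thesis
   using hcomp_hom_el[OF cr id_hom2[OF RZ], of c a "fob F b" "cl (rp F) (cor F) c (fob F b) b f (idpt F b)" ?y]
    fi e2 y o F ZF by simp
 qed
 have 4: "app (mod_lunit W (rp Z)) c a ?x3 = cm (fcod F) c (fob F b) (fob Z a) f ?y"
  using lunit_component(2)[OF RZ, of c a "fob F b" f ?y] u f y by simp
 have oo: "c : ob (mcod (cmod (rp F) M))" "a : ob (mdom (cmod (rp F) M))"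
  using o MA by simp_all
 have x1: "?x1 : El (car (cmod (rp F) (cmod (cor F) (rp Z))) c a)"
  using component_El[OF s1 oo, of ?x0] x0 1 by simp
 have oo1: "c : ob (mcod (cmod (rp F) (cmod (cor F) (rp Z))))" "a : ob (mdom (cmod (rp F) (cmod (cor F) (rp Z))))"
  using o by simp_all
 have x0': "?x0 : El (car (cmod (rp F) M) c a)" using x0 by simp
 note v12 = mor_vcomp_in[OF s1 s2] and v123 = mor_vcomp_in[OF mor_vcomp_in[OF s1 s2] s3]
 show ?thesis
  unfolding mate_def mor_vcomp_el[OF v123 s4 oo x0'] mor_vcomp_el[OF v12 s3 oo x0'] mor_vcomp_el[OF s1 s2 oo x0'] 1 2 3 4 ..
qed

text \<open>The composite in the second equation is the mate of \<open>\<alpha>\<close> after \<open>\<beta>\<close>.\<close>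

lemma E2_iff:
 assumes \<beta>: "\<beta> : mors (rp Z) (cmod (rp F) M)"
 shows "equation_E2 W F Z \<alpha> \<beta> \<longleftrightarrow> vc (mate \<alpha>) \<beta> = idm (rp Z)"
proof -
 note s1 = mate_steps(1) and s2 = mate_steps(2) and s3 = mate_steps(3) and s4 = mate_steps(4)
 note v1 = mor_vcomp_in[OF s1 s2] and v2 = mor_vcomp_in[OF mor_vcomp_in[OF s1 s2] s3]
 let ?l = "mod_lunit W (rp Z)" and ?e = "hc (rep_counit W F) (idm (rp Z))"
  and ?i = "inv2 (Mod W) (mod_assoc W (rp F) (cor F) (rp Z))" and ?w = "hc (idm (rp F)) \<alpha>"
 have "vc (mate \<alpha>) \<beta> = vc ?l (vc (vc ?e (vc ?i ?w)) \<beta>)"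
  unfolding mate_def by (rule mor_vcomp_assoc[OF \<beta> v2 s4])
 also have "vc (vc ?e (vc ?i ?w)) \<beta> = vc ?e (vc (vc ?i ?w) \<beta>)"
  by (rule mor_vcomp_assoc[OF \<beta> v1 s3])
 also have "vc (vc ?i ?w) \<beta> = vc ?i (vc ?w \<beta>)"
  by (rule mor_vcomp_assoc[OF \<beta> s1 s2])
 finally have "vc (mate \<alpha>) \<beta> = vc ?l (vc ?e (vc ?i (vc ?w \<beta>)))" .
 then show ?thesis by (simp only: equation_E2_Mod)
qed

text \<open>Evaluated at \<open>m\<close>, the two sides of the first equation are classes \<open>1 \<otimes> \<beta>(\<alpha>(m))\<close> and
 \<open>1 \<otimes> [1 \<otimes> m]\<close>; the Yoneda isomorphism removes the outer \<open>1\<close>.\<close>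

lemma E1_iff:
 assumes \<beta>: "\<beta> : mors (rp Z) (cmod (rp F) M)"
 shows "equation_E1 W M F \<alpha> \<beta> \<longleftrightarrow> (ALL b:ob (fdom F). ALL a:ob (fdom Z). ALL m:El (car M b a).
  app \<beta> (fob F b) a (ap (bar F (rp Z) \<alpha> b a) m) = cl (rp F) M (fob F b) a b (idpt F b) m)"
  (is "_ \<longleftrightarrow> ?R")
proof -
 note u = F Z ZF MA MB Mod_hom2D(1-5)[OF \<alpha>] M
 let ?N = "cmod (rp F) M"
 let ?L = "vc (hc (idm (cor F)) \<beta>) \<alpha>"
 have p: "mdom (cor F) = mcod (rp F)" "mdom (rp F) = mcod M" using MB by simp_all
 have FN: "fcod F = mcod ?N" by simp
 have ci: "idm (cor F) : mors (cor F) (cor F)" "idm M : mors M M"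
  using CF Mc by (simp_all add: Mod_hom2_iff)
 have h1: "hc (idm (cor F)) \<beta> : mors (cmod (cor F) (rp Z)) (cmod (cor F) ?N)"
  by (rule mor_hcomp_in[OF ci(1) \<beta>]) (use ZF in simp)
 note L = mor_vcomp_in[OF \<alpha> h1]
 have h2: "hc (rep_unit W F) (idm M) : mors (cmod (mod_id (mcod M)) M) (cmod (cmod (cor F) (rp F)) M)"
  by (rule mor_hcomp_in) (use rep_unit_in_hom[OF F] ci MB in simp_all)
 note h3 = Mod_inv2(1)[OF lunit_inverse(1)[OF Mc] lunit_in_hom[OF Mc]]
 note h4 = assoc_in_hom[OF CF RF Mc p]
 let ?Rm = "vc (mod_assoc W (cor F) (rp F) M) (vc (hc (rep_unit W F) (idm M)) (inv2 (Mod W) (mod_lunit W M)))"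
 note v = mor_vcomp_in[OF h3 h2]
 note R = mor_vcomp_in[OF v h4]
 let ?n = "%b a m. cl (rp F) M (fob F b) a b (idpt F b) m"
 have Lel: "app ?L b a m = cl (cor F) ?N b a (fob F b) (idpt F b) (app \<beta> (fob F b) a (ap (bar F (rp Z) \<alpha> b a) m))"
  if o: "b : ob (fdom F)" "a : ob (fdom Z)" "m : El (car M b a)" for b a m
 proof -
  have oo: "b : ob (mcod M)" "a : ob (mdom M)" using o u by simp_all
  have cb: "app \<alpha> b a m = cl (cor F) (rp Z) b a (fob F b) (idpt F b) (ap (bar F (rp Z) \<alpha> b a) m)"
   using component_bar[OF F RZ FZ' \<alpha>, of b a m] o by simp
  show ?thesis
   unfolding mor_vcomp_el[OF \<alpha> h1 oo o(3)] cb
   using hcomp_hom_el[OF id_hom2[OF CF] \<beta>, of b a "fob F b" "idpt F b" "ap (bar F (rp Z) \<alpha> b a) m"]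
    F ZF o bar_El by simp
 qed
 have Rel: "app ?Rm b a m = cl (cor F) ?N b a (fob F b) (idpt F b) (?n b a m)"
  if o: "b : ob (fdom F)" "a : ob (fdom Z)" "m : El (car M b a)" for b a m
 proof -
  have oo: "b : ob (mcod M)" "a : ob (mdom M)" using o u by simp_all
  have i: "idpt F b : El (hom (fcod F) (fob F b) (fob F b))" using u o by simp
  have ub: "pt (unt (fdom F) b) : El (hom (fdom F) b b)" using u o by simp
  have 1: "app (inv2 (Mod W) (mod_lunit W M)) b a m = cl (mod_id (mcod M)) M b a b (pt (unt (mcod M) b)) m"
   by (rule lunit_inverse(2)[OF Mc oo o(3)])
  have 2: "app (rep_unit W F) b b (pt (unt (fdom F) b)) = cl (cor F) (rp F) b b (fob F b) (idpt F b) (idpt F b)"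
   using rep_unit_el[OF F o(1) o(1) ub] u o by simp
  have 3: "app (hc (rep_unit W F) (idm M)) b a (cl (mod_id (mcod M)) M b a b (pt (unt (mcod M) b)) m)
   = cl (cmod (cor F) (rp F)) M b a b (cl (cor F) (rp F) b b (fob F b) (idpt F b) (idpt F b)) m"
   using hcomp_hom_el[OF rep_unit_in_hom[OF F] id_hom2[OF Mc], of b a b "pt (unt (fdom F) b)" m]
    M MA MB o ub 2 by simp
  have 4: "ap (component (mod_assoc W (cor F) (rp F) M) b a)
    (cl (cmod (cor F) (rp F)) M b a b (cl (cor F) (rp F) b b (fob F b) (idpt F b) (idpt F b)) m)
   = cl (cor F) ?N b a (fob F b) (idpt F b) (?n b a m)"
   using assoc_component(2)[OF CF RF Mc p, of b a "fob F b" b "idpt F b" "idpt F b" m] u o i by simp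
  show ?thesis
   unfolding mor_vcomp_el[OF v h4 oo o(3)] mor_vcomp_el[OF h3 h2 oo o(3)] 1 3 4 ..
 qed
 have E: "equation_E1 W M F \<alpha> \<beta> \<longleftrightarrow> ?L = ?Rm" by (rule equation_E1_Mod)
 show ?thesis
 proof
  assume "equation_E1 W M F \<alpha> \<beta>"
  then have eq: "?L = ?Rm" using E by simp
  show ?R
  proof (intro ballI)
   fix b a m assume o: "b : ob (fdom F)" "a : ob (fdom Z)" "m : El (car M b a)"
   let ?y = "app \<beta> (fob F b) a (ap (bar F (rp Z) \<alpha> b a) m)"
   have y: "?y : El (cob (rp F) M (fob F b) a)"
    using component_El[OF \<beta>, of "fob F b" a "ap (bar F (rp Z) \<alpha> b a) m"] bar_El[OF o] o u by simp
   have n: "?n b a m : El (cob (rp F) M (fob F b) a)" using FM_El[of "fob F b" a b "idpt F b" m] u o by simp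
   have aN: "a : ob (mdom ?N)" using o MA by simp
   have 1: "cl (cor F) ?N b a (fob F b) (idpt F b) ?y = cl (cor F) ?N b a (fob F b) (idpt F b) (?n b a m)"
    unfolding Lel[OF o, symmetric] Rel[OF o, symmetric] eq ..
   have 2: "ap (yoneda F ?N b a) (cl (cor F) ?N b a (fob F b) (idpt F b) ?y) = ?y"
    by (rule yoneda_one[OF F FMc FN o(1) aN _ FN]) (simp only: y mod_comp_sel)
   have 3: "ap (yoneda F ?N b a) (cl (cor F) ?N b a (fob F b) (idpt F b) (?n b a m)) = ?n b a m"
    by (rule yoneda_one[OF F FMc FN o(1) aN _ FN]) (simp only: n mod_comp_sel)
   show "?y = ?n b a m" using arg_cong[OF 1, of "ap (yoneda F ?N b a)"] unfolding 2 3 .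
  qed
 next
  assume r: ?R
  have "?L = ?Rm"
  proof (rule mor_eqI[OF L R])
   fix b a m assume "b : ob (mcod M)" "a : ob (mdom M)" and m: "m : El (car M b a)"
   then have o: "b : ob (fdom F)" "a : ob (fdom Z)" using MA MB by simp_all
   show "app ?L b a m = app ?Rm b a m"
    unfolding Lel[OF o m] Rel[OF o m] r[rule_format, OF o m] ..
  qed
  then show "equation_E1 W M F \<alpha> \<beta>" using E by simp
 qed
qed

subsection \<open>The module morphism comparing a colimit with a right lifting\<close>

text \<open>The module morphism whose transpose must be invertible for \<open>\<alpha>\<close> to exhibit a weighted
 colimit.\<close>

definition colimit_cell where
 "colimit_cell = vc (mod_runit W (cor F)) (vc (hc (idm (cor F)) (rep_counit W Z))
   (vc (mod_assoc W (cor F) (rp Z) (cor Z)) (hc \<alpha> (idm (cor Z)))))"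

lemma colimit_steps:
 "hc \<alpha> (idm (cor Z)) : mors (cmod M (cor Z)) (cmod (cmod (cor F) (rp Z)) (cor Z))"
 "mod_assoc W (cor F) (rp Z) (cor Z) : mors (cmod (cmod (cor F) (rp Z)) (cor Z))
   (cmod (cor F) (cmod (rp Z) (cor Z)))"
 "hc (idm (cor F)) (rep_counit W Z) : mors (cmod (cor F) (cmod (rp Z) (cor Z)))
   (cmod (cor F) (mod_id (mdom (cor F))))"
 "mod_runit W (cor F) : mors (cmod (cor F) (mod_id (mdom (cor F)))) (cor F)"
proof -
 have p: "mdom (cor F) = mcod (rp Z)" "mdom (rp Z) = mcod (cor Z)" using ZF by simp_all
 have ci: "idm (cor F) : mors (cor F) (cor F)" "idm (cor Z) : mors (cor Z) (cor Z)"
  using CF CZ by (simp_all add: Mod_hom2_iff)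
 show "hc \<alpha> (idm (cor Z)) : mors (cmod M (cor Z)) (cmod (cmod (cor F) (rp Z)) (cor Z))"
  by (rule mor_hcomp_in[OF \<alpha> ci(2)]) (use MA in simp)
 show "mod_assoc W (cor F) (rp Z) (cor Z) : mors (cmod (cmod (cor F) (rp Z)) (cor Z))
   (cmod (cor F) (cmod (rp Z) (cor Z)))"
  by (rule assoc_in_hom[OF CF RZ CZ p])
 show "hc (idm (cor F)) (rep_counit W Z) : mors (cmod (cor F) (cmod (rp Z) (cor Z)))
   (cmod (cor F) (mod_id (mdom (cor F))))"
  by (rule mor_hcomp_in[OF ci(1)]) (use rep_counit_in_hom[OF Zc] ZF in simp_all)
 show "mod_runit W (cor F) : mors (cmod (cor F) (mod_id (mdom (cor F)))) (cor F)"
  by (rule runit_in_hom[OF CF])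
qed

lemma colimit_cell_in_hom: "colimit_cell : mors (cmod M (cor Z)) (cor F)"
 unfolding colimit_cell_def using colimit_steps mor_vcomp_in by blast

lemma colimit_cell_el:
 assumes o: "b : ob (fdom F)" "a : ob (fdom Z)" "c : ob (fcod F)" and m: "m : El (car M b a)" and g: "g : El (hom (fcod F) (fob Z a) c)"
 shows "app colimit_cell b c (cl M (cor Z) b c a m g)
  = cm (fcod F) (fob F b) (fob Z a) c (ap (bar F (rp Z) \<alpha> b a) m) g"
proof -
 note u = o F Z ZF MA MB Mod_hom2D(1-5)[OF \<alpha>] M
 have p: "mdom (cor F) = mcod (rp Z)" "mdom (rp Z) = mcod (cor Z)" using ZF by simp_all
 note s1 = colimit_steps(1) and s2 = colimit_steps(2) and s3 = colimit_steps(3) and s4 = colimit_steps(4)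
 let ?y = "ap (bar F (rp Z) \<alpha> b a) m"
 let ?yg = "cm (fcod F) (fob F b) (fob Z a) c ?y g"
 let ?x0 = "cl M (cor Z) b c a m g"
 let ?i = "idpt F b"
 let ?x1 = "cl (cmod (cor F) (rp Z)) (cor Z) b c a (cl (cor F) (rp Z) b a (fob F b) ?i ?y) g"
 let ?x2 = "cl (cor F) (cmod (rp Z) (cor Z)) b c (fob F b) ?i (cl (rp Z) (cor Z) (fob F b) c a ?y g)"
 let ?x3 = "cl (cor F) (mod_id (mdom (cor F))) b c (fob F b) ?i ?yg"
 have y: "?y : El (hom (fcod F) (fob F b) (fob Z a))" using bar_El o m by simp
 have i: "?i : El (hom (fcod F) (fob F b) (fob F b))" using u by simp
 have yg: "?yg : El (hom (fcod F) (fob F b) c)" using u y g by simp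
 have x0: "?x0 : El (car (cmod M (cor Z)) b c)"
  using coend_El[OF Mc CZ, of b c a m g] u m g by simp
 have oo: "b : ob (mcod (cmod M (cor Z)))" "c : ob (mdom (cmod M (cor Z)))" using u by simp_all
 have 1: "app (hc \<alpha> (idm (cor Z))) b c ?x0 = ?x1"
  using hcomp_hom_el[OF \<alpha> id_hom2[OF CZ], of b c a m g] component_bar[OF F RZ FZ' \<alpha>, of b a m] M MA MB Z ZF F o m g by simp
 have 2: "app (mod_assoc W (cor F) (rp Z) (cor Z)) b c ?x1 = ?x2"
  using assoc_component(2)[OF CF RZ CZ p, of b c "fob F b" a ?i ?y g] u y g i by simp
 have e: "cl (rp Z) (cor Z) (fob F b) c a ?y g : El (cob (rp Z) (cor Z) (fob F b) c)"
  using coend_El[OF RZ CZ, of "fob F b" c a ?y g] u y g by simp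
 have k: "app (rep_counit W Z) (fob F b) c (cl (rp Z) (cor Z) (fob F b) c a ?y g) = ?yg"
  using rep_counit_el(2)[OF Zc, of "fob F b" c a ?y g] u y g by simp
 have 3: "app (hc (idm (cor F)) (rep_counit W Z)) b c ?x2 = ?x3"
  using hcomp_hom_el[OF id_hom2[OF CF] rep_counit_in_hom[OF Zc], of b c "fob F b" ?i
    "cl (rp Z) (cor Z) (fob F b) c a ?y g"] F ZF o e k i by simp
 have 4: "app (mod_runit W (cor F)) b c ?x3 = ?yg"
  using runit_component(2)[OF CF, of b c "fob F b" ?i ?yg] u i yg y g by simp
 note v12 = mor_vcomp_in[OF s1 s2] and v123 = mor_vcomp_in[OF mor_vcomp_in[OF s1 s2] s3]
 show ?thesis
  unfolding colimit_cell_def mor_vcomp_el[OF v123 s4 oo x0] mor_vcomp_el[OF v12 s3 oo x0] mor_vcomp_el[OF s1 s2 oo x0] 1 2 3 4 ..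
qed

end

subsection \<open>Morphisms out of \<open>F \<circ> M\<close>\<close>

text \<open>By the Yoneda lemma a morphism out of \<open>F \<circ> M\<close> is determined by its values on the
 classes \<open>[1 \<otimes> m]\<close>.\<close>

lemma unmate:
 assumes \<sigma>: "\<sigma> : mors (cmod (rp F) M) (rp Z)"
 shows "\<exists>\<alpha>\<in>mors M (cmod (cor F) (rp Z)). mate \<alpha> = \<sigma>"
proof -
 note u = F Z ZF MA MB M Mod_hom2D(1-3)[OF \<sigma>]
 let ?N = "cmod (rp F) M"
 define g where "g b a = component \<sigma> (fob F b) a \<cdot> cin (rp F) M (fob F b) a b
   \<cdot> (unt (fcod F) (fob F b) \<ast> \<iota> (car M b a)) \<cdot> inv2 W (\<l> (car M b a))" for b a
 let ?n = "%b a m. cl (rp F) M (fob F b) a b (idpt F b) m"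
 have cin: "cin (rp F) M c a b : cells2 W" "dom2 W (cin (rp F) M c a b) = hom (fcod F) c (fob F b) \<star> car M b a"
   "cod2 W (cin (rp F) M c a b) = cob (rp F) M c a"
  if "c : ob (fcod F)" "b : ob (fdom F)" "a : ob (fdom Z)" for c b a
  using coend_in_cell[OF RF Mc, of c a b] that MA MB by simp_all
 have gin: "g b a : hom2 W (car M b a) (hom (fcod F) (fob F b) (fob Z a))" if "b : ob (fdom F)" "a : ob (fdom Z)" for b a
  using that u cin[of "fob F b" b a] by (simp add: g_def hom2_iff)
 have gel: "ap (g b a) m = app \<sigma> (fob F b) a (?n b a m)" if "b : ob (fdom F)" "a : ob (fdom Z)" "m : El (car M b a)" for b a m
  using that u cin[of "fob F b" b a] by (simp add: g_def)
 have nE: "?n b a m : El (cob (rp F) M (fob F b) a)" if "b : ob (fdom F)" "a : ob (fdom Z)" "m : El (car M b a)" for b a m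
  using FM_El[of "fob F b" a b "idpt F b" m] that u by simp
 let ?\<alpha> = "mk_wmor M (cmod (cor F) (rp Z)) (%b a. inv2 W (yoneda F (rp Z) b a) \<cdot> g b a)"
 have \<alpha>: "?\<alpha> : mors M (cmod (cor F) (rp Z))"
 proof (rule into_corep_comp[OF F RZ FZ' Mc MB])
  fix b' b a x m assume "b' : ob (fdom F)" "b : ob (fdom F)" "a : ob (mdom (rp Z))" "x : El (hom (fdom F) b' b)" "m : El (car M b a)"
  then have *: "b' : ob (fdom F)" "b : ob (fdom F)" "a : ob (fdom Z)" "x : El (hom (fdom F) b' b)" "m : El (car M b a)" by simp_all
  have fx: "ap (fmap F b' b) x : El (hom (fcod F) (fob F b') (fob F b))" using * u by simp
  have "?n b' a (la M b' b a x m) = cl (rp F) M (fob F b') a b (ap (fmap F b' b) x) m"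
   using FM_bal[of "fob F b'" a b' b "idpt F b'" x m] * u fx by simp
  also have "\<dots> = la ?N (fob F b') (fob F b) a (ap (fmap F b' b) x) (?n b a m)"
   using FM_act(1)[of "fob F b" a b "idpt F b" m "fob F b'" "ap (fmap F b' b) x"] * u fx by simp
  finally have 1: "?n b' a (la M b' b a x m) = la ?N (fob F b') (fob F b) a (ap (fmap F b' b) x) (?n b a m)" .
  have lm: "la M b' b a x m : El (car M b' a)" using * u by simp
  show "ap (g b' a) (la M b' b a x m) = la (rp Z) (fob F b') (fob F b) a (ap (fmap F b' b) x) (ap (g b a) m)"
   unfolding gel[OF *(1,3) lm] gel[OF *(2,3,5)] 1
   using component_lact_hom[OF \<sigma>, of "fob F b'" "fob F b" a "ap (fmap F b' b) x" "?n b a m"] * u fx nE by simp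
 next
  fix b a a' m x assume "b : ob (fdom F)" "a : ob (mdom (rp Z))" "a' : ob (mdom (rp Z))" "m : El (car M b a)" "x : El (hom (mdom (rp Z)) a a')"
  then have *: "b : ob (fdom F)" "a : ob (fdom Z)" "a' : ob (fdom Z)" "m : El (car M b a)" "x : El (hom (fdom Z) a a')" by simp_all
  have 1: "?n b a' (ra M b a a' m x) = ra ?N (fob F b) a a' (?n b a m) x"
   using FM_act(2)[of "fob F b" a b "idpt F b" m a' x] * u by simp
  have lm: "ra M b a a' m x : El (car M b a')" using * u by simp
  show "ap (g b a') (ra M b a a' m x) = ra (rp Z) (fob F b) a a' (ap (g b a) m) x"
   unfolding gel[OF *(1,3) lm] gel[OF *(1,2,4)] 1
   using component_ract_hom[OF \<sigma>, of "fob F b" a a' "?n b a m" x] * u nE by simp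
 qed (use gin MA ZF in auto)
 have ba: "ap (bar F (rp Z) ?\<alpha> b a) m = app \<sigma> (fob F b) a (?n b a m)"
  if o: "b : ob (fdom F)" "a : ob (fdom Z)" "m : El (car M b a)" for b a m
 proof -
  have gm: "ap (g b a) m : El (hom (fcod F) (fob F b) (fob Z a))"
   using hom2D[OF gin[OF o(1,2)]] o by simp
  have gd: "g b a : cells2 W" "dom2 W (g b a) = car M b a" "cod2 W (g b a) = hom (fcod F) (fob F b) (fob Z a)"
   using hom2D[OF gin[OF o(1,2)]] by simp_all
  have "ap (bar F (rp Z) ?\<alpha> b a) m = ap (yoneda F (rp Z) b a) (ap (inv2 W (yoneda F (rp Z) b a)) (ap (g b a) m))"
   using o u gd by (simp add: bar_def)
  also have "\<dots> = ap (g b a) m"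
   using o u gm by simp
  finally show ?thesis using gel[OF o] by simp
 qed
 have "mate ?\<alpha> = \<sigma>"
 proof (rule mor_eqI_gen[OF mate_in_hom[OF \<alpha>] \<sigma>, where G = "coend_El_gens (rp F) M"])
  fix c a assume "c : ob (mcod ?N)" "a : ob (mdom ?N)"
  then have o: "c : ob (fcod F)" "a : ob (fdom Z)" using MA by simp_all
  show "generates (coend_El_gens (rp F) M c a) (car ?N c a)" using FM_gens[OF o] by simp
  fix x assume "x : coend_El_gens (rp F) M c a"
  then obtain b f m where x: "b : ob (fdom F)" "f : El (hom (fcod F) c (fob F b))" "m : El (car M b a)" "x = cl (rp F) M c a b f m"
   by (rule FM_gensE)
  have fn: "x = la ?N c (fob F b) a f (?n b a m)"
   using FM_act(1)[of "fob F b" a b "idpt F b" m c f] x o u by simp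
  have "app \<sigma> c a x = cm (fcod F) c (fob F b) (fob Z a) f (app \<sigma> (fob F b) a (?n b a m))"
   unfolding fn using component_lact_hom[OF \<sigma>, of c "fob F b" a f "?n b a m"] o x nE u by simp
  then show "app (mate ?\<alpha>) c a x = app \<sigma> c a x"
   using mate_el[OF \<alpha> o x(1-3)] ba[OF x(1) o(2) x(3)] x(4) by simp
 qed
 then show ?thesis using \<alpha> by blast
qed

end
end


section \<open>Right liftings of modules\<close>

context enriched_base
begin

text \<open>The equation that defines a lift, read on generating elements of \<open>M \<circ> L\<close>.\<close>

lemma lift_eq_iff:
 fixes M K R L :: "('u, 'o, 'm, 'c) wmod"
 assumes M: "ismod M"
  and \<rho>: "\<rho> : mors (cmod M R) K" and MR: "mcod R = mdom M"
  and \<tau>: "\<tau> : mors L R" and \<sigma>: "\<sigma> : mors (cmod M L) K"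
 shows "vc \<rho> (hc (idm M) \<tau>) = \<sigma> \<longleftrightarrow>
  (ALL b:ob (mcod M). ALL a:ob (mdom M). ALL c:ob (mdom L). ALL m:El (car M b a). ALL l:El (car L a c).
   app \<rho> b c (cl M R b c a m (app \<tau> a c l))
   = app \<sigma> b c (cl M L b c a m l))" (is "?eq \<longleftrightarrow> ?R")
proof -
 note t = Mod_hom2D[OF \<tau>]
 have L: "ismod L" and LM: "mdom M = mcod L" using t MR by simp_all
 have h: "hc (idm M) \<tau> : mors (cmod M L) (cmod M R)"
  by (rule mor_hcomp_in[OF id_hom2[OF M] \<tau> LM])
 note v = mor_vcomp_in[OF h \<rho>]
 have e: "app (vc \<rho> (hc (idm M) \<tau>)) b c (cl M L b c a m l)
  = app \<rho> b c (cl M R b c a m (app \<tau> a c l))"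
  if o: "b : ob (mcod M)" "a : ob (mdom M)" "c : ob (mdom L)" and m: "m : El (car M b a)" and l: "l : El (car L a c)" for b a c m l
 proof -
  have a: "a : ob (mcod L)" using o LM by simp
  have x: "cl M L b c a m l : El (car (cmod M L) b c)"
   using coend_El[OF M L LM o(1,3) a m l] by simp
  have oo: "b : ob (mcod (cmod M L))" "c : ob (mdom (cmod M L))" using o by simp_all
  have i: "app (idm M) b a m = m" using o m by simp
  show ?thesis
   unfolding mor_vcomp_el[OF h \<rho> oo x] hcomp_hom_el[OF id_hom2[OF M] \<tau> LM o(1,3) a m l] i ..
 qed
 show ?thesis
 proof
  assume eq: ?eq
  show ?R by (intro ballI) (use e[unfolded eq] in metis)
 next
  assume r: ?R
  show ?eq
  proof (rule mor_eqI_gen[OF v \<sigma>, where G = "coend_El_gens M L"])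
   fix b c assume "b : ob (mcod (cmod M L))" "c : ob (mdom (cmod M L))"
   then have o: "b : ob (mcod M)" "c : ob (mdom L)" by simp_all
   show "generates (coend_El_gens M L b c) (car (cmod M L) b c)"
    using generates_coend_El[OF M L LM o] by simp
   fix x assume "x : coend_El_gens M L b c"
   then obtain a m l where x: "a : ob (mcod L)" "m : El (car M b a)" "l : El (car L a c)" "x = cl M L b c a m l"
    by (rule coend_El_gensE)
   have a: "a : ob (mdom M)" using x LM by simp
   show "app (vc \<rho> (hc (idm M) \<tau>)) b c x = app \<sigma> b c x"
    unfolding x(4) e[OF o(1) a o(2) x(2,3)] using r[rule_format, OF o(1) a o(2) x(2,3)] .
  qed
 qed
qed

lemma is_right_lifting_Mod_iff:
 fixes M K R :: "('u, 'o, 'm, 'c) wmod"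
 shows "is_right_lifting (Mod W) M K R \<rho> \<longleftrightarrow>
  ismod R & mdom R = mdom K & mcod R = mdom M & \<rho> : mors (cmod M R) K &
  (ALL L \<sigma>. ismod L & mdom L = mdom K & mcod L = mdom M & \<sigma> : mors (cmod M L) K -->
   (\<exists>!\<tau>. \<tau> : mors L R & vc \<rho> (hc (idm M) \<tau>) = \<sigma>))"
 unfolding is_right_lifting_def Mod_sel Mod_hom1_iff by (simp only: Ball_def Mod_hom1_iff imp_conjL conj_assoc all_simps)

subsection \<open>Comparison with a chosen right lifting\<close>

text \<open>The chosen right lifting is one of many; the transpose of \<open>\<sigma>\<close> is invertible precisely
 when \<open>\<sigma>\<close> is universal itself.\<close>

lemma lifting_transpose_iso_iff:
 fixes M K L :: "('u, 'o, 'm, 'c) wmod"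
 assumes M: "ismod M"
  and ex: "EX R \<rho>. is_right_lifting (Mod W) M K R \<rho>"
  and L: "ismod L" "mdom L = mdom K" "mcod L = mdom M"
  and \<sigma>: "\<sigma> : mors (cmod M L) K"
 shows "iso2 (Mod W) (lifting_transpose (Mod W) M K L \<sigma>) \<longleftrightarrow> is_right_lifting (Mod W) M K L \<sigma>"
proof -
 obtain R \<rho> where rl: "right_lifting (Mod W) M K = (R, \<rho>)" by (cases "right_lifting (Mod W) M K")
 have "EX x. case x of (R, \<rho>) => is_right_lifting (Mod W) M K R \<rho>" using ex by auto
 from someI_ex[OF this] have lift: "is_right_lifting (Mod W) M K R \<rho>"
  using rl by (simp add: right_lifting_def)
 note li = lift[unfolded is_right_lifting_Mod_iff]
 have R: "ismod R" "mdom R = mdom K" "mcod R = mdom M" and \<rho>: "\<rho> : mors (cmod M R) K"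
  using li by blast+
 have univ: "\<exists>!\<tau>. \<tau> : mors P R & vc \<rho> (hc (idm M) \<tau>) = \<upsilon>"
  if "ismod P" "mdom P = mdom K" "mcod P = mdom M" "\<upsilon> : mors (cmod M P) K" for P \<upsilon>
  using li that by blast
 let ?w = "%\<tau>. hc (idm M) \<tau>"
 define \<tau> where "\<tau> = lifting_transpose (Mod W) M K L \<sigma>"
 have \<tau>_eq: "\<tau> = (THE \<tau>. \<tau> : mors L R & vc \<rho> (?w \<tau>) = \<sigma>)"
  unfolding \<tau>_def lifting_transpose_def rl fst_conv snd_conv Mod_sel ..
 have \<tau>: "\<tau> : mors L R" "vc \<rho> (?w \<tau>) = \<sigma>"
  using the_spec[OF \<tau>_eq univ[OF L \<sigma>]] by auto
 have wh: "?w x : mors (cmod M P) (cmod M Q)" if "x : mors P Q" "mcod P = mdom M" for x P Q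
  by (rule mor_hcomp_in[OF id_hom2[OF M] that(1)]) (simp only: that(2))
 have wc: "vc \<upsilon> (?w (vc y x)) = vc (vc \<upsilon> (?w y)) (?w x)"
  if x: "x : mors P Q" and y: "y : mors Q S" and P: "mcod P = mdom M" and \<upsilon>: "\<upsilon> : mors (cmod M S) K" for x y \<upsilon> P Q S
 proof -
  have Q: "mcod Q = mdom M" using Mod_hom2D(7)[OF x] P by simp
  show ?thesis
   unfolding whisker_vcomp[OF M x y P[symmetric]]
   by (rule mor_vcomp_assoc[OF wh[OF x P] wh[OF y Q] \<upsilon>, symmetric])
 qed
 have wi: "vc \<upsilon> (?w (idm P)) = \<upsilon>"
  if P: "ismod P" "mcod P = mdom M" and \<upsilon>: "\<upsilon> : mors (cmod M P) K" for \<upsilon> P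
  unfolding whisker_id[OF M P(1) P(2)[symmetric]] by (rule mor_vcomp_id(2)[OF \<upsilon>])
 show ?thesis unfolding \<tau>_def[symmetric]
 proof
  assume "iso2 (Mod W) \<tau>"
  note i = Mod_inv2[OF this \<tau>(1)]
  let ?t = "inv2 (Mod W) \<tau>"
  have \<rho>': "vc \<sigma> (?w ?t) = \<rho>"
   using wc[OF i(1) \<tau>(1) R(3) \<rho>] wi[OF R(1,3) \<rho>] i(3) \<tau>(2) by simp
  show "is_right_lifting (Mod W) M K L \<sigma>"
   unfolding is_right_lifting_Mod_iff
  proof (intro conjI allI impI L \<sigma>, elim conjE)
   fix P \<upsilon> assume P: "ismod P" "mdom P = mdom K" "mcod P = mdom M" and \<upsilon>: "\<upsilon> : mors (cmod M P) K"
   from univ[OF P \<upsilon>] obtain x where x: "x : mors P R" "vc \<rho> (?w x) = \<upsilon>"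
    and xu: "!!y. y : mors P R ==> vc \<rho> (?w y) = \<upsilon> ==> y = x" by blast
   show "\<exists>!x. x : mors P L & vc \<sigma> (?w x) = \<upsilon>"
   proof (rule ex1I[of _ "vc ?t x"], intro conjI)
    show "vc ?t x : mors P L" by (rule mor_vcomp_in[OF x(1) i(1)])
    show "vc \<sigma> (?w (vc ?t x)) = \<upsilon>"
     unfolding wc[OF x(1) i(1) P(3) \<sigma>] \<rho>' by (rule x(2))
    fix y assume y: "y : mors P L & vc \<sigma> (?w y) = \<upsilon>"
    then have y1: "y : mors P L" by simp
    have "vc \<rho> (?w (vc \<tau> y)) = \<upsilon>"
     unfolding wc[OF y1 \<tau>(1) P(3) \<rho>] \<tau>(2) using y by simp
    then have "vc \<tau> y = x" using xu mor_vcomp_in[OF y1 \<tau>(1)] by blast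
    then have "vc ?t x = vc (vc ?t \<tau>) y" using mor_vcomp_assoc[OF y1 \<tau>(1) i(1)] by simp
    then show "y = vc ?t x" unfolding i(2) using mor_vcomp_id(1)[OF y1] by simp
   qed
  qed
 next
  assume "is_right_lifting (Mod W) M K L \<sigma>"
  note ls = this[unfolded is_right_lifting_Mod_iff]
  have univ': "\<exists>!x. x : mors P L & vc \<sigma> (?w x) = \<upsilon>"
   if "ismod P" "mdom P = mdom K" "mcod P = mdom M" "\<upsilon> : mors (cmod M P) K" for P \<upsilon>
   using ls that by blast
  obtain t where t: "t : mors R L" "vc \<sigma> (?w t) = \<rho>" using univ'[OF R \<rho>] by blast
  have "vc \<rho> (?w (vc \<tau> t)) = \<rho>"
   unfolding wc[OF t(1) \<tau>(1) R(3) \<rho>] \<tau>(2) by (rule t(2))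
  moreover have "vc \<rho> (?w (idm R)) = \<rho>" by (rule wi[OF R(1,3) \<rho>])
  ultimately have 1: "vc \<tau> t = idm R"
   using univ[OF R \<rho>] mor_vcomp_in[OF t(1) \<tau>(1)] id_hom2[OF R(1)] by blast
  have "vc \<sigma> (?w (vc t \<tau>)) = \<sigma>"
   unfolding wc[OF \<tau>(1) t(1) L(3) \<sigma>] t(2) by (rule \<tau>(2))
  moreover have "vc \<sigma> (?w (idm L)) = \<sigma>" by (rule wi[OF L(1,3) \<sigma>])
  ultimately have 2: "vc t \<tau> = idm L"
   using univ'[OF L \<sigma>] mor_vcomp_in[OF \<tau>(1) t(1)] id_hom2[OF L(1)] by blast
  show "iso2 (Mod W) \<tau>" unfolding iso2_def Mod_inverse2_iff
   by (rule exI[of _ t]) (use 1 2 t(1) Mod_hom2D(1-3)[OF \<tau>(1)] in simp)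
 qed
qed

subsection \<open>Existence\<close>

text \<open>A family of 2-cells \<open>M(b,a) \<star> l \<Rightarrow> K(b,c)\<close> that is compatible with the action of \<open>mcod
 K\<close>.\<close>

definition lift_family :: "('u, 'o, 'm, 'c) wmod => ('u, 'o, 'm, 'c) wmod => 'u => 'u => 'm => ('u => 'c) => bool" where
 "lift_family M K a c l \<sigma> \<longleftrightarrow> l : hom1 W (ext (mdom K) c) (ext (mdom M) a) &
   (ALL b:ob (mcod K). \<sigma> b : hom2 W (car M b a \<star> l) (car K b c)) &
   (ALL b':ob (mcod K). ALL b:ob (mcod K). ALL x:El (hom (mcod K) b' b). ALL m:El (car M b a). ALL s:El l.
    ap (\<sigma> b') (ten (la M b' b a x m) s) = la K b' b c x (ap (\<sigma> b) (ten m s)))"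

text \<open>The universal such family: \<open>r\<close> is the end over \<open>b\<close> of the right liftings of \<open>K(b,c)\<close>
 through \<open>M(b,a)\<close>, the value at \<open>(a,c)\<close> of the right lifting of modules.\<close>

definition hom_object :: "('u, 'o, 'm, 'c) wmod => ('u, 'o, 'm, 'c) wmod => 'u => 'u => 'm => ('u => 'c) => bool" where
 "hom_object M K a c r e \<longleftrightarrow> lift_family M K a c r e &
   (ALL l \<sigma>. lift_family M K a c l \<sigma> --> (\<exists>!t. t : hom2 W l r & (ALL b:ob (mcod K). e b \<cdot> (\<iota> (car M b a) \<ast> t) = \<sigma> b)))"

context
 fixes M K :: "('u, 'o, 'm, 'c) wmod"
 assumes M: "ismod M" and K: "ismod K" and MK: "mcod M = mcod K"
begin

text \<open>The end is a co-gluing of the liftings \<open>f b\<close> of \<open>K(b,c)\<close> through \<open>M(b,a)\<close> along the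
 liftings \<open>k b b'\<close> of \<open>K(b',c)\<close> through \<open>B(b',b) \<star> M(b,a)\<close>; the two legs transpose the
 two ways of acting with an element of \<open>B(b',b)\<close>.\<close>

lemma ex_hom_object:
 assumes a: "a : ob (mdom M)" and c: "c : ob (mdom K)"
 shows "EX r e. hom_object M K a c r e"
proof -
 note u = a c M K MK
 let ?S = "ob (mcod K)"
 let ?A = "ext (mdom M) a" and ?C = "ext (mdom K) c"
 have "EX r \<rho>. is_right_lifting W (car M b a) (car K b c) r \<rho>" if "b : ?S" for b
  by (rule ex_right_lifting) (use that u in simp_all)
 then obtain f \<rho> where lf: "!!b. b : ?S ==> is_right_lifting W (car M b a) (car K b c) (f b) (\<rho> b)" by metis
 have f: "f b : cells1 W" "src W (f b) = ?C" "trg W (f b) = ?A" "f b : hom1 W ?C ?A"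
  and \<rho>: "\<rho> b : cells2 W" "dom2 W (\<rho> b) = car M b a \<star> f b" "cod2 W (\<rho> b) = car K b c" if "b : ?S" for b
  using lf[OF that] that u by (auto simp: is_right_lifting_def hom1_iff hom2_iff)
 have uf: "\<exists>!\<tau>. \<tau> : hom2 W l (f b) & \<rho> b \<cdot> (\<iota> (car M b a) \<ast> \<tau>) = \<sigma>"
  if "b : ?S" "l : hom1 W ?C ?A" "\<sigma> : hom2 W (car M b a \<star> l) (car K b c)" for b l \<sigma>
  using lf[OF that(1)] that u by (simp add: is_right_lifting_def)
 let ?g = "%b b'. hom (mcod K) b' b \<star> car M b a"
 have g: "?g b b' : cells1 W" "src W (?g b b') = ?A" "trg W (?g b b') = ext (mcod K) b'" if "b : ?S" "b' : ?S" for b b'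
  using that u by simp_all
 have "EX r \<rho>. is_right_lifting W (?g b b') (car K b' c) r \<rho>" if "b : ?S" "b' : ?S" for b b'
  by (rule ex_right_lifting) (use that u in simp_all)
 then obtain k \<kappa> where lk: "!!b b'. b : ?S ==> b' : ?S ==> is_right_lifting W (?g b b') (car K b' c) (k b b') (\<kappa> b b')" by metis
 have k: "k b b' : cells1 W" "src W (k b b') = ?C" "trg W (k b b') = ?A" "k b b' : hom1 W ?C ?A"
  and \<kappa>: "\<kappa> b b' : cells2 W" "dom2 W (\<kappa> b b') = ?g b b' \<star> k b b'" "cod2 W (\<kappa> b b') = car K b' c" if "b : ?S" "b' : ?S" for b b'
  using lk[OF that] that u by (auto simp: is_right_lifting_def hom1_iff hom2_iff)
 have uk: "\<exists>!\<tau>. \<tau> : hom2 W l (k b b') & \<kappa> b b' \<cdot> (\<iota> (?g b b') \<ast> \<tau>) = \<sigma>"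
  if "b : ?S" "b' : ?S" "l : hom1 W ?C ?A" "\<sigma> : hom2 W (?g b b' \<star> l) (car K b' c)" for b b' l \<sigma>
  using lk[OF that(1,2)] that u by (simp add: is_right_lifting_def)
 let ?pu = "%b b'. lact K b' b c \<cdot> (\<iota> (hom (mcod K) b' b) \<ast> \<rho> b) \<cdot> \<a> (hom (mcod K) b' b) (car M b a) (f b)"
 let ?pv = "%b b'. \<rho> b' \<cdot> (lact M b' b a \<ast> \<iota> (f b'))"
 have "EX t. t : hom2 W (f b) (k b b') & \<kappa> b b' \<cdot> (\<iota> (?g b b') \<ast> t) = ?pu b b'" if "b : ?S" "b' : ?S" for b b'
  by (rule ex1_implies_ex[OF uk]) (use that f \<rho> u in "auto simp: hom2_iff")
 then obtain p where p: "!!b b'. b : ?S ==> b' : ?S ==> p b b' : hom2 W (f b) (k b b')"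
  "!!b b'. b : ?S ==> b' : ?S ==> \<kappa> b b' \<cdot> (\<iota> (?g b b') \<ast> p b b') = ?pu b b'" by metis
 have "EX t. t : hom2 W (f b') (k b b') & \<kappa> b b' \<cdot> (\<iota> (?g b b') \<ast> t) = ?pv b b'" if "b : ?S" "b' : ?S" for b b'
  by (rule ex1_implies_ex[OF uk]) (use that f \<rho> u in "auto simp: hom2_iff")
 then obtain q where q: "!!b b'. b : ?S ==> b' : ?S ==> q b b' : hom2 W (f b') (k b b')"
  "!!b b'. b : ?S ==> b' : ?S ==> \<kappa> b b' \<cdot> (\<iota> (?g b b') \<ast> q b b') = ?pv b b'" by metis
 note pc = p(1)[THEN hom2D(1)] p(1)[THEN hom2D(2)] p(1)[THEN hom2D(3)]
 note qc = q(1)[THEN hom2D(1)] q(1)[THEN hom2D(2)] q(1)[THEN hom2D(3)]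
 have pel: "ap (\<kappa> b b') (ten (ten x m) (ap (p b b') s)) = la K b' b c x (ap (\<rho> b) (ten m s))"
  if "b : ?S" "b' : ?S" "x : El (hom (mcod K) b' b)" "m : El (car M b a)" "s : El (f b)" for b b' x m s
 proof -
  have "ap (\<kappa> b b' \<cdot> (\<iota> (?g b b') \<ast> p b b')) (ten (ten x m) s) = ap (?pu b b') (ten (ten x m) s)"
   using p(2)[OF that(1,2)] by simp
  then show ?thesis using that u f \<rho> \<kappa> k by (simp add: pc)
 qed
 have qel: "ap (\<kappa> b b') (ten (ten x m) (ap (q b b') s)) = ap (\<rho> b') (ten (la M b' b a x m) s)"
  if "b : ?S" "b' : ?S" "x : El (hom (mcod K) b' b)" "m : El (car M b a)" "s : El (f b')" for b b' x m s
 proof -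
  have "ap (\<kappa> b b' \<cdot> (\<iota> (?g b b') \<ast> q b b')) (ten (ten x m) s) = ap (?pv b b') (ten (ten x m) s)"
   using q(2)[OF that(1,2)] by simp
  then show ?thesis using that u f \<rho> \<kappa> k by (simp add: qc)
 qed
 have small: "small ?S" using wcategory.small_ob[OF wmodule.cod_wcategory[OF K]] .
 obtain r i where ri: "coglued (hom1 W ?C ?A) ?S f p q r i"
  using ex_coglued[OF small, of ?C ?A f k p q] f k p q u by auto
 then have r: "r : hom1 W ?C ?A" and i: "!!b. b : ?S ==> i b : hom2 W r (f b)"
  and ii: "!!b b'. b : ?S ==> b' : ?S ==> p b b' \<cdot> i b = q b b' \<cdot> i b'"
  by (auto simp: coglued_def coglues_def)
 note ic = i[THEN hom2D(1)] i[THEN hom2D(2)] i[THEN hom2D(3)]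
 have rc: "r : cells1 W" "src W r = ?C" "trg W r = ?A" using r by (auto simp: hom1_iff)
 let ?e = "%b. \<rho> b \<cdot> (\<iota> (car M b a) \<ast> i b)"
 have lf_e: "lift_family M K a c r ?e"
  unfolding lift_family_def
 proof (intro conjI ballI r)
  fix b assume b: "b : ?S"
  show "?e b : hom2 W (car M b a \<star> r) (car K b c)" using b u f \<rho> rc by (simp add: ic hom2_iff)
 next
  fix b' b x m s assume *: "b' : ?S" "b : ?S" "x : El (hom (mcod K) b' b)" "m : El (car M b a)" "s : El r"
  have isE: "ap (i b) s : El (f b)" "ap (i b') s : El (f b')" using * by (simp_all add: ic)
  have "ap (p b b') (ap (i b) s) = ap (q b b') (ap (i b') s)"
   using arg_cong[OF ii[OF *(2,1)], of "%t. ap t s"] * by (simp add: ic pc qc)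
  then have "ap (\<rho> b') (ten (la M b' b a x m) (ap (i b') s)) = la K b' b c x (ap (\<rho> b) (ten m (ap (i b) s)))"
   using pel[OF *(2,1,3,4) isE(1)] qel[OF *(2,1,3,4) isE(2)] by simp
  then show "ap (?e b') (ten (la M b' b a x m) s) = la K b' b c x (ap (?e b) (ten m s))"
   using * u f \<rho> rc by (simp add: ic)
 qed
 have "hom_object M K a c r ?e"
  unfolding hom_object_def
 proof (intro conjI lf_e allI impI)
  fix l \<sigma> assume "lift_family M K a c l \<sigma>"
  then have l: "l : hom1 W ?C ?A" and \<sigma>: "!!b. b : ?S ==> \<sigma> b : hom2 W (car M b a \<star> l) (car K b c)"
   and \<sigma>\<sigma>: "!!b' b x m s. b' : ?S ==> b : ?S ==> x : El (hom (mcod K) b' b) ==> m : El (car M b a) ==> s : El l ==>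
    ap (\<sigma> b') (ten (la M b' b a x m) s) = la K b' b c x (ap (\<sigma> b) (ten m s))"
   by (auto simp: lift_family_def)
  have lc: "l : cells1 W" "src W l = ?C" "trg W l = ?A" using l by (auto simp: hom1_iff)
  have "EX t. t : hom2 W l (f b) & \<rho> b \<cdot> (\<iota> (car M b a) \<ast> t) = \<sigma> b" if "b : ?S" for b
   by (rule ex1_implies_ex[OF uf[OF that l \<sigma>[OF that]]])
  then obtain j where j: "!!b. b : ?S ==> j b : hom2 W l (f b)" "!!b. b : ?S ==> \<rho> b \<cdot> (\<iota> (car M b a) \<ast> j b) = \<sigma> b" by metis
  note jc = j(1)[THEN hom2D(1)] j(1)[THEN hom2D(2)] j(1)[THEN hom2D(3)]
  have jel: "ap (\<rho> b) (ten m (ap (j b) s)) = ap (\<sigma> b) (ten m s)" if "b : ?S" "m : El (car M b a)" "s : El l" for b m s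
   using arg_cong[OF j(2)[OF that(1)], of "%t. ap t (ten m s)"] that u f \<rho> lc by (simp add: jc)
  have "coglues (hom1 W ?C ?A) ?S f p q l j"
   unfolding coglues_def
  proof (intro conjI ballI l j)
   fix b b' assume b: "b : ?S" "b' : ?S"
   have 1: "p b b' \<cdot> j b : hom2 W l (k b b')" "q b b' \<cdot> j b' : hom2 W l (k b b')"
    using b by (simp_all add: hom2_iff pc qc jc)
   have "\<kappa> b b' \<cdot> (\<iota> (?g b b') \<ast> (p b b' \<cdot> j b)) = \<kappa> b b' \<cdot> (\<iota> (?g b b') \<ast> (q b b' \<cdot> j b'))"
    by (rule gen_ext3[OF generates_El generates_El generates_El, of "hom (mcod K) b' b" "car M b a" l _ "car K b' c"])
     (use b u lc \<kappa> k f in "simp_all add: hom2_iff pc qc jc pel qel jel \<sigma>\<sigma>")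
   moreover have "\<kappa> b b' \<cdot> (\<iota> (?g b b') \<ast> (p b b' \<cdot> j b)) : hom2 W (?g b b' \<star> l) (car K b' c)"
    using b u lc \<kappa> k f by (simp add: hom2_iff pc jc)
   ultimately show "p b b' \<cdot> j b = q b b' \<cdot> j b'" using uk[OF b l] 1 by metis
  qed
  then obtain t where t: "t : hom2 W l r" "!!b. b : ?S ==> i b \<cdot> t = j b"
   and tu: "!!s. s : hom2 W l r ==> (ALL b:?S. i b \<cdot> s = j b) ==> s = t"
   using ri unfolding coglued_def by metis
  have ex: "?e b \<cdot> (\<iota> (car M b a) \<ast> s) = \<rho> b \<cdot> (\<iota> (car M b a) \<ast> (i b \<cdot> s))" if "s : hom2 W l r" "b : ?S" for s b
   using that u f \<rho> rc lc by (simp add: hom2_iff ic vassoc inter)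
  show "\<exists>!t. t : hom2 W l r & (ALL b:?S. ?e b \<cdot> (\<iota> (car M b a) \<ast> t) = \<sigma> b)"
  proof (rule ex1I[of _ t])
   show "t : hom2 W l r & (ALL b:?S. ?e b \<cdot> (\<iota> (car M b a) \<ast> t) = \<sigma> b)"
    using t ex[OF t(1)] j by simp
   fix s assume s: "s : hom2 W l r & (ALL b:?S. ?e b \<cdot> (\<iota> (car M b a) \<ast> s) = \<sigma> b)"
   have "i b \<cdot> s = j b" if b: "b : ?S" for b
   proof -
    have "i b \<cdot> s : hom2 W l (f b)" using s b by (simp add: hom2_iff ic)
    moreover have "\<rho> b \<cdot> (\<iota> (car M b a) \<ast> (i b \<cdot> s)) = \<sigma> b" using s b ex[of s b] by simp
    ultimately show ?thesis using uf[OF b l \<sigma>[OF b]] j[OF b] by blast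
   qed
   then show "s = t" using tu s by blast
  qed
 qed
 then show ?thesis by blast
qed

end
end


subsection \<open>The lifting module\<close>

context bicategory
begin

lemma stage_simps [simp]: "stage (ap \<sigma> x) = stage x" "stage (ten x y) = stage x @ stage y" "stage (pt \<sigma>) = []"
 by (simp_all add: ap_def ten_def pt_def)

text \<open>Every element is the image, under its own cell, of the identity at its stage. Universal
 properties stated for 2-cells thereby apply to single elements.\<close>

lemma element_generic:
 assumes u: "u : El f"
 defines "l \<equiv> path_comp (src W f) (stage u)" and "v \<equiv> Element (stage u) (\<iota> (path_comp (src W f) (stage u)))"
 shows "l : hom1 W (src W f) (trg W f)" "cell u : hom2 W l f" "v : El l" "generates {v} l" "ap (cell u) v = u" "stage v = stage u"
proof -
 note U = ElD[OF u]
 show l: "l : hom1 W (src W f) (trg W f)" and "cell u : hom2 W l f" using U by (auto simp: l_def hom1_iff hom2_iff)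
 have "path (src W l) (stage u)" using U by (simp add: l_def)
 then show v: "v : El l" unfolding v_def by (intro ElI) (use U in "simp_all add: l_def hom2_iff")
 have "iso2 W (cell v)" using U by (simp add: v_def)
 then show "generates {v} l" unfolding generates_def
  using l v el_cancel[of _ l _ _ v] by (auto simp: hom1_iff)
 show "ap (cell u) v = u" using U by (cases u) (simp add: ap_def v_def)
 show "stage v = stage u" by (simp add: v_def)
qed

end

context enriched_base
begin

text \<open>A family on the pairs \<open>n \<otimes> m\<close> that is balanced and compatible with the outer actions
 descends to a morphism out of the composite module.\<close>

lemma ex_mor_out_of_comp:
 fixes N M P :: "('u, 'o, 'm, 'c) wmod"
 assumes N: "ismod N" and M: "ismod M" and NM: "mdom N = mcod M"
  and P: "ismod P" and PM: "mdom P = mdom M" and PN: "mcod P = mcod N"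
  and j: "!!c b a. [|c : ob (mcod N); b : ob (mcod M); a : ob (mdom M)|] ==> j c b a : hom2 W (car N c b \<star> car M b a) (car P c a)"
  and bal: "!!c b b' a n f m. [|c : ob (mcod N); b : ob (mcod M); b' : ob (mcod M); a : ob (mdom M);
    n : El (car N c b); f : El (hom (mcod M) b b'); m : El (car M b' a)|]
   ==> ap (j c b a) (ten n (la M b b' a f m)) = ap (j c b' a) (ten (ra N c b b' n f) m)"
  and ll: "!!c' c b a x n m. [|c' : ob (mcod N); c : ob (mcod N); b : ob (mcod M); a : ob (mdom M);
    x : El (hom (mcod N) c' c); n : El (car N c b); m : El (car M b a)|]
   ==> ap (j c' b a) (ten (la N c' c b x n) m) = la P c' c a x (ap (j c b a) (ten n m))"
  and rr: "!!c b a a' n m y. [|c : ob (mcod N); b : ob (mcod M); a : ob (mdom M); a' : ob (mdom M);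
    n : El (car N c b); m : El (car M b a); y : El (hom (mdom M) a a')|]
   ==> ap (j c b a') (ten n (ra M b a a' m y)) = ra P c a a' (ap (j c b a) (ten n m)) y"
 shows "\<exists>\<sigma>\<in>mors (cmod N M) P. ALL c:ob (mcod N). ALL b:ob (mcod M). ALL a:ob (mdom M). ALL n:El (car N c b). ALL m:El (car M b a).
   app \<sigma> c a (cl N M c a b n m) = ap (j c b a) (ten n m)"
proof -
 note J = j[THEN hom2D(1)] j[THEN hom2D(2)] j[THEN hom2D(3)]
 note u = N M NM P PM PN J
 have "\<exists>!t. t : hom2 W (cob N M c a) (car P c a) & (ALL b:ob (mcod M). t \<cdot> cin N M c a b = j c b a)"
  if o: "c : ob (mcod N)" "a : ob (mdom M)" for c a
  by (rule coend_factor[OF N M NM o]) (use P PM PN o bal in "auto intro: j")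
 then obtain t where t: "!!c a. c : ob (mcod N) ==> a : ob (mdom M) ==> t c a : hom2 W (cob N M c a) (car P c a)"
  and t': "!!c a b. c : ob (mcod N) ==> a : ob (mdom M) ==> b : ob (mcod M) ==> t c a \<cdot> cin N M c a b = j c b a"
  by metis
 note T = t[THEN hom2D(1)] t[THEN hom2D(2)] t[THEN hom2D(3)]
 have te: "ap (t c a) (cl N M c a b n m) = ap (j c b a) (ten n m)"
  if "c : ob (mcod N)" "a : ob (mdom M)" "b : ob (mcod M)" "n : El (car N c b)" "m : El (car M b a)" for c a b n m
  using arg_cong[OF t'[OF that(1-3)], of "%s. ap s (ten n m)"] that N M NM by (simp add: T)
 have Q: "ismod (cmod N M)"
  using wmodule_mod_comp[OF N M NM] by simp
 have "mk_wmor (cmod N M) P t : mors (cmod N M) P"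
 proof (rule mk_wmor_gen[OF Q P, where G = "coend_El_gens N M"])
  fix c' c a x z assume "c' : ob (mcod (cmod N M))" "c : ob (mcod (cmod N M))" "a : ob (mdom (cmod N M))"
   "x : El (hom (mcod (cmod N M)) c' c)" and z: "z : coend_El_gens N M c a"
  then have o: "c' : ob (mcod N)" "c : ob (mcod N)" "a : ob (mdom M)" "x : El (hom (mcod N) c' c)" by simp_all
  from z obtain b n m where z: "b : ob (mcod M)" "n : El (car N c b)" "m : El (car M b a)" "z = cl N M c a b n m"
   by (rule coend_El_gensE)
  have xn: "la N c' c b x n : El (car N c' b)" using o z N NM by simp
  show "ap (t c' a) (la (cmod N M) c' c a x z) = la P c' c a x (ap (t c a) z)"
   unfolding z(4) lact_mod_comp_el[OF N M NM o(1-3) z(1) o(4) z(2,3)] te[OF o(2,3) z(1-3)] te[OF o(1,3) z(1) xn z(3)]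
   by (rule ll[OF o(1,2) z(1) o(3,4) z(2,3)])
 next
  fix c a a' z y assume "c : ob (mcod (cmod N M))" "a : ob (mdom (cmod N M))" "a' : ob (mdom (cmod N M))"
   and z: "z : coend_El_gens N M c a" and "y : El (hom (mdom (cmod N M)) a a')"
  then have o: "c : ob (mcod N)" "a : ob (mdom M)" "a' : ob (mdom M)" "y : El (hom (mdom M) a a')" by simp_all
  from z obtain b n m where z: "b : ob (mcod M)" "n : El (car N c b)" "m : El (car M b a)" "z = cl N M c a b n m"
   by (rule coend_El_gensE)
  have my: "ra M b a a' m y : El (car M b a')" using o z M by simp
  show "ap (t c a') (ra (cmod N M) c a a' z y) = ra P c a a' (ap (t c a) z) y"
   unfolding z(4) ract_mod_comp_el[OF N M NM o(1-3) z(1) o(4) z(2,3)] te[OF o(1,2) z(1-3)] te[OF o(1,3) z(1,2) my]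
   by (rule rr[OF o(1) z(1) o(2,3) z(2,3) o(4)])
 qed (use N M NM PM PN t in auto)
 then show ?thesis using te by (intro bexI) auto
qed

context
 fixes M K :: "('u, 'o, 'm, 'c) wmod"
 assumes M: "ismod M" and K: "ismod K" and MK: "mcod M = mcod K"
begin

lemma lift_familyI:
 assumes a: "a : ob (mdom M)" and c: "c : ob (mdom K)"
  and l: "l : hom1 W (ext (mdom K) c) (ext (mdom M) a)" and X: "generates X l"
  and s: "!!b. b : ob (mcod K) ==> \<sigma> b : hom2 W (car M b a \<star> l) (car K b c)"
  and e: "!!b' b x m s. [|b' : ob (mcod K); b : ob (mcod K); x : El (hom (mcod K) b' b); m : El (car M b a); s : X|] ==>
    ap (\<sigma> b') (ten (la M b' b a x m) s) = la K b' b c x (ap (\<sigma> b) (ten m s))"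
 shows "lift_family M K a c l \<sigma>"
 unfolding lift_family_def
proof (intro conjI ballI l s)
 fix b' b x m t assume o: "b' : ob (mcod K)" "b : ob (mcod K)" and *: "x : El (hom (mcod K) b' b)" "m : El (car M b a)" "t : El l"
 note S = s[THEN hom2D(1)] s[THEN hom2D(2)] s[THEN hom2D(3)]
 have lc: "l : cells1 W" "src W l = ext (mdom K) c" "trg W l = ext (mdom M) a" using l by (auto simp: hom1_iff)
 have XE: "s : X ==> s : El l" for s using X by (auto simp: generates_def)
 have "\<sigma> b' \<cdot> (lact M b' b a \<ast> \<iota> l) = lact K b' b c \<cdot> (\<iota> (hom (mcod K) b' b) \<ast> \<sigma> b) \<cdot> \<a> (hom (mcod K) b' b) (car M b a) l"
  by (rule gen_ext3[OF generates_El generates_El X, of "hom (mcod K) b' b" "car M b a" _ "car K b' c"])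
   (use o lc a c M K MK e[OF o] XE in "simp_all add: hom2_iff S")
 from arg_cong[OF this, of "%t'. ap t' (ten (ten x m) t)"]
 show "ap (\<sigma> b') (ten (la M b' b a x m) t) = la K b' b c x (ap (\<sigma> b) (ten m t))"
  using o * lc a c M K MK by (simp add: S)
qed

context
 fixes a c r e
 assumes a: "a : ob (mdom M)" and c: "c : ob (mdom K)" and he: "hom_object M K a c r e"
begin

lemma hom_object_cell:
 shows "r : cells1 W" "src W r = ext (mdom K) c" "trg W r = ext (mdom M) a"
  and "b : ob (mcod K) ==> e b : cells2 W" "b : ob (mcod K) ==> dom2 W (e b) = car M b a \<star> r" "b : ob (mcod K) ==> cod2 W (e b) = car K b c"
 using he unfolding hom_object_def lift_family_def by (auto simp: hom1_iff hom2_iff)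

lemma hom_object_lin:
 "[|b' : ob (mcod K); b : ob (mcod K); x : El (hom (mcod K) b' b); m : El (car M b a); s : El r|] ==>
   ap (e b') (ten (la M b' b a x m) s) = la K b' b c x (ap (e b) (ten m s))"
 using he unfolding hom_object_def lift_family_def by blast

lemma hom_object_map:
 assumes "lift_family M K a c l \<sigma>"
 shows "EX t:hom2 W l r. ALL b:ob (mcod K). ALL m:El (car M b a). ALL s:El l. ap (e b) (ten m (ap t s)) = ap (\<sigma> b) (ten m s)"
proof -
 from he assms obtain t where t: "t : hom2 W l r" "ALL b:ob (mcod K). e b \<cdot> (\<iota> (car M b a) \<ast> t) = \<sigma> b"
  unfolding hom_object_def by blast
 have "ap (e b) (ten m (ap t s)) = ap (\<sigma> b) (ten m s)" if "b : ob (mcod K)" "m : El (car M b a)" "s : El l" for b m s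
 proof -
  have "ap (e b \<cdot> (\<iota> (car M b a) \<ast> t)) (ten m s) = ap (\<sigma> b) (ten m s)" using t that by simp
  then show ?thesis using that hom_object_cell a M MK t(1) hom2D[OF t(1)] by simp
 qed
 then show ?thesis using t by blast
qed

text \<open>Elements of the end are separated by evaluation. The stages have to agree, since an
 element includes its stage.\<close>

lemma hom_object_ext:
 assumes u: "u : El r" and v: "v : El r" and st: "stage u = stage v"
  and eq: "!!b m. b : ob (mcod K) ==> m : El (car M b a) ==> ap (e b) (ten m u) = ap (e b) (ten m v)"
 shows "u = v"
proof -
 define l where "l = path_comp (src W r) (stage u)"
 define w where "w = Element (stage u) (\<iota> (path_comp (src W r) (stage u)))"
 note U = element_generic[OF u, folded l_def w_def] and V = element_generic[OF v, folded st l_def w_def, folded st, folded l_def w_def]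
 note hc = hom_object_cell
 have lc: "l : cells1 W" "src W l = ext (mdom K) c" "trg W l = ext (mdom M) a" using U(1) hc by (auto simp: hom1_iff)
 have lin: "lift_family M K a c l (%b. e b \<cdot> (\<iota> (car M b a) \<ast> t))" if t: "t : hom2 W l r" for t
  by (rule lift_familyI[OF a c _ U(4)]) (use a c M K MK lc hc hom2D[OF t] U(3) in "auto simp: hom1_iff hom2_iff hom_object_lin")
 have eq': "e b \<cdot> (\<iota> (car M b a) \<ast> cell u) = e b \<cdot> (\<iota> (car M b a) \<ast> cell v)" if b: "b : ob (mcod K)" for b
  by (rule gen_ext2[OF generates_El U(4), of "car M b a" _ "car K b c"])
   (use a b M MK lc hc hom2D[OF U(2)] hom2D[OF V(2)] U V eq[OF b] in "auto simp: hom2_iff")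
 have "\<exists>!t. t : hom2 W l r & (ALL b:ob (mcod K). e b \<cdot> (\<iota> (car M b a) \<ast> t) = e b \<cdot> (\<iota> (car M b a) \<ast> cell u))"
  using he lin[OF U(2)] unfolding hom_object_def by blast
 moreover have "cell v : hom2 W l r & (ALL b:ob (mcod K). e b \<cdot> (\<iota> (car M b a) \<ast> cell v) = e b \<cdot> (\<iota> (car M b a) \<ast> cell u))"
  using V(2) eq' by simp
 ultimately have "cell u = cell v" using U(2) by blast
 then show ?thesis using st by (simp add: element.expand)
qed

end

context
 fixes r :: "'u => 'u => 'm" and e :: "'u => 'u => 'u => 'c"
 assumes he: "!!a c. a : ob (mdom M) ==> c : ob (mdom K) ==> hom_object M K a c (r a c) (e a c)"
begin

lemma hom_object_cells:
 assumes "a : ob (mdom M)" "c : ob (mdom K)"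
 shows "r a c : cells1 W" "src W (r a c) = ext (mdom K) c" "trg W (r a c) = ext (mdom M) a"
  and "b : ob (mcod K) ==> e a c b : cells2 W" "b : ob (mcod K) ==> dom2 W (e a c b) = car M b a \<star> r a c" "b : ob (mcod K) ==> cod2 W (e a c b) = car K b c"
 using hom_object_cell[OF assms he[OF assms]] by blast+

text \<open>The actions on \<open>R(a,c)\<close> are forced by evaluation, \<open>m \<cdot> (x s) = (m x) \<cdot> s\<close> and \<open>m \<cdot>
 (s z) = (m \<cdot> s) z\<close>; the axioms follow because evaluation separates elements.\<close>

lemma ex_lifting_module:
 "EX R. ismod R & mdom R = mdom K & mcod R = mdom M & car R = r &
   (ALL b:ob (mcod K). ALL a':ob (mdom M). ALL a:ob (mdom M). ALL c:ob (mdom K). ALL m:El (car M b a'). ALL x:El (hom (mdom M) a' a). ALL s:El (r a c).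
    ap (e a' c b) (ten m (la R a' a c x s)) = ap (e a c b) (ten (ra M b a' a m x) s)) &
   (ALL b:ob (mcod K). ALL a:ob (mdom M). ALL c:ob (mdom K). ALL c':ob (mdom K). ALL m:El (car M b a). ALL s:El (r a c). ALL z:El (hom (mdom K) c c').
    ap (e a c' b) (ten m (ra R a c c' s z)) = ra K b c c' (ap (e a c b) (ten m s)) z)"
proof -
 let ?A = "mdom M" and ?B = "mcod K" and ?C = "mdom K"
 note hc = hom_object_cells
 note u = M K MK
 have "EX t. t : hom2 W (hom ?A a' a \<star> r a c) (r a' c) & (ALL b:ob ?B. ALL m:El (car M b a'). ALL x:El (hom ?A a' a). ALL s:El (r a c).
    ap (e a' c b) (ten m (ap t (ten x s))) = ap (e a c b) (ten (ra M b a' a m x) s))"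
  if o: "a' : ob ?A" "a : ob ?A" "c : ob ?C" for a' a c
 proof -
  let ?s = "%b. e a c b \<cdot> (ract M b a' a \<ast> \<iota> (r a c)) \<cdot> inv2 W (\<a> (car M b a') (hom ?A a' a) (r a c))"
  have "lift_family M K a' c (hom ?A a' a \<star> r a c) ?s"
   by (rule lift_familyI[OF o(1,3) _ generates_Ten[OF generates_El generates_El]])
    (use u o hc[OF o(2,3)] in "auto simp: hom1_iff hom2_iff Ten_def hom_object_lin[OF o(2,3) he[OF o(2,3)]]")
  from hom_object_map[OF o(1,3) he[OF o(1,3)] this]
  obtain t where t: "t : hom2 W (hom ?A a' a \<star> r a c) (r a' c)" and
   te: "!!b m s. b : ob ?B ==> m : El (car M b a') ==> s : El (hom ?A a' a \<star> r a c) ==> ap (e a' c b) (ten m (ap t s)) = ap (?s b) (ten m s)"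
   by blast
  have "ap (e a' c b) (ten m (ap t (ten x s))) = ap (e a c b) (ten (ra M b a' a m x) s)"
   if "b : ob ?B" "m : El (car M b a')" "x : El (hom ?A a' a)" "s : El (r a c)" for b m x s
   using te[OF that(1,2), of "ten x s"] that u o hc[OF o(2,3)] by simp
  then show ?thesis using t by blast
 qed
 then obtain L where L: "!!a' a c. a' : ob ?A ==> a : ob ?A ==> c : ob ?C ==> L a' a c : hom2 W (hom ?A a' a \<star> r a c) (r a' c)"
  and Le: "!!a' a c b m x s. a' : ob ?A ==> a : ob ?A ==> c : ob ?C ==> b : ob ?B ==> m : El (car M b a') ==> x : El (hom ?A a' a) ==> s : El (r a c) ==>
    ap (e a' c b) (ten m (ap (L a' a c) (ten x s))) = ap (e a c b) (ten (ra M b a' a m x) s)"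
  by metis
 have "EX t. t : hom2 W (r a c \<star> hom ?C c c') (r a c') & (ALL b:ob ?B. ALL m:El (car M b a). ALL s:El (r a c). ALL z:El (hom ?C c c').
    ap (e a c' b) (ten m (ap t (ten s z))) = ra K b c c' (ap (e a c b) (ten m s)) z)"
  if o: "a : ob ?A" "c : ob ?C" "c' : ob ?C" for a c c'
 proof -
  let ?s = "%b. ract K b c c' \<cdot> (e a c b \<ast> \<iota> (hom ?C c c')) \<cdot> inv2 W (\<a> (car M b a) (r a c) (hom ?C c c'))"
  have "lift_family M K a c' (r a c \<star> hom ?C c c') ?s"
   by (rule lift_familyI[OF o(1,3) _ generates_Ten[OF generates_El generates_El]])
    (use u o hc[OF o(1,2)] in "auto simp: hom1_iff hom2_iff Ten_def hom_object_lin[OF o(1,2) he[OF o(1,2)]]")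
  from hom_object_map[OF o(1,3) he[OF o(1,3)] this]
  obtain t where t: "t : hom2 W (r a c \<star> hom ?C c c') (r a c')" and
   te: "!!b m s. b : ob ?B ==> m : El (car M b a) ==> s : El (r a c \<star> hom ?C c c') ==> ap (e a c' b) (ten m (ap t s)) = ap (?s b) (ten m s)"
   by blast
  have "ap (e a c' b) (ten m (ap t (ten s z))) = ra K b c c' (ap (e a c b) (ten m s)) z"
   if "b : ob ?B" "m : El (car M b a)" "s : El (r a c)" "z : El (hom ?C c c')" for b m s z
   using te[OF that(1,2), of "ten s z"] that u o hc[OF o(1,2)] by simp
  then show ?thesis using t by blast
 qed
 then obtain T where T: "!!a c c'. a : ob ?A ==> c : ob ?C ==> c' : ob ?C ==> T a c c' : hom2 W (r a c \<star> hom ?C c c') (r a c')"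
  and Te: "!!a c c' b m s z. a : ob ?A ==> c : ob ?C ==> c' : ob ?C ==> b : ob ?B ==> m : El (car M b a) ==> s : El (r a c) ==> z : El (hom ?C c c') ==>
    ap (e a c' b) (ten m (ap (T a c c') (ten s z))) = ra K b c c' (ap (e a c b) (ten m s)) z"
  by metis
 note Lc = L[THEN hom2D(1)] L[THEN hom2D(2)] L[THEN hom2D(3)] and Tc = T[THEN hom2D(1)] T[THEN hom2D(2)] T[THEN hom2D(3)]
 define R :: "('u, 'o, 'm, 'c) wmod" where "R = \<lparr>mdom = ?C, mcod = ?A, car = r, lact = L, ract = T\<rparr>"
 have Rs: "mdom R = ?C" "mcod R = ?A" "car R = r" "lact R = L" "ract R = T" by (simp_all add: R_def)
 have LE: "ap (L a' a c) (ten x s) : El (r a' c)" if "a' : ob ?A" "a : ob ?A" "c : ob ?C" "x : El (hom ?A a' a)" "s : El (r a c)" for a' a c x s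
  using that u hc by (simp add: Lc)
 have TE: "ap (T a c c') (ten s z) : El (r a c')" if "a : ob ?A" "c : ob ?C" "c' : ob ?C" "s : El (r a c)" "z : El (hom ?C c c')" for a c c' s z
  using that u hc by (simp add: Tc)
 have eE: "ap (e a c b) (ten m s) : El (car K b c)" if "a : ob ?A" "c : ob ?C" "b : ob ?B" "m : El (car M b a)" "s : El (r a c)" for a b c m s
  using that u hc by simp
 have ME: "ra M b a a' m x : El (car M b a')" if "a : ob ?A" "a' : ob ?A" "b : ob ?B" "m : El (car M b a)" "x : El (hom ?A a a')" for a a' b m x
  using that u by simp
 note ext = hom_object_ext[OF _ _ he]
 have "wmodule W R ?C ?A"
 proof (rule wmoduleI)
  show "la R a'' a c (cm ?A a'' a' a x y) s = la R a'' a' c x (la R a' a c y s)"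
   if "a'' : ob ?A" "a' : ob ?A" "a : ob ?A" "c : ob ?C" "x : El (hom ?A a'' a')" "y : El (hom ?A a' a)" "s : El (car R a c)" for a'' a' a c x y s
   by (rule ext[of a'' c]) (use that u hc in "simp_all add: Rs Le LE ME")
  show "la R a a c (pt (unt ?A a)) s = s" if "a : ob ?A" "c : ob ?C" "s : El (car R a c)" for a c s
   by (rule ext[of a c]) (use that u hc in "simp_all add: Rs Le LE ME")
  show "ra R a c' c'' (ra R a c c' s x) y = ra R a c c'' s (cm ?C c c' c'' x y)"
   if "a : ob ?A" "c : ob ?C" "c' : ob ?C" "c'' : ob ?C" "s : El (car R a c)" "x : El (hom ?C c c')" "y : El (hom ?C c' c'')" for a c c' c'' x y s
   by (rule ext[of a c'']) (use that u hc in "simp_all add: Rs Te TE eE")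
  show "ra R a c c s (pt (unt ?C c)) = s" if "a : ob ?A" "c : ob ?C" "s : El (car R a c)" for a c s
   by (rule ext[of a c]) (use that u hc in "simp_all add: Rs Te TE eE")
  show "ra R a' c c' (la R a' a c x s) y = la R a' a c' x (ra R a c c' s y)"
   if "a' : ob ?A" "a : ob ?A" "c : ob ?C" "c' : ob ?C" "x : El (hom ?A a' a)" "s : El (car R a c)" "y : El (hom ?C c c')" for a' a c c' x y s
   by (rule ext[of a' c']) (use that u hc in "simp_all add: Rs Te TE eE Le LE ME")
 qed (use u hc L T in "auto simp: Rs hom1_iff")
 then show ?thesis using Rs Le Te by (intro exI[of _ R]) auto
qed

end

lemma ex_right_lifting_Mod: "EX R \<rho>. is_right_lifting (Mod W) M K R \<rho>"
proof -
 let ?A = "mdom M" and ?B = "mcod K" and ?C = "mdom K"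
 define p where "p a c = (SOME p. hom_object M K a c (fst p) (snd p))" for a c
 define r e where "r a c = fst (p a c)" and "e a c = snd (p a c)" for a c
 have he: "hom_object M K a c (r a c) (e a c)" if o: "a : ob ?A" "c : ob ?C" for a c
 proof -
  have "EX p. hom_object M K a c (fst p) (snd p)" using ex_hom_object[OF M K MK o] by auto
  from someI_ex[OF this] show ?thesis by (simp add: p_def r_def e_def)
 qed
 note hc = hom_object_cell[OF _ _ he]
 obtain R where R: "ismod R" "mdom R = ?C" "mcod R = ?A" "car R = r"
  and Rl: "!!b a' a c m x s. [|b : ob ?B; a' : ob ?A; a : ob ?A; c : ob ?C; m : El (car M b a'); x : El (hom ?A a' a); s : El (r a c)|] ==>
    ap (e a' c b) (ten m (la R a' a c x s)) = ap (e a c b) (ten (ra M b a' a m x) s)"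
  and Rr: "!!b a c c' m s z. [|b : ob ?B; a : ob ?A; c : ob ?C; c' : ob ?C; m : El (car M b a); s : El (r a c); z : El (hom ?C c c')|] ==>
    ap (e a c' b) (ten m (ra R a c c' s z)) = ra K b c c' (ap (e a c b) (ten m s)) z"
  by (rule exE[OF ex_lifting_module[of r e]], rule he, assumption+, elim conjE, rule that) (assumption | blast)+
 have "\<exists>\<rho>\<in>mors (cmod M R) K. ALL b:ob (mcod M). ALL a:ob (mcod R). ALL c:ob (mdom R). ALL m:El (car M b a). ALL s:El (car R a c).
   app \<rho> b c (cl M R b c a m s) = ap (e a c b) (ten m s)"
 proof (rule ex_mor_out_of_comp[OF M R(1)], goal_cases)
  case (5 b a c) then show ?case using hc R MK by (simp add: hom2_iff)
 next
  case (6 b a a' c m x s) then show ?case using Rl[of b a a' c m x s] R MK by simp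
 next
  case (7 b' b a c x m s) then show ?case using hom_object_lin[OF _ _ he, of a c b' b x m s] R MK by simp
 next
  case (8 b a c c' m s z) then show ?case using Rr[of b a c c' m s z] R MK by simp
 qed (use R K MK in simp_all)
 then obtain \<rho> where \<rho>: "\<rho> : mors (cmod M R) K"
  and \<rho>e: "!!b a c m s. [|b : ob ?B; a : ob ?A; c : ob ?C; m : El (car M b a); s : El (r a c)|] ==>
   app \<rho> b c (cl M R b c a m s) = ap (e a c b) (ten m s)"
  using R MK by auto
 have "is_right_lifting (Mod W) M K R \<rho>" unfolding is_right_lifting_Mod_iff
 proof (intro conjI allI impI R \<rho>, elim conjE)
  fix L \<sigma> assume L: "ismod L" "mdom L = ?C" "mcod L = ?A" and \<sigma>: "\<sigma> : mors (cmod M L) K"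
  note LMeq = L(3)[symmetric]
  note sc = Mod_hom2D(1-3)[OF \<sigma>]
  let ?s = "%a c b. component \<sigma> b c \<cdot> cin M L b c a"
  have cin: "cin M L b c a : cells2 W" "dom2 W (cin M L b c a) = car M b a \<star> car L a c" "cod2 W (cin M L b c a) = cob M L b c"
   "component \<sigma> b c : cells2 W" "dom2 W (component \<sigma> b c) = cob M L b c" "cod2 W (component \<sigma> b c) = car K b c"
   if "b : ob ?B" "a : ob ?A" "c : ob ?C" for a b c
   using coend_in_cell[OF M L(1) LMeq, of b c a] component_cell[OF sc(1), of b c] that L MK sc by simp_all
  have lc: "car L a c : cells1 W" "src W (car L a c) = ext ?C c" "trg W (car L a c) = ext ?A a" if "a : ob ?A" "c : ob ?C" for a c
   using L(1) L(2,3) that by simp_all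
  have CE: "cl M L b c a m l : El (car (cmod M L) b c)" if "b : ob ?B" "a : ob ?A" "c : ob ?C" "m : El (car M b a)" "l : El (car L a c)" for a b c m l
   using coend_El[OF M L(1) LMeq, of b c a m l] that L MK by simp
  have sel: "ap (?s a c b) (ten m l) = app \<sigma> b c (cl M L b c a m l)"
   if "b : ob ?B" "a : ob ?A" "c : ob ?C" "m : El (car M b a)" "l : El (car L a c)" for a b c m l
   using that cin[OF that(1-3)] lc[OF that(2,3)] M K MK by simp
  have "EX t:hom2 W (car L a c) (r a c). ALL b:ob ?B. ALL m:El (car M b a). ALL l:El (car L a c). ap (e a c b) (ten m (ap t l)) = ap (?s a c b) (ten m l)"
   if o: "a : ob ?A" "c : ob ?C" for a c
  proof (rule hom_object_map[OF o he[OF o]], rule lift_familyI[OF o _ generates_El])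
   fix b' b x m l assume *: "b' : ob ?B" "b : ob ?B" "x : El (hom ?B b' b)" "m : El (car M b a)" "l : El (car L a c)"
   have xm: "la M b' b a x m : El (car M b' a)" using * o M K MK by simp
   have 1: "la (cmod M L) b' b c x (cl M L b c a m l) = cl M L b' c a (la M b' b a x m) l"
    by (rule lact_mod_comp_el[OF M L(1) LMeq]) (use * o L M K MK in simp_all)
   have 2: "app \<sigma> b' c (la (cmod M L) b' b c x (cl M L b c a m l))
    = la K b' b c x (app \<sigma> b c (cl M L b c a m l))"
    by (rule component_lact_hom[OF \<sigma>]) (use * o L MK CE[of b a c m l] in simp_all)
   show "ap (?s a c b') (ten (la M b' b a x m) l) = la K b' b c x (ap (?s a c b) (ten m l))"
    unfolding sel[OF *(1) o xm *(5)] sel[OF *(2) o *(4,5)] using 2 unfolding 1 .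
  qed (use lc[OF o] cin o M K MK in "auto simp: hom1_iff hom2_iff")
  then obtain t where t: "!!a c. a : ob ?A ==> c : ob ?C ==> t a c : hom2 W (car L a c) (r a c)"
   and te: "!!a c b m l. [|b : ob ?B; a : ob ?A; c : ob ?C; m : El (car M b a); l : El (car L a c)|]
     ==> ap (e a c b) (ten m (ap (t a c) l)) = app \<sigma> b c (cl M L b c a m l)"
   using sel by metis
  note T = t[THEN hom2D(1)] t[THEN hom2D(2)] t[THEN hom2D(3)]
  have tE: "ap (t a c) l : El (r a c)" if "a : ob ?A" "c : ob ?C" "l : El (car L a c)" for a c l using that by (simp add: T)
  let ?t = "mk_wmor L R t"
  have \<tau>: "?t : mors L R"
  proof (rule mk_wmor_in[OF L(1) R(1)])
   fix a' a c x l assume "a' : ob (mcod L)" "a : ob (mcod L)" "c : ob (mdom L)" "x : El (hom (mcod L) a' a)" and l: "l : El (car L a c)"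
   then have o: "a' : ob ?A" "a : ob ?A" "c : ob ?C" "x : El (hom ?A a' a)" using L by simp_all
   have xl: "la L a' a c x l : El (car L a' c)" using o l L M K by simp
   show "ap (t a' c) (la L a' a c x l) = la R a' a c x (ap (t a c) l)"
   proof (rule hom_object_ext[OF o(1,3) he[OF o(1,3)] tE[OF o(1,3) xl]])
    show "la R a' a c x (ap (t a c) l) : El (r a' c)" using R o tE[OF o(2,3) l] M K hc by simp
    fix b m assume b: "b : ob ?B" and m: "m : El (car M b a')"
    have mx: "ra M b a' a m x : El (car M b a)" using M K MK o b m by simp
    show "ap (e a' c b) (ten m (ap (t a' c) (la L a' a c x l))) = ap (e a' c b) (ten m (la R a' a c x (ap (t a c) l)))"
     unfolding te[OF b o(1,3) m xl] Rl[OF b o(1-3) m o(4) tE[OF o(2,3) l]] te[OF b o(2,3) mx l]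
     using coend_bal[OF M L(1) LMeq, of b c a' a m x l] b o m l L MK by simp
   qed simp
  next
   fix a c c' l z assume "a : ob (mcod L)" "c : ob (mdom L)" "c' : ob (mdom L)" and l: "l : El (car L a c)" and "z : El (hom (mdom L) c c')"
   then have o: "a : ob ?A" "c : ob ?C" "c' : ob ?C" "z : El (hom ?C c c')" using L by simp_all
   have lz: "ra L a c c' l z : El (car L a c')" using o l L M K by simp
   show "ap (t a c') (ra L a c c' l z) = ra R a c c' (ap (t a c) l) z"
   proof (rule hom_object_ext[OF o(1,3) he[OF o(1,3)] tE[OF o(1,3) lz]])
    show "ra R a c c' (ap (t a c) l) z : El (r a c')" using R o tE[OF o(1,2) l] M K hc by simp
    fix b m assume b: "b : ob ?B" and m: "m : El (car M b a)"
    have 1: "ra (cmod M L) b c c' (cl M L b c a m l) z = cl M L b c' a m (ra L a c c' l z)"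
     by (rule ract_mod_comp_el[OF M L(1) LMeq]) (use b o m l L M K MK in simp_all)
    have 2: "app \<sigma> b c' (ra (cmod M L) b c c' (cl M L b c a m l) z)
     = ra K b c c' (app \<sigma> b c (cl M L b c a m l)) z"
     by (rule component_ract_hom[OF \<sigma>]) (use b o m l L MK CE[of b a c m l] in simp_all)
    show "ap (e a c' b) (ten m (ap (t a c') (ra L a c c' l z))) = ap (e a c' b) (ten m (ra R a c c' (ap (t a c) l) z))"
     unfolding te[OF b o(1,3) m lz] Rr[OF b o(1-3) m tE[OF o(1,2) l] o(4)] te[OF b o(1,2) m l] using 2 unfolding 1 .
   qed simp
  qed (use L R t in auto)
  note iff = lift_eq_iff[OF M \<rho> R(3) _ \<sigma>, unfolded MK L(2)]
  show "\<exists>!\<tau>. \<tau> : mors L R & vc \<rho> (hc (idm M) \<tau>) = \<sigma>"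
  proof (rule ex1I[of _ ?t], intro conjI \<tau>)
   show "vc \<rho> (hc (idm M) ?t) = \<sigma>"
    unfolding iff[OF \<tau>] using L \<rho>e te tE by simp
   fix \<tau>' assume "\<tau>' : mors L R & vc \<rho> (hc (idm M) \<tau>') = \<sigma>"
   then have \<tau>': "\<tau>' : mors L R" and eq: "vc \<rho> (hc (idm M) \<tau>') = \<sigma>" by simp_all
   show "\<tau>' = ?t"
   proof (rule mor_eqI[OF \<tau>' \<tau>])
    fix a c l assume "a : ob (mcod L)" "c : ob (mdom L)" and l: "l : El (car L a c)"
    then have o: "a : ob ?A" "c : ob ?C" using L by simp_all
    have E: "app \<tau>' a c l : El (r a c)" using component_El[OF \<tau>', of a c l] o l L R by simp
    have "app \<tau>' a c l = ap (t a c) l"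
    proof (rule hom_object_ext[OF o he[OF o] E tE[OF o l]])
     fix b m assume b: "b : ob ?B" and m: "m : El (car M b a)"
     show "ap (e a c b) (ten m (app \<tau>' a c l)) = ap (e a c b) (ten m (ap (t a c) l))"
      unfolding te[OF b o m l] \<rho>e[OF b o m E, symmetric]
      by (rule eq[unfolded iff[OF \<tau>'], rule_format, OF b o m l])
    qed simp
    then show "app \<tau>' a c l = app ?t a c l" using o L by simp
   qed
  qed
 qed
 then show ?thesis by blast
qed

end
end


section \<open>Solutions of the two equations and representability\<close>

lemma (in bicategory) ap_inv_runit [simp]:
 assumes "x : El f" "f : cells1 W" shows "ap (inv2 W (\<r> f)) x = ten x (pt (\<iota> (\<one> (src W f))))"
proof -
 have t: "ten x (pt (\<iota> (\<one> (src W f)))) : El (f \<star> \<one> (src W f))"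
  by (rule ten_El[OF assms(1)]) (use assms in "auto intro!: pt_El")
 have "ap (inv2 W (\<r> f)) (ap (\<r> f) (ten x (pt (\<iota> (\<one> (src W f)))))) = ten x (pt (\<iota> (\<one> (src W f))))"
  by (rule ap_inv2) (use assms t in simp_all)
 then show ?thesis using assms by simp
qed

context enriched_base
begin

context
 fixes F Z :: "('u, 'o, 'm, 'c) wfun" and M :: "('u, 'o, 'm, 'c) wmod"
 assumes F: "isfun F" and Z: "wfunctor W Z (fdom Z) (fcod F)" and ZF: "fcod Z = fcod F"
  and M: "wmodule W M (fdom Z) (fdom F)" and MA: "mdom M = fdom Z" and MB: "mcod M = fdom F"
begin

lemmas preE = F Z ZF M MA MB

lemma to_rep_act:
 assumes \<sigma>: "\<sigma> : mors P (rp Z)" and P: "mcod P = fcod F" "mdom P = fdom Z"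
  and o: "c : ob (fcod F)" "a : ob (fdom Z)" "n : El (car P c a)"
 shows "app \<sigma> c a n : El (hom (fcod F) c (fob Z a))"
  "c' : ob (fcod F) ==> x : El (hom (fcod F) c' c) ==> app \<sigma> c' a (la P c' c a x n)
   = cm (fcod F) c' c (fob Z a) x (app \<sigma> c a n)"
  "a' : ob (fdom Z) ==> y : El (hom (fdom Z) a a') ==> app \<sigma> c a' (ra P c a a' n y)
   = cm (fcod F) c (fob Z a) (fob Z a') (app \<sigma> c a n) (ap (fmap Z a a') y)"
proof -
 show 1: "app \<sigma> c a n : El (hom (fcod F) c (fob Z a))"
  using component_El[OF \<sigma>, of c a n] o P ZF by simp
 show "c' : ob (fcod F) ==> x : El (hom (fcod F) c' c) ==> app \<sigma> c' a (la P c' c a x n)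
   = cm (fcod F) c' c (fob Z a) x (app \<sigma> c a n)"
  using component_lact_hom[OF \<sigma>, of c' c a x n] o P ZF by simp
 show "a' : ob (fdom Z) ==> y : El (hom (fdom Z) a a') ==> app \<sigma> c a' (ra P c a a' n y)
   = cm (fcod F) c (fob Z a) (fob Z a') (app \<sigma> c a n) (ap (fmap Z a a') y)"
  using component_ract_hom[OF \<sigma>, of c a a' n y] o P ZF 1 F Z by simp
qed

lemma from_rep_act:
 assumes \<beta>: "\<beta> : mors (rp Z) P"
  and o: "c : ob (fcod F)" "a : ob (fdom Z)" "y : El (hom (fcod F) c (fob Z a))"
 shows "app \<beta> c a y : El (car P c a)"
  "c' : ob (fcod F) ==> x : El (hom (fcod F) c' c) ==> app \<beta> c' a (cm (fcod F) c' c (fob Z a) x y)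
   = la P c' c a x (app \<beta> c a y)"
  "a' : ob (fdom Z) ==> z : El (hom (fdom Z) a a') ==> app \<beta> c a' (cm (fcod F) c (fob Z a) (fob Z a') y (ap (fmap Z a a') z))
   = ra P c a a' (app \<beta> c a y) z"
proof -
 show "app \<beta> c a y : El (car P c a)" using component_El[OF \<beta>, of c a y] o ZF by simp
 show "c' : ob (fcod F) ==> x : El (hom (fcod F) c' c) ==> app \<beta> c' a (cm (fcod F) c' c (fob Z a) x y)
   = la P c' c a x (app \<beta> c a y)"
  using component_lact_hom[OF \<beta>, of c' c a x y] o ZF by simp
 show "a' : ob (fdom Z) ==> z : El (hom (fdom Z) a a') ==> app \<beta> c a' (cm (fcod F) c (fob Z a) (fob Z a') y (ap (fmap Z a a') z))
   = ra P c a a' (app \<beta> c a y) z"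
  using component_ract_hom[OF \<beta>, of c a a' y z] o ZF F Z by simp
qed

abbreviation Zid :: "'u => ('m, 'c) element" where
 "Zid a \<equiv> pt (unt (fcod F) (fob Z a))"

lemma Zid_El: "a : ob (fdom Z) ==> Zid a : El (hom (fcod F) (fob Z a) (fob Z a))"
 using F Z ZF by simp

context
 fixes \<alpha> \<beta>
 assumes \<alpha>: "\<alpha> : mors M (cmod (cor F) (rp Z))" and \<beta>: "\<beta> : mors (rp Z) (cmod (rp F) M)"
begin

text \<open>Both sides are linear, and on a class \<open>f \<otimes> m\<close> one computes \<open>\<beta>(f \<cdot> \<alpha>(m)) = f \<cdot> \<beta>(\<alpha>(m))
 = [f \<otimes> m]\<close>.\<close>

lemma E1_retract:
 assumes E1: "equation_E1 W M F \<alpha> \<beta>"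
  and o: "c : ob (fcod F)" "a : ob (fdom Z)" and n: "n : El (cob (rp F) M c a)"
 shows "app \<beta> c a (app (mate F Z \<alpha>) c a n) = n"
proof -
 note mi = mate_in_hom[OF preE \<alpha>]
 note s = Mod_hom2D(1-3)[OF mi] and b = Mod_hom2D(1-3)[OF \<beta>]
 note u = o F Z ZF MA s b
 show ?thesis
 proof (rule gen_id[OF FM_gens[OF preE o] _ _ _ n])
  show "component (mate F Z \<alpha>) c a : hom2 W (cob (rp F) M c a) (hom (fcod F) c (fob Z a))"
   "component \<beta> c a : hom2 W (hom (fcod F) c (fob Z a)) (cob (rp F) M c a)"
   using component_cell[OF s(1), of c a] component_cell[OF b(1), of c a] u by (simp_all add: hom2_iff)
  show "ALL x:coend_El_gens (rp F) M c a. app \<beta> c a (app (mate F Z \<alpha>) c a x) = x"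
  proof
   fix x assume "x : coend_El_gens (rp F) M c a"
   then obtain b f m where x: "b : ob (fdom F)" "f : El (hom (fcod F) c (fob F b))" "m : El (car M b a)" "x = cl (rp F) M c a b f m"
    by (rule FM_gensE[OF preE])
   have fb: "fob F b : ob (fcod F)" using F x by simp
   have id: "idpt F b : El (hom (fcod F) (fob F b) (fob F b))" using F x by simp
   note bE = bar_El[OF preE \<alpha> x(1) o(2) x(3)]
   have "app \<beta> c a (app (mate F Z \<alpha>) c a x) = la (cmod (rp F) M) c (fob F b) a f (app \<beta> (fob F b) a (ap (bar F (rp Z) \<alpha> b a) m))"
    unfolding x(4) mate_el[OF preE \<alpha> o x(1-3)] by (rule from_rep_act(2)[OF \<beta> fb o(2) bE o(1) x(2)])
   also have "\<dots> = cl (rp F) M c a b (cm (fcod F) c (fob F b) (fob F b) f (idpt F b)) m"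
    using E1[unfolded E1_iff[OF preE \<alpha> \<beta>], rule_format, OF x(1) o(2) x(3)] FM_act(1)[OF preE fb o(2) x(1) id x(3) o(1) x(2)] by simp
   also have "\<dots> = x" using x o fb F by simp
   finally show "app \<beta> c a (app (mate F Z \<alpha>) c a x) = x" .
  qed
 qed
qed

lemma E1_E2_iso:
 assumes E1: "equation_E1 W M F \<alpha> \<beta>" and E2: "equation_E2 W F Z \<alpha> \<beta>"
 shows "isomorphic1 (Mod W) (cmod (rp F) M) (rp Z)"
proof -
 note mi = mate_in_hom[OF preE \<alpha>]
 note s = Mod_hom2D(1-3)[OF mi]
 have "vc \<beta> (mate F Z \<alpha>) = idm (cmod (rp F) M)"
 proof (rule mor_eqI[OF mor_vcomp_in[OF mi \<beta>] id_hom2[OF FMc[OF preE]]])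
  fix c a n assume *: "c : ob (mcod (cmod (rp F) M))" "a : ob (mdom (cmod (rp F) M))" "n : El (car (cmod (rp F) M) c a)"
  then show "app (vc \<beta> (mate F Z \<alpha>)) c a n = app (idm (cmod (rp F) M)) c a n"
   using mor_vcomp_el[OF mi \<beta> *] E1_retract[OF E1, of c a n] MA by simp
 qed
 then have "inverse2 (Mod W) (mate F Z \<alpha>) \<beta>"
  using E2[unfolded E2_iff[OF preE \<alpha> \<beta>]] s \<beta> by (simp add: Mod_inverse2_iff)
 then show ?thesis unfolding isomorphic1_def iso2_def using mi by blast
qed

end

lemma iso_E1_E2:
 assumes "isomorphic1 (Mod W) (cmod (rp F) M) (rp Z)"
 shows "\<exists>\<alpha> \<beta>. \<alpha> : mors M (cmod (cor F) (rp Z)) & \<beta> : mors (rp Z) (cmod (rp F) M) &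
  equation_E1 W M F \<alpha> \<beta> & equation_E2 W F Z \<alpha> \<beta>"
proof -
 from assms obtain \<sigma> where \<sigma>: "\<sigma> : mors (cmod (rp F) M) (rp Z)" and i: "iso2 (Mod W) \<sigma>"
  by (auto simp: isomorphic1_def)
 from unmate[OF preE \<sigma>] obtain \<alpha> where \<alpha>: "\<alpha> : mors M (cmod (cor F) (rp Z))" and ma: "mate F Z \<alpha> = \<sigma>" by blast
 let ?\<beta> = "inv2 (Mod W) \<sigma>"
 note inv = Mod_inv2[OF i \<sigma>]
 have "equation_E2 W F Z \<alpha> ?\<beta>" unfolding E2_iff[OF preE \<alpha> inv(1)] ma by (rule inv(3))
 moreover have "equation_E1 W M F \<alpha> ?\<beta>" unfolding E1_iff[OF preE \<alpha> inv(1)]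
 proof (intro ballI)
  fix b a m assume o: "b : ob (fdom F)" "a : ob (fdom Z)" and m: "m : El (car M b a)"
  let ?n = "cl (rp F) M (fob F b) a b (idpt F b) m"
  have fb: "fob F b : ob (fcod F)" using F o by simp
  have id: "idpt F b : El (hom (fcod F) (fob F b) (fob F b))" using F o by simp
  have n: "?n : El (cob (rp F) M (fob F b) a)" by (rule FM_El[OF preE fb o(2,1) id m])
  note bE = bar_El[OF preE \<alpha> o m]
  have "app \<sigma> (fob F b) a ?n = ap (bar F (rp Z) \<alpha> b a) m"
   unfolding ma[symmetric] mate_el[OF preE \<alpha> fb o(2,1) id m] using bE F Z ZF fb o by simp
  moreover have "app ?\<beta> (fob F b) a (app \<sigma> (fob F b) a ?n) = ?n"
   by (rule Mod_inv2_el[OF i \<sigma>]) (use fb o MA n in simp_all)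
  ultimately show "app ?\<beta> (fob F b) a (ap (bar F (rp Z) \<alpha> b a) m) = ?n" by simp
 qed
 ultimately show ?thesis using \<alpha> inv(1) by blast
qed

subsection \<open>Splitting the idempotent of a solution of the first equation\<close>

lemma pt_point_comp:
 fixes C :: "('u, 'o, 'm, 'c) wcat"
 assumes "f : hom2 W (\<one> (ext C x)) (hom C x y)" "g : hom2 W (\<one> (ext C x)) (hom C y z)" "wcategory W C" "x : ob C" "y : ob C" "z : ob C"
  and "ext C y = ext C x" "ext C z = ext C x"
 shows "pt (point_comp W C x y z f g) = cm C x y z (pt f) (pt g)"
 using assms by (simp add: point_comp_def ten_def ap_def pt_def hom2_iff vassoc)

text \<open>The idempotent \<open>y \<mapsto> mate(\<beta>(y))\<close> on \<open>Z\<close> is right multiplication by the points \<open>e a =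
 mate(\<beta>(1))\<close> of \<open>C(Z a, Z a)\<close>. If \<open>e a = s a \<cdot> r a\<close> and \<open>r a \<cdot> s a = 1\<close>, then \<open>x \<mapsto> r a
 \<cdot> Z x \<cdot> s a'\<close> is a functor \<open>Y\<close>, because \<open>e\<close> commutes with the elements \<open>Z x\<close>, and \<open>n \<mapsto>
 mate(n) \<cdot> s a\<close> has the inverse \<open>y \<mapsto> \<beta>(y \<cdot> r a)\<close>.\<close>

lemma E1_split:
 assumes \<alpha>: "\<alpha> : mors M (cmod (cor F) (rp Z))" and \<beta>: "\<beta> : mors (rp Z) (cmod (rp F) M)"
  and E1: "equation_E1 W M F \<alpha> \<beta>" and split: "idempotents_split W (fcod F)"
 shows "EX Y. wfunctor W Y (fdom Z) (fcod F) & isomorphic1 (Mod W) (cmod (rp F) M) (rp Y)"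
proof -
 let ?C = "fcod F" and ?A = "fdom Z" and ?N = "cmod (rp F) M"
 note mi = mate_in_hom[OF preE \<alpha>]
 define mt where "mt c a n = app (mate F Z \<alpha>) c a n" for c a n
 define bt where "bt c a y = app \<beta> c a y" for c a y
 define ep where "ep a = component (mate F Z \<alpha>) (fob Z a) a \<cdot> component \<beta> (fob Z a) a \<cdot> unt ?C (fob Z a)" for a
 have Np: "mcod ?N = ?C" "mdom ?N = ?A" using MA by simp_all
 have mE: "mt c a n : El (hom ?C c (fob Z a))"
  and ml: "!!c' x. c' : ob ?C ==> x : El (hom ?C c' c) ==> mt c' a (la ?N c' c a x n) = cm ?C c' c (fob Z a) x (mt c a n)"
  and mr: "!!a' y. a' : ob ?A ==> y : El (hom ?A a a') ==> mt c a' (ra ?N c a a' n y) = cm ?C c (fob Z a) (fob Z a') (mt c a n) (ap (fmap Z a a') y)"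
  if "c : ob ?C" "a : ob ?A" "n : El (cob (rp F) M c a)" for c a n
  unfolding mt_def using to_rep_act[OF mi Np that(1,2)] that(3) by simp_all
 have bE: "bt c a y : El (cob (rp F) M c a)"
  and bl: "!!c' x. c' : ob ?C ==> x : El (hom ?C c' c) ==> bt c' a (cm ?C c' c (fob Z a) x y) = la ?N c' c a x (bt c a y)"
  and br: "!!a' z. a' : ob ?A ==> z : El (hom ?A a a') ==> bt c a' (cm ?C c (fob Z a) (fob Z a') y (ap (fmap Z a a') z)) = ra ?N c a a' (bt c a y) z"
  if "c : ob ?C" "a : ob ?A" "y : El (hom ?C c (fob Z a))" for c a y
  unfolding bt_def using from_rep_act[OF \<beta> that] by simp_all
 have bm: "bt c a (mt c a n) = n" if "c : ob ?C" "a : ob ?A" "n : El (cob (rp F) M c a)" for c a n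
  unfolding bt_def mt_def by (rule E1_retract[OF \<alpha> \<beta> E1 that])
 note mc = component_cell[OF Mod_hom2D(1)[OF mi], unfolded Mod_hom2D(2,3)[OF mi] mod_comp_sel rep_sel ZF MA]
  and bc = component_cell[OF Mod_hom2D(1)[OF \<beta>], unfolded Mod_hom2D(2,3)[OF \<beta>] mod_comp_sel rep_sel ZF MA]
 have Za: "fob Z a : ob ?C" "ext ?C (fob Z a) = ext ?A a" if "a : ob ?A" for a using Z that ZF by simp_all
 have Cw: "wcategory W ?C" and Aw: "wcategory W ?A" using F Zc[OF preE] by simp_all
 have ep: "ep a : hom2 W (\<one> (ext ?A a)) (hom ?C (fob Z a) (fob Z a))" "pt (ep a) = mt (fob Z a) a (bt (fob Z a) a (Zid a))"
  if "a : ob ?A" for a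
  using that Cw Za[OF that] by (simp_all add: ep_def mt_def bt_def hom2_iff mc bc)
 have epE: "pt (ep a) : El (hom ?C (fob Z a) (fob Z a))" if "a : ob ?A" for a
  unfolding ep(2)[OF that] by (intro mE bE Zid_El Za that)
 have e_mult: "mt c a (bt c a y) = cm ?C c (fob Z a) (fob Z a) y (pt (ep a))"
  if "c : ob ?C" "a : ob ?A" "y : El (hom ?C c (fob Z a))" for c a y
 proof -
  have "y = cm ?C c (fob Z a) (fob Z a) y (Zid a)" using that Cw Za by simp
  then have "mt c a (bt c a y) = mt c a (bt c a (cm ?C c (fob Z a) (fob Z a) y (Zid a)))" by simp
  also have "\<dots> = cm ?C c (fob Z a) (fob Z a) y (pt (ep a))"
   using bl[OF Za(1)[OF that(2)] that(2) Zid_El[OF that(2)] that(1,3)] ml[OF Za(1)[OF that(2)] that(2) bE[OF Za(1)[OF that(2)] that(2) Zid_El[OF that(2)]] that(1,3)] ep(2)[OF that(2)] by simp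
  finally show ?thesis .
 qed
 have me: "cm ?C c (fob Z a) (fob Z a) (mt c a n) (pt (ep a)) = mt c a n"
  if "c : ob ?C" "a : ob ?A" "n : El (cob (rp F) M c a)" for c a n
  unfolding e_mult[OF that(1,2) mE[OF that], symmetric] bm[OF that] ..
 have eZ: "cm ?C (fob Z a) (fob Z a) (fob Z a') (pt (ep a)) (ap (fmap Z a a') x) = cm ?C (fob Z a) (fob Z a') (fob Z a') (ap (fmap Z a a') x) (pt (ep a'))"
  if o: "a : ob ?A" "a' : ob ?A" "x : El (hom ?A a a')" for a a' x
 proof -
  have Zx: "ap (fmap Z a a') x : El (hom ?C (fob Z a) (fob Z a'))" using Z o ZF by simp
  note i = Zid_El[OF o(1)] and za = Za(1)[OF o(1)]
  have "ap (fmap Z a a') x = cm ?C (fob Z a) (fob Z a) (fob Z a') (Zid a) (ap (fmap Z a a') x)" using Zx Cw za Za(1)[OF o(2)] by simp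
  then have "mt (fob Z a) a' (bt (fob Z a) a' (ap (fmap Z a a') x)) = mt (fob Z a) a' (ra ?N (fob Z a) a a' (bt (fob Z a) a (Zid a)) x)"
   using br[OF za o(1) i o(2,3)] by simp
  also have "\<dots> = cm ?C (fob Z a) (fob Z a) (fob Z a') (pt (ep a)) (ap (fmap Z a a') x)"
   using mr[OF za o(1) bE[OF za o(1) i] o(2,3)] ep(2)[OF o(1)] by simp
  finally show ?thesis using e_mult[OF za o(2) Zx] by simp
 qed
 have ee: "cm ?C (fob Z a) (fob Z a) (fob Z a) (pt (ep a)) (pt (ep a)) = pt (ep a)" if "a : ob ?A" for a
  using me[OF Za(1)[OF that] that bE[OF Za(1)[OF that] that Zid_El[OF that]]] ep(2)[OF that] by simp
 define Q where "Q a y s r \<longleftrightarrow> y : ob ?C & ext ?C y = ext ?A a & s : hom2 W (\<one> (ext ?A a)) (hom ?C (fob Z a) y) & r : hom2 W (\<one> (ext ?A a)) (hom ?C y (fob Z a)) &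
   cm ?C (fob Z a) y (fob Z a) (pt s) (pt r) = pt (ep a) & cm ?C y (fob Z a) y (pt r) (pt s) = pt (unt ?C y)" for a y s r
 have ex: "EX y s r. Q a y s r" if a: "a : ob ?A" for a
 proof -
  note x = Za[OF a]
  have e: "ep a : hom2 W (\<one> (ext ?C (fob Z a))) (hom ?C (fob Z a) (fob Z a))" using ep(1)[OF a] x by simp
  have "pt (point_comp W ?C (fob Z a) (fob Z a) (fob Z a) (ep a) (ep a)) = pt (ep a)"
   using pt_point_comp[OF e e Cw x(1) x(1) x(1)] ee[OF a] by simp
  then obtain y s r where y: "y : ob ?C" "ext ?C y = ext ?C (fob Z a)" and s: "s : hom2 W (\<one> (ext ?C (fob Z a))) (hom ?C (fob Z a) y)"
   and r: "r : hom2 W (\<one> (ext ?C (fob Z a))) (hom ?C y (fob Z a))" and sr: "point_comp W ?C (fob Z a) y (fob Z a) s r = ep a" "point_comp W ?C y (fob Z a) y r s = unt ?C y"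
   using split[unfolded idempotents_split_def, rule_format, OF x(1) e] by auto
  have r': "r : hom2 W (\<one> (ext ?C y)) (hom ?C y (fob Z a))" and s': "s : hom2 W (\<one> (ext ?C y)) (hom ?C (fob Z a) y)" using r s y by simp_all
  show ?thesis
   using pt_point_comp[OF s r Cw x(1) y(1) x(1)] pt_point_comp[OF r' s' Cw y(1) x(1) y(1)] y s r sr x unfolding Q_def by (intro exI[of _ y] exI[of _ s] exI[of _ r]) simp
 qed
 obtain y s r where Qa: "!!a. a : ob ?A ==> Q a (y a) (s a) (r a)" using ex by metis
 from Qa have y: "!!a. a : ob ?A ==> y a : ob ?C" "!!a. a : ob ?A ==> ext ?C (y a) = ext ?A a"
  and s: "!!a. a : ob ?A ==> s a : hom2 W (\<one> (ext ?A a)) (hom ?C (fob Z a) (y a))" and r: "!!a. a : ob ?A ==> r a : hom2 W (\<one> (ext ?A a)) (hom ?C (y a) (fob Z a))"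
  and sr: "!!a. a : ob ?A ==> cm ?C (fob Z a) (y a) (fob Z a) (pt (s a)) (pt (r a)) = pt (ep a)"
  and rs: "!!a. a : ob ?A ==> cm ?C (y a) (fob Z a) (y a) (pt (r a)) (pt (s a)) = pt (unt ?C (y a))"
  unfolding Q_def by blast+
 note sc = s[THEN hom2D(1)] s[THEN hom2D(2)] s[THEN hom2D(3)] and rc = r[THEN hom2D(1)] r[THEN hom2D(2)] r[THEN hom2D(3)]
 have sE: "pt (s a) : El (hom ?C (fob Z a) (y a))" and rE: "pt (r a) : El (hom ?C (y a) (fob Z a))" if "a : ob ?A" for a
  using that Aw by (auto intro!: pt_El[of _ "ext ?A a"] simp: sc rc)
 have ZE: "ap (fmap Z a a') x : El (hom ?C (fob Z a) (fob Z a'))" if "a : ob ?A" "a' : ob ?A" "x : El (hom ?A a a')" for a a' x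
  using that Z ZF by simp
 note cE = ap_El[OF cmp_cell(1)[OF Cw]]
 have mulE: "cm ?C x y z f g : El (hom ?C x z)" if "x : ob ?C" "y : ob ?C" "z : ob ?C" "f : El (hom ?C x y)" "g : El (hom ?C y z)" for x y z f g
  using that Cw by simp
 note assoc = cmp_assoc_el[OF Cw] and unit = cmp_unt_el[OF Cw]
 define mul where "mul x y z f g = cm ?C x y z f g" for x y z f g
 note mul = mul_def[symmetric]
 note mulE' = mulE[unfolded mul] and assoc' = assoc[unfolded mul] and unit' = unit[unfolded mul]
 define rs' where "rs' c a = cmp ?C c (fob Z a) (y a) \<cdot> (\<iota> (hom ?C c (fob Z a)) \<ast> s a) \<cdot> inv2 W (\<r> (hom ?C c (fob Z a)))" for c a
 define rr' where "rr' c a = cmp ?C c (y a) (fob Z a) \<cdot> (\<iota> (hom ?C c (y a)) \<ast> r a) \<cdot> inv2 W (\<r> (hom ?C c (y a)))" for c a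
 have rs'c: "rs' c a : hom2 W (hom ?C c (fob Z a)) (hom ?C c (y a))" and rr'c: "rr' c a : hom2 W (hom ?C c (y a)) (hom ?C c (fob Z a))"
  if "c : ob ?C" "a : ob ?A" for c a
  using that Cw Aw y Za by (simp_all add: hom2_iff sc rc rs'_def rr'_def)
 have rs'e: "ap (rs' c a) f = mul c (fob Z a) (y a) f (pt (s a))" if "c : ob ?C" "a : ob ?A" "f : El (hom ?C c (fob Z a))" for c a f
  using that Cw y Za Aw unfolding rs'_def mul_def by (simp add: sc)
 have rr'e: "ap (rr' c a) f = mul c (y a) (fob Z a) f (pt (r a))" if "c : ob ?C" "a : ob ?A" "f : El (hom ?C c (y a))" for c a f
  using that Cw y Za Aw unfolding rr'_def mul_def by (simp add: rc)
 define Y :: "('u, 'o, 'm, 'c) wfun" where "Y = \<lparr>fdom = ?A, fcod = ?C, fob = y,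
  fmap = (%a a'. cmp ?C (y a) (fob Z a) (y a') \<cdot> (r a \<ast> (rs' (fob Z a) a' \<cdot> fmap Z a a')) \<cdot> inv2 W (\<l> (hom ?A a a')))\<rparr>"
 have Ys: "fdom Y = ?A" "fcod Y = ?C" "fob Y a = y a" for a by (simp_all add: Y_def)
 have Zf: "fmap Z a a' : cells2 W" "dom2 W (fmap Z a a') = hom ?A a a'" "cod2 W (fmap Z a a') = hom ?C (fob Z a) (fob Z a')"
  if "a : ob ?A" "a' : ob ?A" for a a' using that Z ZF by simp_all
 have Yc: "fmap Y a a' : hom2 W (hom ?A a a') (hom ?C (y a) (y a'))" if o: "a : ob ?A" "a' : ob ?A" for a a'
  using o Cw Aw y Za Zf[OF o] hom2D[OF rs'c[OF Za(1)[OF o(1)] o(2)]] by (simp add: Y_def hom2_iff rc)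
 let ?Y = "%a a' x. mul (y a) (fob Z a) (y a') (pt (r a)) (mul (fob Z a) (fob Z a') (y a') (ap (fmap Z a a') x) (pt (s a')))"
 have Ye: "ap (fmap Y a a') x = ?Y a a' x" if o: "a : ob ?A" "a' : ob ?A" "x : El (hom ?A a a')" for a a' x
  using o Cw Aw y Za Zf[OF o(1,2)] hom2D[OF rs'c[OF Za(1)[OF o(1)] o(2)]] rs'e[OF Za(1)[OF o(1)] o(2) ZE[OF o]]
  by (simp add: Y_def rc mul_def[of "y a"])
 note ob = y(1) Za(1)
 have es: "mul (fob Z a) (fob Z a) (y a) (pt (ep a)) (pt (s a)) = pt (s a)" if "a : ob ?A" for a
  using that ob sE rE rs[unfolded mul] sr[unfolded mul, symmetric] by (simp add: assoc' unit')
 have ew: "mul (fob Z a) (y a) c (pt (s a)) (mul (y a) (fob Z a) c (pt (r a)) f) = mul (fob Z a) (fob Z a) c (pt (ep a)) f"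
  if "a : ob ?A" "c : ob ?C" "f : El (hom ?C (fob Z a) c)" for a c f
  using that ob sE rE sr[unfolded mul, symmetric] by (simp add: assoc')
 have srZ: "mul (fob Z a) (y a) (y a') (pt (s a)) (?Y a a' x) = mul (fob Z a) (fob Z a') (y a') (ap (fmap Z a a') x) (pt (s a'))"
  if o: "a : ob ?A" "a' : ob ?A" "x : El (hom ?A a a')" for a a' x
 proof -
  have "mul (fob Z a) (y a) (y a') (pt (s a)) (?Y a a' x) = mul (fob Z a) (fob Z a') (y a') (mul (fob Z a) (fob Z a) (fob Z a') (pt (ep a)) (ap (fmap Z a a') x)) (pt (s a'))"
   using o ob sE ZE epE mulE' by (simp add: ew assoc')
  also have "\<dots> = mul (fob Z a) (fob Z a') (y a') (ap (fmap Z a a') x) (mul (fob Z a') (fob Z a') (y a') (pt (ep a')) (pt (s a')))"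
   unfolding eZ[unfolded mul, OF o] using o ob sE ZE epE by (simp add: assoc')
  finally show ?thesis using es o by simp
 qed
 have Yw: "wfunctor W Y ?A ?C"
 proof (rule wfunctorI)
  fix a a' a'' x x' assume o: "a : ob ?A" "a' : ob ?A" "a'' : ob ?A" and x: "x : El (hom ?A a a')" "x' : El (hom ?A a' a'')"
  have xx: "cm ?A a a' a'' x x' : El (hom ?A a a'')" using o x Aw by simp
  have "ap (fmap Z a a'') (cm ?A a a' a'' x x') = mul (fob Z a) (fob Z a') (fob Z a'') (ap (fmap Z a a') x) (ap (fmap Z a' a'') x')"
   unfolding mul_def using fmap_cmp_el[OF Zc[OF preE] o refl x] ZF by simp
  then have "?Y a a'' (cm ?A a a' a'' x x') = mul (y a) (y a') (y a'') (?Y a a' x) (?Y a' a'' x')"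
   using o ob sE rE x ZE mulE' by (simp add: assoc' srZ)
  then show "ap (fmap Y a a'') (cm ?A a a' a'' x x') = cm ?C (fob Y a) (fob Y a') (fob Y a'') (ap (fmap Y a a') x) (ap (fmap Y a' a'') x')"
   unfolding Ye[OF o(1,3) xx] Ye[OF o(1,2) x(1)] Ye[OF o(2,3) x(2)] Ys mul .
 next
  fix a assume o: "a : ob ?A"
  have i: "pt (unt ?A a) : El (hom ?A a a)" using o Aw by simp
  have "ap (fmap Z a a) (pt (unt ?A a)) = Zid a" using fmap_unt_el[OF Zc[OF preE] o refl] ZF by simp
  then show "ap (fmap Y a a) (pt (unt ?A a)) = pt (unt ?C (fob Y a))"
   unfolding Ye[OF o o i] Ys using o ob sE rs[OF o] by (simp add: unit' mul)
 qed (use Cw Aw y Yc Ys in auto)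
 let ?R = "rp Y"
 have Yw': "isfun Y" using Yw Ys by simp
 have Rw: "ismod ?R" using Yw' by simp
 let ?t = "%c a. rs' c a \<cdot> component (mate F Z \<alpha>) c a" and ?u = "%c a. component \<beta> c a \<cdot> rr' c a"
 have te: "ap (?t c a) n = mul c (fob Z a) (y a) (mt c a n) (pt (s a))" if o: "c : ob ?C" "a : ob ?A" "n : El (cob (rp F) M c a)" for c a n
  using rs'e[OF o(1,2) mE[OF o]] hom2D[OF rs'c[OF o(1,2)]] mc[OF o(1,2)] o by (simp add: mt_def)
 have ue: "ap (?u c a) f = bt c a (mul c (y a) (fob Z a) f (pt (r a)))" if o: "c : ob ?C" "a : ob ?A" "f : El (hom ?C c (y a))" for c a f
  using rr'e[OF o] hom2D[OF rr'c[OF o(1,2)]] bc[OF o(1,2)] o by (simp add: bt_def)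
 have NE: "la ?N c' c a x n : El (cob (rp F) M c' a)" if "c' : ob ?C" "c : ob ?C" "a : ob ?A" "x : El (hom ?C c' c)" "n : El (cob (rp F) M c a)" for c' c a x n
  using lact_cell[OF FMc[OF preE], of c' c a] car_cell[OF FMc[OF preE], of c a] that Np Cw by simp
 have NE': "ra ?N c a a' n x : El (cob (rp F) M c a')" if "c : ob ?C" "a : ob ?A" "a' : ob ?A" "x : El (hom ?A a a')" "n : El (cob (rp F) M c a)" for c a a' x n
  using ract_cell[OF FMc[OF preE], of c a a'] car_cell[OF FMc[OF preE], of c a] that Np Aw by simp
 have hom: "mk_wmor ?N ?R ?t : mors ?N ?R"
 proof (rule mk_wmor_in[OF FMc[OF preE] Rw])
  fix c' c a x n assume "c' : ob (mcod ?N)" "c : ob (mcod ?N)" "a : ob (mdom ?N)" "x : El (hom (mcod ?N) c' c)" "n : El (car ?N c a)"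
  then have o: "c' : ob ?C" "c : ob ?C" "a : ob ?A" "x : El (hom ?C c' c)" "n : El (cob (rp F) M c a)" using Np by simp_all
  have "mul c' (fob Z a) (y a) (mt c' a (la ?N c' c a x n)) (pt (s a)) = mul c' c (y a) x (mul c (fob Z a) (y a) (mt c a n) (pt (s a)))"
   unfolding ml[OF o(2,3,5,1,4), unfolded mul] using o ob sE mE by (simp add: assoc')
  then show "ap (?t c' a) (la ?N c' c a x n) = la ?R c' c a x (ap (?t c a) n)"
   unfolding te[OF o(2,3,5)] te[OF o(1,3) NE[OF o]] rep_sel Ys mul .
 next
  fix c a a' n x assume "c : ob (mcod ?N)" "a : ob (mdom ?N)" "a' : ob (mdom ?N)" "n : El (car ?N c a)" "x : El (hom (mdom ?N) a a')"
  then have o: "c : ob ?C" "a : ob ?A" "a' : ob ?A" "x : El (hom ?A a a')" "n : El (cob (rp F) M c a)" using Np by simp_all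
  have "mul c (fob Z a') (y a') (mt c a' (ra ?N c a a' n x)) (pt (s a')) = mul c (y a) (y a') (mul c (fob Z a) (y a) (mt c a n) (pt (s a))) (?Y a a' x)"
   unfolding mr[OF o(1,2,5,3,4), unfolded mul] using o ob sE rE mE ZE mulE' by (simp add: assoc' srZ)
  moreover have "ra ?R c a a' (ap (?t c a) n) x = cm ?C c (y a) (y a') (ap (?t c a) n) (ap (fmap Y a a') x)"
  proof -
   have "ap (?t c a) n : El (hom ?C c (y a))" unfolding te[OF o(1,2,5)] using o ob sE mE mulE' by simp
   then show ?thesis using hom2D[OF Yc[OF o(2,3)]] o Cw Aw y by (simp add: Ys)
  qed
  ultimately show "ap (?t c a') (ra ?N c a a' n x) = ra ?R c a a' (ap (?t c a) n) x"
   unfolding te[OF o(1,3) NE'[OF o]] unfolding te[OF o(1,2,5)] Ye[OF o(2,3,4)] mul by simp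
 qed (use Np Ys rs'c mc in "auto simp: hom2_iff")
 have "iso2 (Mod W) (mk_wmor ?N ?R ?t)"
 proof (rule Mod_isoI[OF hom, where t = ?u])
  fix c a n assume "c : ob (mcod ?N)" "a : ob (mdom ?N)" and n: "n : El (car ?N c a)"
  then have o: "c : ob ?C" "a : ob ?A" "n : El (cob (rp F) M c a)" using Np by simp_all
  have E: "mul c (fob Z a) (y a) (mt c a n) (pt (s a)) : El (hom ?C c (y a))" using o ob sE mE mulE' by simp
  have "mul c (y a) (fob Z a) (mul c (fob Z a) (y a) (mt c a n) (pt (s a))) (pt (r a)) = mt c a n"
   using o ob sE rE mE me sr by (simp add: assoc' mul)
  then have "ap (?u c a) (ap (?t c a) n) = n" unfolding te[OF o] ue[OF o(1,2) E] using bm[OF o] by simp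
  then show "ap (?u c a) (app (mk_wmor ?N ?R ?t) c a n) = n" using o Np by simp
 next
  fix c a f assume "c : ob (mcod ?N)" "a : ob (mdom ?N)" and f: "f : El (car ?R c a)"
  then have o: "c : ob ?C" "a : ob ?A" "f : El (hom ?C c (y a))" using Np Ys by simp_all
  have E: "mul c (y a) (fob Z a) f (pt (r a)) : El (hom ?C c (fob Z a))" using o ob rE mulE' by simp
  note E' = bE[OF o(1,2) E]
  have "mul c (fob Z a) (y a) (mul c (fob Z a) (fob Z a) (mul c (y a) (fob Z a) f (pt (r a))) (pt (ep a))) (pt (s a)) = f"
   using o ob sE rE epE es rs mulE' by (simp add: assoc' unit' mul)
  then have "ap (?t c a) (ap (?u c a) f) = f" unfolding ue[OF o] te[OF o(1,2) E'] e_mult[OF o(1,2) E] mul .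
  then show "app (mk_wmor ?N ?R ?t) c a (ap (?u c a) f) = f" using o Np by simp
 qed (use Np Ys rr'c bc in "auto simp: hom2_iff")
 then show ?thesis using hom Yw unfolding isomorphic1_def by blast
qed

end
end


section \<open>Weighted colimits\<close>

context enriched_base
begin

context
 fixes F Z :: "('u, 'o, 'm, 'c) wfun" and M :: "('u, 'o, 'm, 'c) wmod"
 assumes F: "isfun F" and Z: "wfunctor W Z (fdom Z) (fcod F)" and ZF: "fcod Z = fcod F"
  and M: "wmodule W M (fdom Z) (fdom F)" and MA: "mdom M = fdom Z" and MB: "mcod M = fdom F"
begin

lemmas preW = F Z ZF M MA MB

abbreviation lifts where
 "lifts \<alpha> L \<sigma> \<tau> \<equiv> ALL b:ob (fdom F). ALL a:ob (fdom Z). ALL c:ob (fcod F). ALL m:El (car M b a). ALL l:El (car L a c).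
   cm (fcod F) (fob F b) (fob Z a) c (ap (bar F (rp Z) \<alpha> b a) m) (app \<tau> a c l)
   = app \<sigma> b c (cl M L b c a m l)"

text \<open>The universal property on elements: \<open>\<tau>\<close> is a lift of \<open>\<sigma>\<close> when \<open>\<alpha>(m) \<cdot> \<tau>(l) = \<sigma>(m \<otimes>
 l)\<close>.\<close>

lemma weighted_colimit_iff:
 assumes \<alpha>: "\<alpha> : mors M (cmod (cor F) (rp Z))"
 shows "weighted_colimit W M F Z \<alpha> \<longleftrightarrow> (ALL L \<sigma>. ismod L & mdom L = fcod F & mcod L = fdom Z &
   \<sigma> : mors (cmod M L) (cor F) --> (\<exists>!\<tau>. \<tau> : mors L (cor Z) & lifts \<alpha> L \<sigma> \<tau>))"
proof -
 note cc = colimit_cell_in_hom[OF preW \<alpha>]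
 have ex: "EX R \<rho>. is_right_lifting (Mod W) M (cor F) R \<rho>"
  by (rule ex_right_lifting_Mod[OF Mc[OF preW] CF[OF preW]]) (simp add: MB)
 have "weighted_colimit W M F Z \<alpha> \<longleftrightarrow> iso2 (Mod W) (lifting_transpose (Mod W) M (cor F) (cor Z) (colimit_cell F Z \<alpha>))"
  unfolding weighted_colimit_def Mod_sel hom_mod_def colimit_cell_def[OF preW \<alpha>] using Z \<alpha> by (simp only: MA simp_thms)
 also have "\<dots> \<longleftrightarrow> is_right_lifting (Mod W) M (cor F) (cor Z) (colimit_cell F Z \<alpha>)"
  by (rule lifting_transpose_iso_iff[OF Mc[OF preW] ex CZ[OF preW] _ _ cc]) (simp_all add: ZF MA)
 also have "\<dots> \<longleftrightarrow> (ALL L \<sigma>. ismod L & mdom L = fcod F & mcod L = fdom Z & \<sigma> : mors (cmod M L) (cor F) -->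
   (\<exists>!\<tau>. \<tau> : mors L (cor Z) & vc (colimit_cell F Z \<alpha>) (hc (idm M) \<tau>) = \<sigma>))"
  unfolding is_right_lifting_Mod_iff using CZ[OF preW] cc by (simp only: MA ZF corep_sel simp_thms)
 also have "\<dots> \<longleftrightarrow> (ALL L \<sigma>. ismod L & mdom L = fcod F & mcod L = fdom Z &
   \<sigma> : mors (cmod M L) (cor F) --> (\<exists>!\<tau>. \<tau> : mors L (cor Z) & lifts \<alpha> L \<sigma> \<tau>))"
 proof -
  have eq: "\<tau> : mors L (cor Z) & vc (colimit_cell F Z \<alpha>) (hc (idm M) \<tau>) = \<sigma> \<longleftrightarrow> \<tau> : mors L (cor Z) & lifts \<alpha> L \<sigma> \<tau>"
   if L: "mdom L = fcod F" "mcod L = fdom Z" and \<sigma>: "\<sigma> : mors (cmod M L) (cor F)" for L \<sigma> \<tau>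
  proof (rule conj_cong[OF refl])
   assume \<tau>: "\<tau> : mors L (cor Z)"
   have e: "app (colimit_cell F Z \<alpha>) b c (cl M (cor Z) b c a m (app \<tau> a c l))
    = cm (fcod F) (fob F b) (fob Z a) c (ap (bar F (rp Z) \<alpha> b a) m) (app \<tau> a c l)"
    if "b : ob (fdom F)" "a : ob (fdom Z)" "c : ob (fcod F)" "m : El (car M b a)" "l : El (car L a c)" for b a c m l
   proof (rule colimit_cell_el[OF preW \<alpha> that(1-4)])
    show "app \<tau> a c l : El (hom (fcod F) (fob Z a) c)" using component_El[OF \<tau>, of a c l] that L ZF by simp
   qed
   have CM: "mcod (cor Z) = mdom M" by (simp add: MA)
   show "vc (colimit_cell F Z \<alpha>) (hc (idm M) \<tau>) = \<sigma> \<longleftrightarrow> lifts \<alpha> L \<sigma> \<tau>"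
    unfolding lift_eq_iff[OF Mc[OF preW] cc CM \<tau> \<sigma>] MA MB L using e by simp
  qed
  show ?thesis by (intro all_cong1 imp_cong refl, elim conjE) (simp only: eq)
 qed
 finally show ?thesis .
qed

lemma comp_mor_act:
 assumes L: "ismod L" "mdom L = fcod F" "mcod L = fdom Z" and \<sigma>: "\<sigma> : mors (cmod M L) (cor F)"
  and o: "b : ob (fdom F)" "a : ob (fdom Z)" "c : ob (fcod F)" and m: "m : El (car M b a)"
 defines "sg \<equiv> %b a c m l. app \<sigma> b c (cl M L b c a m l)"
 shows "l : El (car L a c) ==> sg b a c m l : El (hom (fcod F) (fob F b) c)"
  "!!b' x. b' : ob (fdom F) ==> x : El (hom (fdom F) b' b) ==> l : El (car L a c) ==>
   sg b' a c (la M b' b a x m) l = cm (fcod F) (fob F b') (fob F b) c (ap (fmap F b' b) x) (sg b a c m l)"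
  "!!a' x. a' : ob (fdom Z) ==> x : El (hom (fdom Z) a a') ==> l' : El (car L a' c) ==> sg b a c m (la L a a' c x l') = sg b a' c (ra M b a a' m x) l'"
  "!!c' z. c' : ob (fcod F) ==> z : El (hom (fcod F) c c') ==> l : El (car L a c) ==>
   sg b a c' m (ra L a c c' l z) = cm (fcod F) (fob F b) c c' (sg b a c m l) z"
proof -
 have Mp: "ismod M" and LM: "mdom M = mcod L" using M MA MB L by simp_all
 have E: "l : El (car L a c) ==> cl M L b c a m l : El (car (cmod M L) b c)"
  using coend_El[OF Mp L(1) LM, of b c a m l] o m L MB MA by simp
 show 1: "l : El (car L a c) ==> sg b a c m l : El (hom (fcod F) (fob F b) c)"
  unfolding sg_def using component_El[OF \<sigma>, of b c] E o L MB by simp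
 show "sg b' a c (la M b' b a x m) l = cm (fcod F) (fob F b') (fob F b) c (ap (fmap F b' b) x) (sg b a c m l)"
  if "b' : ob (fdom F)" "x : El (hom (fdom F) b' b)" "l : El (car L a c)" for b' x
 proof -
  have "cl M L b' c a (la M b' b a x m) l = la (cmod M L) b' b c x (cl M L b c a m l)"
   by (rule lact_mod_comp_el[OF Mp L(1) LM, symmetric]) (use that o m L MA MB in simp_all)
  also have "app \<sigma> b' c \<dots> = la (cor F) b' b c x (sg b a c m l)"
   unfolding sg_def by (rule component_lact_hom[OF \<sigma>]) (use that o L MB E in simp_all)
  finally show ?thesis using that o 1[OF that(3)] F by (simp add: sg_def)
 qed
 show "sg b a c m (la L a a' c x l') = sg b a' c (ra M b a a' m x) l'"
  if "a' : ob (fdom Z)" "x : El (hom (fdom Z) a a')" "l' : El (car L a' c)" for a' x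
  using coend_bal[OF Mp L(1) LM, of b c a a' m x l'] that o m L MB by (simp add: sg_def)
 show "sg b a c' m (ra L a c c' l z) = cm (fcod F) (fob F b) c c' (sg b a c m l) z"
  if "c' : ob (fcod F)" "z : El (hom (fcod F) c c')" "l : El (car L a c)" for c' z
 proof -
  have "cl M L b c' a m (ra L a c c' l z) = ra (cmod M L) b c c' (cl M L b c a m l) z"
   by (rule ract_mod_comp_el[OF Mp L(1) LM, symmetric]) (use that o m L MA MB in simp_all)
  also have "app \<sigma> b c' \<dots> = ra (cor F) b c c' (sg b a c m l) z"
   unfolding sg_def by (rule component_ract_hom[OF \<sigma>]) (use that o L MB E in simp_all)
  finally show ?thesis by (simp add: sg_def)
 qed
qed

subsection \<open>Colimits reconstructed from points of \<open>F \<circ> M\<close>\<close>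

text \<open>Points \<open>\<nu> a\<close> of \<open>(F \<circ> M)(Z a, a)\<close> with \<open>\<alpha>(m) \<cdot> \<nu> a = [1 \<otimes> m]\<close> that the mate sends
 to identities. Both conditions are equations and hence are preserved by every functor.\<close>

definition reconstructs where
 "reconstructs \<alpha> \<nu> \<longleftrightarrow> (ALL a:ob (fdom Z). \<nu> a : hom2 W (\<one> (ext (fdom Z) a)) (cob (rp F) M (fob Z a) a) &
   (ALL b:ob (fdom F). ALL m:El (car M b a). la (cmod (rp F) M) (fob F b) (fob Z a) a (ap (bar F (rp Z) \<alpha> b a) m) (pt (\<nu> a))
    = cl (rp F) M (fob F b) a b (idpt F b) m) &
   app (mate F Z \<alpha>) (fob Z a) a (pt (\<nu> a)) = pt (unt (fcod F) (fob Z a)))"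

context
 fixes \<alpha> \<nu>
 assumes \<alpha>: "\<alpha> : mors M (cmod (cor F) (rp Z))" and rec: "reconstructs \<alpha> \<nu>"
begin

lemma rec_cell:
 assumes a: "a : ob (fdom Z)"
 shows "\<nu> a : cells2 W" "dom2 W (\<nu> a) = \<one> (ext (fdom Z) a)" "cod2 W (\<nu> a) = cob (rp F) M (fob Z a) a"
  "pt (\<nu> a) : El (cob (rp F) M (fob Z a) a)"
proof -
 show 1: "\<nu> a : cells2 W" "dom2 W (\<nu> a) = \<one> (ext (fdom Z) a)" "cod2 W (\<nu> a) = cob (rp F) M (fob Z a) a"
  using rec a unfolding reconstructs_def by (auto simp: hom2_iff)
 show "pt (\<nu> a) : El (cob (rp F) M (fob Z a) a)"
  using 1 a Zc[OF preW] by (auto intro!: pt_El[of _ "ext (fdom Z) a"])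
qed

text \<open>If \<open>\<alpha>(m) \<cdot> t\<close> does not depend on the choice between \<open>t\<close> and \<open>t'\<close>, then neither does
 \<open>mate(n) \<cdot> t\<close> for any \<open>n\<close> in \<open>F \<circ> M\<close>; take \<open>n = \<nu> a\<close>.\<close>

lemma probe_ext:
 assumes o: "a : ob (fdom Z)" "c : ob (fcod F)"
  and t: "t : El (hom (fcod F) (fob Z a) c)" "t' : El (hom (fcod F) (fob Z a) c)" "stage t = stage t'"
  and eq: "!!b m. b : ob (fdom F) ==> m : El (car M b a) ==>
   cm (fcod F) (fob F b) (fob Z a) c (ap (bar F (rp Z) \<alpha> b a) m) t
   = cm (fcod F) (fob F b) (fob Z a) c (ap (bar F (rp Z) \<alpha> b a) m) t'"
 shows "t = t'"
proof -
 let ?h = "hom (fcod F) (fob Z a) c"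
 define l where "l = path_comp (src W ?h) (stage t)"
 define w where "w = Element (stage t) (\<iota> (path_comp (src W ?h) (stage t)))"
 note U = element_generic[OF t(1), folded l_def w_def] and V = element_generic[OF t(2), folded t(3) l_def w_def, folded t(3), folded l_def w_def]
 have za: "fob Z a : ob (fcod F)" "ext (fcod F) (fob Z a) = ext (fdom Z) a" using Zc[OF preW] o ZF by simp_all
 have lc: "l : cells1 W" "src W l = ext (fcod F) c" "trg W l = ext (fdom Z) a" using U(1) za F o by (auto simp: hom1_iff)
 note mi = mate_in_hom[OF preW \<alpha>]
 note mc = component_cell[OF Mod_hom2D(1)[OF mi], unfolded Mod_hom2D(2,3)[OF mi] mod_comp_sel rep_sel ZF MA, of "fob Z a" a]
 let ?s = "%u. cmp (fcod F) (fob Z a) (fob Z a) c \<cdot> (component (mate F Z \<alpha>) (fob Z a) a \<ast> u)"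
 have FMcell: "cob (rp F) M (fob Z a) a : cells1 W" "src W (cob (rp F) M (fob Z a) a) = ext (fdom Z) a"
  "trg W (cob (rp F) M (fob Z a) a) = ext (fdom Z) a"
  using coend_ob_cell[OF RF[OF preW] Mc[OF preW], of "fob Z a" a] za o MA MB by simp_all
 have sc: "?s u : hom2 W (cob (rp F) M (fob Z a) a \<star> l) ?h" if "u : hom2 W l ?h" for u
  using hom2D[OF that] mc za o F lc FMcell by (simp add: hom2_iff)
 have se: "ap (?s u) (ten n v) = cm (fcod F) (fob Z a) (fob Z a) c (app (mate F Z \<alpha>) (fob Z a) a n) (ap u v)"
  if "u : hom2 W l ?h" "n : El (cob (rp F) M (fob Z a) a)" "v : El l" for u n v
  using hom2D[OF that(1)] that(2,3) mc za o F lc FMcell by simp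
 have "?s (cell t) = ?s (cell t')"
 proof (rule gen_ext2[OF FM_gens[OF preW za(1) o(1)] U(4) _ sc[OF U(2)] sc[OF V(2)]])
  show "src W (cob (rp F) M (fob Z a) a) = trg W l" using FMcell lc by simp
  fix n v assume n: "n : coend_El_gens (rp F) M (fob Z a) a" and v: "v : {w}"
  obtain b f m where x: "b : ob (fdom F)" "f : El (hom (fcod F) (fob Z a) (fob F b))" "m : El (car M b a)" "n = cl (rp F) M (fob Z a) a b f m"
   by (rule FM_gensE[OF preW n])
  have n': "n : El (cob (rp F) M (fob Z a) a)" unfolding x(4) by (rule FM_El[OF preW za(1) o(1) x(1-3)])
  note bE = bar_El[OF preW \<alpha> x(1) o(1) x(3)]
  have vt: "v : El l" "ap (cell t) v = t" "ap (cell t') v = t'" using v U V by simp_all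
  show "ap (?s (cell t)) (ten n v) = ap (?s (cell t')) (ten n v)"
   unfolding se[OF U(2) n' vt(1)] se[OF V(2) n' vt(1)] vt unfolding x(4) mate_el[OF preW \<alpha> za(1) o(1) x(1-3)]
   using F x(1) za o x(2) bE t eq[OF x(1,3)] by simp
 qed
 then have "ap (?s (cell t)) (ten (pt (\<nu> a)) w) = ap (?s (cell t')) (ten (pt (\<nu> a)) w)" by simp
 moreover have "app (mate F Z \<alpha>) (fob Z a) a (pt (\<nu> a)) = pt (unt (fcod F) (fob Z a))"
  using rec o unfolding reconstructs_def by blast
 ultimately have "cm (fcod F) (fob Z a) (fob Z a) c (pt (unt (fcod F) (fob Z a))) t = cm (fcod F) (fob Z a) (fob Z a) c (pt (unt (fcod F) (fob Z a))) t'"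
  using se[OF U(2) rec_cell(4)[OF o(1)] U(3)] se[OF V(2) rec_cell(4)[OF o(1)] U(3)] U(5) V(5) by simp
 then show ?thesis using t F za o by simp
qed

text \<open>The lift of \<open>\<sigma>\<close> is \<open>\<tau>(l) = \<kappa>(\<nu> a \<otimes> l)\<close>, where \<open>\<kappa>\<close> sends \<open>[f \<otimes> m] \<otimes> l\<close> to \<open>f \<cdot>
 \<sigma>(m \<otimes> l)\<close>; indeed \<open>\<alpha>(m) \<cdot> \<tau>(l) = \<kappa>([1 \<otimes> m] \<otimes> l) = \<sigma>(m \<otimes> l)\<close>. Linearity and uniqueness of
 \<open>\<tau>\<close> follow since the elements \<open>\<alpha>(m)\<close> separate.\<close>

lemma reconstructs_weighted_colimit: "weighted_colimit W M F Z \<alpha>"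
 unfolding weighted_colimit_iff[OF \<alpha>]
proof (intro allI impI, elim conjE)
 fix L \<sigma> assume L: "ismod L" "mdom L = fcod F" "mcod L = fdom Z" and \<sigma>: "\<sigma> : mors (cmod M L) (cor F)"
 let ?C = "fcod F" and ?A = "fdom Z" and ?B = "fdom F"
 have Cw: "wcategory W ?C" and Aw: "wcategory W ?A" using F Zc[OF preW] by simp_all
 have Mp: "ismod M" and LM: "mdom M = mcod L" using M MA MB L by simp_all
 define sg where "sg b a c m l = app \<sigma> b c (cl M L b c a m l)" for b a c m l
 note sg = comp_mor_act[OF L \<sigma>, folded sg_def]
 have lc: "car L a c : cells1 W" "src W (car L a c) = ext ?C c" "trg W (car L a c) = ext ?A a" if "a : ob ?A" "c : ob ?C" for a c
  using L that by simp_all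
 have Mc': "car M b a : cells1 W" "src W (car M b a) = ext ?A a" "trg W (car M b a) = ext ?B b" if "b : ob ?B" "a : ob ?A" for b a
  using Mp that MA MB by simp_all
 have Fo: "fob F b : ob ?C" "ext ?C (fob F b) = ext ?B b" if "b : ob ?B" for b using F that by simp_all
 have Zo: "fob Z a : ob ?C" "ext ?C (fob Z a) = ext ?A a" if "a : ob ?A" for a using Zc[OF preW] that ZF by simp_all
 have Nc: "cob (rp F) M x a : cells1 W" "src W (cob (rp F) M x a) = ext ?A a" "trg W (cob (rp F) M x a) = ext ?C x"
  if "x : ob ?C" "a : ob ?A" for x a
  using coend_ob_cell[OF RF[OF preW] Mc[OF preW], of x a] that MA MB by simp_all
 have cin: "component \<sigma> b c \<cdot> cin M L b c a : hom2 W (car M b a \<star> car L a c) (hom ?C (fob F b) c)"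
  "!!m l. m : El (car M b a) ==> l : El (car L a c) ==> ap (component \<sigma> b c \<cdot> cin M L b c a) (ten m l) = sg b a c m l"
  if o: "b : ob ?B" "a : ob ?A" "c : ob ?C" for b a c
 proof -
  have 1: "cin M L b c a : cells2 W" "dom2 W (cin M L b c a) = car M b a \<star> car L a c" "cod2 W (cin M L b c a) = cob M L b c"
   using coend_in_cell[OF Mp L(1) LM, of b c a] o L MB by simp_all
  have 2: "component \<sigma> b c : cells2 W" "dom2 W (component \<sigma> b c) = cob M L b c" "cod2 W (component \<sigma> b c) = hom ?C (fob F b) c"
   using component_cell[OF Mod_hom2D(1)[OF \<sigma>], of b c] Mod_hom2D(2,3)[OF \<sigma>] o L MB by simp_all
  show "component \<sigma> b c \<cdot> cin M L b c a : hom2 W (car M b a \<star> car L a c) (hom ?C (fob F b) c)"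
   "!!m l. m : El (car M b a) ==> l : El (car L a c) ==> ap (component \<sigma> b c \<cdot> cin M L b c a) (ten m l) = sg b a c m l"
   using 1 2 o lc Mc' by (simp_all add: hom2_iff sg_def)
 qed
 let ?k = "%x a c t. t : hom2 W (cob (rp F) M x a \<star> car L a c) (hom ?C x c) &
   (ALL b:ob ?B. ALL f:El (hom ?C x (fob F b)). ALL m:El (car M b a). ALL l:El (car L a c).
    ap t (ten (cl (rp F) M x a b f m) l) = cm ?C x (fob F b) c f (sg b a c m l))"
 have ex: "EX t. ?k x a c t" if o: "x : ob ?C" "a : ob ?A" "c : ob ?C" for x a c
 proof -
  let ?j = "%b. cmp ?C x (fob F b) c \<cdot> (\<iota> (hom ?C x (fob F b)) \<ast> (component \<sigma> b c \<cdot> cin M L b c a)) \<cdot> \<a> (hom ?C x (fob F b)) (car M b a) (car L a c)"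
  have jc: "?j b : hom2 W ((hom ?C x (fob F b) \<star> car M b a) \<star> car L a c) (hom ?C x c)"
   and je: "!!f m l. f : El (hom ?C x (fob F b)) ==> m : El (car M b a) ==> l : El (car L a c) ==> ap (?j b) (ten (ten f m) l) = cm ?C x (fob F b) c f (sg b a c m l)"
   if b: "b : ob ?B" for b
   using cin(2)[OF b o(2,3)] hom2D[OF cin(1)[OF b o(2,3)]] b o Cw Fo[OF b] lc[OF o(2,3)] Mc'[OF b o(2)]
   by (simp_all add: hom2_iff del: ap_vcomp) (simp add: ap_vcomp[of "a b" for a b])?
  have "\<exists>!t. t : hom2 W (cob (rp F) M x a \<star> car L a c) (hom ?C x c) & (ALL b:ob (mcod M). t \<cdot> (cin (rp F) M x a b \<ast> \<iota> (car L a c)) = ?j b)"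
  proof (rule coend_factor_right[OF RF[OF preW] Mc[OF preW]])
   fix b b' l n f m assume "b : ob (mcod M)" "b' : ob (mcod M)" and l: "l : El (car L a c)" and "n : El (car (rp F) x b)" "f : El (hom (mcod M) b b')" and m: "m : El (car M b' a)"
   then have *: "b : ob ?B" "b' : ob ?B" "n : El (hom ?C x (fob F b))" "f : El (hom ?B b b')" using MB by simp_all
   have fm: "la M b b' a f m : El (car M b a)" using * m o Mp MA MB F by simp
   have Ff: "ap (fmap F b b') f : El (hom ?C (fob F b) (fob F b'))" using * F by simp
   have nf: "cm ?C x (fob F b) (fob F b') n (ap (fmap F b b') f) : El (hom ?C x (fob F b'))" using * Ff Cw o Fo by simp
   have r: "ra (rp F) x b b' n f = cm ?C x (fob F b) (fob F b') n (ap (fmap F b b') f)" using * F o Cw Fo by simp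
   show "ap (?j b) (ten (ten n (la M b b' a f m)) l) = ap (?j b') (ten (ten (ra (rp F) x b b' n f) m) l)"
    unfolding r je[OF *(1,3) fm l] je[OF *(2) nf m l] sg(2)[OF *(2) o(2,3) m *(1,4) l]
    using *(3) Ff sg(1)[OF *(2) o(2,3) m l] Cw o Fo[OF *(1)] Fo[OF *(2)] by simp
  qed (use jc o lc MA MB Cw in simp_all)
  then obtain t where t: "t : hom2 W (cob (rp F) M x a \<star> car L a c) (hom ?C x c)"
   and te: "!!b. b : ob ?B ==> t \<cdot> (cin (rp F) M x a b \<ast> \<iota> (car L a c)) = ?j b" using MB by auto
  have "ap t (ten (cl (rp F) M x a b f m) l) = cm ?C x (fob F b) c f (sg b a c m l)"
   if *: "b : ob ?B" "f : El (hom ?C x (fob F b))" "m : El (car M b a)" "l : El (car L a c)" for b f m l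
  proof -
   have ic: "cin (rp F) M x a b : cells2 W" "dom2 W (cin (rp F) M x a b) = hom ?C x (fob F b) \<star> car M b a" "cod2 W (cin (rp F) M x a b) = cob (rp F) M x a"
    using coend_in_cell[OF RF[OF preW] Mc[OF preW], of x a b] * o MA MB by simp_all
   have "ap (t \<cdot> (cin (rp F) M x a b \<ast> \<iota> (car L a c))) (ten (ten f m) l) = ap (?j b) (ten (ten f m) l)" using te[OF *(1)] by simp
   then show ?thesis unfolding je[OF *] using * ic hom2D[OF t] o lc Mc' Nc Cw Fo by simp
  qed
  then show ?thesis using t by blast
 qed
 define \<kappa> where "\<kappa> x a c = (SOME t. ?k x a c t)" for x a c
 have \<kappa>: "\<kappa> x a c : hom2 W (cob (rp F) M x a \<star> car L a c) (hom ?C x c)"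
  and \<kappa>e: "!!b f m l. b : ob ?B ==> f : El (hom ?C x (fob F b)) ==> m : El (car M b a) ==> l : El (car L a c) ==>
    ap (\<kappa> x a c) (ten (cl (rp F) M x a b f m) l) = cm ?C x (fob F b) c f (sg b a c m l)"
  if o: "x : ob ?C" "a : ob ?A" "c : ob ?C" for x a c
  using someI_ex[OF ex[OF o]] unfolding \<kappa>_def by blast+
 note \<kappa>c = \<kappa>[THEN hom2D(1)] \<kappa>[THEN hom2D(2)] \<kappa>[THEN hom2D(3)]
 let ?N = "cmod (rp F) M"
 have lN: "lact ?N x' x a : cells2 W" "dom2 W (lact ?N x' x a) = hom ?C x' x \<star> cob (rp F) M x a" "cod2 W (lact ?N x' x a) = cob (rp F) M x' a"
  if "x' : ob ?C" "x : ob ?C" "a : ob ?A" for x' x a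
  using lact_cell[OF FMc[OF preW], of x' x a] that MA by simp_all
 have \<kappa>l: "ap (\<kappa> x' a c) (ten (la ?N x' x a g n) l) = cm ?C x' x c g (ap (\<kappa> x a c) (ten n l))"
  if o: "x' : ob ?C" "x : ob ?C" "a : ob ?A" "c : ob ?C" and g: "g : El (hom ?C x' x)" and n: "n : El (cob (rp F) M x a)" and l: "l : El (car L a c)" for x' x a c g n l
 proof -
  have "\<kappa> x' a c \<cdot> (lact ?N x' x a \<ast> \<iota> (car L a c)) = cmp ?C x' x c \<cdot> (\<iota> (hom ?C x' x) \<ast> \<kappa> x a c) \<cdot> \<a> (hom ?C x' x) (cob (rp F) M x a) (car L a c)"
  proof (rule gen_ext3[OF generates_El FM_gens[OF preW o(2,3)] generates_El, of "hom ?C x' x" "car L a c" _ "hom ?C x' c"])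
   fix h z k assume h: "h : El (hom ?C x' x)" and z: "z : coend_El_gens (rp F) M x a" and k: "k : El (car L a c)"
   obtain b f m where x: "b : ob ?B" "f : El (hom ?C x (fob F b))" "m : El (car M b a)" "z = cl (rp F) M x a b f m"
    by (rule FM_gensE[OF preW z])
   have zE: "z : El (cob (rp F) M x a)" unfolding x(4) by (rule FM_El[OF preW o(2,3) x(1-3)])
   have hf: "cm ?C x' x (fob F b) h f : El (hom ?C x' (fob F b))" using Cw o Fo x h by simp
   have 1: "ap (\<kappa> x' a c) (ten (la ?N x' x a h z) k) = cm ?C x' x c h (ap (\<kappa> x a c) (ten z k))"
    unfolding x(4) FM_act(1)[OF preW o(2,3) x(1-3) o(1) h] \<kappa>e[OF o(1,3,4) x(1) hf x(3) k] \<kappa>e[OF o(2-4) x(1-3) k]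
    using Cw o Fo x h sg(1)[OF x(1) o(3,4) x(3) k] by simp
   show "ap (\<kappa> x' a c \<cdot> (lact ?N x' x a \<ast> \<iota> (car L a c))) (ten (ten h z) k)
    = ap (cmp ?C x' x c \<cdot> (\<iota> (hom ?C x' x) \<ast> \<kappa> x a c) \<cdot> \<a> (hom ?C x' x) (cob (rp F) M x a) (car L a c)) (ten (ten h z) k)"
    using 1 h zE k lN[OF o(1-3)] \<kappa>c o Cw lc Nc by simp
  qed (use o Cw lc Nc \<kappa>c lN in "simp_all add: hom2_iff")
  from arg_cong[OF this, of "%t. ap t (ten (ten g n) l)"]
  show ?thesis using g n l lN[OF o(1-3)] \<kappa>c o Cw lc Nc by simp
 qed
 let ?t = "%a c. \<kappa> (fob Z a) a c \<cdot> (\<nu> a \<ast> \<iota> (car L a c)) \<cdot> inv2 W (\<l> (car L a c))"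
 have tc: "?t a c : hom2 W (car L a c) (hom ?C (fob Z a) c)" and te: "!!l. l : El (car L a c) ==> ap (?t a c) l = ap (\<kappa> (fob Z a) a c) (ten (pt (\<nu> a)) l)"
  if o: "a : ob ?A" "c : ob ?C" for a c
  using o rec_cell[OF o(1)] lc[OF o] Nc[OF Zo(1)[OF o(1)] o(1)] \<kappa>c[OF Zo(1)[OF o(1)] o] Aw by (simp_all add: hom2_iff)
 have tE: "ap (?t a c) l : El (hom ?C (fob Z a) c)" if "a : ob ?A" "c : ob ?C" "l : El (car L a c)" for a c l
  by (rule ap_El) (use hom2D[OF tc[OF that(1,2)]] that in simp_all)
 have bt: "cm ?C (fob F b) (fob Z a) c (ap (bar F (rp Z) \<alpha> b a) m) (ap (?t a c) l) = sg b a c m l"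
  if o: "b : ob ?B" "a : ob ?A" "c : ob ?C" and m: "m : El (car M b a)" and l: "l : El (car L a c)" for b a c m l
 proof -
  have i: "idpt F b : El (hom ?C (fob F b) (fob F b))" using F o by simp
  have "cm ?C (fob F b) (fob Z a) c (ap (bar F (rp Z) \<alpha> b a) m) (ap (?t a c) l)
   = ap (\<kappa> (fob F b) a c) (ten (la ?N (fob F b) (fob Z a) a (ap (bar F (rp Z) \<alpha> b a) m) (pt (\<nu> a))) l)"
   unfolding te[OF o(2,3) l] using \<kappa>l[OF Fo(1)[OF o(1)] Zo(1)[OF o(2)] o(2,3) bar_El[OF preW \<alpha> o(1,2) m] rec_cell(4)[OF o(2)] l] by simp
  also have "\<dots> = ap (\<kappa> (fob F b) a c) (ten (cl (rp F) M (fob F b) a b (idpt F b) m) l)"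
   using rec o m unfolding reconstructs_def by metis
  also have "\<dots> = sg b a c m l" unfolding \<kappa>e[OF Fo(1)[OF o(1)] o(2,3,1) i m l]
   using F o sg(1)[OF o m l] by simp
  finally show ?thesis .
 qed
 let ?\<tau> = "mk_wmor L (cor Z) ?t"
 have \<tau>: "?\<tau> : mors L (cor Z)"
 proof (rule mk_wmor_in[OF L(1) CZ[OF preW]])
  fix a' a c x l assume "a' : ob (mcod L)" "a : ob (mcod L)" "c : ob (mdom L)" "x : El (hom (mcod L) a' a)" and l: "l : El (car L a c)"
  then have o: "a' : ob ?A" "a : ob ?A" "c : ob ?C" "x : El (hom ?A a' a)" using L by simp_all
  have xl: "la L a' a c x l : El (car L a' c)" using o l L Aw Cw by simp
  have Zx: "ap (fmap Z a' a) x : El (hom ?C (fob Z a') (fob Z a))" using Zc[OF preW] o ZF by simp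
  note tl = tE[OF o(2,3) l]
  have "ap (?t a' c) (la L a' a c x l) = cm ?C (fob Z a') (fob Z a) c (ap (fmap Z a' a) x) (ap (?t a c) l)"
  proof (rule probe_ext[OF o(1,3) tE[OF o(1,3) xl]])
   show "cm ?C (fob Z a') (fob Z a) c (ap (fmap Z a' a) x) (ap (?t a c) l) : El (hom ?C (fob Z a') c)"
    using Zx tl Cw Zo o by (simp del: ap_vcomp)
   fix b m assume b: "b : ob ?B" and m: "m : El (car M b a')"
   have mx: "ra M b a' a m x : El (car M b a)" using Mp MA MB o b m F Aw by simp
   have bx: "ap (bar F (rp Z) \<alpha> b a) (ra M b a' a m x) = cm ?C (fob F b) (fob Z a') (fob Z a) (ap (bar F (rp Z) \<alpha> b a') m) (ap (fmap Z a' a) x)"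
    using bar_ract[OF F RZ[OF preW] FZ'[OF preW] \<alpha>, of b a' a x m] b m o Zc[OF preW] ZF bar_El[OF preW \<alpha> b o(1) m] Zo Fo Cw by simp
   note bE = bar_El[OF preW \<alpha> b o(1) m]
   show "cm ?C (fob F b) (fob Z a') c (ap (bar F (rp Z) \<alpha> b a') m) (ap (?t a' c) (la L a' a c x l))
    = cm ?C (fob F b) (fob Z a') c (ap (bar F (rp Z) \<alpha> b a') m) (cm ?C (fob Z a') (fob Z a) c (ap (fmap Z a' a) x) (ap (?t a c) l))"
    unfolding bt[OF b o(1,3) m xl] sg(3)[OF b o(1,3) m o(2,4) l] bt[OF b o(2,3) mx l, symmetric] bx
    by (rule cmp_assoc_el[OF Cw Fo(1)[OF b] Zo(1)[OF o(1)] Zo(1)[OF o(2)] o(3) bE Zx tl])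
  qed simp
  then show "ap (?t a' c) (la L a' a c x l) = la (cor Z) a' a c x (ap (?t a c) l)"
   using o Zx tl Zc[OF preW] Cw Zo ZF by (simp del: ap_vcomp add: ap_vcomp[of "p \<ast> q" for p q])
 next
  fix a c c' l z assume "a : ob (mcod L)" "c : ob (mdom L)" "c' : ob (mdom L)" and l: "l : El (car L a c)" and "z : El (hom (mdom L) c c')"
  then have o: "a : ob ?A" "c : ob ?C" "c' : ob ?C" "z : El (hom ?C c c')" using L by simp_all
  have lz: "ra L a c c' l z : El (car L a c')" using o l L Aw Cw by simp
  note tl = tE[OF o(1,2) l]
  have "ap (?t a c') (ra L a c c' l z) = cm ?C (fob Z a) c c' (ap (?t a c) l) z"
  proof (rule probe_ext[OF o(1,3) tE[OF o(1,3) lz]])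
   show "cm ?C (fob Z a) c c' (ap (?t a c) l) z : El (hom ?C (fob Z a) c')"
    using tl Cw Zo o by (simp del: ap_vcomp)
   fix b m assume b: "b : ob ?B" and m: "m : El (car M b a)"
   note bE = bar_El[OF preW \<alpha> b o(1) m]
   show "cm ?C (fob F b) (fob Z a) c' (ap (bar F (rp Z) \<alpha> b a) m) (ap (?t a c') (ra L a c c' l z))
    = cm ?C (fob F b) (fob Z a) c' (ap (bar F (rp Z) \<alpha> b a) m) (cm ?C (fob Z a) c c' (ap (?t a c) l) z)"
    unfolding bt[OF b o(1,3) m lz] sg(4)[OF b o(1,2) m o(3,4) l] bt[OF b o(1,2) m l, symmetric]
    by (rule cmp_assoc_el[OF Cw Fo(1)[OF b] Zo(1)[OF o(1)] o(2,3) bE tl o(4)])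
  qed simp
  then show "ap (?t a c') (ra L a c c' l z) = ra (cor Z) a c c' (ap (?t a c) l) z"
   using ZF by simp
 qed (use tc L ZF in auto)
 show "\<exists>!\<tau>. \<tau> : mors L (cor Z) & lifts \<alpha> L \<sigma> \<tau>"
 proof (rule ex1I[of _ ?\<tau>], intro conjI \<tau>)
  show "lifts \<alpha> L \<sigma> ?\<tau>"
  proof (intro ballI)
   fix b a c m l assume o: "b : ob ?B" "a : ob ?A" "c : ob ?C" and m: "m : El (car M b a)" and l: "l : El (car L a c)"
   have "component ?\<tau> a c = ?t a c" using o L by simp
   then show "cm ?C (fob F b) (fob Z a) c (ap (bar F (rp Z) \<alpha> b a) m) (app ?\<tau> a c l) = app \<sigma> b c (cl M L b c a m l)"
    using bt[OF o m l] by (simp only: sg_def)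
  qed
  fix \<tau>' assume \<tau>': "\<tau>' : mors L (cor Z) & lifts \<alpha> L \<sigma> \<tau>'"
  show "\<tau>' = ?\<tau>"
  proof (rule mor_eqI[OF conjunct1[OF \<tau>'] \<tau>])
   fix a c l assume "a : ob (mcod L)" "c : ob (mdom L)" and l: "l : El (car L a c)"
   then have o: "a : ob ?A" "c : ob ?C" using L by simp_all
   have E: "app \<tau>' a c l : El (hom ?C (fob Z a) c)" using component_El[OF conjunct1[OF \<tau>'], of a c l] o l L ZF by simp
   have "app \<tau>' a c l = ap (?t a c) l"
   proof (rule probe_ext[OF o E tE[OF o l]])
    fix b m assume b: "b : ob ?B" and m: "m : El (car M b a)"
    show "cm ?C (fob F b) (fob Z a) c (ap (bar F (rp Z) \<alpha> b a) m) (app \<tau>' a c l)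
      = cm ?C (fob F b) (fob Z a) c (ap (bar F (rp Z) \<alpha> b a) m) (ap (?t a c) l)"
     unfolding bt[OF b o m l] sg_def by (rule conjunct2[OF \<tau>', rule_format, OF b o m l])
   qed simp
   moreover have "component ?\<tau> a c = ?t a c" using o L by simp
   ultimately show "app \<tau>' a c l = app ?\<tau> a c l" by (simp only:)
  qed
 qed
qed

end

end
end


subsection \<open>Transport along a functor\<close>

context enriched_base
begin

context
 fixes F Z H :: "('u, 'o, 'm, 'c) wfun" and M :: "('u, 'o, 'm, 'c) wmod"
 assumes F: "isfun F" and Z: "wfunctor W Z (fdom Z) (fcod F)" and ZF: "fcod Z = fcod F"
  and M: "wmodule W M (fdom Z) (fdom F)" and MA: "mdom M = fdom Z" and MB: "mcod M = fdom F"
  and H: "isfun H" and FH: "fdom H = fcod F"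
begin

lemmas preT = F Z ZF M MA MB

abbreviation HF where "HF \<equiv> wfun_comp W H F"
abbreviation HZ where "HZ \<equiv> wfun_comp W H Z"

lemma preH: "isfun HF" "wfunctor W HZ (fdom HZ) (fcod HF)" "fcod HZ = fcod HF"
  "wmodule W M (fdom HZ) (fdom HF)" "mdom M = fdom HZ" "mcod M = fdom HF"
 using F Zc[OF preT] H FH ZF M MA MB by simp_all

text \<open>The effect \<open>[f \<otimes> m] \<mapsto> [H f \<otimes> m]\<close> of a functor \<open>H\<close> on \<open>F \<circ> M\<close>.\<close>

definition push :: "'u => 'u => 'c" where
 "push c a = (SOME t. t : hom2 W (cob (rp F) M c a) (cob (rp HF) M (fob H c) a) &
   (ALL b:ob (fdom F). ALL f:El (hom (fcod F) c (fob F b)). ALL m:El (car M b a).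
    ap t (cl (rp F) M c a b f m) = cl (rp HF) M (fob H c) a b (ap (fmap H c (fob F b)) f) m))"

lemma HN_cell:
 assumes "c : ob (fcod F)" "a : ob (fdom Z)"
 shows "fob H c : ob (fcod H)" "ext (fcod H) (fob H c) = ext (fcod F) c"
  "cob (rp HF) M (fob H c) a : cells1 W" "src W (cob (rp HF) M (fob H c) a) = ext (fdom Z) a" "trg W (cob (rp HF) M (fob H c) a) = ext (fcod F) c"
  "b : ob (fdom F) ==> cin (rp HF) M (fob H c) a b : cells2 W"
  "b : ob (fdom F) ==> dom2 W (cin (rp HF) M (fob H c) a b) = hom (fcod H) (fob H c) (fob H (fob F b)) \<star> car M b a"
  "b : ob (fdom F) ==> cod2 W (cin (rp HF) M (fob H c) a b) = cob (rp HF) M (fob H c) a"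
proof -
 show h: "fob H c : ob (fcod H)" "ext (fcod H) (fob H c) = ext (fcod F) c" using H FH assms by simp_all
 show "cob (rp HF) M (fob H c) a : cells1 W" "src W (cob (rp HF) M (fob H c) a) = ext (fdom Z) a" "trg W (cob (rp HF) M (fob H c) a) = ext (fcod F) c"
  using coend_ob_cell[OF RF[OF preH] Mc[OF preH], of "fob H c" a] h assms MA MB by simp_all
 show "b : ob (fdom F) ==> cin (rp HF) M (fob H c) a b : cells2 W"
  "b : ob (fdom F) ==> dom2 W (cin (rp HF) M (fob H c) a b) = hom (fcod H) (fob H c) (fob H (fob F b)) \<star> car M b a"
  "b : ob (fdom F) ==> cod2 W (cin (rp HF) M (fob H c) a b) = cob (rp HF) M (fob H c) a"
  using coend_in_cell[OF RF[OF preH] Mc[OF preH], of "fob H c" a b] h assms MA MB by simp_all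
qed

context
 fixes c a assumes c: "c : ob (fcod F)" and a: "a : ob (fdom Z)"
begin

lemma push_spec:
 "push c a : hom2 W (cob (rp F) M c a) (cob (rp HF) M (fob H c) a)"
 "[|b : ob (fdom F); f : El (hom (fcod F) c (fob F b)); m : El (car M b a)|] ==>
   ap (push c a) (cl (rp F) M c a b f m) = cl (rp HF) M (fob H c) a b (ap (fmap H c (fob F b)) f) m"
proof -
 note hn = HN_cell[OF c a]
 have Fo: "fob F b : ob (fcod F)" "ext (fcod F) (fob F b) = ext (fdom F) b" if "b : ob (fdom F)" for b using F that by simp_all
 have Hc: "fmap H x y : cells2 W" "dom2 W (fmap H x y) = hom (fcod F) x y" "cod2 W (fmap H x y) = hom (fcod H) (fob H x) (fob H y)"
  if "x : ob (fcod F)" "y : ob (fcod F)" for x y using H FH that by simp_all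
 have Mc': "car M b a : cells1 W" "trg W (car M b a) = ext (fdom F) b" "src W (car M b a) = ext (fdom Z) a" if "b : ob (fdom F)" for b
  using Mc[OF preT] that a MA MB by simp_all
 let ?j = "%b. cin (rp HF) M (fob H c) a b \<cdot> (fmap H c (fob F b) \<ast> \<iota> (car M b a))"
 have ho: "hom (fcod F) c (fob F b) : cells1 W" "src W (hom (fcod F) c (fob F b)) = ext (fdom F) b" "trg W (hom (fcod F) c (fob F b)) = ext (fcod F) c"
  if "b : ob (fdom F)" for b using F c that Fo by simp_all
 have jc: "?j b : hom2 W (hom (fcod F) c (fob F b) \<star> car M b a) (cob (rp HF) M (fob H c) a)"
  and je: "!!f m. f : El (hom (fcod F) c (fob F b)) ==> m : El (car M b a) ==> ap (?j b) (ten f m) = cl (rp HF) M (fob H c) a b (ap (fmap H c (fob F b)) f) m"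
  if b: "b : ob (fdom F)" for b
  using b hn(3-) Hc[OF c Fo(1)[OF b]] Mc'[OF b] ho[OF b] by (simp_all add: hom2_iff)
 have "\<exists>!t. t : hom2 W (cob (rp F) M c a) (cob (rp HF) M (fob H c) a) & (ALL b:ob (mcod M). t \<cdot> cin (rp F) M c a b = ?j b)"
 proof (rule coend_factor[OF RF[OF preT] Mc[OF preT]])
  fix b b' n f m assume "b : ob (mcod M)" "b' : ob (mcod M)" "n : El (car (rp F) c b)" "f : El (hom (mcod M) b b')" and m: "m : El (car M b' a)"
  then have *: "b : ob (fdom F)" "b' : ob (fdom F)" "n : El (hom (fcod F) c (fob F b))" "f : El (hom (fdom F) b b')" using MB by simp_all
  have fm: "la M b b' a f m : El (car M b a)" using * m a Mc[OF preT] MA MB F by simp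
  have Ff: "ap (fmap F b b') f : El (hom (fcod F) (fob F b) (fob F b'))" using * F by simp
  have r: "ra (rp F) c b b' n f = cm (fcod F) c (fob F b) (fob F b') n (ap (fmap F b b') f)" using * F c by simp
  have nf: "cm (fcod F) c (fob F b) (fob F b') n (ap (fmap F b b') f) : El (hom (fcod F) c (fob F b'))" using * Ff F c by simp
  have Hn: "ap (fmap H c (fob F b)) n : El (hom (fcod HF) (fob H c) (fob HF b))" using * Hc c Fo by simp
  have c': "fob H c : ob (fcod HF)" "a : ob (fdom HZ)" "b : ob (fdom HF)" "b' : ob (fdom HF)" "f : El (hom (fdom HF) b b')" using hn a * by simp_all
  show "ap (?j b) (ten n (la M b b' a f m)) = ap (?j b') (ten (ra (rp F) c b b' n f) m)"
   unfolding r je[OF *(1,3) fm] je[OF *(2) nf m] FM_bal[OF preH c'(1-4) Hn c'(5) m, symmetric]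
   using * Ff H FH c Fo F by simp
 qed (use jc hn MA MB a c in simp_all)
 then obtain t where t: "t : hom2 W (cob (rp F) M c a) (cob (rp HF) M (fob H c) a)"
  "!!b. b : ob (fdom F) ==> t \<cdot> cin (rp F) M c a b = ?j b" using MB by auto
 have "ap t (cl (rp F) M c a b f m) = cl (rp HF) M (fob H c) a b (ap (fmap H c (fob F b)) f) m"
  if b: "b : ob (fdom F)" "f : El (hom (fcod F) c (fob F b))" "m : El (car M b a)" for b f m
 proof -
  have "ap (t \<cdot> cin (rp F) M c a b) (ten f m) = ap (?j b) (ten f m)" using t(2)[OF b(1)] by simp
  then show ?thesis unfolding je[OF b]
   using b hom2D[OF t(1)] coend_in_cell[OF RF[OF preT] Mc[OF preT], of c a b] c a MA MB Mc'[OF b(1)] ho[OF b(1)] by simp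
 qed
 with t(1) have ex: "EX t. t : hom2 W (cob (rp F) M c a) (cob (rp HF) M (fob H c) a) &
   (ALL b:ob (fdom F). ALL f:El (hom (fcod F) c (fob F b)). ALL m:El (car M b a).
    ap t (cl (rp F) M c a b f m) = cl (rp HF) M (fob H c) a b (ap (fmap H c (fob F b)) f) m)"
  by blast
 note p = someI_ex[OF ex, folded push_def]
 show "push c a : hom2 W (cob (rp F) M c a) (cob (rp HF) M (fob H c) a)" using p by blast
 show "[|b : ob (fdom F); f : El (hom (fcod F) c (fob F b)); m : El (car M b a)|] ==>
   ap (push c a) (cl (rp F) M c a b f m) = cl (rp HF) M (fob H c) a b (ap (fmap H c (fob F b)) f) m"
  using p by blast
qed

lemma N_cell: "cob (rp F) M c a : cells1 W" "src W (cob (rp F) M c a) = ext (fdom Z) a" "trg W (cob (rp F) M c a) = ext (fcod F) c"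
 using coend_ob_cell[OF RF[OF preT] Mc[OF preT], of c a] c a MA MB by simp_all

lemma push_lact:
 assumes c': "c' : ob (fcod F)" and x: "x : El (hom (fcod F) c' c)" and n: "n : El (cob (rp F) M c a)"
  and p': "push c' a : hom2 W (cob (rp F) M c' a) (cob (rp HF) M (fob H c') a)"
   "!!b f m. [|b : ob (fdom F); f : El (hom (fcod F) c' (fob F b)); m : El (car M b a)|] ==>
    ap (push c' a) (cl (rp F) M c' a b f m) = cl (rp HF) M (fob H c') a b (ap (fmap H c' (fob F b)) f) m"
 shows "ap (push c' a) (la (cmod (rp F) M) c' c a x n)
  = la (cmod (rp HF) M) (fob H c') (fob H c) a (ap (fmap H c' c) x) (ap (push c a) n)"
proof -
 let ?N = "cmod (rp F) M" and ?N' = "cmod (rp HF) M"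
 have Hx: "fmap H c' c : cells2 W" "dom2 W (fmap H c' c) = hom (fcod F) c' c" "cod2 W (fmap H c' c) = hom (fcod H) (fob H c') (fob H c)"
  using H FH c c' by simp_all
 have lN: "lact ?N c' c a : cells2 W" "dom2 W (lact ?N c' c a) = hom (fcod F) c' c \<star> cob (rp F) M c a" "cod2 W (lact ?N c' c a) = cob (rp F) M c' a"
  using lact_cell[OF FMc[OF preT], of c' c a] c c' a MA by simp_all
 note hn = HN_cell[OF c a] HN_cell[OF c' a]
 have lN': "lact ?N' (fob H c') (fob H c) a : cells2 W" "dom2 W (lact ?N' (fob H c') (fob H c) a) = hom (fcod H) (fob H c') (fob H c) \<star> cob (rp HF) M (fob H c) a" "cod2 W (lact ?N' (fob H c') (fob H c) a) = cob (rp HF) M (fob H c') a"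
  using lact_cell[OF FMc[OF preH], of "fob H c'" "fob H c" a] hn a MA by simp_all
 have ho: "hom (fcod F) c' c : cells1 W" "src W (hom (fcod F) c' c) = ext (fcod F) c" "trg W (hom (fcod F) c' c) = ext (fcod F) c'"
  using F c c' by simp_all
 note pc = hom2D[OF push_spec(1)] hom2D[OF p'(1)]
 have "push c' a \<cdot> lact ?N c' c a = lact ?N' (fob H c') (fob H c) a \<cdot> (fmap H c' c \<ast> push c a)"
 proof (rule gen_ext2[OF generates_El[OF ho(1)] FM_gens[OF preT c a], of _ "cob (rp HF) M (fob H c') a"])
  fix h z assume h: "h : El (hom (fcod F) c' c)" and "z : coend_El_gens (rp F) M c a"
  then obtain b f m where z: "b : ob (fdom F)" "f : El (hom (fcod F) c (fob F b))" "m : El (car M b a)" "z = cl (rp F) M c a b f m"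
   by (blast elim: FM_gensE[OF preT])
  have zE: "z : El (cob (rp F) M c a)" unfolding z(4) by (rule FM_El[OF preT c a z(1-3)])
  have Fo: "fob F b : ob (fcod F)" using F z by simp
  have hf: "cm (fcod F) c' c (fob F b) h f : El (hom (fcod F) c' (fob F b))" using h z F Fo c c' by simp
  have Hf: "ap (fmap H c (fob F b)) f : El (hom (fcod HF) (fob H c) (fob HF b))" using H FH z c Fo by simp
  have Hhx: "ap (fmap H c' c) h : El (hom (fcod HF) (fob H c') (fob H c))" using Hx h by simp
  have o: "fob H c : ob (fcod HF)" "fob H c' : ob (fcod HF)" "a : ob (fdom HZ)" "b : ob (fdom HF)" using hn a z by simp_all
  note fc = fmap_cmp_el[OF H, unfolded FH, OF c' c Fo refl h z(2)]
  have "ap (push c' a) (la ?N c' c a h z) = la ?N' (fob H c') (fob H c) a (ap (fmap H c' c) h) (ap (push c a) z)"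
   unfolding z(4) FM_act(1)[OF preT c a z(1-3) c' h] p'(2)[OF z(1) hf z(3)] push_spec(2)[OF z(1-3)] FM_act(1)[OF preH o(1,3,4) Hf z(3) o(2) Hhx] fc wfun_comp_sel ..
  then show "ap (push c' a \<cdot> lact ?N c' c a) (ten h z) = ap (lact ?N' (fob H c') (fob H c) a \<cdot> (fmap H c' c \<ast> push c a)) (ten h z)"
   using h zE lN lN' pc Hx ho N_cell by simp
 qed (use lN lN' pc Hx ho hn N_cell in "simp_all add: hom2_iff")
 from arg_cong[OF this, of "%t. ap t (ten x n)"]
 show ?thesis using x n lN lN' pc Hx ho N_cell by simp
qed

lemma push_mate:
 assumes \<alpha>: "\<alpha> : mors M (cmod (cor F) (rp Z))" and n: "n : El (cob (rp F) M c a)"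
 shows "app (mate HF HZ (vc (hom_mod_map W H F Z) \<alpha>)) (fob H c) a (ap (push c a) n)
  = ap (fmap H c (fob Z a)) (app (mate F Z \<alpha>) c a n)"
proof -
 let ?\<alpha> = "vc (hom_mod_map W H F Z) \<alpha>"
 note hh = hom_mod_map_in_hom[OF F Zc[OF preT] H ZF FH]
 have \<alpha>1: "\<alpha> : mors M (hom_mod W F Z)" using \<alpha> by (simp add: hom_mod_def)
 have \<alpha>': "?\<alpha> : mors M (cmod (cor HF) (rp HZ))" using mor_vcomp_in[OF \<alpha>1 hh] by (simp add: hom_mod_def)
 note mi = mate_in_hom[OF preT \<alpha>] and mi' = mate_in_hom[OF preH \<alpha>']
 note mc = component_cell[OF Mod_hom2D(1)[OF mi], unfolded Mod_hom2D(2,3)[OF mi] mod_comp_sel rep_sel ZF MA, OF c a]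
 note mc' = component_cell[OF Mod_hom2D(1)[OF mi'], unfolded Mod_hom2D(2,3)[OF mi'] mod_comp_sel rep_sel wfun_comp_sel ZF MA, OF HN_cell(1)[OF c a] a]
 have za: "fob Z a : ob (fcod F)" using Zc[OF preT] ZF a by simp
 have Hz: "fmap H c (fob Z a) : cells2 W" "dom2 W (fmap H c (fob Z a)) = hom (fcod F) c (fob Z a)" "cod2 W (fmap H c (fob Z a)) = hom (fcod H) (fob H c) (fob H (fob Z a))"
  using H FH c za by simp_all
 note pc = hom2D[OF push_spec(1)]
 have "component (mate HF HZ ?\<alpha>) (fob H c) a \<cdot> push c a = fmap H c (fob Z a) \<cdot> component (mate F Z \<alpha>) c a"
 proof (rule gen_ext[OF FM_gens[OF preT c a], of _ "hom (fcod H) (fob H c) (fob H (fob Z a))"], goal_cases)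
  case 3 show ?case
  proof
   fix z assume "z : coend_El_gens (rp F) M c a"
   then obtain b f m where z: "b : ob (fdom F)" "f : El (hom (fcod F) c (fob F b))" "m : El (car M b a)" "z = cl (rp F) M c a b f m"
    by (rule FM_gensE[OF preT])
   have zE: "z : El (cob (rp F) M c a)" unfolding z(4) by (rule FM_El[OF preT c a z(1-3)])
   have Fo: "fob F b : ob (fcod F)" using F z by simp
   have Hf: "ap (fmap H c (fob F b)) f : El (hom (fcod HF) (fob H c) (fob HF b))" using H FH z c Fo by simp
   have o: "fob H c : ob (fcod HF)" "a : ob (fdom HZ)" "b : ob (fdom HF)" using HN_cell(1)[OF c a] a z by simp_all
   note bE = bar_El[OF preT \<alpha> z(1) a z(3)]
   note fc = fmap_cmp_el[OF H, unfolded FH, OF c Fo za refl z(2) bE]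
   have "app (mate HF HZ ?\<alpha>) (fob H c) a (ap (push c a) z) = ap (fmap H c (fob Z a)) (app (mate F Z \<alpha>) c a z)"
    unfolding z(4) push_spec(2)[OF z(1-3)] mate_el[OF preH \<alpha>' o Hf z(3)] mate_el[OF preT \<alpha> c a z(1-3)]
     hom_mod_map_bar[OF F Zc[OF preT] H ZF FH \<alpha>1 z(1) a z(3)] fc wfun_comp_sel ..
   then show "ap (component (mate HF HZ ?\<alpha>) (fob H c) a \<cdot> push c a) z = ap (fmap H c (fob Z a) \<cdot> component (mate F Z \<alpha>) c a) z"
    using zE pc mc mc' Hz by simp
  qed
 qed (use pc mc mc' Hz in "simp_all add: hom2_iff")
 from arg_cong[OF this, of "%t. ap t n"] show ?thesis using n pc mc mc' Hz by simp
qed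

end

lemma reconstructs_push:
 assumes \<alpha>: "\<alpha> : mors M (cmod (cor F) (rp Z))" and rec: "reconstructs F Z M \<alpha> \<nu>"
 shows "weighted_colimit W M HF HZ (vc (hom_mod_map W H F Z) \<alpha>)"
proof (rule reconstructs_weighted_colimit[OF preH])
 let ?\<alpha> = "vc (hom_mod_map W H F Z) \<alpha>"
 let ?\<nu> = "%a. push (fob Z a) a \<cdot> \<nu> a"
 note hh = hom_mod_map_in_hom[OF F Zc[OF preT] H ZF FH]
 have \<alpha>1: "\<alpha> : mors M (hom_mod W F Z)" using \<alpha> by (simp add: hom_mod_def)
 show \<alpha>': "?\<alpha> : mors M (cmod (cor HF) (rp HZ))" using mor_vcomp_in[OF \<alpha>1 hh] by (simp add: hom_mod_def)
 show "reconstructs HF HZ M ?\<alpha> ?\<nu>" unfolding reconstructs_def[OF preH]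
 proof (intro ballI conjI)
  fix a assume "a : ob (fdom HZ)"
  then have a: "a : ob (fdom Z)" by simp
  have za: "fob Z a : ob (fcod F)" using Zc[OF preT] ZF a by simp
  note r = rec[unfolded reconstructs_def[OF preT], rule_format, OF a]
  have nu: "pt (\<nu> a) : El (cob (rp F) M (fob Z a) a)" by (rule rec_cell(4)[OF preT \<alpha> rec a])
  show "?\<nu> a : hom2 W (\<one> (ext (fdom HZ) a)) (cob (rp HF) M (fob HZ a) a)"
   using r hom2D[OF push_spec(1)[OF za a]] by (simp add: hom2_iff)
  have "app (mate HF HZ ?\<alpha>) (fob H (fob Z a)) a (ap (push (fob Z a) a) (pt (\<nu> a))) = ap (fmap H (fob Z a) (fob Z a)) (pt (unt (fcod F) (fob Z a)))"
   unfolding push_mate[OF za a \<alpha> nu] using r by simp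
  then show "app (mate HF HZ ?\<alpha>) (fob HZ a) a (pt (?\<nu> a)) = pt (unt (fcod HF) (fob HZ a))"
   using fmap_unt_el[OF H, unfolded FH, OF za refl] by simp
  fix b m assume "b : ob (fdom HF)" and m: "m : El (car M b a)"
  then have b: "b : ob (fdom F)" by simp
  have fb: "fob F b : ob (fcod F)" using F b by simp
  have i: "idpt F b : El (hom (fcod F) (fob F b) (fob F b))" using F b by simp
  have "la (cmod (rp HF) M) (fob H (fob F b)) (fob H (fob Z a)) a (ap (bar HF (rp HZ) ?\<alpha> b a) m) (ap (push (fob Z a) a) (pt (\<nu> a)))
   = ap (push (fob F b) a) (la (cmod (rp F) M) (fob F b) (fob Z a) a (ap (bar F (rp Z) \<alpha> b a) m) (pt (\<nu> a)))"
   unfolding hom_mod_map_bar[OF F Zc[OF preT] H ZF FH \<alpha>1 b a m]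
   by (rule push_lact[OF za a fb bar_El[OF preT \<alpha> b a m] nu push_spec[OF fb a], symmetric])
  also have "\<dots> = ap (push (fob F b) a) (cl (rp F) M (fob F b) a b (idpt F b) m)" using r b m by simp
  also have "\<dots> = cl (rp HF) M (fob H (fob F b)) a b (ap (fmap H (fob F b) (fob F b)) (idpt F b)) m"
   by (rule push_spec(2)[OF fb a b i m])
  finally show "la (cmod (rp HF) M) (fob HF b) (fob HZ a) a (ap (bar HF (rp HZ) ?\<alpha> b a) m) (pt (?\<nu> a))
    = cl (rp HF) M (fob HF b) a b (idpt HF b) m"
   using fmap_unt_el[OF H, unfolded FH, OF fb refl] by simp
 qed
qed

end

lemma reconstructs_absolute:
 fixes F Z :: "('u, 'o, 'm, 'c) wfun" and M :: "('u, 'o, 'm, 'c) wmod"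
 assumes preT: "isfun F" "wfunctor W Z (fdom Z) (fcod F)" "fcod Z = fcod F"
   "wmodule W M (fdom Z) (fdom F)" "mdom M = fdom Z" "mcod M = fdom F"
  and \<alpha>: "\<alpha> : mors M (cmod (cor F) (rp Z))" and rec: "reconstructs F Z M \<alpha> \<nu>"
 shows "absolute_weighted_colimit W M F Z \<alpha>"
 unfolding absolute_weighted_colimit_def preserves_weighted_colimit_def Mod_sel
proof (intro conjI allI impI)
 show "weighted_colimit W M F Z \<alpha>" by (rule reconstructs_weighted_colimit[OF preT \<alpha> rec])
 fix X H assume H: "wfunctor W H (fcod F) (X :: ('u, 'o, 'm, 'c) wcat)"
 have HX: "fdom H = fcod F" "fcod H = X" using wfunctor.fdom[OF H] wfunctor.fcod[OF H] by simp_all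
 show "weighted_colimit W M (wfun_comp W H F) (wfun_comp W H Z) (vc (hom_mod_map W H F Z) \<alpha>)"
  by (rule reconstructs_push[OF preT _ HX(1) \<alpha> rec]) (use H HX in simp)
qed

lemma E1_E2_reconstructs:
 fixes F Z :: "('u, 'o, 'm, 'c) wfun" and M :: "('u, 'o, 'm, 'c) wmod"
 assumes preT: "isfun F" "wfunctor W Z (fdom Z) (fcod F)" "fcod Z = fcod F"
   "wmodule W M (fdom Z) (fdom F)" "mdom M = fdom Z" "mcod M = fdom F"
  and \<alpha>: "\<alpha> : mors M (cmod (cor F) (rp Z))" and \<beta>: "\<beta> : mors (rp Z) (cmod (rp F) M)"
  and E1: "equation_E1 W M F \<alpha> \<beta>" and E2: "equation_E2 W F Z \<alpha> \<beta>"
 shows "reconstructs F Z M \<alpha> (%a. component \<beta> (fob Z a) a \<cdot> unt (fcod F) (fob Z a))"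
 unfolding reconstructs_def[OF preT]
proof (intro ballI conjI)
 fix a assume a: "a : ob (fdom Z)"
 have za: "fob Z a : ob (fcod F)" "ext (fcod F) (fob Z a) = ext (fdom Z) a" using Zc[OF preT] preT(3) a by simp_all
 have Cw: "wcategory W (fcod F)" using preT by simp
 have bc: "component \<beta> (fob Z a) a : cells2 W" "dom2 W (component \<beta> (fob Z a) a) = hom (fcod F) (fob Z a) (fob Z a)" "cod2 W (component \<beta> (fob Z a) a) = cob (rp F) M (fob Z a) a"
  using component_cell[OF Mod_hom2D(1)[OF \<beta>], of "fob Z a" a] Mod_hom2D(2,3)[OF \<beta>] za a preT(3) by simp_all
 show "component \<beta> (fob Z a) a \<cdot> unt (fcod F) (fob Z a) : hom2 W (\<one> (ext (fdom Z) a)) (cob (rp F) M (fob Z a) a)"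
  using bc za Cw by (simp add: hom2_iff)
 note i = Zid_El[OF preT a]
 have e2: "app (vc (mate F Z \<alpha>) \<beta>) (fob Z a) a (pt (unt (fcod F) (fob Z a))) = pt (unt (fcod F) (fob Z a))"
  unfolding E2[unfolded E2_iff[OF preT \<alpha> \<beta>]] using za Cw a preT(3) by simp
 show "app (mate F Z \<alpha>) (fob Z a) a (pt (component \<beta> (fob Z a) a \<cdot> unt (fcod F) (fob Z a))) = pt (unt (fcod F) (fob Z a))"
  using mor_vcomp_el[OF \<beta> mate_in_hom[OF preT \<alpha>], of "fob Z a" a "pt (unt (fcod F) (fob Z a))"] e2 za a i preT(3) by simp
 fix b m assume b: "b : ob (fdom F)" and m: "m : El (car M b a)"
 have fb: "fob F b : ob (fcod F)" using preT b by simp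
 note bE = bar_El[OF preT \<alpha> b a m]
 have "la (cmod (rp F) M) (fob F b) (fob Z a) a (ap (bar F (rp Z) \<alpha> b a) m) (app \<beta> (fob Z a) a (pt (unt (fcod F) (fob Z a))))
   = app \<beta> (fob F b) a (ap (bar F (rp Z) \<alpha> b a) m)"
  using from_rep_act(2)[OF preT \<beta> za(1) a i fb bE] bE Cw za fb by simp
 also have "\<dots> = cl (rp F) M (fob F b) a b (idpt F b) m"
  using E1[unfolded E1_iff[OF preT \<alpha> \<beta>], rule_format, OF b a m] .
 finally show "la (cmod (rp F) M) (fob F b) (fob Z a) a (ap (bar F (rp Z) \<alpha> b a) m) (pt (component \<beta> (fob Z a) a \<cdot> unt (fcod F) (fob Z a)))
   = cl (rp F) M (fob F b) a b (idpt F b) m" by simp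
qed

end


section \<open>The collage of a module\<close>

context enriched_base
begin

definition initial1 :: "'m => bool" where
 "initial1 p \<longleftrightarrow> p : cells1 W & (ALL q:hom1 W (src W p) (trg W p). \<exists>!t. t : hom2 W p q)"

definition bang :: "'m => 'm => 'c" where
 "bang p q = (SOME t. t : hom2 W p q)"

lemma bang_in_hom: "initial1 p ==> q : hom1 W (src W p) (trg W p) ==> bang p q : hom2 W p q"
 unfolding bang_def by (rule someI_ex) (auto simp: initial1_def)

lemma initial1_eq:
 assumes p: "initial1 p" and s: "\<sigma> : hom2 W p q" and t: "\<tau> : hom2 W p q"
 shows "\<sigma> = \<tau>"
proof -
 have "q : hom1 W (src W p) (trg W p)" using dom2_cod2[of \<sigma>] hom2D[OF s] by (auto simp: hom1_iff)
 then have "\<exists>!t. t : hom2 W p q" using p unfolding initial1_def by blast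
 then show ?thesis using s t by blast
qed

lemma glued_empty: "glued (hom1 W a b) {} f u v p i \<longleftrightarrow> p : hom1 W a b & (ALL q:hom1 W a b. \<exists>!t. t : hom2 W p q)"
 by (auto simp: glued_def glues_def)

lemma ex_initial1:
 assumes "a : obj W" "b : obj W" shows "EX p:hom1 W a b. initial1 p"
proof -
 have "small ({} :: 'u set)" by (simp add: small_def card_of_ordLess2[symmetric])
 then obtain p i where "glued (hom1 W a b) ({} :: 'u set) undefined undefined undefined p i"
  using ex_glued[of "{}" a b undefined undefined undefined undefined] assms by auto
 then have p: "p : hom1 W a b" "ALL q:hom1 W a b. \<exists>!t. t : hom2 W p q" unfolding glued_empty by simp_all
 then have "p : cells1 W" "src W p = a" "trg W p = b" by (simp_all add: hom1_iff)
 with p(2) have "initial1 p" by (simp add: initial1_def)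
 with p(1) show ?thesis by blast
qed

text \<open>An initial 1-cell is a gluing of the empty diagram, which whiskering preserves.\<close>

lemma initial1_left:
 assumes p: "initial1 p" and g: "g : cells1 W" "src W g = trg W p"
 shows "initial1 (g \<star> p)"
 unfolding initial1_def
proof (intro conjI ballI)
 have pc: "p : cells1 W" using p by (simp add: initial1_def)
 then show "g \<star> p : cells1 W" using g by simp
 fix q assume "q : hom1 W (src W (g \<star> p)) (trg W (g \<star> p))"
 then have q: "q : hom1 W (src W p) (trg W g)" using pc g by simp
 have "glued (hom1 W (src W p) (trg W p)) ({} :: 'u set) undefined undefined undefined p undefined"
  unfolding glued_empty using p by (simp add: initial1_def hom1_iff)
 from glued_whisker_left[OF this, of g "trg W g" undefined q undefined] q pc g ex_right_lifting[of g]
 show "\<exists>!t. t : hom2 W (g \<star> p) q" by (simp add: hom1_iff glues_def)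
qed

lemma initial1_right:
 assumes p: "initial1 p" and h: "h : cells1 W" "src W p = trg W h"
 shows "initial1 (p \<star> h)"
 unfolding initial1_def
proof (intro conjI ballI)
 have pc: "p : cells1 W" using p by (simp add: initial1_def)
 then show "p \<star> h : cells1 W" using h by simp
 fix q assume "q : hom1 W (src W (p \<star> h)) (trg W (p \<star> h))"
 then have q: "q : hom1 W (src W h) (trg W p)" using pc h by simp
 have "glued (hom1 W (src W p) (trg W p)) ({} :: 'u set) undefined undefined undefined p undefined"
  unfolding glued_empty using p by (simp add: initial1_def hom1_iff)
 from glued_whisker_right[OF this, of h "src W h" undefined q undefined] q pc h ex_right_extension[of h]
 show "\<exists>!t. t : hom2 W (p \<star> h) q" by (simp add: hom1_iff glues_def)
qed

definition coll_ob :: "('u, 'o, 'm, 'c) wmod => ('u + 'u) set" where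
 "coll_ob N = Inl ` ob (mcod N) \<union> Inr ` ob (mdom N)"

definition coll_ext :: "('u, 'o, 'm, 'c) wmod => 'u + 'u => 'o" where
 "coll_ext N x = (case x of Inl c => ext (mcod N) c | Inr a => ext (mdom N) a)"

text \<open>The homs from the right part to the left part have to be 1-cells of the base, so the
 missing arrows are represented by initial 1-cells \<open>z\<close>.\<close>

definition coll_hom :: "('u, 'o, 'm, 'c) wmod => ('u => 'u => 'm) => 'u + 'u => 'u + 'u => 'm" where
 "coll_hom N z x y = (case x of
   Inl c => (case y of Inl c' => hom (mcod N) c c' | Inr a => car N c a)
  | Inr a => (case y of Inl c => z a c | Inr a' => hom (mdom N) a a'))"

definition coll_cmp :: "('u, 'o, 'm, 'c) wmod => ('u => 'u => 'm) => 'u + 'u => 'u + 'u => 'u + 'u => 'c" where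
 "coll_cmp N z x y w = (case (x, y, w) of
   (Inl c, Inl c', Inl c'') => cmp (mcod N) c c' c''
  | (Inl c, Inl c', Inr a) => lact N c c' a
  | (Inl c, Inr a, Inr a') => ract N c a a'
  | (Inr a, Inr a', Inr a'') => cmp (mdom N) a a' a''
  | _ => bang (coll_hom N z x y \<star> coll_hom N z y w) (coll_hom N z x w))"

definition coll_unt :: "('u, 'o, 'm, 'c) wmod => 'u + 'u => 'c" where
 "coll_unt N x = (case x of Inl c => unt (mcod N) c | Inr a => unt (mdom N) a)"

definition collage :: "('u, 'o, 'm, 'c) wmod => ('u + 'u => 'u) => ('u => 'u => 'm) => ('u, 'o, 'm, 'c) wcat" where
 "collage N e z = \<lparr>ob = e ` coll_ob N, ext = (%x. coll_ext N (inv e x)), hom = (%x y. coll_hom N z (inv e x) (inv e y)),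
   cmp = (%x y w. coll_cmp N z (inv e x) (inv e y) (inv e w)), unt = (%x. coll_unt N (inv e x))\<rparr>"

context
 fixes N :: "('u, 'o, 'm, 'c) wmod" and z :: "'u => 'u => 'm"
 assumes N: "ismod N"
  and z: "!!a c. a : ob (mdom N) ==> c : ob (mcod N) ==> z a c : hom1 W (ext (mcod N) c) (ext (mdom N) a)"
  and zi: "!!a c. a : ob (mdom N) ==> c : ob (mcod N) ==> initial1 (z a c)"
begin

lemma coll_ext_obj: "x : coll_ob N ==> coll_ext N x : obj W"
 using N by (auto simp: coll_ob_def coll_ext_def)

lemma coll_hom_in: "x : coll_ob N ==> y : coll_ob N ==> coll_hom N z x y : hom1 W (coll_ext N y) (coll_ext N x)"
 using N z by (auto simp: coll_ob_def coll_ext_def coll_hom_def hom1_iff)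

lemmas coll_hom_cell = coll_hom_in[unfolded hom1_iff, THEN conjunct1] coll_hom_in[unfolded hom1_iff, THEN conjunct2, THEN conjunct1]
 coll_hom_in[unfolded hom1_iff, THEN conjunct2, THEN conjunct2]

definition falls where "falls x y \<longleftrightarrow> isl y & \<not> isl x" for x y :: "'u + 'u"

lemma falls_initial: "x : coll_ob N ==> y : coll_ob N ==> falls x y ==> initial1 (coll_hom N z x y)"
 using zi by (auto simp: coll_ob_def coll_hom_def falls_def)

lemma coll_cmp_in:
 assumes o: "x : coll_ob N" "y : coll_ob N" "w : coll_ob N"
 shows "coll_cmp N z x y w : hom2 W (coll_hom N z x y \<star> coll_hom N z y w) (coll_hom N z x w)"
proof (cases "falls x y \<or> falls y w")
 case True
 then have "initial1 (coll_hom N z x y \<star> coll_hom N z y w)"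
  using o by (auto intro: initial1_left initial1_right falls_initial simp: coll_hom_cell)
 from bang_in_hom[OF this] have "bang (coll_hom N z x y \<star> coll_hom N z y w) (coll_hom N z x w) : hom2 W (coll_hom N z x y \<star> coll_hom N z y w) (coll_hom N z x w)"
  using o by (simp add: coll_hom_cell hom1_iff)
 moreover have "coll_cmp N z x y w = bang (coll_hom N z x y \<star> coll_hom N z y w) (coll_hom N z x w)"
  using True by (auto simp: coll_cmp_def falls_def split: sum.splits)
 ultimately show ?thesis by simp
next
 case False
 then show ?thesis using o N
  by (auto simp: coll_cmp_def falls_def coll_hom_def coll_ob_def hom2_iff)
qed

lemmas coll_cmp_cell = coll_cmp_in[THEN hom2D(1)] coll_cmp_in[THEN hom2D(2)] coll_cmp_in[THEN hom2D(3)]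

lemma coll_unt_in: "x : coll_ob N ==> coll_unt N x : hom2 W (\<one> (coll_ext N x)) (coll_hom N z x x)"
 using N by (auto simp: coll_ob_def coll_unt_def coll_hom_def coll_ext_def hom2_iff)

lemmas coll_unt_cell = coll_unt_in[THEN hom2D(1)] coll_unt_in[THEN hom2D(2)] coll_unt_in[THEN hom2D(3)]

text \<open>If one of the three homs is initial, so is their composite, and the equation holds for
 lack of choice. In the remaining cases it is an axiom for the two categories or for the
 module.\<close>

lemma coll_assoc:
 assumes o: "x : coll_ob N" "y : coll_ob N" "w : coll_ob N" "v : coll_ob N"
 shows "coll_cmp N z x w v \<cdot> (coll_cmp N z x y w \<ast> \<iota> (coll_hom N z w v))
  = coll_cmp N z x y v \<cdot> (\<iota> (coll_hom N z x y) \<ast> coll_cmp N z y w v) \<cdot> \<a> (coll_hom N z x y) (coll_hom N z y w) (coll_hom N z w v)"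
proof (cases "falls x y \<or> falls y w \<or> falls w v")
 case True
 note c = coll_hom_cell coll_cmp_cell
 have "initial1 ((coll_hom N z x y \<star> coll_hom N z y w) \<star> coll_hom N z w v)"
 proof (cases "falls w v")
  case True
  then show ?thesis using o by (intro initial1_left falls_initial) (simp_all add: c)
 next
  case False
  with \<open>falls x y \<or> falls y w \<or> falls w v\<close> have "initial1 (coll_hom N z x y \<star> coll_hom N z y w)"
   using o by (auto intro: initial1_right initial1_left falls_initial simp: c)
  from initial1_right[OF this] show ?thesis using o by (simp add: c)
 qed
 then show ?thesis
  by (rule initial1_eq[of _ _ "coll_hom N z x v"]) (use o in "simp_all add: c hom2_iff")
next
 case False
 have B: "wcategory W (mcod N)" and A: "wcategory W (mdom N)" using N by simp_all
 from False o show ?thesis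
  by (auto simp: coll_ob_def coll_cmp_def coll_hom_def falls_def wcategory.cmp_assoc[OF A] wcategory.cmp_assoc[OF B]
   wmodule.lact_assoc[OF N] wmodule.ract_assoc[OF N] wmodule.lact_ract[OF N])
qed

lemma coll_unit:
 assumes o: "x : coll_ob N" "y : coll_ob N"
 shows "coll_cmp N z x x y \<cdot> (coll_unt N x \<ast> \<iota> (coll_hom N z x y)) = \<l> (coll_hom N z x y)"
  "coll_cmp N z x y y \<cdot> (\<iota> (coll_hom N z x y) \<ast> coll_unt N y) = \<r> (coll_hom N z x y)"
proof -
 note c = coll_hom_cell coll_cmp_cell coll_unt_cell coll_ext_obj
 have B: "wcategory W (mcod N)" and A: "wcategory W (mdom N)" using N by simp_all
 show "coll_cmp N z x x y \<cdot> (coll_unt N x \<ast> \<iota> (coll_hom N z x y)) = \<l> (coll_hom N z x y)"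
 proof (cases "falls x y")
  case True
  then have "initial1 (\<one> (coll_ext N x) \<star> coll_hom N z x y)" using o by (intro initial1_left falls_initial) (simp_all add: c)
  then show ?thesis by (rule initial1_eq[of _ _ "coll_hom N z x y"]) (use o in "simp_all add: c hom2_iff")
 next
  case False
  with o show ?thesis
   by (auto simp: coll_ob_def coll_cmp_def coll_hom_def coll_unt_def falls_def wcategory.cmp_unt_left[OF A] wcategory.cmp_unt_left[OF B] wmodule.lact_unt[OF N])
 qed
 show "coll_cmp N z x y y \<cdot> (\<iota> (coll_hom N z x y) \<ast> coll_unt N y) = \<r> (coll_hom N z x y)"
 proof (cases "falls x y")
  case True
  then have "initial1 (coll_hom N z x y \<star> \<one> (coll_ext N y))" using o by (intro initial1_right falls_initial) (simp_all add: c)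
  then show ?thesis by (rule initial1_eq[of _ _ "coll_hom N z x y"]) (use o in "simp_all add: c hom2_iff")
 next
  case False
  with o show ?thesis
   by (auto simp: coll_ob_def coll_cmp_def coll_hom_def coll_unt_def falls_def wcategory.cmp_unt_right[OF A] wcategory.cmp_unt_right[OF B] wmodule.ract_unt[OF N])
 qed
qed

lemma wcategory_collage:
 assumes e: "inj e" shows "wcategory W (collage N e z)"
proof -
 have inf: "infinite (UNIV :: 'u set)" using univ by (simp add: universe_def)
 have small_im: "small (f ` S)" if "small S" for S :: "'u set" and f :: "'u => 'u"
  using that unfolding small_def by (rule ordLeq_ordLess_trans[OF card_of_image])
 have sm: "small (ob (collage N e z))"
 proof -
  have "ob (collage N e z) = (%c. e (Inl c)) ` ob (mcod N) \<union> (%a. e (Inr a)) ` ob (mdom N)"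
   by (auto simp: collage_def coll_ob_def)
  then show ?thesis
   using small_im[OF wcategory.small_ob[OF wmodule.cod_wcategory[OF N]]] small_im[OF wcategory.small_ob[OF wmodule.dom_wcategory[OF N]]]
   unfolding small_def by (simp add: card_of_Un_ordLess_infinite[OF inf])
 qed
 have ie: "inv e (e x) = x" for x using e by simp
 show ?thesis
  by (rule wcategory.intro[OF sm])
   (auto simp: collage_def ie coll_ext_obj coll_hom_in coll_cmp_in coll_unt_in coll_assoc coll_unit)
qed

end

text \<open>The collage of \<open>N\<close> contains both categories as full subcategories, with \<open>N(c,a)\<close> as
 the hom from \<open>a\<close> to \<open>c\<close>, and the actions of \<open>N\<close> as composition.\<close>

lemma ex_collage:
 fixes N :: "('u, 'o, 'm, 'c) wmod"
 assumes N: "ismod N"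
 shows "EX X I J. wfunctor W I (mcod N) X & wfunctor W J (mdom N) X &
  (ALL c:ob (mcod N). ALL c':ob (mcod N). fmap I c c' = \<iota> (hom (mcod N) c c')) &
  (ALL a:ob (mdom N). ALL a':ob (mdom N). fmap J a a' = \<iota> (hom (mdom N) a a')) &
  (ALL c:ob (mcod N). ALL a:ob (mdom N). hom X (fob I c) (fob J a) = car N c a) &
  (ALL c:ob (mcod N). ALL c':ob (mcod N). ALL a:ob (mdom N). cmp X (fob I c) (fob I c') (fob J a) = lact N c c' a) &
  (ALL c:ob (mcod N). ALL a:ob (mdom N). ALL a':ob (mdom N). cmp X (fob I c) (fob J a) (fob J a') = ract N c a a')"
proof -
 let ?C = "mcod N" and ?A = "mdom N"
 have C: "wcategory W ?C" and A: "wcategory W ?A" using N by simp_all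
 obtain s :: "'u shape => 'u" where s: "inj s" using ex_shape_code univ by (auto simp: universe_def)
 define e :: "'u + 'u => 'u" where "e x = s (case x of Inl c => Vertex c | Inr a => Edge a a)" for x
 have e: "inj e" by (rule injI) (auto simp: e_def inj_eq[OF s] split: sum.splits)
 have "EX p. p : hom1 W (ext ?C c) (ext ?A a) & initial1 p" if "a : ob ?A" "c : ob ?C" for a c
  using ex_initial1[of "ext ?C c" "ext ?A a"] that A C by auto
 then obtain z where z: "!!a c. a : ob ?A ==> c : ob ?C ==> z a c : hom1 W (ext ?C c) (ext ?A a)"
  and zi: "!!a c. a : ob ?A ==> c : ob ?C ==> initial1 (z a c)" by metis
 let ?X = "collage N e z"
 have X: "wcategory W ?X" by (rule wcategory_collage[OF N z zi e])
 have ie: "inv e (e x) = x" for x using e by simp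
 let ?I = "\<lparr>fdom = ?C, fcod = ?X, fob = (%c. e (Inl c)), fmap = (%c c'. \<iota> (hom ?C c c'))\<rparr>"
 let ?J = "\<lparr>fdom = ?A, fcod = ?X, fob = (%a. e (Inr a)), fmap = (%a a'. \<iota> (hom ?A a a'))\<rparr>"
 note d = collage_def ie coll_ob_def coll_ext_def coll_hom_def coll_cmp_def coll_unt_def
 have I: "wfunctor W ?I ?C ?X" by (rule wfunctorI[OF _ _ C X]) (use C in "auto simp: d hom2_iff")
 have J: "wfunctor W ?J ?A ?X" by (rule wfunctorI[OF _ _ A X]) (use A in "auto simp: d hom2_iff")
 show ?thesis by (rule exI[of _ ?X], rule exI[of _ ?I], rule exI[of _ ?J]) (use I J in "simp add: d")
qed

end


section \<open>Absolute colimits\<close>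

context enriched_base
begin

context
 fixes F Z :: "('u, 'o, 'm, 'c) wfun" and M :: "('u, 'o, 'm, 'c) wmod"
 assumes F: "isfun F" and Z: "wfunctor W Z (fdom Z) (fcod F)" and ZF: "fcod Z = fcod F"
  and M: "wmodule W M (fdom Z) (fdom F)" and MA: "mdom M = fdom Z" and MB: "mcod M = fdom F"
begin

lemmas preA = F Z ZF M MA MB

subsection \<open>The universal map into the collage\<close>

text \<open>In the collage \<open>X\<close> the classes \<open>n(m) = [1 \<otimes> m]\<close> are elements of \<open>X(F b, a)\<close>, so \<open>m
 \<otimes> y \<mapsto> n(m) \<cdot> y\<close> is a morphism \<open>M \<circ> X(J,1) \<Rightarrow> X(F,1)\<close>, with \<open>J\<close> the inclusion of the domain
 of \<open>M\<close>. Its lift \<open>\<tau>\<close>, evaluated at the identity of \<open>a\<close>, is \<open>\<nu> a\<close>; naturality of \<open>\<nu>\<close>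
 comes from the two ways of writing \<open>x = x \<cdot> 1 = 1 \<cdot> x\<close>.\<close>

lemma absolute_collage:
 assumes \<alpha>: "\<alpha> : mors M (cmod (cor F) (rp Z))"
  and abs: "absolute_weighted_colimit W M F Z \<alpha>"
 shows "\<exists>\<nu>. (ALL a:ob (fdom Z). \<nu> a : hom2 W (\<one> (ext (fdom Z) a)) (cob (rp F) M (fob Z a) a)) &
  (ALL a:ob (fdom Z). ALL b:ob (fdom F). ALL m:El (car M b a). la (cmod (rp F) M) (fob F b) (fob Z a) a (ap (bar F (rp Z) \<alpha> b a) m) (pt (\<nu> a))
    = cl (rp F) M (fob F b) a b (idpt F b) m) &
  (ALL a:ob (fdom Z). ALL a':ob (fdom Z). ALL x:El (hom (fdom Z) a a').
    la (cmod (rp F) M) (fob Z a) (fob Z a') a' (ap (fmap Z a a') x) (pt (\<nu> a')) = ra (cmod (rp F) M) (fob Z a) a a' (pt (\<nu> a)) x)"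
proof -
 let ?N = "cmod (rp F) M" and ?C = "fcod F" and ?A = "fdom Z" and ?B = "fdom F"
 have Np: "mdom ?N = ?A" "mcod ?N = ?C" "car ?N = cob (rp F) M" using MA by simp_all
 obtain X I J where I0: "wfunctor W I ?C X" and J0: "wfunctor W J ?A X"
  and Im: "!!c c'. c : ob ?C ==> c' : ob ?C ==> fmap I c c' = \<iota> (hom ?C c c')"
  and Jm: "!!a a'. a : ob ?A ==> a' : ob ?A ==> fmap J a a' = \<iota> (hom ?A a a')"
  and hX: "!!c a. c : ob ?C ==> a : ob ?A ==> hom X (fob I c) (fob J a) = cob (rp F) M c a"
  and lX: "!!c c' a. c : ob ?C ==> c' : ob ?C ==> a : ob ?A ==> cmp X (fob I c) (fob I c') (fob J a) = lact ?N c c' a"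
  and rX: "!!c a a'. c : ob ?C ==> a : ob ?A ==> a' : ob ?A ==> cmp X (fob I c) (fob J a) (fob J a') = ract ?N c a a'"
  by (rule exE[OF ex_collage[OF FMc[OF preA], unfolded Np]], elim exE conjE, rule that) (assumption | blast)+
 have Id: "fdom I = ?C" "fcod I = X" and Jd: "fdom J = ?A" "fcod J = X"
  using wfunctor.fdom[OF I0] wfunctor.fcod[OF I0] wfunctor.fdom[OF J0] wfunctor.fcod[OF J0] by simp_all
 have I: "isfun I" and J: "isfun J" using I0 J0 Id Jd by simp_all
 have Xw: "wcategory W X" and Cw: "wcategory W ?C" and Aw: "wcategory W ?A" and Bw: "wcategory W ?B"
  using fcod_wcat[OF I] Id F Zc[OF preA] by simp_all
 let ?HF = "wfun_comp W I F" and ?HZ = "wfun_comp W I Z" and ?\<alpha> = "vc (hom_mod_map W I F Z) \<alpha>"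
 note preX = preH[OF preA I Id(1)]
 have \<alpha>1: "\<alpha> : mors M (hom_mod W F Z)" using \<alpha> by (simp add: hom_mod_def)
 have \<alpha>': "?\<alpha> : mors M (cmod (cor ?HF) (rp ?HZ))"
  using mor_vcomp_in[OF \<alpha>1 hom_mod_map_in_hom[OF F Zc[OF preA] I ZF Id(1)]] by (simp add: hom_mod_def)
 have wc: "weighted_colimit W M ?HF ?HZ ?\<alpha>"
  using abs I0 unfolding absolute_weighted_colimit_def preserves_weighted_colimit_def Mod_sel by blast
 have Fo: "fob F b : ob ?C" "ext ?C (fob F b) = ext ?B b" if "b : ob ?B" for b using F that by simp_all
 have Zo: "fob Z a : ob ?C" "ext ?C (fob Z a) = ext ?A a" if "a : ob ?A" for a using Zc[OF preA] that ZF by simp_all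
 have Io: "fob I c : ob X" "ext X (fob I c) = ext ?C c" if "c : ob ?C" for c using I that Id by simp_all
 have Jo: "fob J a : ob X" "ext X (fob J a) = ext ?A a" if "a : ob ?A" for a using J that Jd by simp_all
 have hC: "hom X (fob I c) (fob I c') : cells1 W & hom ?C c c' = hom X (fob I c) (fob I c')" if "c : ob ?C" "c' : ob ?C" for c c'
  using fmap_cell(3)[OF I, of c c'] Im[OF that] that Id Cw Xw Io by simp
 have hA: "hom ?A a a' = hom X (fob J a) (fob J a')" if "a : ob ?A" "a' : ob ?A" for a a'
  using fmap_cell(3)[OF J, of a a'] Jm[OF that] that Jd Aw by simp
 have Ie: "ap (fmap I c c') f = f" if "c : ob ?C" "c' : ob ?C" "f : El (hom ?C c c')" for c c' f using Im that by simp
 have Je: "ap (fmap J c c') f = f" if "c : ob ?A" "c' : ob ?A" "f : El (hom ?A c c')" for c c' f using Jm that by simp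
 define n where "n b a m = cl (rp F) M (fob F b) a b (idpt F b) m" for b a m
 define g where "g b a = cin (rp F) M (fob F b) a b \<cdot> (unt ?C (fob F b) \<ast> \<iota> (car M b a)) \<cdot> inv2 W (\<l> (car M b a))" for b a
 have Mc': "car M b a : cells1 W" "trg W (car M b a) = ext ?B b" "src W (car M b a) = ext ?A a" if "b : ob ?B" "a : ob ?A" for b a
  using Mc[OF preA] that MA MB by simp_all
 have idE: "idpt F b : El (hom ?C (fob F b) (fob F b))" if "b : ob ?B" for b using F that by simp
 have nE: "n b a m : El (hom X (fob I (fob F b)) (fob J a))" if "b : ob ?B" "a : ob ?A" "m : El (car M b a)" for b a m
  unfolding n_def hX[OF Fo(1)[OF that(1)] that(2)] by (rule FM_El[OF preA Fo(1)[OF that(1)] that(2,1) idE[OF that(1)] that(3)])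
 have gc: "g b a : cells2 W" "dom2 W (g b a) = car M b a" "cod2 W (g b a) = hom X (fob I (fob F b)) (fob J a)"
  and ge: "!!m. m : El (car M b a) ==> ap (g b a) m = n b a m"
  if o: "b : ob ?B" "a : ob ?A" for b a
 proof -
  have ci: "cin (rp F) M (fob F b) a b : cells2 W" "dom2 W (cin (rp F) M (fob F b) a b) = hom ?C (fob F b) (fob F b) \<star> car M b a"
    "cod2 W (cin (rp F) M (fob F b) a b) = cob (rp F) M (fob F b) a"
   using coend_in_cell[OF RF[OF preA] Mc[OF preA], of "fob F b" a b] o Fo MA MB by simp_all
  show "g b a : cells2 W" "dom2 W (g b a) = car M b a" "cod2 W (g b a) = hom X (fob I (fob F b)) (fob J a)"
   "!!m. m : El (car M b a) ==> ap (g b a) m = n b a m"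
   using ci o Mc'[OF o] Fo Cw Bw hX by (simp_all add: g_def n_def)
 qed
 have n_l: "n b' a (la M b' b a x m) = cm X (fob I (fob F b')) (fob I (fob F b)) (fob J a) (ap (fmap F b' b) x) (n b a m)"
  if o: "b' : ob ?B" "b : ob ?B" "a : ob ?A" and x: "x : El (hom ?B b' b)" and m: "m : El (car M b a)" for b' b a x m
 proof -
  have Fx: "ap (fmap F b' b) x : El (hom ?C (fob F b') (fob F b))" using F o x by simp
  have "la ?N (fob F b') (fob F b) a (ap (fmap F b' b) x) (n b a m) = cl (rp F) M (fob F b') a b (ap (fmap F b' b) x) m"
   unfolding n_def using FM_act(1)[OF preA Fo(1)[OF o(2)] o(3,2) idE[OF o(2)] m Fo(1)[OF o(1)] Fx] Fx Fo o Cw by simp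
  also have "\<dots> = n b' a (la M b' b a x m)"
   unfolding n_def using FM_bal[OF preA Fo(1)[OF o(1)] o(3,1,2) idE[OF o(1)] x m] Fx Fo o Cw by simp
  finally show ?thesis using lX Fo o by simp
 qed
 have n_r: "n b a' (ra M b a a' m x) = cm X (fob I (fob F b)) (fob J a) (fob J a') (n b a m) x"
  if o: "b : ob ?B" "a : ob ?A" "a' : ob ?A" and x: "x : El (hom ?A a a')" and m: "m : El (car M b a)" for b a a' x m
  unfolding n_def rX[OF Fo(1)[OF o(1)] o(2,3)] by (rule FM_act(2)[OF preA Fo(1)[OF o(1)] o(2,1) idE[OF o(1)] m o(3) x, symmetric])
 let ?j = "%b a x. cmp X (fob I (fob F b)) (fob J a) x \<cdot> (g b a \<ast> \<iota> (hom X (fob J a) x))"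
 have je: "ap (?j b a x) (ten m y) = cm X (fob I (fob F b)) (fob J a) x (n b a m) y"
  and jc: "?j b a x : hom2 W (car M b a \<star> hom X (fob J a) x) (hom X (fob I (fob F b)) x)"
  if "b : ob ?B" "a : ob ?A" "x : ob X" "m : El (car M b a)" "y : El (hom X (fob J a) x)" for b a x m y
  using that gc[OF that(1,2)] ge[OF that(1,2)] Xw Io Jo Fo Mc' by (simp_all add: hom2_iff)
 have jc: "?j b a x : hom2 W (car M b a \<star> hom X (fob J a) x) (hom X (fob I (fob F b)) x)"
  if "b : ob ?B" "a : ob ?A" "x : ob X" for b a x
  using that gc[OF that(1,2)] Xw Io Jo Fo Mc' by (simp add: hom2_iff)
 have CJ: "ismod (cor J)" using J by simp
 have CH: "ismod (cor ?HF)" by (rule CF[OF preX])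
 note as = cmp_assoc_el[OF Xw]
 have HFx: "ap (fmap ?HF b' b) x = ap (fmap F b' b) x" and FxE: "ap (fmap F b' b) x : El (hom X (fob I (fob F b')) (fob I (fob F b)))"
  if "b' : ob ?B" "b : ob ?B" "x : El (hom ?B b' b)" for b' b x
  using that F Im[OF Fo(1) Fo(1)] Fo hC[OF Fo(1) Fo(1)] Cw by simp_all
 have "\<exists>\<sigma>\<in>mors (cmod M (cor J)) (cor ?HF). ALL b:ob (mcod M). ALL a:ob (mcod (cor J)). ALL x:ob (mdom (cor J)). ALL m:El (car M b a). ALL y:El (car (cor J) a x).
   app \<sigma> b x (cl M (cor J) b x a m y) = ap (?j b a x) (ten m y)"
 proof (rule ex_mor_out_of_comp[OF Mc[OF preA] CJ _ CH])
  show "?j b a x : hom2 W (car M b a \<star> car (cor J) a x) (car (cor ?HF) b x)"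
   if "b : ob (mcod M)" "a : ob (mcod (cor J))" "x : ob (mdom (cor J))" for b a x
   using jc[of b a x] that MB Id Jd by simp
 next
  fix b a a' x m f y assume "b : ob (mcod M)" "a : ob (mcod (cor J))" "a' : ob (mcod (cor J))" "x : ob (mdom (cor J))"
   and m: "m : El (car M b a)" and "f : El (hom (mcod (cor J)) a a')" "y : El (car (cor J) a' x)"
  then have o: "b : ob ?B" "a : ob ?A" "a' : ob ?A" "x : ob X" and f: "f : El (hom ?A a a')" and y: "y : El (hom X (fob J a') x)"
   using MB Jd by simp_all
  have f': "f : El (hom X (fob J a) (fob J a'))" using f hA o by simp
  have fy: "cm X (fob J a) (fob J a') x f y : El (hom X (fob J a) x)" using f' y Xw Jo o by simp
  have mf: "ra M b a a' m f : El (car M b a')" using m f o Mc[OF preA] MA MB Aw by simp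
  have l: "la (cor J) a a' x f y = cm X (fob J a) (fob J a') x f y"
   using f f' y o Jd Jm[OF o(2,3)] hA[OF o(2,3)] Xw Aw Jo by simp
  show "ap (?j b a x) (ten m (la (cor J) a a' x f y)) = ap (?j b a' x) (ten (ra M b a a' m f) y)"
   unfolding l je[OF o(1,2,4) m fy] je[OF o(1,3,4) mf y] n_r[OF o(1-3) f m]
   by (rule as[OF Io(1)[OF Fo(1)[OF o(1)]] Jo(1)[OF o(2)] Jo(1)[OF o(3)] o(4) nE[OF o(1,2) m] f' y, symmetric])
 next
  fix b' b a x q m y assume "b' : ob (mcod M)" "b : ob (mcod M)" "a : ob (mcod (cor J))" "x : ob (mdom (cor J))"
   and "q : El (hom (mcod M) b' b)" and m: "m : El (car M b a)" and "y : El (car (cor J) a x)"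
  then have o: "b' : ob ?B" "b : ob ?B" "a : ob ?A" "x : ob X" and q: "q : El (hom ?B b' b)" and y: "y : El (hom X (fob J a) x)"
   using MB Jd by simp_all
  have qm: "la M b' b a q m : El (car M b' a)" using m q o Mc[OF preA] MA MB Bw by simp
  note Fq = FxE[OF o(1,2) q] and ob = Io(1)[OF Fo(1)[OF o(1)]] Io(1)[OF Fo(1)[OF o(2)]] Jo(1)[OF o(3)] o(4)
  have ny: "cm X (fob I (fob F b)) (fob J a) x (n b a m) y : El (hom X (fob I (fob F b)) x)" using nE[OF o(2,3) m] y Xw ob by simp
  have l: "la (cor ?HF) b' b x q w = cm X (fob I (fob F b')) (fob I (fob F b)) x (ap (fmap F b' b) q) w"
   if w: "w : El (hom X (fob I (fob F b)) x)" for w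
  proof -
   note hc = fmap_cell[OF preX(1), of b' b]
   have "la (cor ?HF) b' b x q w = cm X (fob I (fob F b')) (fob I (fob F b)) x (ap (fmap ?HF b' b) q) w"
    using hc o q w ob Xw Bw Id Fo Io unfolding corep_sel by (simp del: wfun_comp_sel(4))
   then show ?thesis unfolding HFx[OF o(1,2) q] .
  qed
  show "ap (?j b' a x) (ten (la M b' b a q m) y) = la (cor ?HF) b' b x q (ap (?j b a x) (ten m y))"
   unfolding je[OF o(1,3,4) qm y] je[OF o(2,3,4) m y] l[OF ny] n_l[OF o(1-3) q m]
   by (rule as[OF ob Fq nE[OF o(2,3) m] y])
 next
  fix b a x x' m y w assume "b : ob (mcod M)" "a : ob (mcod (cor J))" "x : ob (mdom (cor J))" "x' : ob (mdom (cor J))"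
   and m: "m : El (car M b a)" and "y : El (car (cor J) a x)" "w : El (hom (mdom (cor J)) x x')"
  then have o: "b : ob ?B" "a : ob ?A" "x : ob X" "x' : ob X" and y: "y : El (hom X (fob J a) x)" and w: "w : El (hom X x x')"
   using MB Jd by simp_all
  have yw: "cm X (fob J a) x x' y w : El (hom X (fob J a) x')" using y w Xw Jo o by simp
  show "ap (?j b a x') (ten m (ra (cor J) a x x' y w)) = ra (cor ?HF) b x x' (ap (?j b a x) (ten m y)) w"
   unfolding corep_sel Jd Id wfun_comp_sel je[OF o(1,2,4) m yw] je[OF o(1,2,3) m y]
   by (rule as[OF Io(1)[OF Fo(1)[OF o(1)]] Jo(1)[OF o(2)] o(3,4) nE[OF o(1,2) m] y w, symmetric])
 qed (use MA MB Id Jd in simp_all)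
 then obtain \<sigma> where \<sigma>: "\<sigma> : mors (cmod M (cor J)) (cor ?HF)"
  and \<sigma>0: "ALL b:ob (mcod M). ALL a:ob (mcod (cor J)). ALL x:ob (mdom (cor J)). ALL m:El (car M b a). ALL y:El (car (cor J) a x).
   app \<sigma> b x (cl M (cor J) b x a m y) = ap (?j b a x) (ten m y)" by blast
 have CJ': "mdom (cor J) = fcod ?HF" "mcod (cor J) = fdom ?HZ" using Id Jd by simp_all
 obtain \<tau> where \<tau>: "\<tau> : mors (cor J) (cor ?HZ)" and l\<tau>: "lifts ?HF ?HZ M ?\<alpha> (cor J) \<sigma> \<tau>"
  using wc[unfolded weighted_colimit_iff[OF preX \<alpha>'], rule_format, OF conjI[OF CJ conjI[OF CJ'(1) conjI[OF CJ'(2) \<sigma>]]]] by blast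
 define \<nu> where "\<nu> a = component \<tau> a (fob J a) \<cdot> unt X (fob J a)" for a
 note \<tau>c = component_cell[OF Mod_hom2D(1)[OF \<tau>], unfolded Mod_hom2D(2,3)[OF \<tau>] corep_sel wfun_comp_sel Id Jd]
 have uE: "pt (unt X (fob J a)) : El (hom X (fob J a) (fob J a))" if "a : ob ?A" for a using that Xw Jo Aw by simp
 have \<nu>p: "pt (\<nu> a) = app \<tau> a (fob J a) (pt (unt X (fob J a)))" for a by (simp add: \<nu>_def)
 have \<tau>E: "app \<tau> a x y : El (hom X (fob I (fob Z a)) x)" if "a : ob ?A" "x : ob X" "y : El (hom X (fob J a) x)" for a x y
  using \<tau>c[OF that(1,2)] that by simp
 have 1: "\<nu> a : hom2 W (\<one> (ext ?A a)) (cob (rp F) M (fob Z a) a)" if "a : ob ?A" for a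
  using \<tau>c[OF that Jo(1)[OF that]] that Jo Xw hX Zo by (simp add: hom2_iff \<nu>_def)
 have 2: "la ?N (fob F b) (fob Z a) a (ap (bar F (rp Z) \<alpha> b a) m) (pt (\<nu> a)) = n b a m"
  if o: "a : ob ?A" "b : ob ?B" and m: "m : El (car M b a)" for a b m
 proof -
  have bb: "ap (bar ?HF (rp ?HZ) ?\<alpha> b a) m = ap (bar F (rp Z) \<alpha> b a) m"
   unfolding hom_mod_map_bar[OF F Zc[OF preA] I ZF Id(1) \<alpha>1 o(2,1) m]
   by (rule Ie[OF Fo(1)[OF o(2)] Zo(1)[OF o(1)] bar_El[OF preA \<alpha> o(2,1) m]])
  have o': "b : ob (fdom ?HF)" "a : ob (fdom ?HZ)" "fob J a : ob (fcod ?HF)" "pt (unt X (fob J a)) : El (car (cor J) a (fob J a))"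
   using o Jo Id Jd uE by simp_all
  have "cm (fcod ?HF) (fob ?HF b) (fob ?HZ a) (fob J a) (ap (bar ?HF (rp ?HZ) ?\<alpha> b a) m) (pt (\<nu> a))
   = app \<sigma> b (fob J a) (cl M (cor J) b (fob J a) a m (pt (unt X (fob J a))))"
   unfolding \<nu>p by (rule l\<tau>[rule_format, OF o'(1-3) m o'(4)])
  also have "\<dots> = ap (?j b a (fob J a)) (ten m (pt (unt X (fob J a))))"
   by (rule \<sigma>0[rule_format]) (use o o' m MB Id Jd in simp_all)
  also have "\<dots> = n b a m"
   unfolding je[OF o(2,1) Jo(1)[OF o(1)] m uE[OF o(1)]] using nE[OF o(2,1) m] Xw Io Jo Fo o by simp
  finally show ?thesis unfolding bb wfun_comp_sel Id lX[OF Fo(1)[OF o(2)] Zo(1)[OF o(1)] o(1)] .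
 qed
 have 3: "la ?N (fob Z a) (fob Z a') a' (ap (fmap Z a a') x) (pt (\<nu> a')) = ra ?N (fob Z a) a a' (pt (\<nu> a)) x"
  if o: "a : ob ?A" "a' : ob ?A" and x: "x : El (hom ?A a a')" for a a' x
 proof -
  have x': "x : El (hom X (fob J a) (fob J a'))" using x hA o by simp
  have Zx: "ap (fmap Z a a') x : El (hom ?C (fob Z a) (fob Z a'))" using Zc[OF preA] x o ZF by simp
  have Zx': "ap (fmap ?HZ a a') x = ap (fmap Z a a') x"
   using Zc[OF preA] o x ZF Im[OF Zo(1) Zo(1), OF o] Cw Zo Zx by simp
  note ob = Jo(1)[OF o(1)] Jo(1)[OF o(2)]
  have e1: "la (cor J) a a' (fob J a') x (pt (unt X (fob J a'))) = x"
   using x x' o Jd Jm[OF o] hA[OF o] Xw Aw Jo uE[OF o(2)] by simp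
  have "app \<tau> a (fob J a') (la (cor J) a a' (fob J a') x (pt (unt X (fob J a'))))
   = la (cor ?HZ) a a' (fob J a') x (pt (\<nu> a'))"
   unfolding \<nu>p by (rule component_lact_hom[OF \<tau>]) (use o x Jd Jo uE in simp_all)
  also have "\<dots> = cm X (fob I (fob Z a)) (fob I (fob Z a')) (fob J a') (ap (fmap ?HZ a a') x) (pt (\<nu> a'))"
  proof -
   note hc = fmap_cell[OF Zc[OF preX], of a a']
   have "pt (\<nu> a') : El (hom X (fob I (fob Z a')) (fob J a'))" unfolding \<nu>p by (rule \<tau>E[OF o(2) ob(2) uE[OF o(2)]])
   moreover have "\<iota> (hom X (fob I (fob Z a')) (fob J a')) \<cdot> \<nu> a' = \<nu> a'" using 1[OF o(2)] hX[OF Zo(1)[OF o(2)] o(2)] by (auto simp: hom2_iff)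
   ultimately show ?thesis using hc o x ob Xw Aw Id Zo Io ZF unfolding corep_sel by (simp del: wfun_comp_sel(4))
  qed
  finally have l: "app \<tau> a (fob J a') x = la ?N (fob Z a) (fob Z a') a' (ap (fmap Z a a') x) (pt (\<nu> a'))"
   unfolding e1 Zx' lX[OF Zo(1)[OF o(1)] Zo(1)[OF o(2)] o(2)] .
  have e2: "ra (cor J) a (fob J a) (fob J a') (pt (unt X (fob J a))) x = x"
   using x' o Jd Xw Jo by simp
  have "app \<tau> a (fob J a') (ra (cor J) a (fob J a) (fob J a') (pt (unt X (fob J a))) x)
   = ra (cor ?HZ) a (fob J a) (fob J a') (pt (\<nu> a)) x"
   unfolding \<nu>p by (rule component_ract_hom[OF \<tau>]) (use o x' Jd Jo uE in simp_all)
  from this[unfolded e2] have r: "app \<tau> a (fob J a') x = ra ?N (fob Z a) a a' (pt (\<nu> a)) x"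
   unfolding corep_sel wfun_comp_sel Id rX[OF Zo(1)[OF o(1)] o] .
  show ?thesis using l r by simp
 qed
 show ?thesis using 1 2 3 unfolding n_def by (intro exI[of _ \<nu>]) blast
qed

text \<open>The inverse is \<open>\<beta>(y) = y \<cdot> \<nu> a\<close>. The first equation is the defining property of \<open>\<nu>\<close>.
 For the second, left multiplication by \<open>u a = mate(\<nu> a)\<close> and the identity are both lifts,
 through the original colimit, of its universal morphism, whence \<open>u a = 1\<close>.\<close>

lemma absolute_E1_E2:
 assumes \<alpha>: "\<alpha> : mors M (cmod (cor F) (rp Z))"
  and abs: "absolute_weighted_colimit W M F Z \<alpha>"
 shows "\<exists>\<beta>\<in>mors (rp Z) (cmod (rp F) M). equation_E1 W M F \<alpha> \<beta> & equation_E2 W F Z \<alpha> \<beta>"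
proof -
 let ?N = "cmod (rp F) M" and ?C = "fcod F" and ?A = "fdom Z" and ?B = "fdom F"
 have Np: "mcod ?N = ?C" "mdom ?N = ?A" "car ?N = cob (rp F) M" using MA by simp_all
 from absolute_collage[OF \<alpha> abs] obtain \<nu> where \<nu>: "!!a. a : ob ?A ==> \<nu> a : hom2 W (\<one> (ext ?A a)) (cob (rp F) M (fob Z a) a)"
  and bn: "!!a b m. a : ob ?A ==> b : ob ?B ==> m : El (car M b a) ==> la ?N (fob F b) (fob Z a) a (ap (bar F (rp Z) \<alpha> b a) m) (pt (\<nu> a))
    = cl (rp F) M (fob F b) a b (idpt F b) m"
  and nat: "!!a a' x. a : ob ?A ==> a' : ob ?A ==> x : El (hom ?A a a') ==>
    la ?N (fob Z a) (fob Z a') a' (ap (fmap Z a a') x) (pt (\<nu> a')) = ra ?N (fob Z a) a a' (pt (\<nu> a)) x"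
  by blast
 note \<nu>c = \<nu>[THEN hom2D(1)] \<nu>[THEN hom2D(2)] \<nu>[THEN hom2D(3)]
 have Cw: "wcategory W ?C" and Aw: "wcategory W ?A" using F Zc[OF preA] by simp_all
 have Fo: "fob F b : ob ?C" "ext ?C (fob F b) = ext ?B b" if "b : ob ?B" for b using F that by simp_all
 have Zo: "fob Z a : ob ?C" "ext ?C (fob Z a) = ext ?A a" if "a : ob ?A" for a using Zc[OF preA] that ZF by simp_all
 have \<nu>E: "pt (\<nu> a) : El (cob (rp F) M (fob Z a) a)" if "a : ob ?A" for a
  using that Aw by (auto intro!: pt_El[of _ "ext ?A a"] simp: \<nu>c)
 note mi = mate_in_hom[OF preA \<alpha>]
 note mact = to_rep_act[OF preA mi Np(1,2), unfolded Np(3)]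
 note mc = component_cell[OF Mod_hom2D(1)[OF mi], unfolded Mod_hom2D(2,3)[OF mi] mod_comp_sel rep_sel ZF MA]
 define u where "u a = component (mate F Z \<alpha>) (fob Z a) a \<cdot> \<nu> a" for a
 have up: "pt (u a) = app (mate F Z \<alpha>) (fob Z a) a (pt (\<nu> a))" for a by (simp add: u_def)
 have uc: "u a : cells2 W" "dom2 W (u a) = \<one> (ext ?A a)" "cod2 W (u a) = hom ?C (fob Z a) (fob Z a)" and uE: "pt (u a) : El (hom ?C (fob Z a) (fob Z a))"
  if "a : ob ?A" for a
  using that mc[OF Zo(1)[OF that] that] \<nu>c mact(1)[OF Zo(1)[OF that] that \<nu>E[OF that], folded up] by (simp_all add: u_def)
 have ZE: "ap (fmap Z a a') x : El (hom ?C (fob Z a) (fob Z a'))" if "a : ob ?A" "a' : ob ?A" "x : El (hom ?A a a')" for a a' x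
  using Zc[OF preA] that ZF by simp
 have unat: "cm ?C (fob Z a) (fob Z a') (fob Z a') (ap (fmap Z a a') x) (pt (u a')) = cm ?C (fob Z a) (fob Z a) (fob Z a') (pt (u a)) (ap (fmap Z a a') x)"
  if o: "a : ob ?A" "a' : ob ?A" "x : El (hom ?A a a')" for a a' x
  using arg_cong[OF nat[OF o], of "ap (component (mate F Z \<alpha>) (fob Z a) a')"]
   mact(2)[OF Zo(1)[OF o(2)] o(2) \<nu>E[OF o(2)] Zo(1)[OF o(1)] ZE[OF o]] mact(3)[OF Zo(1)[OF o(1)] o(1) \<nu>E[OF o(1)] o(2,3)] by (simp only: up)
 note as = cmp_assoc_el[OF Cw]
 have lift_u: "cm ?C (fob F b) (fob Z a) (fob Z a) (ap (bar F (rp Z) \<alpha> b a) m) (pt (u a)) = ap (bar F (rp Z) \<alpha> b a) m"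
  if o: "a : ob ?A" "b : ob ?B" and m: "m : El (car M b a)" for a b m
 proof -
  note bE = bar_El[OF preA \<alpha> o(2,1) m]
  have i: "idpt F b : El (hom ?C (fob F b) (fob F b))" using F o by simp
  have "cm ?C (fob F b) (fob Z a) (fob Z a) (ap (bar F (rp Z) \<alpha> b a) m) (pt (u a)) = app (mate F Z \<alpha>) (fob F b) a (cl (rp F) M (fob F b) a b (idpt F b) m)"
   unfolding up bn[OF o m, symmetric] by (rule mact(2)[OF Zo(1)[OF o(1)] o(1) \<nu>E[OF o(1)] Fo(1)[OF o(2)] bE, symmetric])
  also have "\<dots> = ap (bar F (rp Z) \<alpha> b a) m"
   unfolding mate_el[OF preA \<alpha> Fo(1)[OF o(2)] o i m] using bE Cw Fo Zo o by simp
  finally show ?thesis .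
 qed
 have u_id: "pt (u a) = pt (unt ?C (fob Z a))" if a: "a : ob ?A" for a
 proof -
  let ?K = "cor Z" and ?\<sigma> = "colimit_cell F Z \<alpha>"
  note CZ' = CZ[OF preA]
  let ?t = "%a c. cmp ?C (fob Z a) (fob Z a) c \<cdot> (u a \<ast> \<iota> (hom ?C (fob Z a) c)) \<cdot> inv2 W (\<l> (hom ?C (fob Z a) c))"
  have tc: "?t a c : hom2 W (hom ?C (fob Z a) c) (hom ?C (fob Z a) c)"
   and te: "!!f. f : El (hom ?C (fob Z a) c) ==> ap (?t a c) f = cm ?C (fob Z a) (fob Z a) c (pt (u a)) f"
   if "a : ob ?A" "c : ob ?C" for a c
   using that Cw Zo uc Aw by (simp_all add: hom2_iff)
  let ?\<tau> = "mk_wmor ?K ?K ?t"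
  have lZ: "la ?K a' a c x f = cm ?C (fob Z a') (fob Z a) c (ap (fmap Z a' a) x) f"
   if "a' : ob ?A" "a : ob ?A" "c : ob ?C" "x : El (hom ?A a' a)" "f : El (hom ?C (fob Z a) c)" for a' a c x f
   using that fmap_cell[OF Zc[OF preA], of a' a] ZF Cw Aw Zo by simp
  have \<tau>: "?\<tau> : mors ?K ?K"
  proof (rule mk_wmor_in[OF CZ' CZ'])
   fix a' a c x f assume "a' : ob (mcod ?K)" "a : ob (mcod ?K)" "c : ob (mdom ?K)" "x : El (hom (mcod ?K) a' a)" "f : El (car ?K a c)"
   then have o: "a' : ob ?A" "a : ob ?A" "c : ob ?C" and x: "x : El (hom ?A a' a)" and f: "f : El (hom ?C (fob Z a) c)" using ZF by simp_all
   note Zx = ZE[OF o(1,2) x] and ob = Zo(1)[OF o(1)] Zo(1)[OF o(2)] o(3)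
   have Zf: "cm ?C (fob Z a') (fob Z a) c (ap (fmap Z a' a) x) f : El (hom ?C (fob Z a') c)"
    and uf: "cm ?C (fob Z a) (fob Z a) c (pt (u a)) f : El (hom ?C (fob Z a) c)" using Zx f uE[OF o(2)] Cw ob by simp_all
   have "cm ?C (fob Z a') (fob Z a') c (pt (u a')) (cm ?C (fob Z a') (fob Z a) c (ap (fmap Z a' a) x) f)
    = cm ?C (fob Z a') (fob Z a) c (ap (fmap Z a' a) x) (cm ?C (fob Z a) (fob Z a) c (pt (u a)) f)"
    unfolding as[OF ob(1,1,2,3) uE[OF o(1)] Zx f, symmetric] as[OF ob(1,2,2,3) Zx uE[OF o(2)] f, symmetric] unat[OF o(1,2) x] ..
   then show "ap (?t a' c) (la ?K a' a c x f) = la ?K a' a c x (ap (?t a c) f)"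
    unfolding lZ[OF o x f] te[OF o(1,3) Zf] te[OF o(2,3) f] lZ[OF o x uf] .
  next
   fix a c c' f y assume "a : ob (mcod ?K)" "c : ob (mdom ?K)" "c' : ob (mdom ?K)" "f : El (car ?K a c)" "y : El (hom (mdom ?K) c c')"
   then have o: "a : ob ?A" "c : ob ?C" "c' : ob ?C" and f: "f : El (hom ?C (fob Z a) c)" and y: "y : El (hom ?C c c')" using ZF by simp_all
   have fy: "cm ?C (fob Z a) c c' f y : El (hom ?C (fob Z a) c')" using f y Cw Zo o by simp
   show "ap (?t a c') (ra ?K a c c' f y) = ra ?K a c c' (ap (?t a c) f) y"
    unfolding corep_sel ZF te[OF o(1,3) fy] te[OF o(1,2) f]
    by (rule as[OF Zo(1)[OF o(1)] Zo(1)[OF o(1)] o(2,3) uE[OF o(1)] f y, symmetric])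
  qed (use tc ZF in auto)
  have ce: "app ?\<sigma> b c (cl M ?K b c a m f) = cm ?C (fob F b) (fob Z a) c (ap (bar F (rp Z) \<alpha> b a) m) f"
   if "b : ob ?B" "a : ob ?A" "c : ob ?C" "m : El (car M b a)" "f : El (hom ?C (fob Z a) c)" for b a c m f
   by (rule colimit_cell_el[OF preA \<alpha> that])
  have "lifts F Z M \<alpha> ?K ?\<sigma> (idm ?K)" using ce ZF by simp
  moreover have "lifts F Z M \<alpha> ?K ?\<sigma> ?\<tau>"
  proof (intro ballI)
   fix b a c m f assume o: "b : ob ?B" "a : ob ?A" "c : ob ?C" and m: "m : El (car M b a)" and "f : El (car ?K a c)"
   then have f: "f : El (hom ?C (fob Z a) c)" using ZF by simp
   have cmpn: "component ?\<tau> a c = ?t a c" using o ZF by simp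
   note bE = bar_El[OF preA \<alpha> o(1,2) m] and ob = Fo(1)[OF o(1)] Zo(1)[OF o(2)]
   show "cm ?C (fob F b) (fob Z a) c (ap (bar F (rp Z) \<alpha> b a) m) (app ?\<tau> a c f) = app ?\<sigma> b c (cl M ?K b c a m f)"
    unfolding cmpn te[OF o(2,3) f] ce[OF o m f] as[OF ob ob(2) o(3) bE uE[OF o(2)] f, symmetric] lift_u[OF o(2,1) m] ..
  qed
  moreover have wc: "weighted_colimit W M F Z \<alpha>" using abs unfolding absolute_weighted_colimit_def by blast
  have KM: "mdom ?K = ?C" "mcod ?K = ?A" using ZF by simp_all
  have "\<exists>!\<tau>. \<tau> : mors ?K ?K & lifts F Z M \<alpha> ?K ?\<sigma> \<tau>"
   by (rule wc[unfolded weighted_colimit_iff[OF preA \<alpha>], rule_format, OF conjI[OF CZ' conjI[OF KM(1) conjI[OF KM(2) colimit_cell_in_hom[OF preA \<alpha>]]]]])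
  ultimately have "?\<tau> = idm ?K" using \<tau> id_hom2[OF CZ'] by blast
  then have "app ?\<tau> a (fob Z a) (pt (unt ?C (fob Z a))) = app (idm ?K) a (fob Z a) (pt (unt ?C (fob Z a)))" by simp
  moreover have i: "pt (unt ?C (fob Z a)) : El (hom ?C (fob Z a) (fob Z a))" by (rule Zid_El[OF preA a])
  moreover have "component ?\<tau> a (fob Z a) = ?t a (fob Z a)" "component (idm ?K) a (fob Z a) = \<iota> (hom ?C (fob Z a) (fob Z a))"
   using a Zo ZF by simp_all
  ultimately have "cm ?C (fob Z a) (fob Z a) (fob Z a) (pt (u a)) (pt (unt ?C (fob Z a))) = pt (unt ?C (fob Z a))"
   using te[OF a Zo(1)[OF a] i] ap_id[OF i] by (simp only:)
  then show ?thesis using uE[OF a] Cw Zo a by simp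
 qed
 let ?b = "%c a. lact ?N c (fob Z a) a \<cdot> (\<iota> (hom ?C c (fob Z a)) \<ast> \<nu> a) \<cdot> inv2 W (\<r> (hom ?C c (fob Z a)))"
 note NW = FMc[OF preA]
 have NC: "cob (rp F) M c a : cells1 W" "src W (cob (rp F) M c a) = ext ?A a" "trg W (cob (rp F) M c a) = ext ?C c"
  "c' : ob ?C ==> lact ?N c' c a : cells2 W" "c' : ob ?C ==> dom2 W (lact ?N c' c a) = hom ?C c' c \<star> cob (rp F) M c a" "c' : ob ?C ==> cod2 W (lact ?N c' c a) = cob (rp F) M c' a"
  if "c : ob ?C" "a : ob ?A" for c a c'
  using car_cell[OF NW, of c a] lact_cell[OF NW, of c' c a] that Np by simp_all
 have bc: "?b c a : hom2 W (hom ?C c (fob Z a)) (cob (rp F) M c a)"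
  and be: "!!y. y : El (hom ?C c (fob Z a)) ==> ap (?b c a) y = la ?N c (fob Z a) a y (pt (\<nu> a))"
  if "c : ob ?C" "a : ob ?A" for c a
  using that Cw Aw Zo \<nu>c NC[OF Zo(1)[OF that(2)] that(2)] by (simp_all add: hom2_iff)
 let ?\<beta> = "mk_wmor (rp Z) ?N ?b"
 note la = lact_assoc_el[OF NW, unfolded Np] and ra = ract_assoc_el[OF NW, unfolded Np] and lr = lact_ract_el[OF NW, unfolded Np]
 have \<beta>: "?\<beta> : mors (rp Z) ?N"
 proof (rule mk_wmor_in[OF RZ[OF preA] NW])
  fix c' c a x y assume "c' : ob (mcod (rp Z))" "c : ob (mcod (rp Z))" "a : ob (mdom (rp Z))" "x : El (hom (mcod (rp Z)) c' c)" "y : El (car (rp Z) c a)"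
  then have o: "c' : ob ?C" "c : ob ?C" "a : ob ?A" and x: "x : El (hom ?C c' c)" and y: "y : El (hom ?C c (fob Z a))" using ZF by simp_all
  have xy: "cm ?C c' c (fob Z a) x y : El (hom ?C c' (fob Z a))" using x y Cw Zo o by simp
  show "ap (?b c' a) (la (rp Z) c' c a x y) = la ?N c' c a x (ap (?b c a) y)"
   unfolding rep_sel ZF be[OF o(1,3) xy] be[OF o(2,3) y]
   by (rule la[OF o(1,2) Zo(1)[OF o(3)] o(3) refl x y \<nu>E[OF o(3)]])
 next
  fix c a a' y x assume "c : ob (mcod (rp Z))" "a : ob (mdom (rp Z))" "a' : ob (mdom (rp Z))" "y : El (car (rp Z) c a)" "x : El (hom (mdom (rp Z)) a a')"
  then have o: "c : ob ?C" "a : ob ?A" "a' : ob ?A" and x: "x : El (hom ?A a a')" and y: "y : El (hom ?C c (fob Z a))" using ZF by simp_all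
  note Zx = ZE[OF o(2,3) x] and ob = Zo(1)[OF o(2)] Zo(1)[OF o(3)]
  have yx: "cm ?C c (fob Z a) (fob Z a') y (ap (fmap Z a a') x) : El (hom ?C c (fob Z a'))" using y Zx Cw ob o by simp
  have r: "ra (rp Z) c a a' y x = cm ?C c (fob Z a) (fob Z a') y (ap (fmap Z a a') x)"
   using y x o fmap_cell[OF Zc[OF preA], of a a'] ZF Cw Aw Zo by simp
  have "la ?N c (fob Z a') a' (cm ?C c (fob Z a) (fob Z a') y (ap (fmap Z a a') x)) (pt (\<nu> a'))
   = la ?N c (fob Z a) a' y (ra ?N (fob Z a) a a' (pt (\<nu> a)) x)"
   unfolding nat[OF o(2,3) x, symmetric] by (rule la[OF o(1) ob o(3) refl y Zx \<nu>E[OF o(3)]])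
  also have "\<dots> = ra ?N c a a' (la ?N c (fob Z a) a y (pt (\<nu> a))) x"
   by (rule lr[OF o(1) ob(1) o(2,3) y \<nu>E[OF o(2)] x, symmetric])
  finally show "ap (?b c a') (ra (rp Z) c a a' y x) = ra ?N c a a' (ap (?b c a) y) x"
   unfolding r be[OF o(1,3) yx] be[OF o(1,2) y] .
 qed (use bc ZF MA in auto)
 have \<beta>c: "component ?\<beta> c a = ?b c a" if "c : ob ?C" "a : ob ?A" for c a using that ZF by simp
 have "equation_E1 W M F \<alpha> ?\<beta>" unfolding E1_iff[OF preA \<alpha> \<beta>]
 proof (intro ballI)
  fix b a m assume o: "b : ob ?B" "a : ob ?A" and m: "m : El (car M b a)"
  show "app ?\<beta> (fob F b) a (ap (bar F (rp Z) \<alpha> b a) m) = cl (rp F) M (fob F b) a b (idpt F b) m"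
   unfolding \<beta>c[OF Fo(1)[OF o(1)] o(2)] be[OF Fo(1)[OF o(1)] o(2) bar_El[OF preA \<alpha> o m]] by (rule bn[OF o(2,1) m])
 qed
 moreover have "equation_E2 W F Z \<alpha> ?\<beta>" unfolding E2_iff[OF preA \<alpha> \<beta>]
 proof (rule mor_eqI[OF mor_vcomp_in[OF \<beta> mi] id_hom2[OF RZ[OF preA]]])
  fix c a y assume *: "c : ob (mcod (rp Z))" "a : ob (mdom (rp Z))" "y : El (car (rp Z) c a)"
  then have o: "c : ob ?C" "a : ob ?A" and y: "y : El (hom ?C c (fob Z a))" using ZF by simp_all
  have "app (mate F Z \<alpha>) c a (app ?\<beta> c a y) = cm ?C c (fob Z a) (fob Z a) y (pt (unt ?C (fob Z a)))"
   unfolding \<beta>c[OF o] be[OF o y] u_id[OF o(2), symmetric] up by (rule mact(2)[OF Zo(1)[OF o(2)] o(2) \<nu>E[OF o(2)] o(1) y])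
  then show "app (vc (mate F Z \<alpha>) ?\<beta>) c a y = app (idm (rp Z)) c a y"
   unfolding mor_vcomp_el[OF \<beta> mi *] using y Cw Zo o ZF by simp
 qed
 ultimately show ?thesis using \<beta> by blast
qed

end

end


theorem theorem1p1:
 fixes W :: "('o, 'm, 'c) bicat"
  and A B C :: "('u, 'o, 'm, 'c) wcat"
  and M :: "('u, 'o, 'm, 'c) wmod"
  and F :: "('u, 'o, 'm, 'c) wfun"
 assumes base: "enrichment_base TYPE('u) W"
  and A: "wcategory W A" and B: "wcategory W B" and C: "wcategory W C"
  and M: "wmodule W M A B"
  and F: "wfunctor W F B C"
 defines "cond_i \<equiv> \<exists>Z \<alpha>. absolute_weighted_colimit W M F Z \<alpha>"
  and "cond_ii \<equiv> \<exists>Z \<alpha> \<beta>. wfunctor W Z A C \<and>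
      \<alpha> \<in> hom2 (Mod W) M (hom_mod W F Z) \<and>
      \<beta> \<in> hom2 (Mod W) (rep W Z) (rep W F \<star>\<^bsub>Mod W\<^esub> M) \<and>
      equation_E1 W M F \<alpha> \<beta> \<and> equation_E2 W F Z \<alpha> \<beta>"
  and "cond_iii \<equiv> \<exists>Z. wfunctor W Z A C \<and>
      isomorphic1 (Mod W) (rep W F \<star>\<^bsub>Mod W\<^esub> M) (rep W Z)"
  and "cond_iv \<equiv> \<exists>Z \<alpha> \<beta>. wfunctor W Z A C \<and>
      \<alpha> \<in> hom2 (Mod W) M (hom_mod W F Z) \<and>
      \<beta> \<in> hom2 (Mod W) (rep W Z) (rep W F \<star>\<^bsub>Mod W\<^esub> M) \<and>
      equation_E1 W M F \<alpha> \<beta>"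
 shows "(cond_i \<longleftrightarrow> cond_ii) \<and> (cond_ii \<longleftrightarrow> cond_iii) \<and>
     (idempotents_split W C \<longrightarrow> (cond_iii \<longleftrightarrow> cond_iv))"
proof -
 interpret bicategory W using base by (simp add: enrichment_base_def)
 interpret enriched_base W "TYPE('u)" by unfold_locales (rule base)
 have Fd: "fdom F = B" "fcod F = C" using wfunctor.fdom[OF F] wfunctor.fcod[OF F] by simp_all
 have Md: "mdom M = A" "mcod M = B" using wmodule.mdom[OF M] wmodule.mcod[OF M] by simp_all
 have pre: "wfunctor W F (fdom F) (fcod F)" "wfunctor W Z (fdom Z) (fcod F)" "fcod Z = fcod F"
   "wmodule W M (fdom Z) (fdom F)" "mdom M = fdom Z" "mcod M = fdom F" "fdom Z = A"
  if "wfunctor W Z A C" for Z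
  using that wfunctor.fdom[OF that] wfunctor.fcod[OF that] F M Fd Md by simp_all
 have 12: cond_ii if i: cond_i
 proof -
  from i obtain Z \<alpha> where abs: "absolute_weighted_colimit W M F Z \<alpha>" unfolding cond_i_def by blast
  then have Z: "wfunctor W Z A C" and \<alpha>: "\<alpha> \<in> hom2 (Mod W) M (hom_mod W F Z)"
   unfolding absolute_weighted_colimit_def weighted_colimit_def Fd Md by blast+
  note p = pre(1-6)[OF Z]
  from absolute_E1_E2[OF p \<alpha>[unfolded hom_mod_def] abs] \<alpha> Z show cond_ii unfolding cond_ii_def Mod_sel by blast
 qed
 have 21: cond_i if ii: cond_ii
 proof -
  from ii obtain Z \<alpha> \<beta> where Z: "wfunctor W Z A C" and \<alpha>: "\<alpha> \<in> hom2 (Mod W) M (mod_comp W (corep W F) (rep W Z))"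
   and \<beta>: "\<beta> \<in> hom2 (Mod W) (rep W Z) (mod_comp W (rep W F) M)" and E: "equation_E1 W M F \<alpha> \<beta>" "equation_E2 W F Z \<alpha> \<beta>"
   unfolding cond_ii_def Mod_sel hom_mod_def by blast
  note p = pre(1-6)[OF Z]
  show cond_i unfolding cond_i_def using reconstructs_absolute[OF p \<alpha> E1_E2_reconstructs[OF p \<alpha> \<beta> E]] by blast
 qed
 have 23: cond_iii if ii: cond_ii
 proof -
  from ii obtain Z \<alpha> \<beta> where Z: "wfunctor W Z A C" and \<alpha>: "\<alpha> \<in> hom2 (Mod W) M (mod_comp W (corep W F) (rep W Z))"
   and \<beta>: "\<beta> \<in> hom2 (Mod W) (rep W Z) (mod_comp W (rep W F) M)" and E: "equation_E1 W M F \<alpha> \<beta>" "equation_E2 W F Z \<alpha> \<beta>"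
   unfolding cond_ii_def Mod_sel hom_mod_def by blast
  show cond_iii unfolding cond_iii_def Mod_sel using E1_E2_iso[OF pre(1-6)[OF Z] \<alpha> \<beta> E] Z by blast
 qed
 have 32: cond_ii if iii: cond_iii
 proof -
  from iii obtain Z where Z: "wfunctor W Z A C" and iso: "isomorphic1 (Mod W) (mod_comp W (rep W F) M) (rep W Z)"
   unfolding cond_iii_def Mod_sel by blast
  show cond_ii unfolding cond_ii_def Mod_sel hom_mod_def using iso_E1_E2[OF pre(1-6)[OF Z] iso] Z by blast
 qed
 have 24: cond_iv if cond_ii using that unfolding cond_ii_def cond_iv_def by blast
 have 43: cond_iii if split: "idempotents_split W C" and iv: cond_iv
 proof -
  from iv obtain Z \<alpha> \<beta> where Z: "wfunctor W Z A C" and \<alpha>: "\<alpha> \<in> hom2 (Mod W) M (mod_comp W (corep W F) (rep W Z))"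
   and \<beta>: "\<beta> \<in> hom2 (Mod W) (rep W Z) (mod_comp W (rep W F) M)" and E: "equation_E1 W M F \<alpha> \<beta>"
   unfolding cond_iv_def Mod_sel hom_mod_def by blast
  from E1_split[OF pre(1-6)[OF Z] \<alpha> \<beta> E split[folded Fd(2)]] show cond_iii
   unfolding cond_iii_def Mod_sel Fd pre(7)[OF Z] .
 qed
 show ?thesis using 12 21 23 32 24 43 by blast
qed

end
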